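(* For any integer $n\geq 3$, there is exactly one, up to isomorphism, non-degenerate hypersurface of degree $n-1$ in $\mathbb{P}^n$ admitting an induced additive action. The corresponding Gorenstein local algebra is $\mathbb{K}[x,y]/(xy,\; y^2-x^{n-1})$.
   Context: The ground field $\mathbb{K}$ is algebraically closed of characteristic zero. All algebras are commutative, associative and unital; $\mathbb{G}_a^m$ denotes the algebraic group $(\mathbb{K}^m,+)$. Induced additive actions. An additive action on an algebraic variety $X$ is an effective regular action of $\mathbb{G}_a^m$ on $X$ with an open orbit. If $X\subseteq\mathbb{P}^n$ is a projective hypersurface, the action is induced if it can be extended to a regular action of $\mathbb{G}_a^m$ on $\mathbb{P}^n$ (so $m=n-1$). Non-degeneracy. A hypersurface $X=\{f=0\}\subseteq\mathbb{P}^n$, with $f$ a homogeneous polynomial in $n+1$ variables, is non-degenerate if there is no linear change of variables after which $f$ depends on fewer than $n+1$ variables (equivalently, $X$ is not a projective cone over a hypersurface in a projective subspace $\mathbb{P}^k\subseteq\mathbb{P}^n$, $k<n$). Hypersurfaces in $\mathbb{P}^n$ are considered up to isomorphism, i.e. $X_1\cong X_2$ if $\psi(X_1)=X_2$ for some automorphism $\psi$ of $\mathbb{P}^n$. Gorenstein local algebras. For a finite-dimensional local algebra $A$ with maximal ideal $\mathfrak{m}$, the socle is $\operatorname{Soc}A=\{a\in A\mid a\mathfrak{m}=0\}$; $A$ is Gorenstein if $\dim\operatorname{Soc}A=1$ (then $\operatorname{Soc}A=\mathfrak{m}^d$, where $d$ is maximal with $\mathfrak{m}^d\neq 0$). Correspondence.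 An $H$-pair is a pair $(A,U)$ where $A$ is a finite-dimensional local algebra with maximal ideal $\mathfrak{m}$ and $U\subseteq\mathfrak{m}$ is a hyperplane (codimension one subspace) generating $A$ as a unital algebra. An $H$-pair with $\dim A=n+1$ corresponds to the hypersurface $X=p(\overline{\mathbb{K}^{\times}\exp U})\subseteq\mathbb{P}(A)\cong\mathbb{P}^n$, where $p:A\setminus\{0\}\to\mathbb{P}(A)$ is the canonical projection and the bar is Zariski closure, with the induced additive action of $\exp U\cong\mathbb{G}_a^{n-1}$ by multiplication. Conversely, an induced additive action on a hypersurface $X\subseteq\mathbb{P}^n=\mathbb{P}(V)$ that is not a hyperplane lifts to a faithful linear representation $\rho:\mathbb{G}_a^{n-1}\to \operatorname{GL}(V)$, and one puts $U=d\rho(\operatorname{Lie}\mathbb{G}_a^{n-1})$ and takes $A$ to be the unital subalgebra of $\operatorname{End}(V)$ generated by $U$. Known results: these constructions are mutually inverse up to equivalence; induced additive actions on non-degenerate hypersurfaces of degree $d$ in $\mathbb{P}^n$ correspond exactly to $H$-pairs $(A,U)$ with $A$ Gorenstein of dimension $n+1$, $\operatorname{Soc}A=\mathfrak{m}^d$ and $\mathfrak{m}=U\oplus\mathfrak{m}^d$; and a non-degenerate hypersurface admits at most one induced additive action up to equivalence. The algebra $A$ so obtained (unique up to isomorphism) is called the Gorenstein local algebra corresponding to the hypersurface. *)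

theory Defs
  imports
    "Jordan_Normal_Form.VS_Connect"
    "HOL-Algebra.QuotRing"
    "HOL-Computational_Algebra.Polynomial"
    "HOL-Library.Poly_Mapping"
begin

section \<open>Multivariate polynomials\<close>

text \<open>Polynomials in variables indexed by natural numbers: a monomial is a finitely supported
  exponent function, and \<^const>\<open>Poly_Mapping.lookup\<close> gives the coefficients.\<close>

type_synonym 'k mpoly = "(nat \<Rightarrow>\<^sub>0 nat) \<Rightarrow>\<^sub>0 'k"

definition vars :: "'k::zero mpoly \<Rightarrow> nat set" where
  "vars f = (\<Union>t\<in>Poly_Mapping.keys f. Poly_Mapping.keys t)"

definition mpoly_eval :: "('k::zero \<Rightarrow> 'b::comm_semiring_1) \<Rightarrow> (nat \<Rightarrow> 'b) \<Rightarrow> 'k mpoly \<Rightarrow> 'b" where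
  "mpoly_eval h s f =
    (\<Sum>t\<in>Poly_Mapping.keys f. h (Poly_Mapping.lookup f t) *
       (\<Prod>i\<in>Poly_Mapping.keys t. s i ^ Poly_Mapping.lookup t i))"

definition eval_at :: "'k::comm_semiring_1 mpoly \<Rightarrow> 'k vec \<Rightarrow> 'k" where
  "eval_at f v = mpoly_eval (\<lambda>c. c) (\<lambda>i. v $ i) f"

definition mpoly_var :: "nat \<Rightarrow> 'k::zero_neq_one mpoly" where
  "mpoly_var i = Poly_Mapping.single (Poly_Mapping.single i 1) 1"

definition mpoly_const :: "'k::zero \<Rightarrow> 'k mpoly" where
  "mpoly_const c = Poly_Mapping.single 0 c"

definition linear_change :: "'k::comm_ring_1 mat \<Rightarrow> 'k mpoly \<Rightarrow> 'k mpoly" where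
  "linear_change M f =
    mpoly_eval mpoly_const (\<lambda>i. \<Sum>j<dim_col M. mpoly_const (M $$ (i, j)) * mpoly_var j) f"

text \<open>Coordinates on \<open>K\<^sup>m \<times> P\<^sup>n\<close>: variables \<open>0, \<dots>, m - 1\<close> are the affine coordinates and
  \<open>m, \<dots>, m + n\<close> the homogeneous ones.  The polynomials below are arbitrary in the former and
  homogeneous of degree \<open>d\<close> in the latter; for \<open>m = 0\<close> these are the forms of degree \<open>d\<close> in
  \<open>n + 1\<close> variables.\<close>

definition homog :: "nat \<Rightarrow> nat \<Rightarrow> nat \<Rightarrow> 'k::zero mpoly \<Rightarrow> bool" where
  "homog m n d f \<longleftrightarrow> vars f \<subseteq> {..m + n} \<and>
    (\<forall>t\<in>Poly_Mapping.keys f. (\<Sum>i\<in>{m..m + n}. Poly_Mapping.lookup t i) = d)"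


section \<open>Projective space and regular maps\<close>

text \<open>A point of \<open>P\<^sup>n\<close> is the set of its homogeneous coordinate vectors.\<close>

definition proj_point :: "'k::field vec \<Rightarrow> 'k vec set" where
  "proj_point v = {c \<cdot>\<^sub>v v | c. c \<noteq> 0}"

definition proj_space :: "nat \<Rightarrow> 'k::field vec set set" where
  "proj_space n = {proj_point v | v. v \<in> carrier_vec (n + 1) \<and> v \<noteq> 0\<^sub>v (n + 1)}"

definition zariski_closed :: "nat \<Rightarrow> nat \<Rightarrow> ('k::field vec \<times> 'k vec set) set \<Rightarrow> bool" where
  "zariski_closed m n Z \<longleftrightarrow> (\<exists>S. (\<forall>f\<in>S. \<exists>d. homog m n d f) \<and>
    Z = {(a, p). a \<in> carrier_vec m \<and> p \<in> proj_space n \<and>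
                 (\<forall>f\<in>S. \<forall>v\<in>p. eval_at f (a @\<^sub>v v) = 0)})"

definition zariski_open_in ::
  "nat \<Rightarrow> nat \<Rightarrow> ('k::field vec \<times> 'k vec set) set \<Rightarrow> ('k vec \<times> 'k vec set) set \<Rightarrow> bool" where
  "zariski_open_in m n Y W \<longleftrightarrow> (\<exists>Z. zariski_closed m n Z \<and> W = Y - Z)"

text \<open>Morphisms from a subset \<open>Y\<close> of \<open>K\<^sup>m \<times> P\<^sup>n\<close> to \<open>P\<^sup>n\<close>: locally in the Zariski topology, they
  are given by \<open>n + 1\<close> polynomials, homogeneous of one common degree in the homogeneous
  coordinates and without common zeros.\<close>

definition regular_map ::
  "nat \<Rightarrow> nat \<Rightarrow> ('k::field vec \<times> 'k vec set) set \<Rightarrow> ('k vec \<Rightarrow> 'k vec set \<Rightarrow> 'k vec set) \<Rightarrow> bool" where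
  "regular_map m n Y \<phi> \<longleftrightarrow> (\<forall>y\<in>Y. \<exists>W F d.
    zariski_open_in m n Y W \<and> y \<in> W \<and> (\<forall>i\<le>n. homog m n d (F i)) \<and>
    (\<forall>(b, q)\<in>W. \<forall>v\<in>q. let w = vec (n + 1) (\<lambda>i. eval_at (F i) (b @\<^sub>v v)) in
       w \<noteq> 0\<^sub>v (n + 1) \<and> \<phi> b q = proj_point w))"

text \<open>Subsets of \<open>P\<^sup>n\<close> and self-maps of \<open>P\<^sup>n\<close> are treated through \<open>K\<^sup>0 \<times> P\<^sup>n\<close>, where
  \<open>K\<^sup>0\<close> is the single point \<^term>\<open>0\<^sub>v 0\<close>.\<close>

definition proj_open_in :: "nat \<Rightarrow> 'k::field vec set set \<Rightarrow> 'k vec set set \<Rightarrow> bool" where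
  "proj_open_in n X W \<longleftrightarrow> zariski_open_in 0 n ({0\<^sub>v 0} \<times> X) ({0\<^sub>v 0} \<times> W)"

definition regular_self_map :: "nat \<Rightarrow> ('k::field vec set \<Rightarrow> 'k vec set) \<Rightarrow> bool" where
  "regular_self_map n \<psi> \<longleftrightarrow> regular_map 0 n ({0\<^sub>v 0} \<times> proj_space n) (\<lambda>_. \<psi>)"

definition proj_automorphism :: "nat \<Rightarrow> ('k::field vec set \<Rightarrow> 'k vec set) \<Rightarrow> bool" where
  "proj_automorphism n \<psi> \<longleftrightarrow> bij_betw \<psi> (proj_space n) (proj_space n) \<and>
    regular_self_map n \<psi> \<and> regular_self_map n (inv_into (proj_space n) \<psi>)"

definition proj_isomorphic :: "nat \<Rightarrow> 'k::field vec set set \<Rightarrow> 'k vec set set \<Rightarrow> bool" where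
  "proj_isomorphic n X Y \<longleftrightarrow> (\<exists>\<psi>. proj_automorphism n \<psi> \<and> \<psi> ` X = Y)"


section \<open>Non-degenerate hypersurfaces\<close>

definition nondegenerate :: "nat \<Rightarrow> 'k::field mpoly \<Rightarrow> bool" where
  "nondegenerate n f \<longleftrightarrow>
    \<not> (\<exists>M\<in>carrier_mat (n + 1) (n + 1). invertible_mat M \<and> card (vars (linear_change M f)) < n + 1)"

text \<open>Hypersurfaces are irreducible varieties, so the degree is that of the irreducible
  defining form, which over an algebraically closed field is unique up to a scalar.\<close>

definition nondegenerate_hypersurface :: "nat \<Rightarrow> nat \<Rightarrow> 'k::field vec set set \<Rightarrow> bool" where
  "nondegenerate_hypersurface n d X \<longleftrightarrow>
    (\<exists>f. homog 0 n d f \<and> irreducible f \<and> nondegenerate n f \<and>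
         X = {p \<in> proj_space n. \<forall>v\<in>p. eval_at f v = 0})"


section \<open>Induced additive actions\<close>

definition regular_action ::
  "nat \<Rightarrow> nat \<Rightarrow> 'k::field vec set set \<Rightarrow> ('k vec \<Rightarrow> 'k vec set \<Rightarrow> 'k vec set) \<Rightarrow> bool" where
  "regular_action m n X \<phi> \<longleftrightarrow>
    (\<forall>a\<in>carrier_vec m. \<forall>p\<in>X. \<phi> a p \<in> X) \<and>
    (\<forall>p\<in>X. \<phi> (0\<^sub>v m) p = p) \<and>
    (\<forall>a\<in>carrier_vec m. \<forall>b\<in>carrier_vec m. \<forall>p\<in>X. \<phi> (a + b) p = \<phi> a (\<phi> b p)) \<and>
    regular_map m n (carrier_vec m \<times> X) \<phi>"

definition additive_action ::
  "nat \<Rightarrow> nat \<Rightarrow> 'k::field vec set set \<Rightarrow> ('k vec \<Rightarrow> 'k vec set \<Rightarrow> 'k vec set) \<Rightarrow> bool" where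
  "additive_action m n X \<phi> \<longleftrightarrow> regular_action m n X \<phi> \<and>
    (\<forall>a\<in>carrier_vec m. (\<forall>p\<in>X. \<phi> a p = p) \<longrightarrow> a = 0\<^sub>v m) \<and>
    (\<exists>p\<in>X. proj_open_in n X ((\<lambda>a. \<phi> a p) ` carrier_vec m))"

text \<open>For a hypersurface \<open>X\<close> in \<open>P\<^sup>n\<close> the acting group has dimension \<open>dim X = n - 1\<close>.\<close>

definition induced_additive_action ::
  "nat \<Rightarrow> 'k::field vec set set \<Rightarrow> ('k vec \<Rightarrow> 'k vec set \<Rightarrow> 'k vec set) \<Rightarrow> bool" where
  "induced_additive_action n X \<phi> \<longleftrightarrow> additive_action (n - 1) n X \<phi> \<and>
    (\<exists>\<Phi>. regular_action (n - 1) n (proj_space n) \<Phi> \<and>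
         (\<forall>a\<in>carrier_vec (n - 1). \<forall>p\<in>X. \<Phi> a p = \<phi> a p))"

definition additive_hypersurface :: "nat \<Rightarrow> nat \<Rightarrow> 'k::field vec set set \<Rightarrow> bool" where
  "additive_hypersurface n d X \<longleftrightarrow>
    nondegenerate_hypersurface n d X \<and> (\<exists>\<phi>. induced_additive_action n X \<phi>)"


section \<open>The algebra corresponding to a hypersurface\<close>

text \<open>A rational representation of \<open>(K\<^sup>m, +)\<close> on \<open>K\<^sup>N\<close>, given by its matrix \<open>P\<close> of polynomial
  entries; over an infinite field \<open>P\<close> is determined by the representation.\<close>

definition rep_at :: "nat \<Rightarrow> (nat \<Rightarrow> nat \<Rightarrow> 'k::comm_semiring_1 mpoly) \<Rightarrow> 'k vec \<Rightarrow> 'k mat" where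
  "rep_at N P a = mat N N (\<lambda>(i, j). eval_at (P i j) a)"

definition linear_rep :: "nat \<Rightarrow> nat \<Rightarrow> (nat \<Rightarrow> nat \<Rightarrow> 'k::field mpoly) \<Rightarrow> bool" where
  "linear_rep m N P \<longleftrightarrow> (\<forall>i<N. \<forall>j<N. vars (P i j) \<subseteq> {..<m}) \<and>
    rep_at N P (0\<^sub>v m) = 1\<^sub>m N \<and>
    (\<forall>a\<in>carrier_vec m. \<forall>b\<in>carrier_vec m. rep_at N P (a + b) = rep_at N P a * rep_at N P b)"

definition faithful_rep :: "nat \<Rightarrow> nat \<Rightarrow> (nat \<Rightarrow> nat \<Rightarrow> 'k::field mpoly) \<Rightarrow> bool" where
  "faithful_rep m N P \<longleftrightarrow> linear_rep m N P \<and> inj_on (rep_at N P) (carrier_vec m)"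

text \<open>The differential at \<open>0\<close> in direction \<open>u\<close>: the coefficient of the \<open>k\<close>-th variable is the
  \<open>k\<close>-th partial derivative at \<open>0\<close>.\<close>

definition rep_differential ::
  "nat \<Rightarrow> nat \<Rightarrow> (nat \<Rightarrow> nat \<Rightarrow> 'k::field mpoly) \<Rightarrow> 'k vec \<Rightarrow> 'k mat" where
  "rep_differential m N P u =
    mat N N (\<lambda>(i, j). \<Sum>k<m. u $ k * Poly_Mapping.lookup (P i j) (Poly_Mapping.single k 1))"

inductive_set generated_algebra :: "nat \<Rightarrow> 'k::field mat set \<Rightarrow> 'k mat set"
  for N :: nat and U :: "'k mat set" where
  gen: "A \<in> U \<Longrightarrow> A \<in> generated_algebra N U"
| one: "1\<^sub>m N \<in> generated_algebra N U"
| add: "A \<in> generated_algebra N U \<Longrightarrow> B \<in> generated_algebra N U \<Longrightarrow> A + B \<in> generated_algebra N U"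
| mult: "A \<in> generated_algebra N U \<Longrightarrow> B \<in> generated_algebra N U \<Longrightarrow> A * B \<in> generated_algebra N U"
| smult: "A \<in> generated_algebra N U \<Longrightarrow> c \<cdot>\<^sub>m A \<in> generated_algebra N U"

text \<open>A \<open>K\<close>-algebra is a \<^typ>\<open>('k, 'a) module\<close> record satisfying the locale \<^locale>\<open>algebra\<close>
  over \<^const>\<open>class_ring\<close>.\<close>

definition mat_algebra :: "nat \<Rightarrow> 'k::field mat set \<Rightarrow> ('k, 'k mat) module" where
  "mat_algebra N B = (module_mat TYPE('k) N N)\<lparr>carrier := B\<rparr>"

definition corresponding_algebra ::
  "nat \<Rightarrow> 'k::field vec set set \<Rightarrow> ('k, 'k mat) module \<Rightarrow> bool" where
  "corresponding_algebra n X A \<longleftrightarrow> (\<exists>\<phi> P.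
    induced_additive_action n X \<phi> \<and> faithful_rep (n - 1) (n + 1) P \<and>
    (\<forall>a\<in>carrier_vec (n - 1). \<forall>v\<in>carrier_vec (n + 1). proj_point v \<in> X \<longrightarrow>
       \<phi> a (proj_point v) = proj_point (rep_at (n + 1) P a *\<^sub>v v)) \<and>
    A = mat_algebra (n + 1)
          (generated_algebra (n + 1) (rep_differential (n - 1) (n + 1) P ` carrier_vec (n - 1))))"

definition socle :: "('a, 'b) ring_scheme \<Rightarrow> 'a set \<Rightarrow> 'a set" where
  "socle A M = {a \<in> carrier A. \<forall>x\<in>M. a \<otimes>\<^bsub>A\<^esub> x = \<zero>\<^bsub>A\<^esub>}"

definition gorenstein_local_algebra :: "('k::field, 'a) module \<Rightarrow> bool" where
  "gorenstein_local_algebra A \<longleftrightarrow>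
    algebra class_ring A \<and> vectorspace.fin_dim class_ring A \<and>
    (\<exists>M. {I. maximalideal I A} = {M} \<and>
         vectorspace.dim class_ring (A\<lparr>carrier := socle A M\<rparr>) = 1)"

definition algebra_isomorphic ::
  "('k, 'a, 'c) module_scheme \<Rightarrow> ('k, 'b, 'd) module_scheme \<Rightarrow> bool" where
  "algebra_isomorphic A B \<longleftrightarrow>
    (\<exists>h\<in>ring_iso A B. \<forall>c. \<forall>x\<in>carrier A. h (c \<odot>\<^bsub>A\<^esub> x) = c \<odot>\<^bsub>B\<^esub> h x)"

text \<open>\<open>K[x, y]\<close> is \<^typ>\<open>'k poly poly\<close> with \<open>x\<close> the inner and \<open>y\<close> the outer variable.\<close>

definition poly_x :: "'k::field poly poly" where "poly_x = [:[:0, 1:]:]"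

definition poly_y :: "'k::field poly poly" where "poly_y = [:0, 1:]"

definition bivariate_quotient :: "'k::field poly poly set \<Rightarrow> ('k, 'k poly poly set) module" where
  "bivariate_quotient S = (let R = class_ring; I = genideal R S in
    \<lparr>carrier = carrier (R Quot I), mult = mult (R Quot I), one = one (R Quot I),
     zero = zero (R Quot I), add = add (R Quot I),
     smult = (\<lambda>c. mult (R Quot I) (I +>\<^bsub>R\<^esub> [:[:c:]:]))\<rparr>)"

end

theory Submission
  imports Defs "HOL-Computational_Algebra.Formal_Power_Series"
begin

text \<open>An action of \<open>K\<^sup>m\<close> on projective space lifts to a unipotent linear representation, and
  the algebra generated by its differential is a local algebra \<open>A\<close> with a cyclic vector, the
  vector being a point of the open orbit.  Writing group elements as exponentials of nilpotents,
  the closure of the orbit is given by \<open>z\<^sub>0\<^sup>d \<pi> (ln (1 + z / z\<^sub>0)) = 0\<close> for a linear functional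
  \<open>\<pi>\<close> vanishing on the Lie algebra \<open>U\<close>; so \<open>d\<close> is the largest exponent with \<open>\<pi> (w\<^sup>d) \<noteq> 0\<close> for
  some nilpotent \<open>w\<close>, and non-degeneracy says that \<open>(a, b) \<mapsto> \<pi> (a b)\<close> is non-degenerate.
  For \<open>dim A = d + 2\<close> the powers of \<open>w\<close> leave room for only one more generator, which can be
  normalised to \<open>x y = 0\<close>, \<open>y\<^sup>2 = x\<^sup>d\<close>, with \<open>\<pi>\<close> proportional to the coefficient of \<open>x\<^sup>d\<close>.\<close>

section \<open>Polynomial evaluation and weighted degrees\<close>

text \<open>Lifting the action is where geometry becomes algebra: after cancelling common factors,
  the local formulas glue to one tuple of coprime polynomials. Hence unique factorization in several
  variables is needed; it is proved by adjoining one variable at a time, and the same elimination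
  yields the Nullstellensatz for an irreducible form. The degree of the lift and the scalars in its
  multiplicativity are both controlled by one fact: over an algebraically closed field a polynomial
  in one variable without zeros is constant. The logarithm appears because an orbit is exp U, and
  \<pi> after ln turns multiplication by exp U into addition of 0. This identity gives the equation,
  its invariance, and both directions between non-degeneracy of the form and of the pairing. For
  uniqueness every form is transported to the single polynomial \<open>mform d\<close>. An
  isomorphism of algebras need not respect \<pi>, so the normal form of the generators also includes
  the conditions that \<pi> vanishes at x^i for 0 < i < d and at y.\<close>

definition mon :: "(nat \<Rightarrow> 'b::comm_semiring_1) \<Rightarrow> (nat \<Rightarrow>\<^sub>0 nat) \<Rightarrow> 'b" where
  "mon s t = (\<Prod>i\<in>Poly_Mapping.keys t. s i ^ Poly_Mapping.lookup t i)"

abbreviation ev :: "(nat \<Rightarrow> 'b::comm_semiring_1) \<Rightarrow> 'b mpoly \<Rightarrow> 'b" where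
  "ev s f \<equiv> mpoly_eval (\<lambda>c. c) s f"

lemma mon_superset:
  assumes "finite A" "Poly_Mapping.keys t \<subseteq> A"
  shows "mon s t = (\<Prod>i\<in>A. s i ^ Poly_Mapping.lookup t i)"
  unfolding mon_def using assms
  by (intro prod.mono_neutral_left) (auto simp: in_keys_iff)

lemma mon_0 [simp]: "mon s 0 = 1"
  by (simp add: mon_def)

lemma mon_add: "mon s (t + u) = mon s t * mon s u"
proof -
  let ?A = "Poly_Mapping.keys t \<union> Poly_Mapping.keys u"
  have "Poly_Mapping.keys (t + u) \<subseteq> ?A" by (rule Poly_Mapping.keys_add)
  then show ?thesis
    by (simp add: mon_superset[of ?A] lookup_add power_add prod.distrib)
qed

lemma mon_single [simp]: "mon s (Poly_Mapping.single i k) = s i ^ k"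
  by (cases "k = 0") (auto simp: mon_def)

lemma mon_cong: "(\<And>i. i \<in> Poly_Mapping.keys t ==> s i = s' i) ==> mon s t = mon s' t"
  by (simp add: mon_def)

lemma mpoly_eval_mon:
  "mpoly_eval h s f = (\<Sum>t\<in>Poly_Mapping.keys f. h (Poly_Mapping.lookup f t) * mon s t)"
  by (simp add: mpoly_eval_def mon_def)

lemma mpoly_eval_superset:
  assumes "finite A" "Poly_Mapping.keys f \<subseteq> A" "h 0 = 0"
  shows "mpoly_eval h s f = (\<Sum>t\<in>A. h (Poly_Mapping.lookup f t) * mon s t)"
  unfolding mpoly_eval_mon using assms
  by (intro sum.mono_neutral_left) (auto simp: in_keys_iff)

lemma mpoly_sum_single:
  "f = (\<Sum>t\<in>Poly_Mapping.keys f. Poly_Mapping.single t (Poly_Mapping.lookup f t))"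
  by (rule poly_mapping_eqI)
     (auto simp: lookup_sum lookup_single when_def in_keys_iff sum.delta')

lemma mpoly_eval_hom:
  fixes h :: "'k::comm_ring_1 \<Rightarrow> 'b::comm_ring_1"
  assumes "comm_ring_hom h"
  shows "comm_ring_hom (mpoly_eval h s)"
proof -
  interpret comm_ring_hom h by fact
  have add: "mpoly_eval h s (f + g) = mpoly_eval h s f + mpoly_eval h s g" for f g
  proof -
    let ?A = "Poly_Mapping.keys f \<union> Poly_Mapping.keys g"
    have "Poly_Mapping.keys (f + g) \<subseteq> ?A" by (rule Poly_Mapping.keys_add)
    then show ?thesis
      by (simp add: mpoly_eval_superset[of ?A] lookup_add hom_add algebra_simps sum.distrib)
  qed
  have z: "mpoly_eval h s 0 = 0" by (simp add: mpoly_eval_def)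
  have sm: "mpoly_eval h s (\<Sum>x\<in>A. F x) = (\<Sum>x\<in>A. mpoly_eval h s (F x))" if "finite A"
    for F :: "'c \<Rightarrow> 'k mpoly" and A
    using that by (induction A) (auto simp: z add)
  have sg: "mpoly_eval h s (Poly_Mapping.single t c) = h c * mon s t" for t c
    by (cases "c = 0") (auto simp: mpoly_eval_mon)
  have mult: "mpoly_eval h s (f * g) = mpoly_eval h s f * mpoly_eval h s g" for f g
  proof -
    let ?m = "\<lambda>f t. Poly_Mapping.single t (Poly_Mapping.lookup f t)"
    have "f * g = (\<Sum>t\<in>Poly_Mapping.keys f. \<Sum>u\<in>Poly_Mapping.keys g. ?m f t * ?m g u)"
      unfolding sum_product[symmetric] by (rule arg_cong2[of _ _ _ _ "(*)"]; rule mpoly_sum_single)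
    also have "mpoly_eval h s \<dots> = (\<Sum>t\<in>Poly_Mapping.keys f. \<Sum>u\<in>Poly_Mapping.keys g.
        (h (Poly_Mapping.lookup f t) * mon s t) * (h (Poly_Mapping.lookup g u) * mon s u))"
      by (simp add: sm mult_single sg hom_mult mon_add ac_simps)
    also have "\<dots> = mpoly_eval h s f * mpoly_eval h s g"
      by (simp add: mpoly_eval_mon sum_product)
    finally show ?thesis .
  qed
  show ?thesis
    using sg[of 0 1] by unfold_locales (auto simp: add mult z)
qed

lemma comm_ring_hom_id: "comm_ring_hom (\<lambda>c::'k::comm_ring_1. c)"
  by unfold_locales auto

lemma ev_hom: "comm_ring_hom (ev (s :: nat \<Rightarrow> 'b::comm_ring_1))"
  by (rule mpoly_eval_hom[OF comm_ring_hom_id])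

context
  fixes s :: "nat \<Rightarrow> 'b::comm_ring_1"
begin
interpretation comm_ring_hom "ev s" by (rule ev_hom)
lemmas ev_add [simp] = hom_add
lemmas ev_mult [simp] = hom_mult
lemmas ev_0 [simp] = hom_zero
lemmas ev_1 [simp] = hom_one
lemmas ev_diff [simp] = hom_minus
lemmas ev_uminus [simp] = hom_uminus
lemmas ev_power [simp] = hom_power
lemmas ev_sum [simp] = hom_sum
lemmas ev_prod [simp] = hom_prod
end

lemma mpoly_eval_single:
  "h 0 = 0 ==> mpoly_eval h s (Poly_Mapping.single t c) = h c * mon s t"
  by (cases "c = 0") (auto simp: mpoly_eval_mon)

lemma mpoly_eval_const [simp]: "h 0 = 0 ==> mpoly_eval h s (mpoly_const c) = h c"
  by (simp add: mpoly_const_def mpoly_eval_single)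

lemma mpoly_eval_var [simp]: "h 0 = 0 ==> h 1 = 1 ==> mpoly_eval h s (mpoly_var i) = s i"
  by (simp add: mpoly_var_def mpoly_eval_single)

lemma const_hom: "comm_ring_hom (mpoly_const :: 'k::comm_ring_1 \<Rightarrow> _)"
  by unfold_locales (auto simp: mpoly_const_def single_add mult_single)

context
begin
interpretation comm_ring_hom "mpoly_const :: 'k::comm_ring_1 \<Rightarrow> _" by (rule const_hom)
lemmas const_add = hom_add
lemmas const_mult = hom_mult
lemmas const_0 [simp] = hom_zero
lemmas const_1 [simp] = hom_one
lemmas const_uminus = hom_uminus
lemmas const_power = hom_power
end

lemma const_eq_iff [simp]: "mpoly_const a = mpoly_const b \<longleftrightarrow> a = b"
  by (metis mpoly_const_def lookup_single_eq)

lemma const_eq_0_iff [simp]: "mpoly_const a = 0 \<longleftrightarrow> a = 0"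
  by (metis const_eq_iff mpoly_const_def single_zero)

lemma mon_var: "mon mpoly_var t = Poly_Mapping.single t (1::'k::comm_ring_1)"
proof -
  have a: "mpoly_var i ^ k = Poly_Mapping.single (Poly_Mapping.single i k) (1::'k)" for i k
    by (induction k) (auto simp: mpoly_var_def mult_single single_add[symmetric])
  have "(\<Prod>i\<in>A. mpoly_var i ^ u i) = Poly_Mapping.single (\<Sum>i\<in>A. Poly_Mapping.single i (u i)) (1::'k)"
    if "finite A" for A u
    using that by (induction A) (auto simp: a mult_single)
  then show ?thesis
    unfolding mon_def by (simp flip: mpoly_sum_single)
qed

lemma single_eq_const_mon:
  "Poly_Mapping.single t (c::'k::comm_ring_1) = mpoly_const c * mon mpoly_var t"
  by (simp add: mon_var mpoly_const_def mult_single)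

lemma mpoly_eval_id: "mpoly_eval mpoly_const mpoly_var f = (f :: 'k::comm_ring_1 mpoly)"
  unfolding mpoly_eval_mon single_eq_const_mon[symmetric] by (rule mpoly_sum_single[symmetric])

lemma mon_hom:
  assumes "comm_ring_hom \<phi>"
  shows "\<phi> (mon s t) = mon (\<lambda>i. \<phi> (s i)) t"
proof -
  interpret comm_ring_hom \<phi> by fact
  show ?thesis by (simp add: mon_def hom_prod hom_power)
qed

lemma mpoly_eval_comp:
  assumes "comm_ring_hom \<phi>"
  shows "\<phi> (mpoly_eval h s f) = mpoly_eval (\<lambda>c. \<phi> (h c)) (\<lambda>i. \<phi> (s i)) f"
proof -
  interpret comm_ring_hom \<phi> by fact
  show ?thesis by (simp add: mpoly_eval_mon hom_sum hom_mult mon_hom[OF assms])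
qed

lemma mpoly_induct [case_names const var add mult]:
  fixes f :: "'k::comm_ring_1 mpoly"
  assumes c: "\<And>c. P (mpoly_const c)" and v: "\<And>i. P (mpoly_var i)"
    and a: "\<And>f g. P f ==> P g ==> P (f + g)" and m: "\<And>f g. P f ==> P g ==> P (f * g)"
  shows "P f"
proof -
  have pw: "P (mpoly_var i ^ k)" for i k
    by (induction k) (use c[of 1] v m in auto)
  have mo: "P (mon mpoly_var t)" for t
  proof -
    have "P (\<Prod>i\<in>A. mpoly_var i ^ Poly_Mapping.lookup t i)" if "finite A" for A
      using that by (induction A) (use c[of 1] pw m in auto)
    then show ?thesis by (simp add: mon_def)
  qed
  have "P (\<Sum>t\<in>A. Poly_Mapping.single t (Poly_Mapping.lookup f t))" if "finite A" for A
    using that by (induction A) (use c[of 0] in \<open>auto simp: single_eq_const_mon intro!: a m c mo\<close>)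
  then show ?thesis by (subst mpoly_sum_single) simp
qed

lemma mpoly_eval_cong:
  assumes "\<And>i. i \<in> vars f ==> s i = s' i"
  shows "mpoly_eval h s f = mpoly_eval h s' f"
  unfolding mpoly_eval_mon using assms
  by (intro sum.cong arg_cong2[of _ _ _ _ "(*)"] mon_cong) (auto simp: vars_def)

lemma vars_const [simp]: "vars (mpoly_const c) = {}"
  by (auto simp: vars_def mpoly_const_def split: if_splits)

lemma vars_0 [simp]: "vars 0 = {}" by (simp add: vars_def)
lemma vars_1 [simp]: "vars (1 :: 'k::comm_ring_1 mpoly) = {}" by (metis const_1 vars_const)

lemma vars_var [simp]: "vars (mpoly_var i :: 'k::zero_neq_one mpoly) = {i}"
  by (auto simp: vars_def mpoly_var_def)

lemma finite_vars [simp]: "finite (vars f)"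
  by (auto simp: vars_def)

lemma vars_uminus [simp]: "vars (- f) = vars (f :: 'k::comm_ring_1 mpoly)"
  by (simp add: vars_def Poly_Mapping.keys_def)

lemma vars_add: "vars (f + g) \<subseteq> vars f \<union> vars g"
  using Poly_Mapping.keys_add[of f g] by (fastforce simp: vars_def)

lemma vars_diff: "vars (f - g) \<subseteq> vars f \<union> vars (g :: 'k::comm_ring_1 mpoly)"
  using vars_add[of f "-g"] by simp

lemma vars_mult: "vars (f * g) \<subseteq> vars f \<union> vars (g :: 'k::comm_ring_1 mpoly)"
proof
  fix i assume "i \<in> vars (f * g)"
  then obtain t where t: "t \<in> Poly_Mapping.keys (f * g)" "i \<in> Poly_Mapping.keys t"
    by (auto simp: vars_def)
  then obtain a b where "t = a + b" "a \<in> Poly_Mapping.keys f" "b \<in> Poly_Mapping.keys g"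
    using Poly_Mapping.keys_mult[of f g] by auto
  then show "i \<in> vars f \<union> vars g"
    using t Poly_Mapping.keys_add[of a b] by (auto simp: vars_def)
qed

lemma vars_sum: "vars (\<Sum>x\<in>A. F x) \<subseteq> (\<Union>x\<in>A. vars (F x))"
  by (induction A rule: infinite_finite_induct) (use vars_add in fastforce)+

lemma vars_prod: "vars (\<Prod>x\<in>A. F x :: 'k::comm_ring_1 mpoly) \<subseteq> (\<Union>x\<in>A. vars (F x))"
  by (induction A rule: infinite_finite_induct) (use vars_mult in fastforce)+

lemma vars_power: "vars (f ^ k) \<subseteq> vars (f :: 'k::comm_ring_1 mpoly)"
  by (induction k) (use vars_mult in fastforce)+

lemma vars_subset_intros:
  fixes f g :: "'k::comm_ring_1 mpoly"
  shows "vars f \<subseteq> V ==> vars g \<subseteq> V ==> vars (f + g) \<subseteq> V"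
    and "vars f \<subseteq> V ==> vars g \<subseteq> V ==> vars (f - g) \<subseteq> V"
    and "vars f \<subseteq> V ==> vars g \<subseteq> V ==> vars (f * g) \<subseteq> V"
    and "vars f \<subseteq> V ==> vars (f ^ k) \<subseteq> V"
    and "(\<And>x. x \<in> A ==> vars (F x) \<subseteq> V) ==> vars (\<Sum>x\<in>A. F x) \<subseteq> V"
    and "(\<And>x. x \<in> A ==> vars (F' x :: 'k mpoly) \<subseteq> V) ==> vars (\<Prod>x\<in>A. F' x) \<subseteq> V"
  using vars_add[of f g] vars_diff[of f g] vars_mult[of f g] vars_power[of f k] vars_sum[of F A] vars_prod[of F' A]
  by (blast+)

section \<open>Weighted homogeneity and factors of homogeneous polynomials\<close>

definition wsum :: "(nat \<Rightarrow> nat) \<Rightarrow> (nat \<Rightarrow>\<^sub>0 nat) \<Rightarrow> nat" where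
  "wsum w t = (\<Sum>i\<in>Poly_Mapping.keys t. w i * Poly_Mapping.lookup t i)"

lemma wsum_superset:
  assumes "finite A" "Poly_Mapping.keys t \<subseteq> A"
  shows "wsum w t = (\<Sum>i\<in>A. w i * Poly_Mapping.lookup t i)"
  unfolding wsum_def using assms
  by (intro sum.mono_neutral_left) (auto simp: in_keys_iff)

text \<open>The weights serve three purposes: 1 on a block of variables gives homogeneity in that
  block, 1 everywhere gives the total degree, and the indicator of one variable with
  \<open>d = 0\<close> says that this variable does not occur.\<close>

definition whomog :: "(nat \<Rightarrow> nat) \<Rightarrow> nat \<Rightarrow> 'k::zero mpoly \<Rightarrow> bool" where
  "whomog w d f \<longleftrightarrow> (\<forall>t\<in>Poly_Mapping.keys f. wsum w t = d)"

text \<open>Marks each variable \<open>i\<close> by \<open>S ^ w i\<close>, so that the coefficients in \<open>S\<close> are the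
  weighted homogeneous components.\<close>

definition grade :: "(nat \<Rightarrow> nat) \<Rightarrow> 'k::comm_ring_1 mpoly \<Rightarrow> 'k mpoly poly" where
  "grade w f = mpoly_eval (\<lambda>c. [:mpoly_const c:]) (\<lambda>i. monom (mpoly_var i) (w i)) f"

lemma const_poly_hom: "comm_ring_hom (\<lambda>c::'k::comm_ring_1. [:mpoly_const c:])"
  by unfold_locales (auto simp: const_add const_mult one_pCons)

lemma grade_hom: "comm_ring_hom (grade w :: 'k::comm_ring_1 mpoly \<Rightarrow> _)"
  unfolding grade_def[abs_def] by (rule mpoly_eval_hom[OF const_poly_hom])

lemma mon_monom:
  "mon (\<lambda>i. monom (p i) (w i)) t = monom (mon p t) (wsum w t)"
proof -
  have "(\<Prod>i\<in>A. monom (p i) (w i) ^ u i) = monom (\<Prod>i\<in>A. p i ^ u i) (\<Sum>i\<in>A. w i * u i)"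
    if "finite A" for A u
    using that by (induction A) (auto simp: monom_power mult_monom)
  then show ?thesis by (simp add: mon_def wsum_def)
qed

lemma grade_alt:
  "grade w f = (\<Sum>t\<in>Poly_Mapping.keys f.
     monom (Poly_Mapping.single t (Poly_Mapping.lookup f t)) (wsum w t))"
  unfolding grade_def mpoly_eval_mon mon_monom by (simp add: smult_monom single_eq_const_mon)

lemma lookup_coeff_grade:
  "Poly_Mapping.lookup (coeff (grade w f) e) t = (if wsum w t = e then Poly_Mapping.lookup f t else 0)"
proof -
  have "Poly_Mapping.lookup (coeff (grade w f) e) t =
      (\<Sum>u\<in>Poly_Mapping.keys f. if u = t then (if wsum w t = e then Poly_Mapping.lookup f t else 0) else 0)"
    unfolding grade_alt coeff_sum lookup_sum
    by (rule sum.cong) (auto simp: coeff_monom lookup_single when_def)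
  then show ?thesis by (simp add: in_keys_iff)
qed

lemma whomog_iff_grade: "whomog w d f \<longleftrightarrow> grade w f = monom f d"
proof
  assume *: "whomog w d f"
  show "grade w f = monom f d"
  proof (intro poly_eqI poly_mapping_eqI)
    fix e t
    have "Poly_Mapping.lookup f t = 0" if "wsum w t \<noteq> d"
      using * that by (auto simp: whomog_def in_keys_iff)
    then show "Poly_Mapping.lookup (coeff (grade w f) e) t = Poly_Mapping.lookup (coeff (monom f d) e) t"
      unfolding lookup_coeff_grade coeff_monom by auto
  qed
next
  assume *: "grade w f = monom f d"
  show "whomog w d f"
    unfolding whomog_def
  proof
    fix t assume t: "t \<in> Poly_Mapping.keys f"
    have "Poly_Mapping.lookup (coeff (monom f d) (wsum w t)) t = Poly_Mapping.lookup f t"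
      using lookup_coeff_grade[of w f "wsum w t" t] unfolding * by simp
    then show "wsum w t = d"
      using t by (cases "wsum w t = d") (auto simp: coeff_monom in_keys_iff)
  qed
qed

lemma poly_grade_1 [simp]: "poly (grade w f) 1 = f"
  by (simp add: grade_alt poly_sum poly_monom flip: mpoly_sum_single)

lemma grade_eq_0_iff [simp]: "grade w f = 0 \<longleftrightarrow> f = 0"
proof
  show "grade w f = 0 ==> f = 0" using poly_grade_1[of w f] by simp
qed (simp add: grade_alt)

text \<open>The order at 0 and the degree are both additive and both add up to \<open>d\<close>. The
  order never exceeds the degree, so for each factor the two agree, which leaves only a
  monomial.\<close>

lemma monom_factor:
  fixes p q :: "'a::idom poly"
  assumes "p * q = monom c d" "c \<noteq> 0"
  shows "\<exists>a k. p = monom a k \<and> k \<le> d"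
proof -
  have nz: "p \<noteq> 0" "q \<noteq> 0" using assms by auto
  have o: "order 0 (monom c d) = d" using assms by simp
  have "order 0 p + order 0 q = d" using o assms nz
    by (metis order_mult no_zero_divisors)
  moreover have "degree p + degree q = d"
    using assms nz by (metis degree_mult_eq degree_monom_eq)
  ultimately have eq: "order 0 p = degree p"
    using order_degree[OF nz(1), of 0] order_degree[OF nz(2), of 0] by linarith
  obtain r where r: "p = [:0,1:]^degree p * r"
    using order_1[of 0 p] eq by (auto simp: dvd_def)
  have "r \<noteq> 0" using r nz by auto
  then have "degree p = degree p + degree r"
    by (subst r) (simp add: degree_mult_eq degree_power_eq)
  then obtain a where "r = [:a:]" using degree_eq_zeroE[of r] by auto
  then have "p = monom a (degree p)"
    using r by (simp add: monom_altdef)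
  then show ?thesis using \<open>degree p + degree q = d\<close> by (intro exI[of _ a] exI[of _ "degree p"]) auto
qed

text \<open>\<open>grade w\<close> is a ring homomorphism into polynomials in one variable over a
  domain, where a factor of a monomial is a monomial. Setting that variable to 1 identifies its
  coefficient with \<open>f\<close>.\<close>

lemma whomog_factor:
  fixes f g :: "'k::idom mpoly"
  assumes "whomog w d (f * g)" "f * g \<noteq> 0"
  shows "\<exists>k\<le>d. whomog w k f"
proof -
  interpret comm_ring_hom "grade w :: 'k mpoly \<Rightarrow> _" by (rule grade_hom)
  have "grade w f * grade w g = monom (f * g) d"
    using assms by (simp add: whomog_iff_grade hom_mult)
  then obtain a k where "grade w f = monom a k" "k \<le> d" using monom_factor assms(2) by metis
  moreover from this have "a = f" by (metis poly_grade_1 poly_monom power_one mult.right_neutral)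
  ultimately show ?thesis by (auto simp: whomog_iff_grade)
qed

lemma whomog_mult:
  fixes f g :: "'k::comm_ring_1 mpoly"
  assumes "whomog w d f" "whomog w e g"
  shows "whomog w (d + e) (f * g)"
proof -
  interpret comm_ring_hom "grade w :: 'k mpoly \<Rightarrow> _" by (rule grade_hom)
  show ?thesis using assms by (simp add: whomog_iff_grade hom_mult mult_monom)
qed

lemma whomog_add:
  fixes f g :: "'k::comm_ring_1 mpoly"
  shows "whomog w d f ==> whomog w d g ==> whomog w d (f + g)"
  using Poly_Mapping.keys_add[of f g] by (auto simp: whomog_def)

lemma whomog_0 [simp]: "whomog w d 0"
  by (simp add: whomog_def)

lemma whomog_sum:
  fixes F :: "'a \<Rightarrow> 'k::comm_ring_1 mpoly"
  shows "(\<And>x. x \<in> A ==> whomog w d (F x)) ==> whomog w d (\<Sum>x\<in>A. F x)"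
  by (induction A rule: infinite_finite_induct) (auto intro: whomog_add)

lemma whomog_const: "whomog w 0 (mpoly_const c)"
  by (auto simp: whomog_def mpoly_const_def wsum_def)

lemma whomog_1: "whomog w 0 (1 :: 'k::comm_ring_1 mpoly)"
  using whomog_const[of w "1::'k"] unfolding const_1 .

lemma whomog_var: "whomog w (w i) (mpoly_var i :: 'k::zero_neq_one mpoly)"
  by (auto simp: whomog_def mpoly_var_def wsum_def)

lemma whomog_power:
  fixes f :: "'k::comm_ring_1 mpoly"
  shows "whomog w d f ==> whomog w (k * d) (f ^ k)"
  by (induction k) (auto intro: whomog_1 whomog_mult)

lemma whomog_unique: "whomog w d f ==> whomog w e f ==> f \<noteq> 0 ==> d = e"
  by (cases "Poly_Mapping.keys f = {}") (auto simp: whomog_def)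

lemma ev_scale:
  fixes f :: "'k::comm_ring_1 mpoly"
  assumes "whomog w d f"
  shows "ev (\<lambda>i. c ^ w i * s i) f = c ^ d * ev s f"
proof -
  have m: "mon (\<lambda>i. c ^ w i * s i) t = c ^ wsum w t * mon s t" for t
    by (simp add: mon_def wsum_def power_mult_distrib prod.distrib power_mult[symmetric] power_sum)
  show ?thesis unfolding mpoly_eval_mon m sum_distrib_left
    by (rule sum.cong) (use assms in \<open>auto simp: whomog_def ac_simps\<close>)
qed

text \<open>Reading absence of a variable as weighted degree 0 makes \<open>vars_mult_eq\<close> an
  instance of \<open>whomog_factor\<close>: no variable can cancel in a product.\<close>

lemma notin_vars_iff: "x \<notin> vars f \<longleftrightarrow> whomog (\<lambda>i. if i = x then 1 else 0) 0 f"
  by (auto simp: vars_def whomog_def wsum_def)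

lemma vars_mult_eq:
  fixes f g :: "'k::idom mpoly"
  assumes "f \<noteq> 0" "g \<noteq> 0"
  shows "vars (f * g) = vars f \<union> vars g"
proof -
  have *: "vars f \<subseteq> vars (f * g)" if nz: "f \<noteq> 0" "g \<noteq> 0" for f g :: "'k mpoly"
  proof
    fix x assume x: "x \<in> vars f"
    show "x \<in> vars (f * g)"
    proof (rule ccontr)
      assume "x \<notin> vars (f * g)"
      then obtain k where "k \<le> 0" "whomog (\<lambda>i. if i = x then 1 else 0) k f"
        unfolding notin_vars_iff using whomog_factor[of _ 0 f g] no_zero_divisors[OF nz] by metis
      then show False using x notin_vars_iff[of x f] by simp
    qed
  qed
  show ?thesis using *[OF assms] *[OF assms(2,1)] vars_mult[of f g]
    by (simp add: mult.commute[of g f] subset_antisym)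
qed

section \<open>Total degree, units and irreducible factors\<close>

definition tdeg :: "'k::comm_ring_1 mpoly \<Rightarrow> nat" where
  "tdeg f = degree (grade (\<lambda>_. 1) f)"

lemma tdeg_mult:
  fixes f g :: "'k::idom mpoly"
  assumes "f \<noteq> 0" "g \<noteq> 0"
  shows "tdeg (f * g) = tdeg f + tdeg g"
proof -
  interpret comm_ring_hom "grade (\<lambda>_. 1) :: 'k mpoly \<Rightarrow> _" by (rule grade_hom)
  show ?thesis unfolding tdeg_def hom_mult using assms by (intro degree_mult_eq) auto
qed

lemma wsum_1_eq_0: "wsum (\<lambda>_. 1) t = 0 \<longleftrightarrow> t = 0"
proof
  assume "wsum (\<lambda>_. 1) t = 0"
  then have z: "\<forall>i\<in>Poly_Mapping.keys t. Poly_Mapping.lookup t i = 0" by (simp add: wsum_def)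
  show "t = 0"
  proof (rule poly_mapping_eqI)
    fix i show "Poly_Mapping.lookup t i = Poly_Mapping.lookup 0 i"
      using z by (cases "i \<in> Poly_Mapping.keys t") (auto simp: in_keys_iff)
  qed
qed (simp add: wsum_def)

lemma whomog_0_const: "whomog (\<lambda>_. 1) 0 f ==> f = mpoly_const (Poly_Mapping.lookup f 0)"
  unfolding whomog_def wsum_1_eq_0
  by (intro poly_mapping_eqI) (auto simp: mpoly_const_def lookup_single when_def in_keys_iff)

lemma tdeg_0_const:
  assumes "tdeg f = 0"
  shows "f = mpoly_const (Poly_Mapping.lookup f 0)"
proof -
  obtain a where a: "grade (\<lambda>_. 1) f = [:a:]" using assms degree_eq_zeroE unfolding tdeg_def by blast
  then have "a = f" using poly_grade_1[of "\<lambda>_. 1" f] by simp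
  with a have "whomog (\<lambda>_. 1) 0 f" by (simp add: whomog_iff_grade monom_0)
  then show ?thesis by (rule whomog_0_const)
qed

lemma tdeg_const [simp]: "tdeg (mpoly_const c) = 0"
  using whomog_const[of "\<lambda>_. 1" c] by (simp add: tdeg_def whomog_iff_grade degree_monom_eq monom_0)

lemma is_unit_mpoly_iff:
  fixes f :: "'k::field mpoly"
  shows "f dvd 1 \<longleftrightarrow> f \<noteq> 0 \<and> tdeg f = 0"
proof
  assume "f dvd 1"
  then obtain g where g: "f * g = 1" by (metis dvdE)
  then have "f \<noteq> 0" "g \<noteq> 0" by auto
  then show "f \<noteq> 0 \<and> tdeg f = 0" using tdeg_mult[of f g] g tdeg_const[of "1::'k"] by simp
next
  assume *: "f \<noteq> 0 \<and> tdeg f = 0"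
  then obtain c where c: "f = mpoly_const c" using tdeg_0_const by blast
  then have "f * mpoly_const (1 / c) = 1" using * by (simp flip: const_mult)
  then show "f dvd 1" by (metis dvd_triv_left)
qed

lemma is_unit_const: "c \<noteq> 0 ==> mpoly_const (c :: 'k::field) dvd 1"
  by (simp add: is_unit_mpoly_iff)

lemma is_unit_mpolyE:
  fixes f :: "'k::field mpoly"
  assumes "f dvd 1" obtains c where "c \<noteq> 0" "f = mpoly_const c"
  using assms tdeg_0_const[of f] by (metis is_unit_mpoly_iff const_eq_0_iff)

text \<open>Total degree drops strictly in a proper factorization, so splitting off factors
  terminates.\<close>

lemma exists_irreducible_factor:
  fixes f :: "'k::field mpoly"
  assumes "f \<noteq> 0" "\<not> f dvd 1"
  shows "\<exists>p g. irreducible p \<and> f = p * g"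
  using assms
proof (induction "tdeg f" arbitrary: f rule: less_induct)
  case less
  show ?case
  proof (cases "irreducible f")
    case True
    then have "irreducible f \<and> f = f * 1" by simp
    then show ?thesis by blast
  next
    case False
    then obtain a b where ab: "f = a * b" "\<not> a dvd 1" "\<not> b dvd 1"
      using less.prems by (auto simp: irreducible_def)
    then have nz: "a \<noteq> 0" "b \<noteq> 0" using less.prems by auto
    then have "tdeg a < tdeg f" using ab tdeg_mult[OF nz] by (auto simp: is_unit_mpoly_iff)
    then obtain p g where "irreducible p" "a = p * g" using less.hyps[OF _ nz(1) ab(2)] by metis
    then have "irreducible p \<and> f = p * (g * b)" using ab by (simp add: mult.assoc)
    then show ?thesis by blast
  qed
qed

section \<open>Unique factorization and the Nullstellensatz for hypersurfaces\<close>

text \<open>\<open>f\<close> as a polynomial in the variable \<open>x\<close>.\<close>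

definition up :: "nat \<Rightarrow> 'k::comm_ring_1 mpoly \<Rightarrow> 'k mpoly poly" where
  "up x f = mpoly_eval (\<lambda>c. [:mpoly_const c:])
     (\<lambda>j. if j = x then [:0, 1:] else [:mpoly_var j:]) f"

lemma up_hom: "comm_ring_hom (up x :: 'k::comm_ring_1 mpoly \<Rightarrow> _)"
  unfolding up_def[abs_def] by (rule mpoly_eval_hom[OF const_poly_hom])

context
  fixes x :: nat
begin
interpretation comm_ring_hom "up x :: 'k::comm_ring_1 mpoly \<Rightarrow> _" by (rule up_hom)
lemmas up_mult = hom_mult
lemmas up_add = hom_add
lemmas up_diff = hom_minus
lemmas up_0 [simp] = hom_zero
lemmas up_power = hom_power
end

lemma poly_up [simp]: "poly (up x f) (mpoly_var x) = (f :: 'k::comm_ring_1 mpoly)"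
proof -
  have h: "comm_ring_hom (\<lambda>p. poly p (mpoly_var x :: 'k mpoly))"
    by unfold_locales auto
  have "poly (up x f) (mpoly_var x) =
      mpoly_eval mpoly_const (\<lambda>j. poly (if j = x then [:0, 1:] else [:mpoly_var j:]) (mpoly_var x)) f"
    unfolding up_def by (subst mpoly_eval_comp[OF h]) simp
  also have "(\<lambda>j. poly (if j = x then [:0, 1:] else [:mpoly_var j :: 'k mpoly:]) (mpoly_var x)) = mpoly_var"
    by (auto simp: fun_eq_iff)
  finally show ?thesis by (simp add: mpoly_eval_id)
qed

lemma up_eq_0_iff [simp]: "up x f = 0 \<longleftrightarrow> (f :: 'k::comm_ring_1 mpoly) = 0"
proof
  show "up x f = 0 ==> f = 0" using poly_up[of x f] by simp
qed simp

lemma up_free: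
  assumes "x \<notin> vars f"
  shows "up x f = [:f :: 'k::comm_ring_1 mpoly:]"
proof -
  have h: "comm_ring_hom (\<lambda>c::'k mpoly. [:c:])"
    by unfold_locales (auto simp: one_pCons)
  have "up x f = mpoly_eval (\<lambda>c. [:mpoly_const c:]) (\<lambda>j. [:mpoly_var j:]) f"
    unfolding up_def by (rule mpoly_eval_cong) (use assms in auto)
  also have "\<dots> = [:mpoly_eval mpoly_const mpoly_var f:]"
    by (rule mpoly_eval_comp[OF h, symmetric])
  finally show ?thesis by (simp add: mpoly_eval_id)
qed

lemma up_var [simp]: "up x (mpoly_var x :: 'k::comm_ring_1 mpoly) = [:0, 1:]"
  by (simp add: up_def)

lemma vars_coeff_up: "vars (coeff (up x (f :: 'k::comm_ring_1 mpoly)) k) \<subseteq> vars f - {x}"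
proof -
  let ?s = "\<lambda>j. if j = x then [:0, 1:] else [:mpoly_var j :: 'k mpoly:]"
  have mo: "\<exists>c. vars c \<subseteq> Poly_Mapping.keys t - {x} \<and> mon ?s t = monom c (Poly_Mapping.lookup t x)" for t
  proof -
    let ?u = "\<lambda>j. if j = x then 1 else (mpoly_var j :: 'k mpoly)"
    have eq: "?s = (\<lambda>j. monom (?u j) (if j = x then 1 else 0))"
      by (rule ext) (simp add: monom_0 monom_Suc)
    have vu: "vars (?u j) \<subseteq> {j} - {x}" for j by (cases "j = x") simp_all
    have "vars (mon ?u t) \<subseteq> (\<Union>j\<in>Poly_Mapping.keys t. vars (?u j))"
      unfolding mon_def by (rule order.trans[OF vars_prod]) (rule UN_mono[OF subset_refl], rule vars_power)
    also have "\<dots> \<subseteq> (\<Union>j\<in>Poly_Mapping.keys t. {j} - {x})"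
      by (rule UN_mono[OF subset_refl]) (rule vu)
    also have "\<dots> = Poly_Mapping.keys t - {x}" by blast
    finally have v: "vars (mon ?u t) \<subseteq> Poly_Mapping.keys t - {x}" .
    have "wsum (\<lambda>j. if j = x then 1 else 0) t =
        (\<Sum>j\<in>Poly_Mapping.keys t. if j = x then Poly_Mapping.lookup t j else 0)"
      unfolding wsum_def by (rule sum.cong) simp_all
    then have "wsum (\<lambda>j. if j = x then 1 else 0) t = Poly_Mapping.lookup t x"
      by (simp add: in_keys_iff)
    then have "mon ?s t = monom (mon ?u t) (Poly_Mapping.lookup t x)"
      unfolding eq mon_monom by simp
    then show ?thesis using v by blast
  qed
  have eq: "coeff (up x f) k =
      (\<Sum>t\<in>Poly_Mapping.keys f. mpoly_const (Poly_Mapping.lookup f t) * coeff (mon ?s t) k)"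
    unfolding up_def mpoly_eval_mon by (simp add: coeff_sum)
  have "vars (mpoly_const (Poly_Mapping.lookup f t) * coeff (mon ?s t) k) \<subseteq> vars f - {x}"
    if t: "t \<in> Poly_Mapping.keys f" for t
  proof -
    obtain c where c: "vars c \<subseteq> Poly_Mapping.keys t - {x}" "mon ?s t = monom c (Poly_Mapping.lookup t x)"
      using mo by blast
    have "vars (coeff (mon ?s t) k) \<subseteq> Poly_Mapping.keys t - {x}"
      using c by (auto simp: coeff_monom split: if_splits)
    moreover have "Poly_Mapping.keys t \<subseteq> vars f" using t by (auto simp: vars_def)
    ultimately show ?thesis
      using vars_mult[of "mpoly_const (Poly_Mapping.lookup f t)" "coeff (mon ?s t) k"]
      unfolding vars_const Un_empty_left by (meson Diff_mono order.trans subset_refl)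
  qed
  then show ?thesis
    unfolding eq by (intro order.trans[OF vars_sum] UN_least)
qed

text \<open>The right-hand side is \<open>up x f\<close> with its coefficients evaluated at
  \<open>s\<close>. Its degree may drop, namely when the leading coefficient vanishes at
  \<open>s\<close>; hence the sum is written out up to \<open>degree (up x f)\<close>.\<close>

lemma ev_up:
  fixes f :: "'k::comm_ring_1 mpoly"
  shows "ev (s(x := a)) f = poly (\<Sum>i\<le>degree (up x f). monom (ev s (coeff (up x f) i)) i) a"
proof -
  have "ev (s(x := a)) f = ev (s(x := a)) (poly (up x f) (mpoly_var x))" by simp
  also have "\<dots> = (\<Sum>i\<le>degree (up x f). ev (s(x := a)) (coeff (up x f) i) * a ^ i)"
    unfolding poly_altdef by simp
  also have "\<dots> = (\<Sum>i\<le>degree (up x f). ev s (coeff (up x f) i) * a ^ i)"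
  proof (rule sum.cong)
    fix i
    have "ev (s(x := a)) (coeff (up x f) i) = ev s (coeff (up x f) i)"
      by (rule mpoly_eval_cong) (use vars_coeff_up[of x f i] in auto)
    then show "ev (s(x := a)) (coeff (up x f) i) * a ^ i = ev s (coeff (up x f) i) * a ^ i" by simp
  qed simp
  finally show ?thesis by (simp add: poly_sum poly_monom)
qed

lemma coeff_sum_monom_up:
  "coeff (\<Sum>i\<le>n. monom (c i) i) k = (if k \<le> n then c k else 0)"
  by (simp add: coeff_sum coeff_monom if_distrib cong: if_cong)

text \<open>Induction on the number of variables: with the others fixed, a polynomial in
  \<open>x\<close> with infinitely many zeros is 0, so its coefficients vanish as functions of fewer
  variables.\<close>

lemma mpoly_eq_0_if_ev:
  fixes f :: "'k::field_char_0 mpoly"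
  assumes "\<And>s. ev s f = 0"
  shows "f = 0"
  using assms
proof (induction "card (vars f)" arbitrary: f rule: less_induct)
  case less
  show ?case
  proof (cases "vars f = {}")
    case True
    then have "whomog (\<lambda>_. 1) 0 f" by (auto simp: vars_def whomog_def wsum_def)
    then obtain c where c: "f = mpoly_const c" using whomog_0_const by blast
    have "ev (\<lambda>_. 0) f = 0" by (rule less.prems)
    then show ?thesis using c by simp
  next
    case False
    then obtain x where x: "x \<in> vars f" by blast
    have "coeff (up x f) k = 0" for k
    proof (cases "k \<le> degree (up x f)")
      case True
      have "card (vars (coeff (up x f) k)) < card (vars f)"
        using vars_coeff_up[of x f k] x by (intro psubset_card_mono) auto
      moreover have "ev s (coeff (up x f) k) = 0" for s
      proof -
        let ?q = "\<Sum>i\<le>degree (up x f). monom (ev s (coeff (up x f) i)) i"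
        have "poly ?q a = 0" for a using less.prems[of "s(x := a)"] by (simp add: ev_up)
        then have "?q = 0" using poly_all_0_iff_0 by blast
        then have "coeff ?q k = 0" by simp
        then show ?thesis using True unfolding coeff_sum_monom_up by simp
      qed
      ultimately show ?thesis using less.hyps by blast
    qed (simp add: coeff_eq_0)
    then have "up x f = 0" by (simp add: poly_eq_iff)
    then show ?thesis by simp
  qed
qed

lemma mpoly_eqI:
  fixes f g :: "'k::field_char_0 mpoly"
  shows "(\<And>s. ev s f = ev s g) ==> f = g"
  using mpoly_eq_0_if_ev[of "f - g"] by simp

section \<open>Gauss's lemma: irreducible polynomials are prime\<close>

lemma gauss_poly:
  fixes c :: "'a::comm_ring_1"
  assumes pr: "\<And>i j. c dvd coeff p i * coeff q j ==> c dvd coeff p i \<or> c dvd coeff q j"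
    and pq: "\<And>k. c dvd coeff (p * q) k"
  shows "(\<forall>i. c dvd coeff p i) \<or> (\<forall>j. c dvd coeff q j)"
proof (rule ccontr)
  assume "\<not> ?thesis"
  then obtain i0 j0 where ij: "\<not> c dvd coeff p i0" "\<not> c dvd coeff q j0" by blast
  \<comment> \<open>First indices at which \<open>c\<close> fails to divide. In degree
    \<open>i + j\<close> of the product every other summand has a factor of smaller index, so it is
    divisible by \<open>c\<close>, and the summand for \<open>i\<close>, \<open>j\<close> would be
    divisible as well.\<close>
  define i where "i = (LEAST i. \<not> c dvd coeff p i)"
  define j where "j = (LEAST j. \<not> c dvd coeff q j)"
  have i: "\<not> c dvd coeff p i" "\<And>k. k < i ==> c dvd coeff p k"
    unfolding i_def using LeastI[of "\<lambda>i. \<not> c dvd coeff p i", OF ij(1)] not_less_Least by blast+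
  have j: "\<not> c dvd coeff q j" "\<And>k. k < j ==> c dvd coeff q k"
    unfolding j_def using LeastI[of "\<lambda>j. \<not> c dvd coeff q j", OF ij(2)] not_less_Least by blast+
  have "coeff (p * q) (i + j) = (\<Sum>k\<in>{..i+j}. coeff p k * coeff q (i + j - k))"
    by (rule coeff_mult)
  also have "\<dots> = coeff p i * coeff q j + (\<Sum>k\<in>{..i+j} - {i}. coeff p k * coeff q (i + j - k))"
    by (subst sum.remove[of _ i]) auto
  finally have eq: "coeff p i * coeff q j =
      coeff (p * q) (i + j) - (\<Sum>k\<in>{..i+j} - {i}. coeff p k * coeff q (i + j - k))" by simp
  have "c dvd (\<Sum>k\<in>{..i+j} - {i}. coeff p k * coeff q (i + j - k))"
  proof (rule dvd_sum)
    fix k assume "k \<in> {..i+j} - {i}"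
    then have "k < i \<or> i + j - k < j" by auto
    then show "c dvd coeff p k * coeff q (i + j - k)" using i(2) j(2) by auto
  qed
  then have "c dvd coeff p i * coeff q j" unfolding eq using pq by (intro dvd_diff)
  then show False using pr i j by blast
qed

text \<open>Primality is tested only against polynomials in the variables \<open>V\<close>, so that
  it can be proved by induction on \<open>V\<close>, one variable at a time.\<close>

definition prime_within :: "nat set \<Rightarrow> 'k::field mpoly \<Rightarrow> bool" where
  "prime_within V f \<longleftrightarrow>
    (\<forall>a b. vars a \<subseteq> V --> vars b \<subseteq> V --> f dvd a * b --> f dvd a \<or> f dvd b)"

lemma irreducible_not_const:
  fixes f :: "'k::field mpoly"
  assumes "irreducible f" shows "vars f \<noteq> {}"
proof
  assume "vars f = {}"
  then have "whomog (\<lambda>_. 1) 0 f" by (auto simp: vars_def whomog_def wsum_def)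
  then obtain c where c: "f = mpoly_const c" using whomog_0_const by blast
  then show False using assms is_unit_const[of c] by (cases "c = 0") (auto simp: irreducible_def)
qed

lemma unit_vars: "f dvd 1 ==> vars (f :: 'k::field mpoly) = {}"
  by (metis is_unit_mpolyE vars_const)

lemma unit_dvd_cancel:
  fixes u :: "'a::comm_ring_1"
  assumes "u dvd 1" "f dvd u * h" shows "f dvd h"
proof -
  obtain d where d: "1 = u * d" using assms(1) by (elim dvdE)
  have "h = d * (u * h)" using d by (metis mult.assoc mult.commute mult_1)
  then show ?thesis using assms(2) by (metis dvd_mult)
qed

text \<open>The induction step that adjoins the variable \<open>x\<close> to \<open>V\<close>. The
  parameter \<open>ty\<close> pins down the coefficient field, which \<open>V\<close> and
  \<open>x\<close> do not mention.\<close>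

locale gauss_step =
  fixes V :: "nat set" and x :: nat and ty :: "'k::field itself"
  assumes IH: "\<And>f :: 'k mpoly. vars f \<subseteq> V ==> irreducible f ==> prime_within V f"
    and x: "x \<notin> V"
begin

abbreviation "W \<equiv> insert x V"

text \<open>View the factors as polynomials in \<open>x\<close>. Since \<open>p\<close> does not
  involve \<open>x\<close>, it divides a polynomial once it divides all its coefficients, and
  \<open>gauss_poly\<close> applies with the induction hypothesis as primality of \<open>p\<close>
  on coefficients.\<close>

lemma prime_within_insert:
  fixes p :: "'k mpoly"
  assumes p: "vars p \<subseteq> V" "irreducible p"
  shows "prime_within W p"
  unfolding prime_within_def
proof (intro allI impI)
  fix a b assume a: "vars a \<subseteq> W" and b: "vars b \<subseteq> W" and d: "p dvd a * b"
  have va: "vars (coeff (up x a) i) \<subseteq> V" for i using vars_coeff_up[of x a i] a by auto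
  have vb: "vars (coeff (up x b) i) \<subseteq> V" for i using vars_coeff_up[of x b i] b by auto
  have up: "up x p = [:p:]" using p x by (intro up_free) auto
  have "p dvd coeff (up x a * up x b) k" for k
  proof -
    obtain c where "a * b = p * c" using d by (elim dvdE)
    then have "up x a * up x b = [:p:] * up x c" by (metis up up_mult)
    then show ?thesis by simp
  qed
  moreover have "p dvd coeff (up x a) i * coeff (up x b) j ==>
      p dvd coeff (up x a) i \<or> p dvd coeff (up x b) j" for i j
    using IH[OF p] va vb unfolding prime_within_def by blast
  ultimately have "(\<forall>i. p dvd coeff (up x a) i) \<or> (\<forall>j. p dvd coeff (up x b) j)"
    by (intro gauss_poly)
  moreover have "p dvd f" if "\<forall>i. p dvd coeff (up x f) i" for f
  proof -
    have "p dvd poly (up x f) (mpoly_var x)"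
      unfolding poly_altdef using that by (intro dvd_sum) auto
    then show ?thesis by simp
  qed
  ultimately show "p dvd a \<or> p dvd b" by blast
qed

text \<open>Irreducible factors of \<open>c\<close> are removed one at a time. Such a factor
  \<open>p\<close> is prime by \<open>prime_within_insert\<close>. It cannot divide
  \<open>f\<close>, which is irreducible and involves \<open>x\<close>, so it divides the cofactor
  and cancels.\<close>

lemma cancel_free:
  fixes f h c :: "'k mpoly"
  assumes f: "irreducible f" "x \<in> vars f" "vars f \<subseteq> W" and h: "vars h \<subseteq> W"
    and c: "c \<noteq> 0" "vars c \<subseteq> V" and d: "f dvd c * h"
  shows "f dvd h"
  using c d
proof (induction "tdeg c" arbitrary: c rule: less_induct)
  case less
  show ?case
  proof (cases "c dvd 1 \<or> h = 0")
    case True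
    then show ?thesis using unit_dvd_cancel less.prems(3) by auto
  next
    case False
    then obtain p c' where pc: "irreducible p" "c = p * c'"
      using exists_irreducible_factor[of c] less.prems by auto
    have nz: "p \<noteq> 0" "c' \<noteq> 0" using pc less.prems by auto
    have v: "vars p \<subseteq> V" "vars c' \<subseteq> V" using vars_mult_eq[OF nz] pc less.prems by auto
    have np: "\<not> p dvd 1" using pc by (simp add: irreducible_def)
    have deg: "tdeg c' < tdeg c" using tdeg_mult[OF nz] np nz by (auto simp: pc is_unit_mpoly_iff)
    obtain q where q: "c * h = f * q" using less.prems(3) by (elim dvdE)
    have "c * h \<noteq> 0" using less.prems False by auto
    then have qnz: "f \<noteq> 0" "q \<noteq> 0" using q by auto
    have "vars (c * h) \<subseteq> W" using vars_mult[of c h] less.prems h by auto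
    then have vq: "vars q \<subseteq> W" using vars_mult_eq[OF qnz] q by auto
    have "p dvd f * q" using q pc by (metis dvd_triv_left mult.assoc)
    then have "p dvd f \<or> p dvd q"
      using prime_within_insert[OF v(1) pc(1)] f vq unfolding prime_within_def by blast
    moreover have "\<not> p dvd f"
    proof
      assume "p dvd f"
      then obtain r where r: "f = p * r" by (elim dvdE)
      then have "r dvd 1" using irreducibleD[OF f(1) r] np by blast
      then have "vars f \<subseteq> vars p" using vars_mult[of p r] unit_vars[of r] r by auto
      then show False using v f x by auto
    qed
    ultimately obtain q' where "q = p * q'" by (auto elim: dvdE)
    then have "p * (c' * h) = p * (f * q')" using q pc by (simp add: ac_simps)
    then have "c' * h = f * q'" using nz by simp
    then show ?thesis using less.hyps[OF deg nz(2) v(2)] by auto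
  qed
qed

text \<open>Euclidean division in \<open>x\<close> over the field of fractions of the
  \<open>x\<close>-free polynomials, with the denominators cleared into \<open>c\<close>.\<close>

lemma pseudo_division:
  fixes f g :: "'k mpoly"
  assumes g: "g \<noteq> 0" "vars g \<subseteq> W" and f: "vars f \<subseteq> W"
  shows "\<exists>c s r. c \<noteq> 0 \<and> vars c \<subseteq> V \<and> vars s \<subseteq> W \<and> c * f = s * g + r \<and>
    (r = 0 \<or> degree (up x r) < degree (up x g))"
  using f
proof (induction "degree (up x f)" arbitrary: f rule: less_induct)
  case less
  show ?case
  proof (cases "f = 0 \<or> degree (up x f) < degree (up x g)")
    case True
    then show ?thesis by (intro exI[of _ 1] exI[of _ 0] exI[of _ f]) auto
  next
    case False
    define df where "df = degree (up x f)"
    define dg where "dg = degree (up x g)"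
    define lf where "lf = coeff (up x f) df"
    define lg where "lg = coeff (up x g) dg"
    have lg0: "lg \<noteq> 0" using g by (simp add: lg_def dg_def)
    have vl: "vars lf \<subseteq> V" "vars lg \<subseteq> V"
      unfolding lf_def lg_def using vars_coeff_up[of x f df] vars_coeff_up[of x g dg] less.prems g by auto
    have upl: "up x lf = [:lf:]" "up x lg = [:lg:]" using vl x by (auto intro!: up_free)
    have le: "dg \<le> df" using False by (simp add: df_def dg_def)
    define t where "t = lf * mpoly_var x ^ (df - dg)"
    define f1 where "f1 = lg * f - t * g"
    have vt: "vars t \<subseteq> W"
      unfolding t_def using vars_mult[of lf "mpoly_var x ^ (df - dg)"]
        vars_power[of "mpoly_var x :: 'k mpoly" "df - dg"] vl by auto
    have vf1: "vars f1 \<subseteq> W"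
      unfolding f1_def using vl vt less.prems g by (intro vars_subset_intros) auto
    have upf1: "up x f1 = Polynomial.smult lg (up x f) - Polynomial.smult lf (monom 1 (df - dg) * up x g)"
      unfolding f1_def t_def by (simp add: up_diff up_mult up_power upl monom_altdef)
    have z: "coeff (up x f1) k = 0" if "k \<ge> df" for k
    proof (cases "k = df")
      case True
      then show ?thesis using le by (simp add: upf1 coeff_monom_mult lf_def lg_def)
    next
      case False
      then have "coeff (up x f) k = 0" "coeff (up x g) (k - (df - dg)) = 0"
        using that le by (auto simp: df_def dg_def intro!: coeff_eq_0)
      then show ?thesis by (simp add: upf1 coeff_monom_mult)
    qed
    show ?thesis
    proof (cases "f1 = 0")
      case True
      then show ?thesis using lg0 vl vt unfolding f1_def
        by (intro exI[of _ lg] exI[of _ t] exI[of _ 0]) auto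
    next
      case nz: False
      have "degree (up x f1) < df" using z nz by (intro degree_lessI) auto
      then obtain c s r where c: "c \<noteq> 0" "vars c \<subseteq> V" "vars s \<subseteq> W" "c * f1 = s * g + r"
        "r = 0 \<or> degree (up x r) < degree (up x g)"
        using less.hyps[of f1] vf1 unfolding df_def by blast
      have "(c * lg) * f = (s + c * t) * g + r"
        using c(4) unfolding f1_def by (simp add: algebra_simps)
      moreover have "vars (c * lg) \<subseteq> V" using vars_mult[of c lg] c vl by auto
      moreover have "vars (s + c * t) \<subseteq> W"
        using c vt by (intro vars_subset_intros) auto
      moreover have "c * lg \<noteq> 0" using c lg0 by simp
      ultimately show ?thesis using c(5) by blast
    qed
  qed
qed

text \<open>Each prime factor of \<open>c\<close> divides \<open>s\<close> or \<open>g\<close> and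
  is cancelled there. What is taken from \<open>g\<close> collects in \<open>c2\<close>, so
  \<open>g\<close> divides \<open>f\<close> up to an \<open>x\<close>-free factor.\<close>

lemma split_free:
  fixes f g s c :: "'k mpoly"
  assumes c: "c \<noteq> 0" "vars c \<subseteq> V" and s: "vars s \<subseteq> W" and g: "vars g \<subseteq> W" and f: "f \<noteq> 0"
    and eq: "c * f = s * g"
  shows "\<exists>c2 s' g'. f = s' * g' \<and> g = c2 * g' \<and> vars c2 \<subseteq> V"
  using c s g eq
proof (induction "tdeg c" arbitrary: c s g rule: less_induct)
  case less
  show ?case
  proof (cases "c dvd 1")
    case True
    then obtain d where d: "1 = c * d" by (elim dvdE)
    have "f = (d * s) * g" using d less.prems(5) by (metis mult.assoc mult.commute mult_1)
    then have "f = (d * s) * g \<and> g = 1 * g \<and> vars (1 :: 'k mpoly) \<subseteq> V" by simp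
    then show ?thesis by blast
  next
    case False
    then obtain p c' where pc: "irreducible p" "c = p * c'"
      using exists_irreducible_factor[of c] less.prems by auto
    have nz: "p \<noteq> 0" "c' \<noteq> 0" using pc less.prems by auto
    have v: "vars p \<subseteq> V" "vars c' \<subseteq> V" using vars_mult_eq[OF nz] pc less.prems by auto
    have np: "\<not> p dvd 1" using pc by (simp add: irreducible_def)
    have deg: "tdeg c' < tdeg c" using tdeg_mult[OF nz] np nz by (auto simp: pc is_unit_mpoly_iff)
    have "s * g \<noteq> 0" using less.prems(1,5) f by (metis mult_eq_0_iff)
    then have sg: "s \<noteq> 0" "g \<noteq> 0" by auto
    have "p dvd s * g" using less.prems(5) pc by (metis dvd_triv_left mult.assoc)
    then have "p dvd s \<or> p dvd g"
      using prime_within_insert[OF v(1) pc(1)] less.prems unfolding prime_within_def by blast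
    then show ?thesis
    proof
      assume "p dvd s"
      then obtain s1 where s1: "s = p * s1" by (elim dvdE)
      then have "p * (c' * f) = p * (s1 * g)" using less.prems(5) pc by (simp add: ac_simps)
      then have e: "c' * f = s1 * g" using nz by simp
      have "vars s1 \<subseteq> W" using vars_mult_eq[of p s1] s1 sg less.prems by auto
      then show ?thesis using less.hyps[OF deg nz(2) v(2) _ less.prems(4) e] by blast
    next
      assume "p dvd g"
      then obtain g1 where g1: "g = p * g1" by (elim dvdE)
      then have "p * (c' * f) = p * (s * g1)" using less.prems(5) pc by (simp add: ac_simps)
      then have e: "c' * f = s * g1" using nz by simp
      have "vars g1 \<subseteq> W" using vars_mult_eq[of p g1] g1 sg less.prems by auto
      then obtain c2 s' g' where c2: "f = s' * g'" "g1 = c2 * g'" "vars c2 \<subseteq> V"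
        using less.hyps[OF deg nz(2) v(2) less.prems(3) _ e] by blast
      have "g = (p * c2) * g'" "vars (p * c2) \<subseteq> V"
        using g1 c2 vars_mult[of p c2] v by (auto simp: ac_simps)
      then show ?thesis using c2(1) by blast
    qed
  qed
qed

text \<open>Take a nonzero \<open>g\<close> of least \<open>x\<close>-degree in the ideal of
  \<open>f\<close> and \<open>h\<close>; up to \<open>x\<close>-free factors it divides both. If it
  involved \<open>x\<close>, irreducibility would make it equal to \<open>f\<close> up to such a
  factor, and then \<open>f\<close> would divide \<open>h\<close>.\<close>

lemma bezout_free:
  fixes f h :: "'k mpoly"
  assumes f: "irreducible f" "x \<in> vars f" "vars f \<subseteq> W" and h: "vars h \<subseteq> W"
    and nd: "\<not> f dvd h"
  shows "\<exists>\<alpha> \<beta>. \<alpha> * f + \<beta> * h \<noteq> 0 \<and> vars (\<alpha> * f + \<beta> * h) \<subseteq> V"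
proof -
  define I where "I = {g. \<exists>\<alpha> \<beta>. g = \<alpha> * f + \<beta> * h \<and> vars \<alpha> \<subseteq> W \<and> vars \<beta> \<subseteq> W}"
  have f0: "f \<noteq> 0" using f by auto
  have fI: "f \<in> I" unfolding I_def by (intro CollectI exI[of _ 1] exI[of _ 0]) auto
  have hI: "h \<in> I" unfolding I_def by (intro CollectI exI[of _ 0] exI[of _ 1]) auto
  have Ivars: "vars g \<subseteq> W" if "g \<in> I" for g
  proof -
    obtain \<alpha> \<beta> where g: "g = \<alpha> * f + \<beta> * h" "vars \<alpha> \<subseteq> W" "vars \<beta> \<subseteq> W"
      using \<open>g \<in> I\<close> unfolding I_def by blast
    show ?thesis
      unfolding g(1) using g(2,3) f h by (intro vars_subset_intros)
  qed
  have Icomb: "c * a - s * b \<in> I" if ab: "a \<in> I" "b \<in> I" and v: "vars c \<subseteq> W" "vars s \<subseteq> W" for a b c s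
  proof -
    obtain \<alpha> \<beta> where g: "a = \<alpha> * f + \<beta> * h" "vars \<alpha> \<subseteq> W" "vars \<beta> \<subseteq> W"
      using ab unfolding I_def by blast
    obtain \<gamma> \<delta> where k: "b = \<gamma> * f + \<delta> * h" "vars \<gamma> \<subseteq> W" "vars \<delta> \<subseteq> W"
      using ab unfolding I_def by blast
    have "c * a - s * b = (c * \<alpha> - s * \<gamma>) * f + (c * \<beta> - s * \<delta>) * h"
      unfolding g k by (simp add: algebra_simps)
    moreover have "vars (c * \<alpha> - s * \<gamma>) \<subseteq> W"
      using g k v by (intro vars_subset_intros)
    moreover have "vars (c * \<beta> - s * \<delta>) \<subseteq> W"
      using g k v by (intro vars_subset_intros)
    ultimately show ?thesis unfolding I_def by blast
  qed
  obtain g where g: "g \<in> I" "g \<noteq> 0"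
    and gmin: "\<And>k. k \<in> I ==> k \<noteq> 0 ==> degree (up x g) \<le> degree (up x k)"
    using ex_has_least_nat[of "\<lambda>g. g \<in> I \<and> g \<noteq> 0" f "\<lambda>g. degree (up x g)"] fI f0 by blast
  have vg: "vars g \<subseteq> W" using Ivars g by blast
  have red: "\<exists>c s. c \<noteq> 0 \<and> vars c \<subseteq> V \<and> vars s \<subseteq> W \<and> c * i = s * g" if i: "i \<in> I" for i
  proof -
    obtain c s r where c: "c \<noteq> 0" "vars c \<subseteq> V" "vars s \<subseteq> W" "c * i = s * g + r"
        "r = 0 \<or> degree (up x r) < degree (up x g)"
      using pseudo_division[OF g(2) vg Ivars[OF i]] by blast
    have "r = c * i - s * g" using c(4) by simp
    then have "r \<in> I" using Icomb[OF i g(1), of c s] c by auto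
    then have "r = 0" using gmin[of r] c(5) by (meson leD)
    then show ?thesis using c by auto
  qed
  show ?thesis
  proof (cases "degree (up x g) = 0")
    case True
    then obtain a where a: "up x g = [:a:]" using degree_eq_zeroE by blast
    then have "g = a" using poly_up[of x g] by simp
    then have "g = coeff (up x g) 0" using a by simp
    then have "vars g \<subseteq> V" using vars_coeff_up[of x g 0] vg by auto
    then show ?thesis using g unfolding I_def by blast
  next
    case False
    obtain c s where c: "c \<noteq> 0" "vars c \<subseteq> V" "vars s \<subseteq> W" "c * f = s * g"
      using red[OF fI] by blast
    obtain c2 s' g' where d: "f = s' * g'" "g = c2 * g'" "vars c2 \<subseteq> V"
      using split_free[OF c(1-3) vg f0 c(4)] by blast
    have "x \<in> vars g"
    proof (rule ccontr)
      assume "x \<notin> vars g"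
      then have "up x g = [:g:]" by (rule up_free)
      then show False using False by simp
    qed
    then have "x \<in> vars g'" using d vars_mult[of c2 g'] x by auto
    then have "\<not> g' dvd 1" using unit_vars[of g'] by auto
    then have "s' dvd 1" using irreducibleD[OF f(1) d(1)] by blast
    then have "f dvd g'"
    proof -
      have "f dvd s' * g'" unfolding d(1)[symmetric] by (rule dvd_refl)
      then show ?thesis using unit_dvd_cancel[OF \<open>s' dvd 1\<close>] by blast
    qed
    then have fg: "f dvd g" unfolding d(2) by (rule dvd_mult)
    obtain c' s2 where c': "c' \<noteq> 0" "vars c' \<subseteq> V" "c' * h = s2 * g"
      using red[OF hI] by blast
    have "f dvd c' * h" using c'(3) fg by simp
    then have "f dvd h" by (rule cancel_free[OF f h c'(1,2)])
    then show ?thesis using nd by contradiction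
  qed
qed

text \<open>If \<open>f\<close> does not divide \<open>a\<close>, some combination \<open>r\<close>
  of \<open>f\<close> and \<open>a\<close> is nonzero and free of \<open>x\<close>. Then
  \<open>f\<close> divides \<open>r * b\<close>, and \<open>cancel_free\<close> removes
  \<open>r\<close>.\<close>

lemma irreducible_prime_within:
  fixes f :: "'k mpoly"
  assumes f: "irreducible f" "vars f \<subseteq> W"
  shows "prime_within W f"
proof (cases "x \<in> vars f")
  case False
  then show ?thesis using prime_within_insert f by blast
next
  case True
  show ?thesis unfolding prime_within_def
  proof (intro allI impI)
    fix a b assume a: "vars a \<subseteq> W" and b: "vars b \<subseteq> W" and d: "f dvd a * b"
    show "f dvd a \<or> f dvd b"
    proof (cases "f dvd a")
      case False
      then obtain \<alpha> \<beta> where r: "\<alpha> * f + \<beta> * a \<noteq> 0" "vars (\<alpha> * f + \<beta> * a) \<subseteq> V"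
        using bezout_free[OF f(1) True f(2) a] by blast
      have "(\<alpha> * f + \<beta> * a) * b = f * (\<alpha> * b) + \<beta> * (a * b)" by (simp add: algebra_simps)
      then have "f dvd (\<alpha> * f + \<beta> * a) * b" using d by simp
      then have "f dvd b" by (rule cancel_free[OF f(1) True f(2) b r])
      then show ?thesis ..
    qed simp
  qed
qed

end

lemma irreducible_imp_prime_within:
  fixes f :: "'k::field mpoly"
  assumes "finite V" "vars f \<subseteq> V" "irreducible f"
  shows "prime_within V f"
  using assms
proof (induction V arbitrary: f rule: finite_induct)
  case empty
  then show ?case using irreducible_not_const by blast
next
  case (insert x V)
  interpret gauss_step V x "TYPE('k)"
    using insert.IH insert.hyps by unfold_locales
  show ?case using irreducible_prime_within insert.prems by blast
qed

lemma irreducible_dvd_mult: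
  fixes f :: "'k::field mpoly"
  assumes "irreducible f" "f dvd a * b"
  shows "f dvd a \<or> f dvd b"
  using irreducible_imp_prime_within[of "vars f \<union> vars a \<union> vars b" f] assms
  unfolding prime_within_def by auto

text \<open>The combination plays the part of a resultant of \<open>f\<close> and \<open>h\<close>
  with respect to \<open>x\<close>.\<close>

lemma bezout_elimination:
  fixes f h :: "'k::field mpoly"
  assumes "irreducible f" "x \<in> vars f" "\<not> f dvd h"
  shows "\<exists>\<alpha> \<beta>. \<alpha> * f + \<beta> * h \<noteq> 0 \<and> x \<notin> vars (\<alpha> * f + \<beta> * h)"
proof -
  let ?V = "vars f \<union> vars h - {x}"
  interpret gauss_step ?V x "TYPE('k)"
    using irreducible_imp_prime_within[of ?V] by unfold_locales simp_all
  show ?thesis using bezout_free[OF assms(1,2) _ _ assms(3)] by blast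
qed

text \<open>A combination of \<open>f\<close> and \<open>h\<close> without \<open>x\<close> vanishes
  wherever \<open>f\<close> does. But generic values of the other variables extend to a zero of
  \<open>f\<close>, so the combination would vanish generically, hence identically.\<close>

theorem hypersurface_nullstellensatz:
  fixes f h :: "'k::{alg_closed_field, field_char_0} mpoly"
  assumes f: "irreducible f" and van: "\<And>s. ev s f = 0 ==> ev s h = 0"
  shows "f dvd h"
proof (rule ccontr)
  assume nd: "\<not> f dvd h"
  obtain x where x: "x \<in> vars f" using irreducible_not_const[OF f] by blast
  obtain \<alpha> \<beta> where r: "\<alpha> * f + \<beta> * h \<noteq> 0" "x \<notin> vars (\<alpha> * f + \<beta> * h)"
    using bezout_elimination[OF f x nd] by blast
  define l where "l = lead_coeff (up x f)"
  have "l \<noteq> 0" using f by (auto simp: l_def)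
  \<comment> \<open>The leading coefficient \<open>l\<close> must be nonzero at \<open>s\<close>
    too, so that \<open>f\<close> stays nonconstant in \<open>x\<close> and has a root
    there.\<close>
  then obtain s where s: "ev s (l * (\<alpha> * f + \<beta> * h)) \<noteq> 0"
    using mpoly_eq_0_if_ev[of "l * (\<alpha> * f + \<beta> * h)"] r(1) by (metis mult_eq_0_iff)
  then have s': "ev s l \<noteq> 0" "ev s (\<alpha> * f + \<beta> * h) \<noteq> 0"
    unfolding ev_mult by auto
  let ?q = "\<Sum>i\<le>degree (up x f). monom (ev s (coeff (up x f) i)) i"
  have d: "degree (up x f) > 0"
  proof (rule ccontr)
    assume "\<not> degree (up x f) > 0"
    then obtain a where a: "up x f = [:a:]" using degree_eq_zeroE by blast
    then have "f = coeff (up x f) 0" using poly_up[of x f] by simp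
    then show False using vars_coeff_up[of x f 0] x by auto
  qed
  have "coeff ?q (degree (up x f)) \<noteq> 0"
    using s'(1) unfolding coeff_sum_monom_up l_def by simp
  then have "degree ?q > 0" using d le_degree[of ?q "degree (up x f)"] by linarith
  then obtain a where a: "poly ?q a = 0" using alg_closed_imp_poly_has_root by blast
  then have "ev (s(x := a)) f = 0" by (simp add: ev_up)
  then have "ev (s(x := a)) (\<alpha> * f + \<beta> * h) = 0" using van by simp
  moreover have "ev (s(x := a)) (\<alpha> * f + \<beta> * h) = ev s (\<alpha> * f + \<beta> * h)"
    by (rule mpoly_eval_cong) (use r(2) in auto)
  ultimately show False using s'(2) by simp
qed

section \<open>Regular actions on projective space are linear\<close>

text \<open>Irreducible common factors are split off until none is left; the degree of the nonzero
  entry \<open>F j\<close> bounds the number of steps.\<close>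

lemma exists_common_factor:
  fixes F :: "nat \<Rightarrow> 'k::field mpoly"
  assumes "j \<le> n" "F j \<noteq> 0"
  shows "\<exists>q G. q \<noteq> 0 \<and> (\<forall>i\<le>n. F i = q * G i) \<and> (\<forall>p. irreducible p --> (\<exists>i\<le>n. \<not> p dvd G i))"
  using assms
proof (induction "tdeg (F j)" arbitrary: F rule: less_induct)
  case less
  show ?case
  proof (cases "\<exists>p. irreducible p \<and> (\<forall>i\<le>n. p dvd F i)")
    case False
    then show ?thesis by (intro exI[of _ 1] exI[of _ F]) auto
  next
    case True
    then obtain p where p: "irreducible p" "\<And>i. i \<le> n ==> p dvd F i" by blast
    have "\<forall>i. \<exists>g. i \<le> n --> F i = p * g" using p(2) by (meson dvdE)
    then obtain F' where F': "\<And>i. i \<le> n ==> F i = p * F' i" by metis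
    have nz: "p \<noteq> 0" "F' j \<noteq> 0" using p F'[of j] less.prems by auto
    have "tdeg (F' j) < tdeg (F j)"
      using tdeg_mult[OF nz] F'[of j] less.prems p(1) nz by (auto simp: irreducible_def is_unit_mpoly_iff)
    then obtain q G where q: "q \<noteq> 0" "\<And>i. i \<le> n ==> F' i = q * G i"
        "\<And>p. irreducible p ==> \<exists>i\<le>n. \<not> p dvd G i"
      using less.hyps[of F'] less.prems nz by blast
    have "\<forall>i\<le>n. F i = (p * q) * G i" using F' q(2) by (simp add: mult.assoc)
    then show ?thesis using q(1,3) nz by (intro exI[of _ "p * q"] exI[of _ G]) auto
  qed
qed

text \<open>Stands in for a greatest common divisor: for each irreducible factor of \<open>c\<close>
  some \<open>G i\<close> avoids it, so the factor must come from \<open>b\<close>.\<close>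

lemma coprime_dvd:
  fixes G :: "nat \<Rightarrow> 'k::field mpoly"
  assumes G: "\<And>p. irreducible p ==> \<exists>i\<le>n. \<not> p dvd G i"
    and "c \<noteq> 0" "\<And>i. i \<le> n ==> c dvd b * G i"
  shows "c dvd b"
  using assms(2,3)
proof (induction "tdeg c" arbitrary: c b rule: less_induct)
  case less
  show ?case
  proof (cases "c dvd 1")
    case True
    then show ?thesis by (meson dvd_trans one_dvd)
  next
    case False
    then obtain p c' where pc: "irreducible p" "c = p * c'"
      using exists_irreducible_factor[of c] less.prems by auto
    have nz: "p \<noteq> 0" "c' \<noteq> 0" using pc less.prems by auto
    have deg: "tdeg c' < tdeg c"
      using tdeg_mult[OF nz] pc nz by (auto simp: irreducible_def is_unit_mpoly_iff)
    obtain i where i: "i \<le> n" "\<not> p dvd G i" using G[OF pc(1)] by blast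
    have "p dvd b * G i" using less.prems(2)[OF i(1)] pc(2) by (metis dvd_mult_left)
    then have "p dvd b" using irreducible_dvd_mult[OF pc(1)] i by blast
    then obtain b' where b': "b = p * b'" by (elim dvdE)
    have "c' dvd b' * G i" if "i \<le> n" for i
      using less.prems(2)[OF that] nz(1) unfolding pc(2) b' by (simp add: mult.assoc)
    then have "c' dvd b'" using less.hyps[OF deg nz(2)] by blast
    then show ?thesis unfolding pc(2) b' by simp
  qed
qed

text \<open>Vanishing minors make the tuples proportional over the field of fractions; coprimality
  of \<open>G\<close> forces the ratio to be a polynomial.\<close>

lemma coprime_multiple:
  fixes G F :: "nat \<Rightarrow> 'k::field mpoly"
  assumes G: "\<And>p. irreducible p ==> \<exists>i\<le>n. \<not> p dvd G i"
    and j: "j \<le> n" "G j \<noteq> 0"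
    and cross: "\<And>i j. i \<le> n ==> j \<le> n ==> F i * G j = F j * G i"
  shows "\<exists>h. \<forall>i\<le>n. F i = h * G i"
proof -
  have "G j dvd F j * G i" if "i \<le> n" for i using cross[OF that j(1)] by (metis dvd_triv_right)
  then have "G j dvd F j" using coprime_dvd[OF G j(2)] by blast
  then obtain h where h: "F j = G j * h" by (elim dvdE)
  have "F i = h * G i" if "i \<le> n" for i
  proof -
    have "G j * F i = G j * (h * G i)" using cross[OF that j(1)] h by (simp add: ac_simps)
    then show ?thesis using j(2) by simp
  qed
  then show ?thesis by blast
qed

section \<open>Polynomial formulas for a morphism: local ones and a global one\<close>

definition ind :: "nat \<Rightarrow> nat \<Rightarrow> nat \<Rightarrow> nat" where
  "ind m n i = (if m \<le> i \<and> i \<le> m + n then 1 else 0)"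

lemma wsum_ind: "wsum (ind m n) t = (\<Sum>i\<in>{m..m+n}. Poly_Mapping.lookup t i)"
proof -
  have "wsum (ind m n) t = (\<Sum>i\<in>Poly_Mapping.keys t \<union> {m..m+n}. ind m n i * Poly_Mapping.lookup t i)"
    by (rule wsum_superset) auto
  also have "\<dots> = (\<Sum>i\<in>{m..m+n}. Poly_Mapping.lookup t i)"
    by (rule sum.mono_neutral_cong_right) (auto simp: ind_def)
  finally show ?thesis .
qed

lemma homog_iff: "homog m n d f \<longleftrightarrow> vars f \<subseteq> {..m + n} \<and> whomog (ind m n) d f"
  by (simp add: homog_def whomog_def wsum_ind)

lemma eval_at_ev: "eval_at f v = ev (($) v) f"
  by (simp add: eval_at_def)

lemma eval_at_vec: "vars f \<subseteq> {..<N} ==> eval_at f (vec N s) = ev s f"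
  unfolding eval_at_ev by (rule mpoly_eval_cong) auto

lemma vars_homog: "homog m n d f ==> vars f \<subseteq> {..<m + (n + 1)}"
  by (auto simp: homog_def)

lemma eval_at_scale:
  fixes a v :: "'k::field vec"
  assumes f: "homog m n d f" and a: "a \<in> carrier_vec m" and v: "v \<in> carrier_vec (n + 1)"
  shows "eval_at f (a @\<^sub>v (c \<cdot>\<^sub>v v)) = c ^ d * eval_at f (a @\<^sub>v v)"
proof -
  have "eval_at f (a @\<^sub>v (c \<cdot>\<^sub>v v)) = ev (\<lambda>i. c ^ ind m n i * (a @\<^sub>v v) $ i) f"
    unfolding eval_at_ev
    by (rule mpoly_eval_cong) (use vars_homog[OF f] a v in \<open>auto simp: ind_def subset_iff\<close>)
  then show ?thesis using f by (simp add: ev_scale homog_iff eval_at_ev)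
qed

lemma append_vec_split:
  "vec (m + k) s = vec m s @\<^sub>v vec k (\<lambda>i. s (m + i))"
  by (intro eq_vecI) (auto simp: not_less)

lemma proj_point_eqD:
  assumes "proj_point w = proj_point (w' :: 'k::field vec)"
  shows "\<exists>c. c \<noteq> 0 \<and> w = c \<cdot>\<^sub>v w'"
proof -
  have "w \<in> proj_point w" unfolding proj_point_def by (intro CollectI exI[of _ 1]) auto
  then show ?thesis using assms unfolding proj_point_def by blast
qed

lemma proj_point_smult:
  assumes "c \<noteq> 0"
  shows "proj_point (c \<cdot>\<^sub>v w) = proj_point (w :: 'k::field vec)"
  unfolding proj_point_def
proof (intro Collect_cong iffI)
  fix u
  show "\<exists>e. u = e \<cdot>\<^sub>v (c \<cdot>\<^sub>v w) \<and> e \<noteq> 0 ==> \<exists>e. u = e \<cdot>\<^sub>v w \<and> e \<noteq> 0"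
    using assms by (metis mult_eq_0_iff smult_smult_assoc)
  assume "\<exists>e. u = e \<cdot>\<^sub>v w \<and> e \<noteq> 0"
  then obtain e where "u = e \<cdot>\<^sub>v w" "e \<noteq> 0" by blast
  then have "u = (e / c) \<cdot>\<^sub>v (c \<cdot>\<^sub>v w) \<and> e / c \<noteq> 0" using assms by (simp add: smult_smult_assoc)
  then show "\<exists>e. u = e \<cdot>\<^sub>v (c \<cdot>\<^sub>v w) \<and> e \<noteq> 0" by blast
qed

lemma smult_vec_zero': "c \<cdot>\<^sub>v 0\<^sub>v k = (0\<^sub>v k :: 'k::field vec)"
  by (intro eq_vecI) auto

lemma self_in_proj_point: "v \<in> proj_point (v :: 'k::field vec)"
  unfolding proj_point_def by (intro CollectI exI[of _ 1]) auto

lemma proj_spaceI: "v \<in> carrier_vec (n + 1) ==> v \<noteq> 0\<^sub>v (n + 1) ==> proj_point v \<in> proj_space n"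
  unfolding proj_space_def by blast

definition vals :: "nat \<Rightarrow> (nat \<Rightarrow> 'k::field mpoly) \<Rightarrow> 'k vec \<Rightarrow> 'k vec" where
  "vals n F u = vec (n + 1) (\<lambda>i. eval_at (F i) u)"

lemma vals_carrier [simp]: "vals n F u \<in> carrier_vec (n + 1)" by (simp add: vals_def)

text \<open>\<open>F\<close> represents \<open>\<phi>\<close> on the basic open set where \<open>h\<close> does not vanish.\<close>

definition local_rep ::
  "nat \<Rightarrow> nat \<Rightarrow> ('k::field vec \<Rightarrow> 'k vec set \<Rightarrow> 'k vec set) \<Rightarrow> 'k mpoly \<Rightarrow> nat \<Rightarrow> (nat \<Rightarrow> 'k mpoly) \<Rightarrow> bool"
  where "local_rep m n \<phi> h d F \<longleftrightarrow> vars h \<subseteq> {..m + n} \<and> (\<forall>i\<le>n. homog m n d (F i)) \<and>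
    (\<forall>a\<in>carrier_vec m. \<forall>v\<in>carrier_vec (n + 1). v \<noteq> 0\<^sub>v (n + 1) --> eval_at h (a @\<^sub>v v) \<noteq> 0 -->
       vals n F (a @\<^sub>v v) \<noteq> 0\<^sub>v (n + 1) \<and> \<phi> a (proj_point v) = proj_point (vals n F (a @\<^sub>v v)))"

text \<open>The open set from the definition of a regular map contains a basic one: some form
  cutting out the complement is nonzero at the chosen point.\<close>

lemma local_rep_exists:
  assumes reg: "regular_map m n (carrier_vec m \<times> proj_space n) \<phi>"
    and a: "a \<in> carrier_vec m" and v: "v \<in> carrier_vec (n + 1)" "v \<noteq> 0\<^sub>v (n + 1)"
  shows "\<exists>h d F. local_rep m n \<phi> h d F \<and> eval_at h (a @\<^sub>v v) \<noteq> 0"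
proof -
  let ?Y = "carrier_vec m \<times> proj_space n"
  have Y: "(a, proj_point v) \<in> ?Y" using a proj_spaceI[OF v] by blast
  obtain W F d where W: "zariski_open_in m n ?Y W" "(a, proj_point v) \<in> W"
    and F: "\<forall>i\<le>n. homog m n d (F i)"
    and rep0: "\<forall>(b, q)\<in>W. \<forall>v\<in>q. let w = vec (n + 1) (\<lambda>i. eval_at (F i) (b @\<^sub>v v)) in
       w \<noteq> 0\<^sub>v (n + 1) \<and> \<phi> b q = proj_point w"
    using bspec[OF reg[unfolded regular_map_def] Y] by (elim exE conjE) (rule that)
  have rep: "vals n F (b @\<^sub>v v) \<noteq> 0\<^sub>v (n + 1) \<and> \<phi> b q = proj_point (vals n F (b @\<^sub>v v))"
    if "(b, q) \<in> W" "v \<in> q" for b q v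
    using bspec[OF rep0 that(1)] that(2) unfolding vals_def Let_def split_conv by simp
  obtain Z where Z: "zariski_closed m n Z" "W = ?Y - Z" using W(1) unfolding zariski_open_in_def by blast
  obtain S where S: "\<And>f. f \<in> S ==> \<exists>d. homog m n d f"
    and ZS: "Z = {(a, p). a \<in> carrier_vec m \<and> p \<in> proj_space n \<and> (\<forall>f\<in>S. \<forall>v\<in>p. eval_at f (a @\<^sub>v v) = 0)}"
    using Z(1) unfolding zariski_closed_def by blast
  have "(a, proj_point v) \<notin> Z" using W(2) Z(2) by blast
  then have "\<not> (\<forall>f\<in>S. \<forall>u\<in>proj_point v. eval_at f (a @\<^sub>v u) = 0)"
    using a proj_spaceI[OF v] unfolding ZS mem_Collect_eq split_conv by simp
  then obtain h u where h: "h \<in> S" "u \<in> proj_point v" "eval_at h (a @\<^sub>v u) \<noteq> 0" by blast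
  obtain e where e: "homog m n e h" using S h(1) by blast
  obtain c where c: "u = c \<cdot>\<^sub>v v" "c \<noteq> 0" using h(2) unfolding proj_point_def by blast
  have hv: "eval_at h (a @\<^sub>v v) \<noteq> 0"
    using h(3) unfolding c(1) eval_at_scale[OF e a v(1)] by auto
  have "local_rep m n \<phi> h d F"
    unfolding local_rep_def
  proof (intro conjI ballI impI)
    show "vars h \<subseteq> {..m + n}" using e by (simp add: homog_def)
    show "\<forall>i\<le>n. homog m n d (F i)" by (rule F)
    fix b w :: "'a vec"
    assume b: "b \<in> carrier_vec m" "w \<in> carrier_vec (n + 1)" "w \<noteq> 0\<^sub>v (n + 1)" "eval_at h (b @\<^sub>v w) \<noteq> 0"
    have "(b, proj_point w) \<notin> Z"
      using b(4) h(1) self_in_proj_point[of w] unfolding ZS mem_Collect_eq split_conv by metis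
    then have "(b, proj_point w) \<in> W" using b proj_spaceI[OF b(2,3)] Z(2) by blast
    from rep[OF this self_in_proj_point]
    show "vals n F (b @\<^sub>v w) \<noteq> 0\<^sub>v (n + 1)" "\<phi> b (proj_point w) = proj_point (vals n F (b @\<^sub>v w))"
      by blast+
  qed
  then show ?thesis using hv by blast
qed

lemma mpoly_eq_on_vecs:
  fixes f g :: "'k::field_char_0 mpoly"
  assumes vf: "vars f \<subseteq> {..m + n}" "vars g \<subseteq> {..m + n}" and h: "h \<noteq> 0" "vars h \<subseteq> {..m + n}"
    and eq: "\<And>a v. a \<in> carrier_vec m ==> v \<in> carrier_vec (n + 1) ==> v \<noteq> 0\<^sub>v (n + 1) ==>
      eval_at h (a @\<^sub>v v) \<noteq> 0 ==> eval_at f (a @\<^sub>v v) = eval_at g (a @\<^sub>v v)"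
  shows "f = g"
proof -
  \<comment> \<open>The factor \<open>mpoly_var m\<close> is the first homogeneous coordinate. Where
    it is nonzero the vector \<open>v\<close> is nonzero, as \<open>eq\<close> requires, and it is
    cancelled at the end.\<close>
  have "ev s (mpoly_var m * h * (f - g)) = 0" for s
  proof -
    let ?a = "vec m s" and ?v = "vec (n + 1) (\<lambda>i. s (m + i))"
    have e: "ev s p = eval_at p (?a @\<^sub>v ?v)" if "vars p \<subseteq> {..m + n}" for p :: "'k mpoly"
      unfolding append_vec_split[symmetric]
      by (rule eval_at_vec[symmetric]) (use that in \<open>simp add: lessThan_Suc_atMost\<close>)
    show ?thesis
    proof (cases "s m = 0 \<or> ev s h = 0")
      case False
      then have "?v $ 0 \<noteq> 0\<^sub>v (n + 1) $ 0" by simp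
      then have "?v \<noteq> 0\<^sub>v (n + 1)" by metis
      then have "ev s f = ev s g" using eq[of ?a ?v] False e[OF vf(1)] e[OF vf(2)] e[OF h(2)] by simp
      then show ?thesis by simp
    qed auto
  qed
  then have "mpoly_var m * h * (f - g) = 0" by (rule mpoly_eq_0_if_ev)
  moreover have "(mpoly_var m :: 'k mpoly) \<noteq> 0" by (metis vars_var vars_0 insert_not_empty)
  ultimately show ?thesis using h(1) by simp
qed

text \<open>Where both formulas are valid their value vectors differ by a scalar, so the minors
  vanish on a dense set, hence as polynomials.\<close>

lemma local_reps_cross:
  fixes F F' :: "nat \<Rightarrow> 'k::field_char_0 mpoly"
  assumes F: "local_rep m n \<phi> h d F" "h \<noteq> 0" and F': "local_rep m n \<phi> h' d' F'" "h' \<noteq> 0"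
    and ij: "i \<le> n" "j \<le> n"
  shows "F' i * F j = F' j * F i"
proof (rule mpoly_eq_on_vecs)
  have v: "vars (F k) \<subseteq> {..m + n}" "vars (F' k) \<subseteq> {..m + n}" if "k \<le> n" for k
    using F(1) F'(1) that unfolding local_rep_def homog_def by blast+
  show "vars (F' i * F j) \<subseteq> {..m + n}" "vars (F' j * F i) \<subseteq> {..m + n}"
    by (intro vars_subset_intros v ij)+
  show "h * h' \<noteq> 0" using F F' by simp
  show "vars (h * h') \<subseteq> {..m + n}"
  proof (rule vars_subset_intros)
    show "vars h \<subseteq> {..m + n}" "vars h' \<subseteq> {..m + n}" using F(1) F'(1) unfolding local_rep_def by blast+
  qed
  fix a v :: "'k vec"
  assume a: "a \<in> carrier_vec m" "v \<in> carrier_vec (n + 1)" "v \<noteq> 0\<^sub>v (n + 1)" "eval_at (h * h') (a @\<^sub>v v) \<noteq> 0"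
  then have nz: "eval_at h (a @\<^sub>v v) \<noteq> 0" "eval_at h' (a @\<^sub>v v) \<noteq> 0" by (auto simp: eval_at_ev)
  have "proj_point (vals n F' (a @\<^sub>v v)) = proj_point (vals n F (a @\<^sub>v v))"
    using F(1) F'(1) a nz unfolding local_rep_def by metis
  then obtain c where c: "vals n F' (a @\<^sub>v v) = c \<cdot>\<^sub>v vals n F (a @\<^sub>v v)" using proj_point_eqD by blast
  have "eval_at (F' k) (a @\<^sub>v v) = c * eval_at (F k) (a @\<^sub>v v)" if "k \<le> n" for k
    using arg_cong[OF c, of "\<lambda>w. w $ k"] that by (simp add: vals_def)
  then show "eval_at (F' i * F j) (a @\<^sub>v v) = eval_at (F' j * F i) (a @\<^sub>v v)"
    using ij by (simp add: eval_at_ev)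
qed

text \<open>Divide one local formula by its common factor to get \<open>G\<close>. Every other local
  formula is a polynomial multiple of \<open>G\<close>, and the multiplier is nonzero wherever that
  formula is valid, so \<open>G\<close> is valid everywhere.\<close>

lemma global_rep_exists:
  fixes \<phi> :: "'k::field_char_0 vec \<Rightarrow> 'k vec set \<Rightarrow> 'k vec set"
  assumes reg: "regular_map m n (carrier_vec m \<times> proj_space n) \<phi>"
  shows "\<exists>k G. local_rep m n \<phi> 1 k G"
proof -
  let ?a0 = "0\<^sub>v m :: 'k vec" and ?v0 = "unit_vec (n + 1) 0 :: 'k vec"
  have v0: "?v0 \<in> carrier_vec (n + 1)" "?v0 \<noteq> 0\<^sub>v (n + 1)"
    by (auto simp: unit_vec_def vec_eq_iff)
  obtain h d F where F: "local_rep m n \<phi> h d F" "eval_at h (?a0 @\<^sub>v ?v0) \<noteq> 0"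
    using local_rep_exists[OF reg zero_carrier_vec v0] by blast
  have h: "h \<noteq> 0" using F(2) by (auto simp: eval_at_ev)
  have "vals n F (?a0 @\<^sub>v ?v0) \<noteq> 0\<^sub>v (n + 1)"
    using F v0 zero_carrier_vec[of m] unfolding local_rep_def by blast
  moreover have "vals n F (?a0 @\<^sub>v ?v0) = 0\<^sub>v (n + 1)" if "\<forall>j\<le>n. F j = 0"
    by (intro eq_vecI) (use that in \<open>auto simp: vals_def eval_at_ev\<close>)
  ultimately obtain j where j: "j \<le> n" "F j \<noteq> 0" by blast
  obtain q G where q: "q \<noteq> 0" and FG: "\<And>i. i \<le> n ==> F i = q * G i"
    and co: "\<And>p. irreducible p ==> \<exists>i\<le>n. \<not> p dvd G i"
    using exists_common_factor[of j n F, OF j] by blast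
  have Gj: "G j \<noteq> 0" using FG[OF j(1)] j by auto
  have hF: "whomog (ind m n) d (F i)" "vars (F i) \<subseteq> {..m + n}" if "i \<le> n" for i
    using F(1) that unfolding local_rep_def homog_iff by blast+
  \<comment> \<open>Factors of forms are forms, so dividing by \<open>q\<close> leaves entries of
    the common degree \<open>d - kq\<close>.\<close>
  obtain kq where kq: "whomog (ind m n) kq q" "kq \<le> d"
    using whomog_factor[of "ind m n" d q "G j"] hF[OF j(1)] FG[OF j(1)] q Gj by auto
  have hG: "homog m n (d - kq) (G i)" if i: "i \<le> n" for i
  proof (cases "G i = 0")
    case False
    then have nz: "q * G i \<noteq> 0" "G i * q \<noteq> 0" using q by auto
    have "whomog (ind m n) d (G i * q)" using hF(1)[OF i] FG[OF i] by (simp add: mult.commute)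
    then obtain k where k: "whomog (ind m n) k (G i)" using whomog_factor nz(2) by blast
    have "whomog (ind m n) (kq + k) (F i)" unfolding FG[OF i] by (rule whomog_mult[OF kq(1) k])
    then have "kq + k = d" using whomog_unique[OF _ hF(1)[OF i]] nz FG[OF i] by simp
    moreover have "vars (G i) \<subseteq> {..m + n}" using vars_mult_eq[OF q False] hF(2)[OF i] FG[OF i] by auto
    ultimately show ?thesis using k by (auto simp: homog_iff)
  qed (simp add: homog_def)
  have "local_rep m n \<phi> 1 (d - kq) G"
    unfolding local_rep_def
  proof (intro conjI ballI impI)
    show "vars (1 :: 'k mpoly) \<subseteq> {..m + n}" by simp
    show "\<forall>i\<le>n. homog m n (d - kq) (G i)" using hG by blast
    fix a v :: "'k vec"
    assume a: "a \<in> carrier_vec m" and v: "v \<in> carrier_vec (n + 1)" "v \<noteq> 0\<^sub>v (n + 1)"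
    let ?u = "a @\<^sub>v v"
    obtain h' d' F' where F': "local_rep m n \<phi> h' d' F'" "eval_at h' ?u \<noteq> 0"
      using local_rep_exists[OF reg a v] by blast
    have h': "h' \<noteq> 0" using F'(2) by (auto simp: eval_at_ev)
    have "F' i * G j = F' j * G i" if "i \<le> n" "j \<le> n" for i j
    proof -
      have "q * (F' i * G j) = q * (F' j * G i)"
        using local_reps_cross[OF F(1) h F'(1) h' that] FG that by (simp add: ac_simps)
      then show ?thesis using q by simp
    qed
    then obtain r where r: "\<And>i. i \<le> n ==> F' i = r * G i" using coprime_multiple[OF co j(1) Gj] by blast
    have w: "vals n F' ?u \<noteq> 0\<^sub>v (n + 1)" "\<phi> a (proj_point v) = proj_point (vals n F' ?u)"
      using F' a v unfolding local_rep_def by blast+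
    have e: "vals n F' ?u = eval_at r ?u \<cdot>\<^sub>v vals n G ?u"
      by (intro eq_vecI) (auto simp: vals_def r eval_at_ev)
    have "eval_at r ?u \<noteq> 0"
    proof
      assume "eval_at r ?u = 0"
      then have "vals n F' ?u = 0\<^sub>v (n + 1)" unfolding e by (intro eq_vecI) (auto simp: vals_def)
      then show False using w(1) by contradiction
    qed
    then show "\<phi> a (proj_point v) = proj_point (vals n G ?u)"
      using w(2) unfolding e by (simp add: proj_point_smult)
    show "vals n G ?u \<noteq> 0\<^sub>v (n + 1)" using w(1) unfolding e by (metis smult_vec_zero')
  qed
  then show ?thesis by blast
qed

section \<open>Linearity of the action and correction of its scalars\<close>

lemma smult_smult_mat: "a \<cdot>\<^sub>m (b \<cdot>\<^sub>m A) = (a * b) \<cdot>\<^sub>m (A :: 'a::semigroup_mult mat)"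
  by (intro eq_matI) (simp_all add: mult.assoc)

lemma one_smult_mat [simp]: "1 \<cdot>\<^sub>m A = (A :: 'a::monoid_mult mat)"
  by (intro eq_matI) simp_all

lemma smult_mat_vec:
  fixes A :: "'a::comm_ring_1 mat"
  assumes "A \<in> carrier_mat nr nc" "v \<in> carrier_vec nc"
  shows "(c \<cdot>\<^sub>m A) *\<^sub>v v = c \<cdot>\<^sub>v (A *\<^sub>v v)"
  using assms by (intro eq_vecI) (simp_all add: scalar_prod_def sum_distrib_left mult.assoc)

lemma mat_unit_vec_col:
  fixes A :: "'a::comm_ring_1 mat"
  assumes "A \<in> carrier_mat nr nc" "j < nc"
  shows "A *\<^sub>v unit_vec nc j = col A j"
  using assms by (intro eq_vecI) simp_all

lemma local_rep_homog: "local_rep m n \<phi> h k G ==> i \<le> n ==> homog m n k (G i)"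
  unfolding local_rep_def by blast

lemma local_repD:
  assumes "local_rep m n \<phi> h k G" "a \<in> carrier_vec m" "v \<in> carrier_vec (n + 1)"
    "v \<noteq> 0\<^sub>v (n + 1)" "eval_at h (a @\<^sub>v v) \<noteq> 0"
  shows "vals n G (a @\<^sub>v v) \<noteq> 0\<^sub>v (n + 1)" "\<phi> a (proj_point v) = proj_point (vals n G (a @\<^sub>v v))"
  using assms unfolding local_rep_def by blast+

text \<open>Each monomial contains exactly one homogeneous coordinate, to the first power.
  Substituting the \<open>j\<close>-th unit vector for these coordinates picks out the coefficient
  of the \<open>j\<close>-th one.\<close>

lemma homog_linear:
  fixes f :: "'k::comm_ring_1 mpoly"
  assumes f: "homog m n 1 f"
  shows "ev s f = (\<Sum>j\<le>n. s (m + j) * ev (\<lambda>l. if l < m then s l else if l = m + j then 1 else 0) f)"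
proof -
  let ?e = "\<lambda>j l. if l < m then s l else if l = m + j then 1 else 0"
  have mon: "mon s t = (\<Sum>j\<le>n. s (m + j) * mon (?e j) t)" if t: "t \<in> Poly_Mapping.keys f" for t
  proof -
    have kt: "Poly_Mapping.keys t \<subseteq> {..m + n}" using t f by (auto simp: homog_def vars_def)
    have "(\<Sum>i\<in>{m..m+n}. Poly_Mapping.lookup t i) = 1" using f t by (auto simp: homog_def)
    then obtain i0 where i0: "i0 \<in> {m..m+n}" "Poly_Mapping.lookup t i0 = 1"
      "\<And>i. i \<in> {m..m+n} ==> i0 \<noteq> i ==> Poly_Mapping.lookup t i = 0"
      using sum_eq_1_iff[of "{m..m+n}" "Poly_Mapping.lookup t"] by auto
    define j0 where "j0 = i0 - m"
    have j0: "i0 = m + j0" "j0 \<le> n" using i0(1) by (auto simp: j0_def)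
    define t' where "t' = t - Poly_Mapping.single i0 1"
    have lt': "Poly_Mapping.lookup t' i = (if i = i0 then 0 else Poly_Mapping.lookup t i)" for i
      using i0(2) by (simp add: t'_def minus_poly_mapping.rep_eq lookup_single when_def)
    have tt': "t = t' + Poly_Mapping.single i0 1"
      by (rule poly_mapping_eqI) (use i0(2) in \<open>auto simp: lookup_add lt' lookup_single when_def\<close>)
    have kt': "i < m" if "i \<in> Poly_Mapping.keys t'" for i
    proof (rule ccontr)
      assume "\<not> i < m"
      moreover have "Poly_Mapping.lookup t' i \<noteq> 0" using that by (simp add: in_keys_iff)
      then have i: "i \<noteq> i0" "Poly_Mapping.lookup t i \<noteq> 0" unfolding lt' by (auto split: if_splits)
      then have "i \<in> Poly_Mapping.keys t" by (simp add: in_keys_iff)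
      then have "i \<le> m + n" using kt by blast
      ultimately show False using i0(3)[of i] i by simp
    qed
    have m1: "mon s t = mon s t' * s (m + j0)"
      by (subst tt') (simp add: mon_add j0)
    have m2: "mon (?e j) t = mon s t' * (if j = j0 then 1 else 0)" for j
    proof -
      have "mon (?e j) t' = mon s t'" by (rule mon_cong) (use kt' in auto)
      then show ?thesis by (subst tt') (auto simp: mon_add j0)
    qed
    show ?thesis unfolding m1 m2 using j0(2) by (simp add: if_distrib ac_simps cong: if_cong)
  qed
  have "ev s f = (\<Sum>t\<in>Poly_Mapping.keys f. \<Sum>j\<le>n. s (m + j) * (Poly_Mapping.lookup f t * mon (?e j) t))"
    unfolding mpoly_eval_mon by (rule sum.cong) (simp_all add: mon sum_distrib_left ac_simps)
  also have "\<dots> = (\<Sum>j\<le>n. \<Sum>t\<in>Poly_Mapping.keys f. s (m + j) * (Poly_Mapping.lookup f t * mon (?e j) t))"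
    by (rule sum.swap)
  finally show ?thesis by (simp add: mpoly_eval_mon sum_distrib_left)
qed

definition line_poly :: "(nat \<Rightarrow> 'k) \<Rightarrow> 'k::comm_ring_1 mpoly \<Rightarrow> 'k poly" where
  "line_poly a f = mpoly_eval (\<lambda>c. [:c:]) (\<lambda>i. [:0, a i:]) f"

lemma poly_line_poly: "poly (line_poly a f) t = ev (\<lambda>i. t * a i) (f :: 'k::comm_ring_1 mpoly)"
proof -
  have h: "comm_ring_hom (\<lambda>p. poly p t)" by unfold_locales auto
  show ?thesis unfolding line_poly_def by (subst mpoly_eval_comp[OF h]) simp
qed

lemma poly_no_root_const:
  fixes p :: "'k::alg_closed_field poly"
  assumes "\<And>t. poly p t \<noteq> 0"
  shows "poly p a = poly p b"
proof -
  have "degree p = 0" using assms alg_closed_imp_poly_has_root[of p] by blast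
  then obtain c where "p = [:c:]" using degree_eq_zeroE by blast
  then show ?thesis by simp
qed

text \<open>At \<open>a = 0\<close> the forms of degree \<open>k\<close> describe the identity. On
  the line of the first two coordinates the scalar between point and value never vanishes, so on one
  affine chart it is a constant \<gamma>. On the other chart homogeneity then gives \<gamma> times
  the power \<open>k - 1\<close> of the parameter, which is a polynomial nonzero at 0 only for
  \<open>k = 1\<close>.\<close>

lemma global_rep_degree:
  fixes \<phi> :: "'k::{alg_closed_field, field_char_0} vec \<Rightarrow> 'k vec set \<Rightarrow> 'k vec set"
  assumes n: "n \<ge> 1" and G: "local_rep m n \<phi> 1 k G"
    and id: "\<And>p. p \<in> proj_space n ==> \<phi> (0\<^sub>v m) p = p"
  shows "k = 1"
proof -
  define u where "u s t = vec (n + 1) (\<lambda>i. if i = 0 then s else if i = 1 then t else (0::'k))" for s t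
  define g where "g i s t = eval_at (G i) (0\<^sub>v m @\<^sub>v u s t)" for i s t
  have uc: "u s t \<in> carrier_vec (n + 1)" for s t by (simp add: u_def)
  have hG: "homog m n k (G i)" if "i \<le> n" for i using local_rep_homog[OF G that] .
  have prp: "\<exists>c. c \<noteq> 0 \<and> g 0 s t = c * s \<and> g 1 s t = c * t" if nz: "s \<noteq> 0 \<or> t \<noteq> 0" for s t
  proof -
    have "u s t $ 0 = s" "u s t $ 1 = t" using n by (auto simp: u_def)
    then have unz: "u s t \<noteq> 0\<^sub>v (n + 1)" using nz n by auto
    have "proj_point (u s t) = proj_point (vals n G (0\<^sub>v m @\<^sub>v u s t))"
      using G uc[of s t] unz id[OF proj_spaceI[OF uc unz]] unfolding local_rep_def by (simp add: eval_at_ev)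
    then obtain c where c: "c \<noteq> 0" "vals n G (0\<^sub>v m @\<^sub>v u s t) = c \<cdot>\<^sub>v u s t"
      using proj_point_eqD by metis
    have "g i s t = c * u s t $ i" if "i \<le> n" for i
      using arg_cong[OF c(2), of "\<lambda>w. w $ i"] that uc[of s t] by (simp add: vals_def g_def u_def)
    then have "g 0 s t = c * s \<and> g 1 s t = c * t" using n by (simp add: u_def)
    then show ?thesis using c(1) by blast
  qed
  have pol: "\<exists>p. \<forall>t. g i s t = poly p t" "\<exists>p. \<forall>t. g i t s = poly p t" if "i \<le> n" for i s
  proof -
    let ?h = "comm_ring_hom"
    have h: "?h (\<lambda>p::'k poly. poly p t)" for t by unfold_locales auto
    have v: "vars (G i) \<subseteq> {..m + n}" using hG[OF that] by (simp add: homog_def)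
    have val: "(0\<^sub>v m @\<^sub>v u s t) $ l = (if l = m then s else if l = m + 1 then t else 0)"
      if "l \<le> m + n" for l s t using that n by (auto simp: u_def)
    have vd: "l \<le> m + n" if "l \<in> vars (G i)" for l using v that by auto
    let ?q1 = "mpoly_eval (\<lambda>c. [:c:]) (\<lambda>l. if l = m then [:s:] else if l = m + 1 then [:0,1:] else 0) (G i)"
    let ?q2 = "mpoly_eval (\<lambda>c. [:c:]) (\<lambda>l. if l = m then [:0,1:] else if l = m + 1 then [:s:] else 0) (G i)"
    have 1: "g i s t = poly ?q1 t" for t
      unfolding g_def eval_at_ev mpoly_eval_comp[OF h]
      by (rule sym, simp, rule mpoly_eval_cong) (simp add: val[OF vd])
    have 2: "g i t s = poly ?q2 t" for t
      unfolding g_def eval_at_ev mpoly_eval_comp[OF h]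
      by (rule sym, simp, rule mpoly_eval_cong) (simp add: val[OF vd])
    show "\<exists>p. \<forall>t. g i s t = poly p t" by (rule exI[of _ ?q1]) (use 1 in blast)
    show "\<exists>p. \<forall>t. g i t s = poly p t" by (rule exI[of _ ?q2]) (use 2 in blast)
  qed
  have scale: "g i (c * s) (c * t) = c ^ k * g i s t" if "i \<le> n" for i c s t
  proof -
    have "u (c * s) (c * t) = c \<cdot>\<^sub>v u s t" by (intro eq_vecI) (auto simp: u_def)
    then show ?thesis unfolding g_def using eval_at_scale[OF hG[OF that] _ uc] by simp
  qed
  obtain p where p: "\<And>t. g 0 1 t = poly p t" using pol(1)[of 0 1] by auto
  have "poly p t \<noteq> 0" for t using prp[of 1 t] p[of t] by auto
  then have "g 0 1 t = g 0 1 0" for t using poly_no_root_const[of p t 0] p by simp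
  then obtain \<gamma> where \<gamma>: "\<And>t. g 0 1 t = \<gamma>" by blast
  have \<gamma>0: "\<gamma> \<noteq> 0" using prp[of 1 0] \<gamma>[of 0] by auto
  have g1: "g 1 1 t = \<gamma> * t" for t using prp[of 1 t] \<gamma>[of t] by auto
  have gs: "g 1 s 1 = s ^ k * (\<gamma> / s)" if "s \<noteq> 0" for s
    using scale[of 1 s 1 "1 / s"] g1[of "1 / s"] that n by simp
  obtain q where q: "\<And>s. g 1 s 1 = poly q s" using pol(2)[of 1 1] n by auto
  have q0: "poly q 0 \<noteq> 0" using prp[of 0 1] q[of 0] by auto
  have "[:0, 1:] * q = Polynomial.smult \<gamma> (monom 1 k)"
  proof -
    have "poly ([:0, 1:] * q) s = poly (Polynomial.smult \<gamma> (monom 1 k)) s" if "s \<noteq> 0" for s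
    proof -
      have "s * poly q s = s * (s ^ k * (\<gamma> / s))" using gs[OF that] q[of s] by simp
      also have "\<dots> = \<gamma> * s ^ k" using that by simp
      finally show ?thesis by (simp add: poly_monom)
    qed
    then have sub: "UNIV - {0} \<subseteq> {s. poly ([:0, 1:] * q - Polynomial.smult \<gamma> (monom 1 k)) s = 0}" by auto
    have "infinite (UNIV - {0 :: 'k})" using infinite_UNIV_char_0 by simp
    then have inf: "infinite {s. poly ([:0, 1:] * q - Polynomial.smult \<gamma> (monom 1 k)) s = 0}"
      using finite_subset[OF sub] by blast
    have "[:0, 1:] * q - Polynomial.smult \<gamma> (monom 1 k) = 0"
      using inf poly_roots_finite by blast
    then show ?thesis by simp
  qed
  then have "coeff ([:0, 1:] * q) 1 = coeff (Polynomial.smult \<gamma> (monom 1 k)) 1" by simp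
  then have "coeff q 0 = \<gamma> * (if k = 1 then 1 else 0)" by (simp add: coeff_monom)
  then show ?thesis using q0 by (cases "k = 1") (simp_all add: poly_0_coeff_0)
qed

lemma scalar_mat_if_proportional:
  fixes A :: "'k::field mat"
  assumes A: "A \<in> carrier_mat N N" and N: "N > 0"
    and prp: "\<And>v. v \<in> carrier_vec N ==> v \<noteq> 0\<^sub>v N ==> \<exists>c. A *\<^sub>v v = c \<cdot>\<^sub>v v"
  shows "A = A $$ (0, 0) \<cdot>\<^sub>m 1\<^sub>m N"
proof (rule eq_matI)
  have ent: "A $$ (i, j) = (A *\<^sub>v unit_vec N j) $ i" if "i < N" "j < N" for i j
    using that A by (simp add: mat_unit_vec_col)
  have col: "\<exists>c. \<forall>i<N. A $$ (i, j) = (if i = j then c else 0)" if j: "j < N" for j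
  proof -
    obtain c where c: "A *\<^sub>v unit_vec N j = c \<cdot>\<^sub>v unit_vec N j" using prp[of "unit_vec N j"] j by auto
    then show ?thesis using j by (intro exI[of _ c]) (auto simp: ent)
  qed
  have diag: "A $$ (i, i) = A $$ (0, 0)" if i: "i < N" for i
  proof (cases "i = 0")
    case False
    let ?v = "unit_vec N 0 + unit_vec N i :: 'k vec"
    have "?v $ 0 = 1" using False i N by simp
    then have "?v \<noteq> 0\<^sub>v N" using N index_zero_vec(1)[of 0 N] by (metis zero_neq_one)
    then obtain c where c: "A *\<^sub>v ?v = c \<cdot>\<^sub>v ?v" using prp[of ?v] by auto
    have s: "A *\<^sub>v ?v = A *\<^sub>v unit_vec N 0 + A *\<^sub>v unit_vec N i"
      using A by (intro mult_add_distrib_mat_vec) auto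
    have eq: "A $$ (l, 0) + A $$ (l, i) = (c \<cdot>\<^sub>v ?v) $ l" if "l < N" for l
      unfolding c[symmetric] s using that i N A ent[of l 0] ent[of l i] by simp
    have "A $$ (0, 0) + A $$ (0, i) = c" "A $$ (i, 0) + A $$ (i, i) = c"
      using eq[OF N] eq[OF i] i N False by simp_all
    moreover obtain c1 where "\<forall>l<N. A $$ (l, 0) = (if l = 0 then c1 else 0)" using col[OF N] by blast
    moreover obtain c2 where "\<forall>l<N. A $$ (l, i) = (if l = i then c2 else 0)" using col[OF i] by blast
    ultimately show ?thesis using i N False by auto
  qed simp
  fix i j assume ij: "i < dim_row (A $$ (0, 0) \<cdot>\<^sub>m 1\<^sub>m N)" "j < dim_col (A $$ (0, 0) \<cdot>\<^sub>m 1\<^sub>m N)"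
  obtain c where "\<forall>l<N. A $$ (l, j) = (if l = j then c else 0)" using col[of j] ij by auto
  then show "A $$ (i, j) = (A $$ (0, 0) \<cdot>\<^sub>m 1\<^sub>m N) $$ (i, j)"
    using ij diag[of j] by auto
qed (use A in auto)

lemma rep_at_carrier [simp]: "rep_at N P a \<in> carrier_mat N N"
  by (simp add: rep_at_def)

lemma dim_rep_at [simp]: "dim_row (rep_at N P a) = N" "dim_col (rep_at N P a) = N"
  by (simp_all add: rep_at_def)

text \<open>Forms of degree one are the rows of a matrix; its entry \<open>L i j\<close> arises by
  substituting the \<open>j\<close>-th unit vector into \<open>G i\<close>.\<close>

lemma linear_lift:
  fixes \<phi> :: "'k::{alg_closed_field, field_char_0} vec \<Rightarrow> 'k vec set \<Rightarrow> 'k vec set"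
  assumes n: "n \<ge> 1" and reg: "regular_map m n (carrier_vec m \<times> proj_space n) \<phi>"
    and id: "\<And>p. p \<in> proj_space n ==> \<phi> (0\<^sub>v m) p = p"
  shows "\<exists>L. (\<forall>i<n+1. \<forall>j<n+1. vars (L i j) \<subseteq> {..<m}) \<and>
    (\<forall>a\<in>carrier_vec m. \<forall>v\<in>carrier_vec (n + 1). v \<noteq> 0\<^sub>v (n + 1) -->
      rep_at (n + 1) L a *\<^sub>v v \<noteq> 0\<^sub>v (n + 1) \<and> \<phi> a (proj_point v) = proj_point (rep_at (n + 1) L a *\<^sub>v v))"
proof -
  obtain k G where G: "local_rep m n \<phi> 1 k G" using global_rep_exists[OF reg] by blast
  have k: "k = 1" by (rule global_rep_degree[OF n G id])
  have hG: "homog m n 1 (G i)" if "i \<le> n" for i using local_rep_homog[OF G that] unfolding k .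
  define L where "L i j = mpoly_eval mpoly_const
    (\<lambda>l. if l < m then mpoly_var l else if l = m + j then 1 else 0) (G i)" for i j
  have vL: "vars (L i j) \<subseteq> {..<m}" for i j
  proof -
    have vc: "vars (mpoly_const c :: 'k mpoly) \<subseteq> {..<m}" for c by simp
    have vl: "vars ((if l < m then mpoly_var l else if l = m + j then 1 else 0) :: 'k mpoly) \<subseteq> {..<m}" for l
      by auto
    show ?thesis unfolding L_def mpoly_eval_mon mon_def
      by (rule vars_subset_intros(5), rule vars_subset_intros(3)[OF vc],
          rule vars_subset_intros(6), rule vars_subset_intros(4)[OF vl])
  qed
  have evL: "ev s (L i j) = ev (\<lambda>l. if l < m then s l else if l = m + j then 1 else 0) (G i)" for s i j
  proof -
    have "ev s (L i j) = mpoly_eval (\<lambda>c. ev s (mpoly_const c))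
        (\<lambda>l. ev s (if l < m then mpoly_var l else if l = m + j then 1 else 0)) (G i)"
      unfolding L_def by (rule mpoly_eval_comp[OF ev_hom])
    also have "(\<lambda>l. ev s (if l < m then mpoly_var l else if l = m + j then 1 else 0)) =
        (\<lambda>l. if l < m then s l else if l = m + j then 1 else 0)" by (rule ext) simp
    finally show ?thesis by simp
  qed
  have vals: "vals n G (a @\<^sub>v v) = rep_at (n + 1) L a *\<^sub>v v"
    if a: "a \<in> carrier_vec m" and v: "v \<in> carrier_vec (n + 1)" for a v
  proof (rule eq_vecI)
    fix i assume "i < dim_vec (rep_at (n + 1) L a *\<^sub>v v)"
    then have i: "i \<le> n" by (simp add: rep_at_def)
    have "eval_at (G i) (a @\<^sub>v v) = (\<Sum>j\<le>n. (a @\<^sub>v v) $ (m + j) *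
        ev (\<lambda>l. if l < m then (a @\<^sub>v v) $ l else if l = m + j then 1 else 0) (G i))"
      unfolding eval_at_ev by (rule homog_linear[OF hG[OF i]])
    also have "\<dots> = (\<Sum>j\<le>n. v $ j * eval_at (L i j) a)"
    proof (rule sum.cong)
      fix j assume "j \<in> {..n}"
      then have "(a @\<^sub>v v) $ (m + j) = v $ j" using a v by auto
      moreover have "(\<lambda>l. if l < m then (a @\<^sub>v v) $ l else if l = m + j then 1 else 0) =
          (\<lambda>l. if l < m then a $ l else if l = m + j then 1 else 0)"
        by (rule ext) (use a v in simp)
      ultimately show "(a @\<^sub>v v) $ (m + j) *
        ev (\<lambda>l. if l < m then (a @\<^sub>v v) $ l else if l = m + j then 1 else 0) (G i) = v $ j * eval_at (L i j) a"
        by (simp add: evL eval_at_ev)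
    qed simp
    also have "\<dots> = (rep_at (n + 1) L a *\<^sub>v v) $ i"
      using i v by (simp add: rep_at_def scalar_prod_def mult.commute atLeast0LessThan lessThan_Suc_atMost)
    finally show "vals n G (a @\<^sub>v v) $ i = (rep_at (n + 1) L a *\<^sub>v v) $ i"
      using i by (simp add: vals_def)
  qed (simp add: vals_def rep_at_def)
  show ?thesis
  proof (intro exI[of _ L] conjI ballI impI allI)
    fix a v :: "'k vec" assume av: "a \<in> carrier_vec m" "v \<in> carrier_vec (n + 1)" "v \<noteq> 0\<^sub>v (n + 1)"
    have "eval_at 1 (a @\<^sub>v v) \<noteq> 0" by (simp add: eval_at_ev)
    note local_repD[OF G av this]
    then show "rep_at (n + 1) L a *\<^sub>v v \<noteq> 0\<^sub>v (n + 1)"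
      "\<phi> a (proj_point v) = proj_point (rep_at (n + 1) L a *\<^sub>v v)"
      using vals[OF av(1,2)] by simp_all
  qed (rule vL)
qed

text \<open>The matrices of the linear lift multiply only up to scalars. Along lines through the
  origin the scalar is a polynomial without zeros, hence constant, and its value at the origin is a
  power of \<mu>. Division by \<mu> gives an honest representation.\<close>

lemma action_lift:
  fixes \<phi> :: "'k::{alg_closed_field, field_char_0} vec \<Rightarrow> 'k vec set \<Rightarrow> 'k vec set"
  assumes n: "n \<ge> 1" and act: "regular_action m n (proj_space n) \<phi>"
  shows "\<exists>P. linear_rep m (n + 1) P \<and>
    (\<forall>a\<in>carrier_vec m. \<forall>v\<in>carrier_vec (n + 1). v \<noteq> 0\<^sub>v (n + 1) -->
       \<phi> a (proj_point v) = proj_point (rep_at (n + 1) P a *\<^sub>v v))"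
proof -
  define N where "N = n + 1"
  have N0: "N > 0" by (simp add: N_def)
  have reg: "regular_map m n (carrier_vec m \<times> proj_space n) \<phi>"
    and id: "\<And>p. p \<in> proj_space n ==> \<phi> (0\<^sub>v m) p = p"
    and add: "\<And>a b p. a \<in> carrier_vec m ==> b \<in> carrier_vec m ==> p \<in> proj_space n ==>
      \<phi> (a + b) p = \<phi> a (\<phi> b p)"
    using act unfolding regular_action_def by blast+
  have "\<exists>L. (\<forall>i<N. \<forall>j<N. vars (L i j) \<subseteq> {..<m}) \<and>
    (\<forall>a\<in>carrier_vec m. \<forall>v\<in>carrier_vec N. v \<noteq> 0\<^sub>v N -->
      rep_at N L a *\<^sub>v v \<noteq> 0\<^sub>v N \<and> \<phi> a (proj_point v) = proj_point (rep_at N L a *\<^sub>v v))"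
    unfolding N_def by (rule linear_lift[OF n reg]) (rule id)
  then obtain L where
    vL: "\<forall>i<N. \<forall>j<N. vars (L i j) \<subseteq> {..<m}"
    and L0: "\<forall>a\<in>carrier_vec m. \<forall>v\<in>carrier_vec N. v \<noteq> 0\<^sub>v N -->
      rep_at N L a *\<^sub>v v \<noteq> 0\<^sub>v N \<and> \<phi> a (proj_point v) = proj_point (rep_at N L a *\<^sub>v v)"
    by (elim exE conjE) (rule that)
  note vL = vL[rule_format]
  have L: "rep_at N L a *\<^sub>v v \<noteq> 0\<^sub>v N \<and> \<phi> a (proj_point v) = proj_point (rep_at N L a *\<^sub>v v)"
    if "a \<in> carrier_vec m" "v \<in> carrier_vec N" "v \<noteq> 0\<^sub>v N" for a v
    using L0 that by simp
  let ?M = "rep_at N L"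
  define \<mu> where "\<mu> = ?M (0\<^sub>v m) $$ (0, 0)"
  have M0: "?M (0\<^sub>v m) = \<mu> \<cdot>\<^sub>m 1\<^sub>m N"
    unfolding \<mu>_def
  proof (rule scalar_mat_if_proportional[OF _ N0])
    fix v :: "'k vec" assume v: "v \<in> carrier_vec N" "v \<noteq> 0\<^sub>v N"
    have "proj_point (?M (0\<^sub>v m) *\<^sub>v v) = proj_point v"
      using L[of "0\<^sub>v m" v] v id[OF proj_spaceI] by (simp add: N_def)
    then show "\<exists>c. ?M (0\<^sub>v m) *\<^sub>v v = c \<cdot>\<^sub>v v" using proj_point_eqD by blast
  qed simp
  \<comment> \<open>With the third argument \<open>- (a + b)\<close> the composite acts as the
    identity on projective space, so the product is a scalar matrix and no inverse matrix has to be
    formed.\<close>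
  have three: "\<exists>c. c \<noteq> 0 \<and> ?M a * (?M b * ?M (- (a + b))) = c \<cdot>\<^sub>m 1\<^sub>m N"
    if ab: "a \<in> carrier_vec m" "b \<in> carrier_vec m" for a b
  proof -
    let ?C = "?M a * (?M b * ?M (- (a + b)))"
    have Cc: "?C \<in> carrier_mat N N"
      by (rule mult_carrier_mat[OF rep_at_carrier mult_carrier_mat[OF rep_at_carrier rep_at_carrier]])
    have C: "\<exists>c. c \<noteq> 0 \<and> ?C *\<^sub>v v = c \<cdot>\<^sub>v v" if v: "v \<in> carrier_vec N" "v \<noteq> 0\<^sub>v N" for v
    proof -
      have c: "- (a + b) \<in> carrier_vec m" using ab by simp
      define w1 where "w1 = ?M (- (a + b)) *\<^sub>v v"
      define w2 where "w2 = ?M b *\<^sub>v w1"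
      have w1: "w1 \<in> carrier_vec N" "w1 \<noteq> 0\<^sub>v N" "\<phi> (- (a + b)) (proj_point v) = proj_point w1"
        using L[OF c v] mult_mat_vec_carrier[OF rep_at_carrier v(1)] unfolding w1_def by blast+
      have w2: "w2 \<in> carrier_vec N" "w2 \<noteq> 0\<^sub>v N" "\<phi> b (proj_point w1) = proj_point w2"
        using L[OF ab(2) w1(1,2)] mult_mat_vec_carrier[OF rep_at_carrier w1(1)] unfolding w2_def by blast+
      have pv: "proj_point v \<in> proj_space n" "proj_point w1 \<in> proj_space n"
        using v w1 unfolding N_def by (auto intro: proj_spaceI)
      have "proj_point (?M a *\<^sub>v w2) = \<phi> a (\<phi> b (\<phi> (- (a + b)) (proj_point v)))"
        using L[OF ab(1) w2(1,2)] w1 w2 by simp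
      also have "\<dots> = \<phi> ((a + b) + - (a + b)) (proj_point v)"
        using add[OF ab pv(2)] add[OF _ c pv(1), of "a + b"] ab w1(3) by simp
      also have "(a + b) + - (a + b) = 0\<^sub>v m" using ab by (intro eq_vecI) auto
      also have "\<phi> (0\<^sub>v m) (proj_point v) = proj_point v" by (rule id[OF pv(1)])
      also have "?M a *\<^sub>v w2 = ?C *\<^sub>v v"
      proof -
        have c23: "?M b * ?M (- (a + b)) \<in> carrier_mat N N"
          by (rule mult_carrier_mat[OF rep_at_carrier rep_at_carrier])
        show ?thesis unfolding w1_def w2_def
            assoc_mult_mat_vec[OF rep_at_carrier c23 v(1)] assoc_mult_mat_vec[OF rep_at_carrier rep_at_carrier v(1)] ..
      qed
      finally show ?thesis using proj_point_eqD by blast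
    qed
    then have "?C = ?C $$ (0, 0) \<cdot>\<^sub>m 1\<^sub>m N"
      by (intro scalar_mat_if_proportional[OF Cc N0]) blast
    moreover have "?C $$ (0, 0) \<noteq> 0"
    proof -
      have u: "unit_vec N 0 \<in> carrier_vec N" "unit_vec N 0 \<noteq> (0\<^sub>v N :: 'k vec)"
        using N0 by auto
      obtain c where c: "c \<noteq> 0" "?C *\<^sub>v unit_vec N 0 = c \<cdot>\<^sub>v unit_vec N 0" using C[OF u] by blast
      have "?C $$ (0, 0) = (?C *\<^sub>v unit_vec N 0) $ 0" using Cc N0 by (simp add: mat_unit_vec_col[OF Cc])
      then show ?thesis using c N0 by simp
    qed
    ultimately show ?thesis by blast
  qed
  have \<mu>0: "\<mu> \<noteq> 0"
  proof -
    have "rep_at N L (0\<^sub>v m) *\<^sub>v unit_vec N 0 \<noteq> 0\<^sub>v N" using L[of "0\<^sub>v m" "unit_vec N 0"] N0 by auto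
    then show ?thesis unfolding M0 using N0 by (auto intro!: eq_vecI)
  qed
  have three': "?M a * (?M b * ?M (- (a + b))) = \<mu> ^ 3 \<cdot>\<^sub>m 1\<^sub>m N"
    if ab: "a \<in> carrier_vec m" "b \<in> carrier_vec m" for a b
  proof -
    \<comment> \<open>The corner entry of the triple product at \<open>t \<cdot>\<^sub>v a\<close>
      and \<open>t \<cdot>\<^sub>v b\<close>, as a polynomial in \<open>t\<close>. It equals the
      scalar, so it has no zeros.\<close>
    define p where "p = (\<Sum>k<N. line_poly (($) a) (L 0 k) *
        (\<Sum>l<N. line_poly (($) b) (L k l) * line_poly (($) (- (a + b))) (L l 0)))"
    have ent: "(?M (t \<cdot>\<^sub>v a) * (?M (t \<cdot>\<^sub>v b) * ?M (- (t \<cdot>\<^sub>v a + t \<cdot>\<^sub>v b)))) $$ (0, 0) = poly p t" for t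
    proof -
      have e: "eval_at (L i j) (t \<cdot>\<^sub>v c) = poly (line_poly (($) c) (L i j)) t"
        if "i < N" "j < N" "c \<in> carrier_vec m" for i j c
        unfolding poly_line_poly eval_at_ev using vL[OF that(1,2)] that(3)
        by (intro mpoly_eval_cong) (auto simp: subset_iff)
      have s: "- (t \<cdot>\<^sub>v a + t \<cdot>\<^sub>v b) = t \<cdot>\<^sub>v (- (a + b))"
        using ab by (intro eq_vecI) (auto simp: algebra_simps)
      have c: "- (a + b) \<in> carrier_vec m" using ab by simp
      show ?thesis unfolding s
        using N0 ab c by (simp add: rep_at_def times_mat_def scalar_prod_def e p_def poly_sum atLeast0LessThan)
    qed
    have nz: "poly p t \<noteq> 0" for t
    proof -
      have "t \<cdot>\<^sub>v a \<in> carrier_vec m" "t \<cdot>\<^sub>v b \<in> carrier_vec m" using ab by auto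
      then obtain c where "c \<noteq> 0" "?M (t \<cdot>\<^sub>v a) * (?M (t \<cdot>\<^sub>v b) * ?M (- (t \<cdot>\<^sub>v a + t \<cdot>\<^sub>v b))) = c \<cdot>\<^sub>m 1\<^sub>m N"
        using three by blast
      then show ?thesis using ent[of t] N0 by simp
    qed
    obtain c where c: "?M a * (?M b * ?M (- (a + b))) = c \<cdot>\<^sub>m 1\<^sub>m N" using three[OF ab] by blast
    have "c = poly p 1" using ent[of 1] c ab N0 by simp
    also have "\<dots> = poly p 0" using poly_no_root_const[of p 1 0] nz by blast
    also have "\<dots> = (?M (0\<^sub>v m) * (?M (0\<^sub>v m) * ?M (0\<^sub>v m))) $$ (0, 0)"
    proof -
      have "0 \<cdot>\<^sub>v a = 0\<^sub>v m" "0 \<cdot>\<^sub>v b = 0\<^sub>v m" "- (0\<^sub>v m + 0\<^sub>v m) = (0\<^sub>v m :: 'k vec)"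
        using ab by (auto intro!: eq_vecI)
      then show ?thesis using ent[of 0] by simp
    qed
    also have "\<dots> = \<mu> ^ 3"
      unfolding M0 using N0 by (simp add: mult_smult_assoc_mat[of _ N N _ N] mult_smult_distrib[of _ N N _ N] power3_eq_cube)
    finally show ?thesis using c by simp
  qed
  have inv: "?M (- a) * ?M a = \<mu> ^ 2 \<cdot>\<^sub>m 1\<^sub>m N" if a: "a \<in> carrier_vec m" for a
  proof -
    have z: "- (- a + a) = 0\<^sub>v m" using a by (intro eq_vecI) auto
    have "?M (- a) * (?M a * (\<mu> \<cdot>\<^sub>m 1\<^sub>m N)) = \<mu> ^ 3 \<cdot>\<^sub>m 1\<^sub>m N"
      using three'[of "- a" a] a unfolding z M0 by simp
    moreover have "?M (- a) * (?M a * (\<mu> \<cdot>\<^sub>m 1\<^sub>m N)) = \<mu> \<cdot>\<^sub>m (?M (- a) * ?M a)"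
      unfolding mult_smult_distrib[OF rep_at_carrier one_carrier_mat] right_mult_one_mat[OF rep_at_carrier]
      by (rule mult_smult_distrib[OF rep_at_carrier rep_at_carrier])
    ultimately have "\<mu> \<cdot>\<^sub>m (?M (- a) * ?M a) = \<mu> ^ 3 \<cdot>\<^sub>m 1\<^sub>m N" by simp
    then have "(1 / \<mu>) \<cdot>\<^sub>m (\<mu> \<cdot>\<^sub>m (?M (- a) * ?M a)) = (1 / \<mu>) \<cdot>\<^sub>m (\<mu> ^ 3 \<cdot>\<^sub>m 1\<^sub>m N)" by simp
    then show ?thesis using \<mu>0
      by (simp add: smult_smult_mat power3_eq_cube power2_eq_square)
  qed
  have mul: "?M a * ?M b = \<mu> \<cdot>\<^sub>m ?M (a + b)" if ab: "a \<in> carrier_vec m" "b \<in> carrier_vec m" for a b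
  proof -
    let ?D = "?M (- (a + b))" and ?E = "?M (a + b)"
    have "?M a * (?M b * ?D) * ?E = \<mu> ^ 3 \<cdot>\<^sub>m ?E"
      unfolding three'[OF ab] mult_smult_assoc_mat[OF one_carrier_mat rep_at_carrier]
        left_mult_one_mat[OF rep_at_carrier] ..
    moreover have "?M a * (?M b * ?D) * ?E = (?M a * ?M b) * (?D * ?E)"
      using assoc_mult_mat[OF rep_at_carrier[of N L a] rep_at_carrier[of N L b] rep_at_carrier[of N L "- (a + b)"]]
        assoc_mult_mat[OF mult_carrier_mat[OF rep_at_carrier[of N L a] rep_at_carrier[of N L b]]
          rep_at_carrier[of N L "- (a + b)"] rep_at_carrier[of N L "a + b"]] by metis
    moreover have "?D * ?E = \<mu> ^ 2 \<cdot>\<^sub>m 1\<^sub>m N" using inv[of "a + b"] ab by simp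
    moreover have "(?M a * ?M b) * (\<mu> ^ 2 \<cdot>\<^sub>m 1\<^sub>m N) = \<mu> ^ 2 \<cdot>\<^sub>m (?M a * ?M b)"
      unfolding mult_smult_distrib[OF mult_carrier_mat[OF rep_at_carrier rep_at_carrier] one_carrier_mat]
        right_mult_one_mat[OF mult_carrier_mat[OF rep_at_carrier rep_at_carrier]] ..
    ultimately have "\<mu> ^ 2 \<cdot>\<^sub>m (?M a * ?M b) = \<mu> ^ 3 \<cdot>\<^sub>m ?E" by metis
    then have "(1 / \<mu> ^ 2) \<cdot>\<^sub>m (\<mu> ^ 2 \<cdot>\<^sub>m (?M a * ?M b)) = (1 / \<mu> ^ 2) \<cdot>\<^sub>m (\<mu> ^ 3 \<cdot>\<^sub>m ?E)" by simp
    then show ?thesis using \<mu>0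
      by (simp add: smult_smult_mat power3_eq_cube power2_eq_square)
  qed
  define P where "P i j = mpoly_const (1 / \<mu>) * L i j" for i j
  have PM: "rep_at N P a = (1 / \<mu>) \<cdot>\<^sub>m ?M a" for a
    by (intro eq_matI) (simp_all add: rep_at_def P_def eval_at_ev)
  have "linear_rep m N P"
    unfolding linear_rep_def
  proof (intro conjI allI impI ballI)
    show "vars (P i j) \<subseteq> {..<m}" if "i < N" "j < N" for i j
      unfolding P_def by (intro vars_subset_intros vL that) simp
    show "rep_at N P (0\<^sub>v m) = 1\<^sub>m N" unfolding PM M0 using \<mu>0 by (simp add: smult_smult_mat)
    fix a b :: "'k vec" assume ab: "a \<in> carrier_vec m" "b \<in> carrier_vec m"
    have "rep_at N P a * rep_at N P b = (1 / \<mu>) \<cdot>\<^sub>m ((1 / \<mu>) \<cdot>\<^sub>m (?M a * ?M b))"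
      unfolding PM mult_smult_assoc_mat[OF rep_at_carrier smult_carrier_mat[OF rep_at_carrier]]
        mult_smult_distrib[OF rep_at_carrier rep_at_carrier] ..
    then show "rep_at N P (a + b) = rep_at N P a * rep_at N P b"
      unfolding mul[OF ab] PM using \<mu>0 by (simp add: smult_smult_mat)
  qed
  moreover have X: "\<phi> a (proj_point v) = proj_point (rep_at N P a *\<^sub>v v)"
    if "a \<in> carrier_vec m" "v \<in> carrier_vec N" "v \<noteq> 0\<^sub>v N" for a v
  proof -
    have "rep_at N P a *\<^sub>v v = (1 / \<mu>) \<cdot>\<^sub>v (?M a *\<^sub>v v)"
      unfolding PM by (rule smult_mat_vec[OF rep_at_carrier that(2)])
    then show ?thesis using L[OF that] proj_point_smult[of "1 / \<mu>"] \<mu>0 by simp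
  qed
  ultimately show ?thesis unfolding N_def by blast
qed

section \<open>Exponential and logarithm on nilpotent elements\<close>

text \<open>A local algebra is presented as \<open>R / J\<close> for a \<open>K\<close>-algebra \<open>R\<close> with structure map
  \<open>c\<close> and augmentation \<open>aug\<close>; its elements are handled as elements of \<open>R\<close> modulo \<open>J\<close>.\<close>

locale nil_alg =
  fixes c :: "'k::field_char_0 \<Rightarrow> 'r::comm_ring_1" and aug :: "'r \<Rightarrow> 'k" and J :: "'r set" and D :: nat
  assumes c_hom: "comm_ring_hom c" and aug_hom: "comm_ring_hom aug" and aug_c: "aug (c k) = k"
    and J_0: "0 \<in> J" and J_add: "a \<in> J ==> b \<in> J ==> a + b \<in> J" and J_mult: "a \<in> J ==> r * a \<in> J"
    and J_nil: "aug r = 0 ==> r ^ D \<in> J" and one_notin_J: "1 \<notin> J"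
begin

interpretation c: comm_ring_hom c by (rule c_hom)
interpretation aug: comm_ring_hom aug by (rule aug_hom)

lemmas c_simps = c.hom_add c.hom_mult c.hom_power c.hom_minus c.hom_uminus c.hom_sum
lemmas c_0 [simp] = c.hom_zero
lemmas c_1 [simp] = c.hom_one
lemmas aug_simps [simp] = aug.hom_add aug.hom_mult aug.hom_power aug.hom_minus aug.hom_uminus aug.hom_sum
  aug.hom_zero aug.hom_one aug_c

definition eqv :: "'r \<Rightarrow> 'r \<Rightarrow> bool" (infix "\<approx>" 50) where "a \<approx> b \<longleftrightarrow> a - b \<in> J"

lemma J_mult2: "a \<in> J ==> a * r \<in> J" using J_mult[of a r] by (simp add: mult.commute)
lemma J_uminus: "a \<in> J ==> - a \<in> J" using J_mult[of a "-1"] by simp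
lemma J_diff: "a \<in> J ==> b \<in> J ==> a - b \<in> J" using J_add[of a "-b"] J_uminus[of b] by simp
lemma J_sum: "(\<And>i. i \<in> A ==> f i \<in> J) ==> sum f A \<in> J"
  by (induction A rule: infinite_finite_induct) (auto intro: J_0 J_add)

lemma eqv_refl [simp]: "a \<approx> a" by (simp add: eqv_def J_0)
lemma eqv_sym: "a \<approx> b ==> b \<approx> a" using J_uminus[of "a - b"] by (simp add: eqv_def)
lemma eqv_trans [trans]: "a \<approx> b ==> b \<approx> e ==> a \<approx> e"
  using J_add[of "a - b" "b - e"] by (simp add: eqv_def)
lemma eqv_eq_trans [trans]: "a \<approx> b ==> b = e ==> a \<approx> e" by simp
lemma eq_eqv_trans [trans]: "a = b ==> b \<approx> e ==> a \<approx> e" by simp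
lemma eqv_add: "a \<approx> b ==> a' \<approx> b' ==> a + a' \<approx> b + b'"
  using J_add[of "a - b" "a' - b'"] by (simp add: eqv_def algebra_simps)
lemma eqv_diff: "a \<approx> b ==> a' \<approx> b' ==> a - a' \<approx> b - b'"
  using J_diff[of "a - b" "a' - b'"] by (simp add: eqv_def algebra_simps)
lemma eqv_mult: "a \<approx> b ==> a' \<approx> b' ==> a * a' \<approx> b * b'"
  using J_add[of "(a - b) * a'" "b * (a' - b')"] J_mult2[of "a - b" a'] J_mult[of "a' - b'" b]
  by (simp add: eqv_def algebra_simps)
lemma eqv_power: "a \<approx> b ==> a ^ k \<approx> b ^ k"
  by (induction k) (auto intro: eqv_mult)
lemma eqv_sum: "(\<And>i. i \<in> A ==> f i \<approx> g i) ==> sum f A \<approx> sum g A"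
  by (induction A rule: infinite_finite_induct) (auto intro: eqv_add)
lemma eqv_0_iff: "a \<approx> 0 \<longleftrightarrow> a \<in> J" by (simp add: eqv_def)
lemma eqv_add_J: "b \<in> J ==> a + b \<approx> a" by (simp add: eqv_def)

lemma D_pos: "D > 0"
  using J_nil[of 0] one_notin_J by (cases D) auto

lemma nil_power: "aug p = 0 ==> i \<ge> D ==> p ^ i \<in> J"
  using J_mult[OF J_nil[of p], of "p ^ (i - D)"] by (simp flip: power_add)

text \<open>After scaling, \<open>a\<close> is 1 minus an element that is nilpotent modulo
  \<open>J\<close>, and the geometric series inverts it.\<close>

lemma unit_exists:
  assumes "aug a \<noteq> 0"
  shows "\<exists>b. a * b \<approx> 1"
proof -
  define z where "z = 1 - c (1 / aug a) * a"
  have z: "aug z = 0" using assms by (simp add: z_def)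
  have a: "c (1 / aug a) * a = 1 - z" by (simp add: z_def)
  have "a * (c (1 / aug a) * (\<Sum>i<D. z ^ i)) = (c (1 / aug a) * a) * (\<Sum>i<D. z ^ i)" by (simp add: ac_simps)
  also have "\<dots> = 1 - z ^ D" unfolding a by (rule one_diff_power_eq[symmetric])
  also have "\<dots> \<approx> 1" using J_uminus[OF J_nil[OF z]] by (simp add: eqv_def)
  finally show ?thesis by blast
qed

lemma J_aug:
  assumes "a \<in> J" shows "aug a = 0"
proof (rule ccontr)
  assume "aug a \<noteq> 0"
  then obtain b where "a * b \<approx> 1" using unit_exists by blast
  then have "1 \<approx> a * b" by (rule eqv_sym)
  then have "1 - a * b \<in> J" by (simp add: eqv_def)
  then have "1 - a * b + a * b \<in> J" using J_mult2[OF assms] by (rule J_add)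
  then show False using one_notin_J by simp
qed

lemma eqv_aug: "a \<approx> b ==> aug a = aug b"
  using J_aug[of "a - b"] by (simp add: eqv_def)

lemma unit_cancel:
  assumes "aug a \<noteq> 0" "a * p \<in> J" shows "p \<in> J"
proof -
  obtain b where b: "a * b \<approx> 1" using unit_exists[OF assms(1)] by blast
  have "p = 1 * p" by simp
  also have "\<dots> \<approx> (a * b) * p" by (rule eqv_mult[OF eqv_sym[OF b] eqv_refl])
  also have "\<dots> = b * (a * p)" by (simp add: ac_simps)
  also have "\<dots> \<approx> 0" unfolding eqv_0_iff by (rule J_mult[OF assms(2)])
  finally show ?thesis by (simp add: eqv_0_iff)
qed

text \<open>Series are truncated at twice the nilpotency index: if two exponents add up to at least
  \<open>2 * D\<close>, one of them is at least \<open>D\<close>, so the mixed terms that a product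
  drops lie in \<open>J\<close>.\<close>

abbreviation "K \<equiv> 2 * D"

text \<open>A product of truncated sums runs over a square, the truncated product series over a
  triangle; the terms in between lie in \<open>J\<close>.\<close>

lemma square_sum_eqv:
  assumes "\<And>i j. i + j \<ge> K ==> f i j \<in> J"
  shows "(\<Sum>i<K. \<Sum>j<K. f i j) \<approx> (\<Sum>k<K. \<Sum>i\<le>k. f i (k - i))"
proof -
  let ?T = "{(i, j). i + j < K}"
  have fin: "finite ({..<K} \<times> {..<K})" by simp
  have sub: "?T \<subseteq> {..<K} \<times> {..<K}" by auto
  have "(\<Sum>i<K. \<Sum>j<K. f i j) = (\<Sum>(i, j)\<in>{..<K} \<times> {..<K}. f i j)"
    by (rule sum.cartesian_product)
  also have "\<dots> = (\<Sum>(i, j)\<in>{..<K} \<times> {..<K} - ?T. f i j) + (\<Sum>(i, j)\<in>?T. f i j)"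
    by (rule sum.subset_diff[OF sub fin])
  also have "\<dots> \<approx> 0 + (\<Sum>(i, j)\<in>?T. f i j)"
  proof (rule eqv_add[OF _ eqv_refl])
    show "(\<Sum>(i, j)\<in>{..<K} \<times> {..<K} - ?T. f i j) \<approx> 0"
      unfolding eqv_0_iff by (rule J_sum) (auto intro: assms)
  qed
  also have "0 + (\<Sum>(i, j)\<in>?T. f i j) = (\<Sum>k<K. \<Sum>i\<le>k. f i (k - i))"
    by (simp add: sum.triangle_reindex)
  finally show ?thesis .
qed

text \<open>A formal power series evaluated at a nilpotent element, as a finite sum; identities
  between series become congruences modulo \<open>J\<close>.\<close>

definition evf :: "'k fps \<Rightarrow> 'r \<Rightarrow> 'r" where
  "evf F p = (\<Sum>i<K. c (fps_nth F i) * p ^ i)"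

lemma evf_cong: "p \<approx> q ==> evf F p \<approx> evf F q"
  unfolding evf_def by (intro eqv_sum eqv_mult eqv_refl eqv_power)

lemma aug_evf:
  assumes "aug p = 0" shows "aug (evf F p) = fps_nth F 0"
proof -
  have "aug (evf F p) = (\<Sum>i<K. fps_nth F i * 0 ^ i)" using assms by (simp add: evf_def)
  also have "\<dots> = (\<Sum>i<K. if i = 0 then fps_nth F i else 0)" by (rule sum.cong) (auto simp: power_0_left)
  also have "\<dots> = fps_nth F 0" using D_pos by simp
  finally show ?thesis .
qed

lemma evf_mult:
  assumes p: "aug p = 0"
  shows "evf (F * G) p \<approx> evf F p * evf G p"
proof -
  have "evf F p * evf G p = (\<Sum>i<K. \<Sum>j<K. c (fps_nth F i * fps_nth G j) * p ^ (i + j))"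
    unfolding evf_def sum_product by (simp add: c_simps power_add ac_simps)
  also have "\<dots> \<approx> (\<Sum>k<K. \<Sum>i\<le>k. c (fps_nth F i * fps_nth G (k - i)) * p ^ (i + (k - i)))"
    by (rule square_sum_eqv) (rule J_mult, rule nil_power[OF p], simp)
  also have "\<dots> = evf (F * G) p"
    unfolding evf_def fps_mult_nth by (simp add: c_simps sum_distrib_right atLeast0AtMost)
  finally show ?thesis by (rule eqv_sym)
qed

lemma evf_1: "evf 1 p = 1"
proof -
  have "evf 1 p = (\<Sum>i<K. if i = 0 then 1 else 0)"
    unfolding evf_def by (rule sum.cong) auto
  then show ?thesis using D_pos by simp
qed

lemma evf_power:
  assumes "aug p = 0" shows "evf (F ^ k) p \<approx> evf F p ^ k"
proof (induction k)
  case (Suc k)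
  have "evf (F ^ Suc k) p \<approx> evf F p * evf (F ^ k) p" using evf_mult[OF assms] by simp
  also have "\<dots> \<approx> evf F p * evf F p ^ k" by (rule eqv_mult[OF eqv_refl Suc])
  finally show ?case by simp
qed (simp add: evf_1)

text \<open>As \<open>G\<close> has no constant term, \<open>G ^ i\<close> starts in degree
  \<open>i\<close>, so the coefficient of degree \<open>n\<close> in the composite involves only
  \<open>i \<le> n\<close>.\<close>

lemma evf_compose:
  assumes p: "aug p = 0" and G: "fps_nth G 0 = 0"
  shows "evf (F oo G) p \<approx> evf F (evf G p)"
proof -
  have "evf F (evf G p) \<approx> (\<Sum>i<K. c (fps_nth F i) * evf (G ^ i) p)"
    unfolding evf_def[of F] by (intro eqv_sum eqv_mult eqv_refl eqv_sym[OF evf_power[OF p]])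
  also have "\<dots> = (\<Sum>i<K. \<Sum>n<K. c (fps_nth F i * fps_nth (G ^ i) n) * p ^ n)"
    unfolding evf_def sum_distrib_left by (simp add: c_simps ac_simps)
  also have "\<dots> = (\<Sum>n<K. \<Sum>i<K. c (fps_nth F i * fps_nth (G ^ i) n) * p ^ n)" by (rule sum.swap)
  also have "\<dots> = (\<Sum>n<K. \<Sum>i\<le>n. c (fps_nth F i * fps_nth (G ^ i) n) * p ^ n)"
  proof (rule sum.cong[OF refl], rule sum.mono_neutral_right)
    fix n assume n: "n \<in> {..<K}"
    show "\<forall>i\<in>{..<K} - {..n}. c (fps_nth F i * fps_nth (G ^ i) n) * p ^ n = 0"
      using startsby_zero_power_prefix[OF G] by auto
  qed auto
  also have "\<dots> = evf (F oo G) p"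
    unfolding evf_def fps_compose_nth by (simp add: c_simps sum_distrib_right atLeast0AtMost)
  finally show ?thesis by (rule eqv_sym)
qed

section \<open>Exponential and logarithm\<close>

definition E :: "'r \<Rightarrow> 'r" where "E = evf (fps_exp 1)"
text \<open>\<open>fps_ln 1\<close> is the series of ln(1 + X), so \<open>L p\<close> stands for
  ln(1 + p). This shift accounts for the arguments \<open>E p - 1\<close> and
  \<open>(1 + p) * (1 + q) - 1\<close> below.\<close>

definition L :: "'r \<Rightarrow> 'r" where "L = evf (fps_ln 1)"

lemma E_cong: "p \<approx> q ==> E p \<approx> E q" unfolding E_def by (rule evf_cong)
lemma L_cong: "p \<approx> q ==> L p \<approx> L q" unfolding L_def by (rule evf_cong)
lemma aug_E: "aug p = 0 ==> aug (E p) = 1" unfolding E_def by (simp add: aug_evf)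
lemma aug_L: "aug p = 0 ==> aug (L p) = 0" unfolding L_def by (simp add: aug_evf)

lemma E_0: "E 0 = 1"
proof -
  have "E 0 = (\<Sum>i<K. if i = 0 then 1 else 0)"
    unfolding E_def evf_def by (rule sum.cong) (auto simp: power_0_left)
  then show ?thesis using D_pos by simp
qed

lemma E_add:
  assumes p: "aug p = 0" and q: "aug q = 0"
  shows "E (p + q) \<approx> E p * E q"
proof -
  have "E p * E q = (\<Sum>i<K. \<Sum>j<K. c (1 / (fact i * fact j)) * (p ^ i * q ^ j))"
    unfolding E_def evf_def sum_product by (simp add: c_simps[symmetric] ac_simps)
  also have "\<dots> \<approx> (\<Sum>k<K. \<Sum>i\<le>k. c (1 / (fact i * fact (k - i))) * (p ^ i * q ^ (k - i)))"
  proof (rule square_sum_eqv)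
    fix i j assume "i + j \<ge> K"
    then have "i \<ge> D \<or> j \<ge> D" by auto
    then have "p ^ i * q ^ j \<in> J"
      using nil_power[OF p, of i] nil_power[OF q, of j] J_mult2 J_mult by blast
    then show "c (1 / (fact i * fact j)) * (p ^ i * q ^ j) \<in> J" by (rule J_mult)
  qed
  also have "\<dots> = E (p + q)"
    unfolding E_def evf_def
  proof (rule sum.cong[OF refl])
    fix k
    have "c (1 / (fact i * fact (k - i))) = c (1 / fact k) * of_nat (k choose i)" if "i \<le> k" for i
    proof -
      have "(1 / (fact i * fact (k - i)) :: 'k) = 1 / fact k * of_nat (k choose i)"
        using that by (simp add: binomial_fact)
      then have "c (1 / (fact i * fact (k - i))) = c (1 / fact k) * c (of_nat (k choose i))"
        by (simp only: c_simps)
      then show ?thesis by (simp add: c.hom_of_nat)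
    qed
    then show "(\<Sum>i\<le>k. c (1 / (fact i * fact (k - i))) * (p ^ i * q ^ (k - i))) = c (fps_nth (fps_exp 1) k) * (p + q) ^ k"
      by (simp add: binomial_ring sum_distrib_left ac_simps)
  qed
  finally show ?thesis by (rule eqv_sym)
qed

lemma E_L:
  assumes p: "aug p = 0"
  shows "E (L p) \<approx> 1 + p"
proof -
  have c: "fps_exp 1 oo fps_ln 1 = (1 + fps_X :: 'k fps)"
  proof -
    have "(fps_exp 1 - 1 :: 'k fps) oo fps_inv (fps_exp 1 - 1) = fps_X"
      by (rule fps_inv_right) simp_all
    moreover have "fps_ln 1 = fps_inv (fps_exp 1 - 1 :: 'k fps)" by (rule fps_ln_fps_exp_inv) simp
    ultimately have "(fps_exp 1 - 1 :: 'k fps) oo fps_ln 1 = fps_X" by simp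
    then show ?thesis by (simp add: fps_compose_sub_distrib algebra_simps)
  qed
  have "evf (1 + fps_X) p = (\<Sum>i<K. if i = 0 then 1 else if i = 1 then p else 0)"
    unfolding evf_def by (rule sum.cong) auto
  also have "\<dots> = (\<Sum>i\<in>{0::nat, 1}. if i = 0 then 1 else if i = 1 then p else 0)"
    using D_pos by (intro sum.mono_neutral_right) auto
  also have "\<dots> = 1 + p" by simp
  finally have "evf (1 + fps_X) p = 1 + p" .
  moreover have "evf (fps_exp 1 oo fps_ln 1) p \<approx> evf (fps_exp 1) (evf (fps_ln 1) p)"
    by (rule evf_compose[OF p]) simp
  ultimately show ?thesis unfolding c E_def L_def by (metis eqv_sym)
qed

text \<open>\<open>E w - 1\<close> is \<open>w\<close> times a sum with constant term 1, that is,
  \<open>w\<close> times a unit.\<close>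

lemma E_eq_1_imp:
  assumes w: "aug w = 0" and "E w \<approx> 1"
  shows "w \<in> J"
proof -
  obtain k where k: "K = Suc k" using D_pos by (cases "K") auto
  define u where "u = (\<Sum>i<k. c (1 / fact (Suc i)) * w ^ i)"
  have "E w = 1 + w * u"
    unfolding E_def evf_def k sum.lessThan_Suc_shift u_def sum_distrib_left
    by (simp add: ac_simps of_nat_Suc[of 0] del: fact_Suc of_nat_Suc)
  then have wu: "u * w \<in> J" using assms(2) by (simp add: eqv_def mult.commute)
  have k0: "k > 0" using k D_pos by (cases k) auto
  have "aug u = (\<Sum>i<k. 1 / fact (Suc i) * 0 ^ i)" using w by (simp add: u_def)
  also have "\<dots> = (\<Sum>i<k. if i = 0 then 1 else 0)" by (rule sum.cong) (auto simp: power_0_left)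
  also have "\<dots> = 1" using k0 by simp
  finally show ?thesis using unit_cancel[OF _ wu] by simp
qed

lemma E_inj:
  assumes p: "aug p = 0" and q: "aug q = 0" and eq: "E p \<approx> E q"
  shows "p \<approx> q"
proof -
  have q': "aug (- q) = 0" using q by simp
  have "E (p + - q) \<approx> E p * E (- q)" by (rule E_add[OF p q'])
  also have "\<dots> \<approx> E q * E (- q)" by (rule eqv_mult[OF eq eqv_refl])
  also have "\<dots> \<approx> E (q + - q)" by (rule eqv_sym[OF E_add[OF q q']])
  also have "\<dots> = 1" by (simp add: E_0)
  finally have "p + - q \<in> J" by (intro E_eq_1_imp) (use p q in simp_all)
  then show ?thesis by (simp add: eqv_def)
qed

lemma L_E:
  assumes p: "aug p = 0"
  shows "L (E p - 1) \<approx> p"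
proof (rule E_inj[OF _ p])
  have a: "aug (E p - 1) = 0" using aug_E[OF p] by simp
  show "aug (L (E p - 1)) = 0" by (rule aug_L[OF a])
  show "E (L (E p - 1)) \<approx> E p" using E_L[OF a] by simp
qed

text \<open>Exponentiate the sum by \<open>E_add\<close> and take the logarithm back. This law turns
  multiplication by group elements into translation.\<close>

lemma L_mult:
  assumes p: "aug p = 0" and q: "aug q = 0"
  shows "L ((1 + p) * (1 + q) - 1) \<approx> L p + L q"
proof -
  have "E (L p + L q) \<approx> E (L p) * E (L q)" by (rule E_add) (use aug_L p q in auto)
  also have "\<dots> \<approx> (1 + p) * (1 + q)" by (rule eqv_mult[OF E_L[OF p] E_L[OF q]])
  finally have "E (L p + L q) - 1 \<approx> (1 + p) * (1 + q) - 1" by (rule eqv_diff[OF _ eqv_refl])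
  then have "L ((1 + p) * (1 + q) - 1) \<approx> L (E (L p + L q) - 1)" by (rule L_cong[OF eqv_sym])
  also have "\<dots> \<approx> L p + L q" by (rule L_E) (use aug_L p q in simp)
  finally show ?thesis .
qed

end

text \<open>\<open>\<tau>\<close> identifies \<open>R / J\<close> with \<open>K\<^sup>N\<close>.\<close>

locale quot_alg =
  fixes N :: nat and c :: "'k::field_char_0 \<Rightarrow> 'r::comm_ring_1" and aug :: "'r \<Rightarrow> 'k"
    and \<tau> :: "'r \<Rightarrow> 'k vec" and D :: nat
  assumes c_hom': "comm_ring_hom c" and aug_hom': "comm_ring_hom aug" and aug_c': "aug (c k) = k"
    and \<tau>_carrier [simp]: "\<tau> r \<in> carrier_vec N"
    and \<tau>_add: "\<tau> (r + s) = \<tau> r + \<tau> s" and \<tau>_c: "\<tau> (c k * r) = k \<cdot>\<^sub>v \<tau> r"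
    and \<tau>_surj: "v \<in> carrier_vec N ==> \<exists>r. \<tau> r = v"
    and \<tau>_ideal: "\<tau> r = 0\<^sub>v N ==> \<tau> (q * r) = 0\<^sub>v N"
    and \<tau>_nil: "aug r = 0 ==> \<tau> (r ^ D) = 0\<^sub>v N" and N_pos: "N > 0"
begin

definition J :: "'r set" where "J = {r. \<tau> r = 0\<^sub>v N}"

lemma \<tau>_0: "\<tau> 0 = 0\<^sub>v N"
proof -
  interpret c: comm_ring_hom c by (rule c_hom')
  have z: "\<tau> 0 = 0 \<cdot>\<^sub>v \<tau> 0" using \<tau>_c[of 0 0] by simp
  show ?thesis by (subst z, intro eq_vecI) (simp_all add: carrier_vecD[OF \<tau>_carrier])
qed

sublocale nil_alg c aug J D
proof
  show "1 \<notin> J"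
  proof
    assume "1 \<in> J"
    then have z: "\<tau> r = 0\<^sub>v N" for r using \<tau>_ideal[of 1 r] by (simp add: J_def)
    obtain r where "\<tau> r = unit_vec N 0" using \<tau>_surj[of "unit_vec N 0"] by auto
    then have "unit_vec N 0 $ 0 = (0\<^sub>v N :: 'k vec) $ 0" using z[of r] by simp
    then show False using N_pos by simp
  qed
  interpret c: comm_ring_hom c by (rule c_hom')
  interpret aug: comm_ring_hom aug by (rule aug_hom')
  show "c 0 = 0" "c 1 = 1" "aug 0 = 0" "aug 1 = 1" by simp_all
  show "c (x + y) = c x + c y" "c (x * y) = c x * c y" for x y by (simp_all add: c.hom_add c.hom_mult)
  show "aug (x + y) = aug x + aug y" "aug (x * y) = aug x * aug y" for x y
    by (simp_all add: aug.hom_add aug.hom_mult)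
qed (auto simp: J_def \<tau>_add \<tau>_ideal \<tau>_nil \<tau>_0 aug_c')

notation eqv (infix "\<approx>" 50)

lemma eqv_iff: "r \<approx> s \<longleftrightarrow> \<tau> r = \<tau> s"
proof -
  have eq: "\<tau> r = \<tau> (r - s) + \<tau> s" by (simp flip: \<tau>_add)
  have "\<tau> (r - s) = 0\<^sub>v N \<longleftrightarrow> \<tau> r = \<tau> s"
  proof (rule iffI)
    assume "\<tau> (r - s) = 0\<^sub>v N"
    then show "\<tau> r = \<tau> s" using eq by simp
  next
    assume e: "\<tau> r = \<tau> s"
    show "\<tau> (r - s) = 0\<^sub>v N"
    proof (rule eq_vecI)
      fix i assume "i < dim_vec (0\<^sub>v N :: 'k vec)"
      then show "\<tau> (r - s) $ i = 0\<^sub>v N $ i"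
        using arg_cong[OF eq, of "\<lambda>v. v $ i"] e by (simp add: carrier_vecD[OF \<tau>_carrier])
    qed (simp add: carrier_vecD[OF \<tau>_carrier])
  qed
  then show ?thesis unfolding eqv_def by (simp add: J_def)
qed

lemma \<tau>_sum: "finite A ==> i < N ==> \<tau> (\<Sum>x\<in>A. f x) $ i = (\<Sum>x\<in>A. \<tau> (f x) $ i)"
  by (induction A rule: finite_induct) (auto simp: \<tau>_0 \<tau>_add carrier_vecD[OF \<tau>_carrier])

end

section \<open>Polynomial functions\<close>

text \<open>Lets polynomiality be established by closure rules, so that a witness polynomial is
  extracted only where one is needed, for instance for divisibility.\<close>

definition pfn :: "nat \<Rightarrow> ((nat \<Rightarrow> 'k::comm_ring_1) \<Rightarrow> 'k) \<Rightarrow> bool" where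
  "pfn N F \<longleftrightarrow> (\<exists>p. vars p \<subseteq> {..<N} \<and> (\<forall>v. F v = ev v p))"

lemma pfn_const [intro]: "pfn N (\<lambda>v. k)"
  unfolding pfn_def by (intro exI[of _ "mpoly_const k"]) simp

lemma pfn_var [intro]: "i < N ==> pfn N (\<lambda>v. v i)"
  unfolding pfn_def by (intro exI[of _ "mpoly_var i"]) simp

lemma pfn_add [intro]: "pfn N F ==> pfn N G ==> pfn N (\<lambda>v. F v + G v)"
proof -
  assume "pfn N F" "pfn N G"
  then obtain p q where "vars p \<subseteq> {..<N}" "\<forall>v. F v = ev v p" "vars q \<subseteq> {..<N}" "\<forall>v. G v = ev v q"
    unfolding pfn_def by (elim exE conjE)
  then show ?thesis unfolding pfn_def by (intro exI[of _ "p + q"]) (simp add: vars_subset_intros)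
qed

lemma pfn_mult [intro]: "pfn N F ==> pfn N G ==> pfn N (\<lambda>v. F v * G v)"
proof -
  assume "pfn N F" "pfn N G"
  then obtain p q where "vars p \<subseteq> {..<N}" "\<forall>v. F v = ev v p" "vars q \<subseteq> {..<N}" "\<forall>v. G v = ev v q"
    unfolding pfn_def by (elim exE conjE)
  then show ?thesis unfolding pfn_def by (intro exI[of _ "p * q"]) (simp add: vars_subset_intros)
qed

lemma pfn_power [intro]: "pfn N F ==> pfn N (\<lambda>v. F v ^ k)"
  by (induction k) auto

lemma pfn_sum [intro]: "(\<And>x. x \<in> A ==> pfn N (F x)) ==> pfn N (\<lambda>v. \<Sum>x\<in>A. F x v)"
  by (induction A rule: infinite_finite_induct) auto

lemma pfn_diff [intro]: "pfn N F ==> pfn N G ==> pfn N (\<lambda>v. F v - G v)"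
  using pfn_add[of N F "\<lambda>v. - 1 * G v"] pfn_mult[OF pfn_const[of N "-1"], of G] by simp

lemma pfn_compose:
  assumes "\<And>i. i \<in> vars p ==> pfn N (G i)"
  shows "pfn N (\<lambda>v. ev (\<lambda>i. G i v) p)"
proof -
  \<comment> \<open>Nothing is known about \<open>G i\<close> outside \<open>vars p\<close>; the
    default 0 there does not change the value.\<close>
  define H where "H i = (if i \<in> vars p then G i else (\<lambda>v. 0))" for i
  have H: "pfn N (H i)" for i using assms by (auto simp: H_def)
  have "pfn N (\<lambda>v. ev (\<lambda>i. H i v) q)" for q :: "'a mpoly"
  proof (induction q rule: mpoly_induct)
    case (var i)
    then show ?case using H[of i] by simp
  qed (auto)
  moreover have "(\<lambda>v. ev (\<lambda>i. H i v) p) = (\<lambda>v. ev (\<lambda>i. G i v) p)"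
    by (rule ext, rule mpoly_eval_cong) (simp add: H_def)
  ultimately show ?thesis by metis
qed

context quot_alg
begin

text \<open>Polynomial functions with values in the ring: finite sums of a polynomial function times
  a fixed element. They are closed under products, hence under truncated series, and their
  \<open>\<tau>\<close>-coordinates are polynomial functions.\<close>

inductive rpf :: "nat \<Rightarrow> ((nat \<Rightarrow> 'k) \<Rightarrow> 'r) \<Rightarrow> bool" for M where
  base: "pfn M g ==> rpf M (\<lambda>v. c (g v) * r)"
| add: "rpf M F ==> rpf M G ==> rpf M (\<lambda>v. F v + G v)"

lemma rpf_const: "rpf M (\<lambda>v. r)"
  using rpf.base[OF pfn_const[of M 1], of r] by simp

lemma rpf_mult:
  assumes "rpf M F" "rpf M G" shows "rpf M (\<lambda>v. F v * G v)"
  using assms(1)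
proof induction
  case (base g r)
  show ?case using assms(2)
  proof induction
    case (base g' r')
    have "(\<lambda>v. c (g v) * r * (c (g' v) * r')) = (\<lambda>v. c (g v * g' v) * (r * r'))"
      by (simp add: c_simps ac_simps)
    then show ?case using rpf.base[OF pfn_mult[OF \<open>pfn M g\<close> base], of "r * r'"] by simp
  next
    case (add F' G')
    show ?case using rpf.add[OF add.IH] by (simp add: distrib_left)
  qed
next
  case (add F' G')
  show ?case using rpf.add[OF add.IH] by (simp add: distrib_right)
qed

lemma rpf_power: "rpf M F ==> rpf M (\<lambda>v. F v ^ k)"
  by (induction k) (simp_all add: rpf_const rpf_mult)

lemma rpf_sum: "(\<And>x. x \<in> A ==> rpf M (F x)) ==> rpf M (\<lambda>v. \<Sum>x\<in>A. F x v)"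
  by (induction A rule: infinite_finite_induct) (simp_all add: rpf_const rpf.add)

lemma rpf_evf: "rpf M F ==> rpf M (\<lambda>v. evf f (F v))"
  unfolding evf_def by (intro rpf_sum rpf_mult rpf_const rpf_power)

lemma pfn_\<tau>:
  assumes "rpf M F" "i < N" shows "pfn M (\<lambda>v. \<tau> (F v) $ i)"
  using assms(1)
proof induction
  case (base g r)
  have "(\<lambda>v. \<tau> (c (g v) * r) $ i) = (\<lambda>v. g v * \<tau> r $ i)"
    using assms(2) by (simp add: \<tau>_c carrier_vecD[OF \<tau>_carrier])
  then show ?case using pfn_mult[OF base pfn_const] by simp
next
  case (add F G)
  have "(\<lambda>v. \<tau> (F v + G v) $ i) = (\<lambda>v. \<tau> (F v) $ i + \<tau> (G v) $ i)"
    using assms(2) by (simp add: \<tau>_add carrier_vecD[OF \<tau>_carrier])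
  then show ?case using pfn_add[OF add.IH] by simp
qed

end

section \<open>The equation of the hypersurface of an H-pair\<close>

lemma tdeg_var [simp]: "tdeg (mpoly_var i :: 'k::field mpoly) = 1"
proof -
  have "whomog (\<lambda>_. 1) 1 (mpoly_var i :: 'k mpoly)" using whomog_var[of "\<lambda>_. 1" i] by simp
  moreover have "(mpoly_var i :: 'k mpoly) \<noteq> 0" by (metis vars_var vars_0 insert_not_empty)
  ultimately show ?thesis unfolding tdeg_def whomog_iff_grade by (simp add: degree_monom_eq)
qed

lemma mpoly_var_nonzero [simp]: "(mpoly_var i :: 'k::field mpoly) \<noteq> 0"
  by (metis vars_var vars_0 insert_not_empty)

lemma irreducible_mpoly_var: "irreducible (mpoly_var i :: 'k::field mpoly)"
  unfolding irreducible_def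
proof (intro conjI allI impI)
  show "\<not> (mpoly_var i :: 'k mpoly) dvd 1" by (simp add: is_unit_mpoly_iff)
  fix a b :: "'k mpoly" assume ab: "mpoly_var i = a * b"
  then have nz: "a \<noteq> 0" "b \<noteq> 0" by (metis mpoly_var_nonzero mult_eq_0_iff)+
  then have "tdeg a + tdeg b = 1" using tdeg_mult[OF nz] ab tdeg_var[where 'k='k, of i] by simp
  then show "a dvd 1 \<or> b dvd 1" using nz by (auto simp: is_unit_mpoly_iff)
qed simp

text \<open>The constant term of \<open>f\<close> as a polynomial in variable \<open>i\<close> is
  the restriction of \<open>f\<close> to the coordinate hyperplane.\<close>

lemma mpoly_var_dvd:
  fixes f :: "'k::field_char_0 mpoly"
  assumes "\<And>v. v i = 0 ==> ev v f = 0"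
  shows "mpoly_var i dvd f"
proof -
  have "ev v (coeff (up i f) 0) = 0" for v
  proof -
    have "ev (v(i := 0)) f = coeff (\<Sum>k\<le>degree (up i f). monom (ev v (coeff (up i f) k)) k) 0"
      unfolding ev_up poly_0_coeff_0 ..
    then show ?thesis using assms[of "v(i := 0)"] unfolding coeff_sum_monom_up by simp
  qed
  then have "coeff (up i f) 0 = 0" by (rule mpoly_eq_0_if_ev)
  then obtain q where q: "up i f = pCons 0 q" by (metis pCons_cases coeff_pCons_0)
  have "f = mpoly_var i * poly q (mpoly_var i)" using poly_up[of i f] unfolding q by simp
  then show ?thesis by (rule dvdI)
qed

text \<open>Passes from the affine chart back to homogeneous coordinates; the exponent
  \<open>e\<close> is merely some sufficient one.\<close>

lemma clear_denominators:
  fixes q :: "'k::field_char_0 mpoly"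
  shows "\<exists>e Q. \<forall>v. v 0 \<noteq> 0 --> v 0 ^ e * ev (\<lambda>j. v j / v 0) q = ev v Q"
proof (induction q rule: mpoly_induct)
  case (const k)
  show ?case by (intro exI[of _ 0] exI[of _ "mpoly_const k"]) simp
next
  case (var i)
  show ?case by (intro exI[of _ 1] exI[of _ "mpoly_var i"]) simp
next
  case (add f g)
  from add(1) obtain e Q where f: "\<And>v. v 0 \<noteq> 0 ==> v 0 ^ e * ev (\<lambda>j. v j / v 0) f = ev v Q" by blast
  from add(2) obtain e' Q' where g: "\<And>v. v 0 \<noteq> 0 ==> v 0 ^ e' * ev (\<lambda>j. v j / v 0) g = ev v Q'" by blast
  have "v 0 ^ (e + e') * ev (\<lambda>j. v j / v 0) (f + g) = ev v (mpoly_var 0 ^ e' * Q + mpoly_var 0 ^ e * Q')"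
    if "v 0 \<noteq> 0" for v
    unfolding ev_add ev_mult ev_power using f[of v, OF that, symmetric] g[of v, OF that, symmetric] that by (simp add: power_add algebra_simps)
  then show ?case by blast
next
  case (mult f g)
  from mult(1) obtain e Q where f: "\<And>v. v 0 \<noteq> 0 ==> v 0 ^ e * ev (\<lambda>j. v j / v 0) f = ev v Q" by blast
  from mult(2) obtain e' Q' where g: "\<And>v. v 0 \<noteq> 0 ==> v 0 ^ e' * ev (\<lambda>j. v j / v 0) g = ev v Q'" by blast
  have "v 0 ^ (e + e') * ev (\<lambda>j. v j / v 0) (f * g) = ev v (Q * Q')" if "v 0 \<noteq> 0" for v
    unfolding ev_mult using f[of v, OF that, symmetric] g[of v, OF that, symmetric] that by (simp add: power_add algebra_simps)
  then show ?case by blast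
qed

lemma mpoly_eqI_nz:
  fixes f g :: "'k::field_char_0 mpoly"
  assumes "\<And>v. v 0 \<noteq> 0 ==> ev v f = ev v g"
  shows "f = g"
proof -
  have "mpoly_var 0 * f = mpoly_var 0 * g"
  proof (rule mpoly_eqI)
    fix v :: "nat \<Rightarrow> 'k"
    show "ev v (mpoly_var 0 * f) = ev v (mpoly_var 0 * g)" using assms[of v] by (cases "v 0 = 0") simp_all
  qed
  then show ?thesis by simp
qed

lemma homog_scale:
  fixes f :: "'k::field mpoly"
  assumes "homog 0 n d f"
  shows "ev (\<lambda>i. t * v i) f = t ^ d * ev v f"
proof -
  have "ev (\<lambda>i. t * v i) f = ev (\<lambda>i. t ^ ind 0 n i * v i) f"
    by (rule mpoly_eval_cong) (use vars_homog[OF assms] in \<open>auto simp: ind_def\<close>)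
  then show ?thesis using assms by (simp add: ev_scale homog_iff)
qed

text \<open>Vector 0 of the basis is the unit and the others lie in the maximal ideal, so coordinate
  0 is the augmentation. Vectors 1 to n - 1 are meant to span the Lie algebra \<open>U\<close>; then
  the last coordinate \<pi> is the functional vanishing on 1 and on \<open>U\<close>.\<close>

locale norm_alg = quot_alg N c aug \<tau> D
  for N :: nat and c :: "'k::field_char_0 \<Rightarrow> 'r::comm_ring_1" and aug :: "'r \<Rightarrow> 'k"
    and \<tau> :: "'r \<Rightarrow> 'k vec" and D :: nat +
  fixes n :: nat and b :: "nat \<Rightarrow> 'r"
  assumes N_eq: "N = n + 1" and n_pos: "n \<ge> 1"
    and \<tau>_b: "j < N ==> \<tau> (b j) = unit_vec N j" and b_0: "b 0 = 1"
    and aug_b: "0 < j ==> j < N ==> aug (b j) = 0"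
begin

notation eqv (infix "\<approx>" 50)

definition \<pi> :: "'r \<Rightarrow> 'k" where "\<pi> r = \<tau> r $ n"
definition z :: "(nat \<Rightarrow> 'k) \<Rightarrow> 'r" where "z v = (\<Sum>j\<in>{1..n}. c (v j) * b j)"
definition s :: "nat \<Rightarrow> 'k" where "s i = fps_nth (fps_ln 1) i"
text \<open>The expression \<open>v 0 ^ d * \<pi> (L (z / v 0))\<close> with denominators cleared
  term by term, which makes it a polynomial. By \<open>G_eq\<close> the two agree as soon as \<pi>
  kills all powers above \<open>d\<close>.\<close>

definition G :: "nat \<Rightarrow> (nat \<Rightarrow> 'k) \<Rightarrow> 'k" where
  "G d v = (\<Sum>i\<in>{1..d}. s i * v 0 ^ (d - i) * \<pi> (z v ^ i))"

lemma n_less: "n < N" by (simp add: N_eq)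

lemma dim_\<tau> [simp]: "dim_vec (\<tau> r) = N" by (rule carrier_vecD[OF \<tau>_carrier])

lemma \<pi>_add: "\<pi> (p + q) = \<pi> p + \<pi> q" using n_less by (simp add: \<pi>_def \<tau>_add)
lemma \<pi>_c: "\<pi> (c k * p) = k * \<pi> p" using n_less by (simp add: \<pi>_def \<tau>_c)
lemma \<pi>_sum: "finite A ==> \<pi> (\<Sum>x\<in>A. f x) = (\<Sum>x\<in>A. \<pi> (f x))"
  unfolding \<pi>_def by (rule \<tau>_sum[OF _ n_less])
lemma \<pi>_J: "p \<in> J ==> \<pi> p = 0" using n_less by (simp add: \<pi>_def J_def)
lemma \<pi>_eqv: "p \<approx> q ==> \<pi> p = \<pi> q" by (simp add: \<pi>_def eqv_iff)

lemma s_0 [simp]: "s 0 = 0" by (simp add: s_def)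
lemma s_nz: "i > 0 ==> s i \<noteq> 0" by (simp add: s_def fps_ln_nth)

lemma \<pi>_L: "\<pi> (L p) = (\<Sum>i<K. s i * \<pi> (p ^ i))"
  unfolding L_def evf_def by (simp add: \<pi>_sum \<pi>_c s_def)

lemma \<tau>_z:
  assumes "i < N" shows "\<tau> (z v) $ i = (if i = 0 then 0 else v i)"
proof -
  have "\<tau> (z v) $ i = (\<Sum>j\<in>{1..n}. \<tau> (c (v j) * b j) $ i)"
    unfolding z_def by (rule \<tau>_sum[OF _ assms]) simp
  also have "\<dots> = (\<Sum>j\<in>{1..n}. if j = i then v i else 0)"
    by (rule sum.cong) (use assms in \<open>auto simp: \<tau>_c \<tau>_b N_eq\<close>)
  also have "\<dots> = (if i = 0 then 0 else v i)" using assms by (auto simp: N_eq)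
  finally show ?thesis .
qed

lemma aug_z [simp]: "aug (z v) = 0"
  unfolding z_def aug_simps by (rule sum.neutral) (simp add: aug_b N_eq)

lemma coords: "r \<approx> c (\<tau> r $ 0) + z (\<lambda>j. \<tau> r $ j)"
  unfolding eqv_iff
proof (rule eq_vecI)
  fix i assume "i < dim_vec (\<tau> (c (\<tau> r $ 0) + z (\<lambda>j. \<tau> r $ j)))"
  then have i: "i < N" by simp
  have "\<tau> (c (\<tau> r $ 0)) = \<tau> (c (\<tau> r $ 0) * b 0)" by (simp add: b_0)
  also have "\<dots> = \<tau> r $ 0 \<cdot>\<^sub>v unit_vec N 0" using N_pos by (simp add: \<tau>_c \<tau>_b)
  finally show "\<tau> r $ i = \<tau> (c (\<tau> r $ 0) + z (\<lambda>j. \<tau> r $ j)) $ i"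
    using i by (auto simp: \<tau>_add \<tau>_z)
qed simp

lemma aug_\<tau>: "aug r = \<tau> r $ 0"
  using eqv_aug[OF coords[of r]] by simp

lemma z_coords: "aug r = 0 ==> z (\<lambda>j. \<tau> r $ j) \<approx> r"
  using eqv_sym[OF coords[of r]] by (simp add: aug_\<tau>)

lemma z_scale: "z (\<lambda>j. t * v j) = c t * z v"
  unfolding z_def sum_distrib_left by (rule sum.cong) (simp_all add: c_simps ac_simps)

lemma z_cong: "(\<And>j. 1 \<le> j ==> j \<le> n ==> v j = w j) ==> z v = z w"
  unfolding z_def by (rule sum.cong) auto

lemma rpf_z: "rpf N z"
proof -
  have "rpf N (\<lambda>v. \<Sum>j\<in>{1..n}. c (v j) * b j)"
    by (rule rpf_sum, rule rpf.base, rule pfn_var) (simp add: N_eq)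
  then show ?thesis unfolding z_def[abs_def] .
qed

lemma pfn_\<pi>_z: "pfn N (\<lambda>v. \<pi> (z v ^ i))"
  unfolding \<pi>_def by (rule pfn_\<tau>[OF rpf_power[OF rpf_z] n_less])

lemma pfn_G: "pfn N (G d)"
proof -
  have "pfn N (\<lambda>v. \<Sum>i\<in>{1..d}. s i * v 0 ^ (d - i) * \<pi> (z v ^ i))"
    by (intro pfn_sum pfn_mult pfn_const pfn_power pfn_var pfn_\<pi>_z N_pos)
  then show ?thesis unfolding G_def[abs_def] .
qed

lemma G_scale: "G d (\<lambda>j. t * v j) = t ^ d * G d v"
  unfolding G_def sum_distrib_left
proof (rule sum.cong[OF refl])
  fix i assume "i \<in> {1..d}"
  then have "t ^ d = t ^ (d - i) * t ^ i" by (simp flip: power_add)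
  moreover have "\<pi> (z (\<lambda>j. t * v j) ^ i) = t ^ i * \<pi> (z v ^ i)"
    unfolding z_scale power_mult_distrib c_simps(3)[symmetric] by (rule \<pi>_c)
  ultimately show "s i * (t * v 0) ^ (d - i) * \<pi> (z (\<lambda>j. t * v j) ^ i) =
      t ^ d * (s i * v 0 ^ (d - i) * \<pi> (z v ^ i))"
    by (simp add: power_mult_distrib ac_simps)
qed

lemma G_eq:
  assumes hi: "\<And>w i. aug w = 0 ==> i > d ==> \<pi> (w ^ i) = 0" and v: "v 0 \<noteq> 0"
  shows "G d v = v 0 ^ d * \<pi> (L (z (\<lambda>j. v j / v 0)))"
proof -
  let ?u = "\<lambda>j. v j / v 0"
  have v_eq: "v = (\<lambda>j. v 0 * ?u j)" using v by (simp add: fun_eq_iff)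
  have zero: "s i * \<pi> (z ?u ^ i) = 0" if "i > d \<or> i \<ge> K \<or> i = 0" for i
  proof -
    have "\<pi> (z ?u ^ i) = 0" if "i \<ge> K" using nil_power[of "z ?u" i] that by (simp add: \<pi>_J)
    then show ?thesis using hi[of "z ?u" i] that by auto
  qed
  have "\<pi> (L (z ?u)) = (\<Sum>i\<in>{1..d}. s i * \<pi> (z ?u ^ i))"
  proof -
    have "(\<Sum>i<K. s i * \<pi> (z ?u ^ i)) = (\<Sum>i\<in>{..<K} \<union> {1..d}. s i * \<pi> (z ?u ^ i))"
      by (rule sum.mono_neutral_left) (use zero in auto)
    also have "\<dots> = (\<Sum>i\<in>{1..d}. s i * \<pi> (z ?u ^ i))"
    proof (rule sum.mono_neutral_right)
      show "\<forall>i\<in>{..<K} \<union> {1..d} - {1..d}. s i * \<pi> (z ?u ^ i) = 0"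
      proof
        fix i assume "i \<in> {..<K} \<union> {1..d} - {1..d}"
        then have "i > d \<or> i \<ge> K \<or> i = 0" by auto
        then show "s i * \<pi> (z ?u ^ i) = 0" by (rule zero)
      qed
    qed auto
    finally show ?thesis unfolding \<pi>_L .
  qed
  also have "\<dots> = G d ?u" unfolding G_def using v by simp
  finally have "v 0 ^ d * \<pi> (L (z ?u)) = v 0 ^ d * G d ?u" by simp
  also have "\<dots> = G d (\<lambda>j. v 0 * ?u j)" by (rule G_scale[symmetric])
  finally show ?thesis unfolding v_eq[symmetric] by simp
qed

lemma max_power_exists:
  "\<exists>d>0. (\<exists>w. aug w = 0 \<and> \<pi> (w ^ d) \<noteq> 0) \<and> (\<forall>w i. aug w = 0 --> i > d --> \<pi> (w ^ i) = 0)"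
proof -
  define P where "P d \<longleftrightarrow> (\<exists>w. aug w = 0 \<and> \<pi> (w ^ d) \<noteq> 0)" for d
  have P1: "P 1"
    unfolding P_def by (rule exI[of _ "b n"]) (use n_pos aug_b \<tau>_b in \<open>auto simp: \<pi>_def N_eq\<close>)
  have bd: "d \<le> D" if d: "P d" for d
  proof (rule ccontr)
    assume "\<not> d \<le> D"
    from d obtain w where w: "aug w = 0" "\<pi> (w ^ d) \<noteq> 0" unfolding P_def by blast
    then show False using \<pi>_J[OF nil_power[OF w(1), of d]] \<open>\<not> d \<le> D\<close> by simp
  qed
  define d where "d = Greatest P"
  have d: "P d" unfolding d_def by (rule GreatestI_nat[where P = P, OF P1 bd])
  have "\<pi> (w ^ i) = 0" if wi: "aug w = 0" "i > d" for w i
  proof (rule ccontr)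
    assume "\<pi> (w ^ i) \<noteq> 0"
    then have "P i" using wi(1) unfolding P_def by blast
    then have "i \<le> d" unfolding d_def by (rule Greatest_le_nat[where P = P]) (rule bd)
    then show False using wi by simp
  qed
  moreover have "d \<ge> 1" unfolding d_def by (rule Greatest_le_nat[where P = P, OF P1 bd])
  ultimately show ?thesis using d unfolding P_def by (intro exI[of _ d]) simp
qed

text \<open>In logarithmic coordinates the orbit is the hyperplane \<open>a n = 0\<close>, so
  \<open>f\<close> composed with \<open>E\<close> is divisible by that coordinate. Going back
  through \<open>L\<close> and homogenizing, a power of variable 0 times \<open>f\<close> is a
  multiple of \<open>G d0\<close>. That variable does not divide \<open>G d0\<close>, so
  \<open>f\<close> itself is a multiple, and irreducibility leaves only a constant factor.\<close>

lemma equation: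
  assumes f: "irreducible f" "homog 0 n d f"
    and van: "\<And>a. a n = 0 ==> ev (\<lambda>j. \<tau> (E (z a)) $ j) f = 0"
  shows "\<exists>\<kappa>. \<kappa> \<noteq> 0 \<and> (\<forall>v. ev v f = \<kappa> * G d v) \<and> (\<forall>w i. aug w = 0 --> i > d --> \<pi> (w ^ i) = 0) \<and>
    (\<exists>w. aug w = 0 \<and> \<pi> (w ^ d) \<noteq> 0)"
proof -
  obtain d0 where d0: "d0 > 0" and lo: "\<exists>w. aug w = 0 \<and> \<pi> (w ^ d0) \<noteq> 0"
    and hi0: "\<forall>w i. aug w = 0 --> i > d0 --> \<pi> (w ^ i) = 0"
    using max_power_exists by blast
  have hi: "\<pi> (w ^ i) = 0" if "aug w = 0" "i > d0" for w i using hi0 that by simp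
  obtain g where g: "vars g \<subseteq> {..<N}" "\<And>v. ev v g = G d0 v"
    using pfn_G[of d0] unfolding pfn_def by metis
  have vf: "vars f \<subseteq> {..<N}" using vars_homog[OF f(2)] by (simp add: N_eq)
  have "pfn N (\<lambda>a. ev (\<lambda>j. \<tau> (E (z a)) $ j) f)"
  proof (rule pfn_compose)
    fix j assume "j \<in> vars f"
    then have j: "j < N" using vf by auto
    show "pfn N (\<lambda>a. \<tau> (E (z a)) $ j)" unfolding E_def by (rule pfn_\<tau>[OF rpf_evf[OF rpf_z] j])
  qed
  then obtain \<Phi> where \<Phi>: "vars \<Phi> \<subseteq> {..<N}" "\<And>a. ev (\<lambda>j. \<tau> (E (z a)) $ j) f = ev a \<Phi>"
    unfolding pfn_def by metis
  have "mpoly_var n dvd \<Phi>" by (rule mpoly_var_dvd) (use van \<Phi>(2) in simp)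
  then obtain Q where Q: "\<Phi> = mpoly_var n * Q" by (elim dvdE)
  have vQ: "vars Q \<subseteq> {..<N}"
  proof (cases "Q = 0")
    case False
    then have "vars Q \<subseteq> vars \<Phi>" unfolding Q by (subst vars_mult_eq) auto
    then show ?thesis using \<Phi>(1) by (rule order.trans)
  qed simp
  have "pfn N (\<lambda>u. ev (\<lambda>j. \<tau> (L (z u)) $ j) Q)"
  proof (rule pfn_compose)
    fix j assume "j \<in> vars Q"
    then have j: "j < N" using vQ by auto
    show "pfn N (\<lambda>u. \<tau> (L (z u)) $ j)" unfolding L_def by (rule pfn_\<tau>[OF rpf_evf[OF rpf_z] j])
  qed
  then obtain q where q: "\<And>u. ev (\<lambda>j. \<tau> (L (z u)) $ j) Q = ev u q"
    unfolding pfn_def by metis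
  have fu: "ev u f = \<pi> (L (z u)) * ev u q" if u: "u 0 = 1" for u
  proof -
    define y where "y = (\<lambda>j. \<tau> (L (z u)) $ j)"
    have "z y \<approx> L (z u)" unfolding y_def by (rule z_coords) (simp add: aug_L)
    then have "E (z y) \<approx> E (L (z u))" by (rule E_cong)
    also have "\<dots> \<approx> 1 + z u" by (rule E_L) simp
    finally have e: "\<tau> (E (z y)) = \<tau> (1 + z u)" by (simp add: eqv_iff)
    have t: "\<tau> (E (z y)) $ j = u j" if "j < N" for j
      unfolding e using that u N_pos \<tau>_b[of 0] by (simp add: \<tau>_add \<tau>_z b_0)
    have "ev u f = ev (\<lambda>j. \<tau> (E (z y)) $ j) f"
      by (rule mpoly_eval_cong) (use vf t in auto)
    also have "\<dots> = y n * ev y Q" unfolding \<Phi>(2) Q by simp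
    also have "ev y Q = ev u q" unfolding y_def by (rule q)
    finally show ?thesis unfolding y_def \<pi>_def .
  qed
  obtain e Q' where Q': "\<And>v. v 0 \<noteq> 0 ==> v 0 ^ e * ev (\<lambda>j. v j / v 0) q = ev v Q'"
    using clear_denominators[of q] by metis
  have "mpoly_var 0 ^ (d0 + e) * f = g * (mpoly_var 0 ^ d * Q')"
  proof (rule mpoly_eqI_nz)
    fix v :: "nat \<Rightarrow> 'k" assume v: "v 0 \<noteq> 0"
    let ?u = "\<lambda>j. v j / v 0"
    have v_eq: "v = (\<lambda>j. v 0 * ?u j)" using v by (simp add: fun_eq_iff)
    have "ev v f = v 0 ^ d * ev ?u f" by (subst v_eq) (rule homog_scale[OF f(2)])
    also have "ev ?u f = \<pi> (L (z ?u)) * ev ?u q" by (rule fu) (use v in simp)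
    finally have "v 0 ^ (d0 + e) * ev v f = (v 0 ^ d0 * \<pi> (L (z ?u))) * (v 0 ^ d * (v 0 ^ e * ev ?u q))"
      by (simp add: power_add ac_simps)
    also have "\<dots> = G d0 v * (v 0 ^ d * ev v Q')"
      using G_eq[of d0 v, OF hi v] Q'[of v, OF v] by simp
    finally show "ev v (mpoly_var 0 ^ (d0 + e) * f) = ev v (g * (mpoly_var 0 ^ d * Q'))"
      by (simp add: g(2))
  qed
  \<comment> \<open>At \<open>v 0 = 0\<close> only the summand \<open>i = d0\<close> of
    \<open>G\<close> survives, and it is nonzero at the coordinates of a \<open>w\<close> with
    nonzero \<open>\<pi> (w ^ d0)\<close>.\<close>
  moreover have n0: "\<not> mpoly_var 0 dvd g"
  proof
    assume "mpoly_var 0 dvd g"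
    then obtain h where h: "g = mpoly_var 0 * h" by (elim dvdE)
    obtain w where w: "aug w = 0" "\<pi> (w ^ d0) \<noteq> 0" using lo by blast
    define v where "v = (\<lambda>j. \<tau> w $ j)"
    have v0: "v 0 = 0" using w(1) by (simp add: v_def aug_\<tau>)
    have zw: "z v \<approx> w" unfolding v_def by (rule z_coords[OF w(1)])
    have "G d0 v = (\<Sum>i\<in>{1..d0}. if i = d0 then s d0 * \<pi> (w ^ d0) else 0)"
      unfolding G_def
    proof (rule sum.cong[OF refl])
      fix i assume "i \<in> {1..d0}"
      moreover have "\<pi> (z v ^ i) = \<pi> (w ^ i)" by (rule \<pi>_eqv[OF eqv_power[OF zw]])
      ultimately show "s i * v 0 ^ (d0 - i) * \<pi> (z v ^ i) = (if i = d0 then s d0 * \<pi> (w ^ d0) else 0)"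
        using v0 by auto
    qed
    also have "\<dots> = s d0 * \<pi> (w ^ d0)" using d0 by simp
    finally have "ev v g \<noteq> 0" using w(2) s_nz[OF d0] by (simp add: g(2))
    then show False unfolding h by (simp add: v0)
  qed
  moreover have "\<exists>R. f = g * R" if "mpoly_var 0 ^ A * f = g * R" for A R
    using that
  proof (induction A arbitrary: R)
    case (Suc A)
    have "mpoly_var 0 dvd g * R" using Suc.prems by (metis dvd_triv_left mult.assoc power_Suc)
    then have "mpoly_var 0 dvd R" using irreducible_dvd_mult[OF irreducible_mpoly_var] n0 by blast
    then obtain R' where "R = mpoly_var 0 * R'" by (elim dvdE)
    then have "mpoly_var 0 * (mpoly_var 0 ^ A * f) = mpoly_var 0 * (g * R')"
      using Suc.prems by (simp add: ac_simps)
    then have "mpoly_var 0 ^ A * f = g * R'" by simp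
    then show ?case by (rule Suc.IH)
  qed auto
  ultimately obtain R where R: "f = g * R" by blast
  have "\<not> g dvd 1"
  proof
    assume "g dvd 1"
    then obtain k where k: "k \<noteq> 0" "g = mpoly_const k" by (rule is_unit_mpolyE)
    have "ev (\<lambda>_. 0) g = 0"
    proof -
      have "(0 :: 'k) ^ d0 = 0" using d0 by simp
      then show ?thesis unfolding g(2) using G_scale[of d0 0 "\<lambda>_. 0"] by (simp only: mult_zero_left)
    qed
    then show False using k by simp
  qed
  then have "R dvd 1" using irreducibleD[OF f(1) R] by blast
  then obtain \<kappa> where \<kappa>: "\<kappa> \<noteq> 0" "R = mpoly_const \<kappa>" by (rule is_unit_mpolyE)
  have fG: "ev v f = \<kappa> * G d0 v" for v unfolding R \<kappa>(2) by (simp add: g(2))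
  have "f \<noteq> 0" using f by auto
  then obtain v where v: "ev v f \<noteq> 0" using mpoly_eq_0_if_ev by blast
  \<comment> \<open>Scaling by 2 compares the degree of the form with the largest exponent
    \<open>d0\<close>.\<close>
  have "2 ^ d * ev v f = ev (\<lambda>j. 2 * v j) f" by (rule homog_scale[OF f(2), symmetric])
  also have "\<dots> = 2 ^ d0 * ev v f" unfolding fG G_scale by simp
  finally have "(2 :: 'k) ^ d = 2 ^ d0" using v by simp
  then have "(of_nat (2 ^ d) :: 'k) = of_nat (2 ^ d0)" by simp
  then have "(2::nat) ^ d = 2 ^ d0" unfolding of_nat_eq_iff .
  then have "d = d0" by simp
  then show ?thesis using \<kappa>(1) fG hi0 lo by blast
qed

text \<open>If \<open>w\<close> is orthogonal to everything, adding a multiple of \<open>w\<close>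
  multiplies \<open>1 + z\<close> by some \<open>1 + p\<close> with \<open>p\<close> divisible by
  \<open>w\<close>. The logarithm becomes a sum and \<pi> kills ln(1 + p), so \<open>f\<close> is
  invariant under translation along \<open>w\<close>, against non-degeneracy.\<close>

lemma nondegenerate_imp:
  assumes fG: "\<And>v. ev v f = \<kappa> * G d v" and vf: "vars f \<subseteq> {..<N}"
    and hi: "\<And>w i. aug w = 0 ==> i > d ==> \<pi> (w ^ i) = 0"
    and nd: "\<And>w. w \<in> carrier_vec N ==> w \<noteq> 0\<^sub>v N ==> \<exists>v t. ev (\<lambda>j. v j + t * w $ j) f \<noteq> ev v f"
    and w: "aug w = 0" "\<And>r. \<pi> (w * r) = 0"
  shows "w \<in> J"
proof (rule ccontr)
  assume "w \<notin> J"
  then have "\<tau> w \<noteq> 0\<^sub>v N" by (simp add: J_def)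
  then obtain v0 t where neq: "ev (\<lambda>j. v0 j + t * \<tau> w $ j) f \<noteq> ev v0 f"
    using nd[OF \<tau>_carrier, of w] by blast
  have key: "ev (\<lambda>j. v j + t * \<tau> w $ j) f = ev v f" if v: "v 0 \<noteq> 0" for v
  proof -
    define v' where "v' = (\<lambda>j. v j + t * \<tau> w $ j)"
    have v'0: "v' 0 = v 0" using w(1) by (simp add: v'_def aug_\<tau>)
    define u where "u = (\<lambda>j. v j / v 0)"
    define k where "k = c (t / v 0)"
    have "z (\<lambda>j. v' j / v' 0) = z u + k * z (\<lambda>j. \<tau> w $ j)"
      unfolding z_def sum_distrib_left sum.distrib[symmetric]
    proof (rule sum.cong[OF refl])
      fix j
      have "v' j / v' 0 = u j + t / v 0 * \<tau> w $ j"
        unfolding v'0 by (simp add: v'_def u_def add_divide_distrib)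
      then show "c (v' j / v' 0) * b j = c (u j) * b j + k * (c (\<tau> w $ j) * b j)"
        unfolding k_def by (simp only: c_simps distrib_right mult.assoc)
    qed
    also have "\<dots> \<approx> z u + k * w" by (intro eqv_add eqv_mult eqv_refl z_coords w(1))
    finally have z': "z (\<lambda>j. v' j / v' 0) \<approx> z u + k * w" .
    obtain e where e: "(1 + z u) * e \<approx> 1" using unit_exists[of "1 + z u"] by auto
    \<comment> \<open>As \<open>e\<close> inverts \<open>1 + z u\<close>, this \<open>p\<close>
      solves \<open>(1 + z u) * (1 + p) = 1 + z u + k * w\<close> modulo \<open>J\<close>.\<close>
    define p where "p = w * (k * e)"
    have p: "aug p = 0" using w(1) by (simp add: p_def)
    have "(1 + z u) * (1 + p) - 1 = z u + (k * w) * ((1 + z u) * e)"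
      by (simp add: p_def algebra_simps)
    also have "\<dots> \<approx> z u + (k * w) * 1" by (intro eqv_add eqv_mult eqv_refl e)
    finally have "z u + k * w \<approx> (1 + z u) * (1 + p) - 1" unfolding mult_1_right by (rule eqv_sym)
    with z' have "z (\<lambda>j. v' j / v' 0) \<approx> (1 + z u) * (1 + p) - 1" by (rule eqv_trans)
    then have "L (z (\<lambda>j. v' j / v' 0)) \<approx> L ((1 + z u) * (1 + p) - 1)" by (rule L_cong)
    also have "\<dots> \<approx> L (z u) + L p" by (rule L_mult) (simp_all add: p)
    finally have "\<pi> (L (z (\<lambda>j. v' j / v' 0))) = \<pi> (L (z u)) + \<pi> (L p)" by (simp add: \<pi>_eqv \<pi>_add)
    moreover have "\<pi> (L p) = 0"
      unfolding \<pi>_L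
    proof (rule sum.neutral, rule ballI)
      fix i
      show "s i * \<pi> (p ^ i) = 0"
      proof (cases i)
        case (Suc j)
        have "p ^ i = w * (k * e * p ^ j)" unfolding Suc by (simp add: p_def ac_simps)
        then show ?thesis using w(2) by simp
      qed simp
    qed
    moreover have "v' 0 \<noteq> 0" using v v'0 by simp
    note G_eq[of d v', OF hi this] G_eq[of d v, OF hi v]
    ultimately have "G d v' = G d v" unfolding u_def v'0 by simp
    then show ?thesis unfolding fG v'_def by simp
  qed
  have "pfn N (\<lambda>v. ev (\<lambda>j. v j + t * \<tau> w $ j) f)"
  proof (rule pfn_compose)
    fix j assume "j \<in> vars f"
    then have "j < N" using vf by auto
    then show "pfn N (\<lambda>v. v j + t * \<tau> w $ j)" by (intro pfn_add pfn_const pfn_var)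
  qed
  then obtain h where h: "\<And>v. ev (\<lambda>j. v j + t * \<tau> w $ j) f = ev v h" unfolding pfn_def by metis
  have "h = f" by (rule mpoly_eqI_nz) (use key h in simp)
  then show False using neq h[of v0] by simp
qed

end

section \<open>Structure of the algebra\<close>

lemma inverse_mat_exists:
  fixes B :: "'k::field mat"
  assumes B: "B \<in> carrier_mat N N" and ker: "\<And>v. v \<in> carrier_vec N ==> B *\<^sub>v v = 0\<^sub>v N ==> v = 0\<^sub>v N"
  shows "\<exists>B'\<in>carrier_mat N N. B * B' = 1\<^sub>m N \<and> B' * B = 1\<^sub>m N"
proof -
  have "det B \<noteq> 0" using ker det_0_iff_vec_prod_zero[OF B] by blast
  then have "B \<in> Units (ring_mat TYPE('k) N ())" by (rule det_non_zero_imp_unit[OF B])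
  then show ?thesis unfolding Units_def by (auto simp: ring_mat_simps)
qed

lemma annihilator_exists:
  fixes V :: "nat \<Rightarrow> 'k::field vec"
  assumes V: "\<And>i. i < k ==> V i \<in> carrier_vec N" and k: "k < N"
  shows "\<exists>l\<in>carrier_vec N. l \<noteq> 0\<^sub>v N \<and> (\<forall>i<k. (\<Sum>j<N. V i $ j * l $ j) = 0)"
proof -
  \<comment> \<open>The conditions, fewer than \<open>N\<close>, are padded with zero rows to a
    square matrix, which row \<open>k\<close> makes singular.\<close>
  define C where "C = mat N N (\<lambda>(i, j). if i < k then V i $ j else 0)"
  have C: "C \<in> carrier_mat N N" by (simp add: C_def)
  have "transpose_mat C *\<^sub>v unit_vec N k = 0\<^sub>v N"
    by (intro eq_vecI) (simp_all add: C_def k)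
  then have "\<exists>v. v \<in> carrier_vec N \<and> v \<noteq> 0\<^sub>v N \<and> transpose_mat C *\<^sub>v v = 0\<^sub>v N"
    by (intro exI[of _ "unit_vec N k"] conjI unit_vec_carrier unit_vec_nonzero k)
  moreover have "transpose_mat C \<in> carrier_mat N N" using C by simp
  ultimately have "det (transpose_mat C) = 0" using det_0_iff_vec_prod_zero by blast
  then have "det C = 0" using det_transpose[OF C] by simp
  then obtain l where l: "l \<in> carrier_vec N" "l \<noteq> 0\<^sub>v N" "C *\<^sub>v l = 0\<^sub>v N"
    using det_0_iff_vec_prod_zero[OF C] by blast
  have "(\<Sum>j<N. V i $ j * l $ j) = 0" if i: "i < k" for i
  proof -
    have "(C *\<^sub>v l) $ i = (\<Sum>j<N. V i $ j * l $ j)"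
      using i k l(1) by (simp add: C_def scalar_prod_def atLeast0LessThan)
    then show ?thesis unfolding l(3) using i k by simp
  qed
  then show ?thesis using l(1,2) by blast
qed

lemma nonzero_vec_entry:
  assumes "l \<in> carrier_vec N" "l \<noteq> 0\<^sub>v N" shows "\<exists>j<N. l $ j \<noteq> 0"
proof (rule ccontr)
  assume "\<not> (\<exists>j<N. l $ j \<noteq> 0)"
  then have "l = 0\<^sub>v N" using assms(1) by (intro eq_vecI) auto
  then show False using assms(2) by contradiction
qed

text \<open>Pairing a relation with a functional \<open>l\<close> that kills the \<open>V i\<close> but not \<open>w\<close>.\<close>

lemma independent_extend:
  fixes V :: "nat \<Rightarrow> 'k::field vec"
  assumes lV: "\<And>i. i < k ==> (\<Sum>j<N. V i $ j * l $ j) = 0" and lw: "(\<Sum>j<N. w $ j * l $ j) \<noteq> 0"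
    and eq: "\<And>j. j < N ==> (\<Sum>i<k. a i * V i $ j) + e * w $ j = 0"
  shows "e = 0"
proof -
  have "0 = (\<Sum>j<N. ((\<Sum>i<k. a i * V i $ j) + e * w $ j) * l $ j)"
    using eq by simp
  also have "\<dots> = (\<Sum>j<N. \<Sum>i<k. a i * (V i $ j * l $ j)) + (\<Sum>j<N. e * (w $ j * l $ j))"
    unfolding sum.distrib[symmetric] by (rule sum.cong) (simp_all add: distrib_right sum_distrib_right mult.assoc)
  also have "(\<Sum>j<N. \<Sum>i<k. a i * (V i $ j * l $ j)) = (\<Sum>i<k. a i * (\<Sum>j<N. V i $ j * l $ j))"
    unfolding sum_distrib_left by (rule sum.swap)
  also have "\<dots> = 0" using lV by simp
  also have "(\<Sum>j<N. e * (w $ j * l $ j)) = e * (\<Sum>j<N. w $ j * l $ j)" by (rule sum_distrib_left[symmetric])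
  finally show ?thesis using lw by simp
qed

text \<open>A unit vector on which some annihilator of the \<open>V i\<close> is nonzero is
  independent of them.\<close>

lemma extend_to_basis:
  fixes V :: "nat \<Rightarrow> 'k::field vec"
  assumes V: "\<And>i. i < M ==> V i \<in> carrier_vec (M + 1)"
    and ind: "\<And>a. (\<And>j. j < M + 1 ==> (\<Sum>i<M. a i * V i $ j) = 0) ==> \<forall>i<M. a i = 0"
  shows "\<exists>w\<in>carrier_vec (M + 1). \<forall>a e. (\<forall>j<M+1. (\<Sum>i<M. a i * V i $ j) + e * w $ j = 0) -->
    e = 0 \<and> (\<forall>i<M. a i = 0)"
proof -
  have "M < M + 1" by simp
  from annihilator_exists[of M V "M + 1", OF V this]
  obtain l where l: "l \<in> carrier_vec (M + 1)" "l \<noteq> 0\<^sub>v (M + 1)"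
    and Vl: "\<And>i. i < M ==> (\<Sum>j<M+1. V i $ j * l $ j) = 0" by blast
  obtain j0 where j0: "j0 < M + 1" "l $ j0 \<noteq> 0" using nonzero_vec_entry[OF l] by blast
  let ?w = "unit_vec (M + 1) j0 :: 'k vec"
  have "(\<Sum>j<M+1. ?w $ j * l $ j) = (\<Sum>j<M+1. if j = j0 then l $ j0 else 0)"
    by (rule sum.cong) (use j0 in auto)
  also have "\<dots> = l $ j0" using j0 by simp
  finally have lw: "(\<Sum>j<M+1. ?w $ j * l $ j) \<noteq> 0" using j0 by simp
  have "e = 0 \<and> (\<forall>i<M. a i = 0)"
    if eq: "\<forall>j<M+1. (\<Sum>i<M. a i * V i $ j) + e * ?w $ j = 0" for a e
  proof -
    have e: "e = 0" by (rule independent_extend[OF Vl lw eq[rule_format]])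
    have "(\<Sum>i<M. a i * V i $ j) = 0" if "j < M + 1" for j using eq[rule_format, OF that] e by simp
    then have "\<forall>i<M. a i = 0" by (rule ind)
    with e show ?thesis by (rule conjI)
  qed
  then show ?thesis by (intro bexI[of _ ?w] allI impI unit_vec_carrier)
qed

context quot_alg
begin

definition fam_mat :: "(nat \<Rightarrow> 'r) \<Rightarrow> 'k mat" where
  "fam_mat r = mat N N (\<lambda>(j, i). \<tau> (r i) $ j)"

lemma fam_mat_carrier [simp]: "fam_mat r \<in> carrier_mat N N" by (simp add: fam_mat_def)

lemma \<tau>_fam:
  "\<tau> (\<Sum>i<N. c (a i) * r i) = fam_mat r *\<^sub>v vec N a"
proof (rule eq_vecI)
  fix j assume "j < dim_vec (fam_mat r *\<^sub>v vec N a)"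
  then have j: "j < N" by (simp add: fam_mat_def)
  have "\<tau> (\<Sum>i<N. c (a i) * r i) $ j = (\<Sum>i<N. \<tau> (c (a i) * r i) $ j)"
    by (rule \<tau>_sum[OF _ j]) simp
  also have "\<dots> = (\<Sum>i<N. \<tau> (r i) $ j * a i)"
    by (rule sum.cong) (use j in \<open>simp_all add: \<tau>_c carrier_vecD[OF \<tau>_carrier]\<close>)
  also have "\<dots> = (fam_mat r *\<^sub>v vec N a) $ j"
    using j by (simp add: fam_mat_def scalar_prod_def atLeast0LessThan)
  finally show "\<tau> (\<Sum>i<N. c (a i) * r i) $ j = (fam_mat r *\<^sub>v vec N a) $ j" .
qed (simp add: fam_mat_def carrier_vecD[OF \<tau>_carrier])

lemma fam_mat_inverse:
  assumes ind: "\<And>a. (\<Sum>i<N. c (a i) * r i) \<in> J ==> \<forall>i<N. a i = 0"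
  shows "\<exists>B'\<in>carrier_mat N N. fam_mat r * B' = 1\<^sub>m N \<and> B' * fam_mat r = 1\<^sub>m N"
proof (rule inverse_mat_exists[OF fam_mat_carrier])
  fix v :: "'k vec" assume v: "v \<in> carrier_vec N" "fam_mat r *\<^sub>v v = 0\<^sub>v N"
  have "vec N (($) v) = v" using v(1) by auto
  then have "(\<Sum>i<N. c (v $ i) * r i) \<in> J" unfolding J_def mem_Collect_eq \<tau>_fam using v(2) by simp
  then have "\<forall>i<N. v $ i = 0" by (rule ind)
  then show "v = 0\<^sub>v N" using v(1) by (intro eq_vecI) auto
qed

lemma fam_span:
  assumes ind: "\<And>a. (\<Sum>i<N. c (a i) * r i) \<in> J ==> \<forall>i<N. a i = 0"
  shows "\<exists>a. p \<approx> (\<Sum>i<N. c (a i) * r i)"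
proof -
  obtain B' where B': "B' \<in> carrier_mat N N" "fam_mat r * B' = 1\<^sub>m N"
    using fam_mat_inverse[of r, OF ind] by blast
  let ?v = "B' *\<^sub>v \<tau> p"
  have v: "?v \<in> carrier_vec N" using B'(1) \<tau>_carrier by (rule mult_mat_vec_carrier)
  have "vec N (($) ?v) = ?v" by (rule eq_vecI) (use carrier_vecD[OF v] in simp_all)
  then have "\<tau> (\<Sum>i<N. c (?v $ i) * r i) = fam_mat r *\<^sub>v ?v" unfolding \<tau>_fam by simp
  also have "\<dots> = (fam_mat r * B') *\<^sub>v \<tau> p"
    by (rule assoc_mult_mat_vec[symmetric, OF fam_mat_carrier B'(1) \<tau>_carrier])
  also have "\<dots> = \<tau> p" unfolding B'(2) by (rule one_mult_mat_vec[OF \<tau>_carrier])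
  finally show ?thesis unfolding eqv_iff by (metis (no_types))
qed

lemma fam_extend:
  assumes N: "N = M + 1"
    and ind: "\<And>a. (\<Sum>i<M. c (a i) * r i) \<in> J ==> \<forall>i<M. a i = 0"
  shows "\<exists>y. \<forall>a e. (\<Sum>i<M. c (a i) * r i) + c e * y \<in> J --> e = 0 \<and> (\<forall>i<M. a i = 0)"
proof -
  have t: "\<tau> (\<Sum>i<M. c (a i) * r i) $ j = (\<Sum>i<M. a i * \<tau> (r i) $ j)" if j: "j < N" for a j
  proof -
    have "\<tau> (\<Sum>i<M. c (a i) * r i) $ j = (\<Sum>i<M. \<tau> (c (a i) * r i) $ j)" by (rule \<tau>_sum[OF _ j]) simp
    then show ?thesis using j by (simp add: \<tau>_c carrier_vecD[OF \<tau>_carrier])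
  qed
  have "\<exists>w\<in>carrier_vec (M + 1). \<forall>a e. (\<forall>j<M+1. (\<Sum>i<M. a i * \<tau> (r i) $ j) + e * w $ j = 0) -->
    e = 0 \<and> (\<forall>i<M. a i = 0)"
  proof (rule extend_to_basis)
    show "\<tau> (r i) \<in> carrier_vec (M + 1)" for i using \<tau>_carrier[of "r i"] unfolding N .
    fix a assume a: "\<And>j. j < M + 1 ==> (\<Sum>i<M. a i * \<tau> (r i) $ j) = 0"
    have "\<tau> (\<Sum>i<M. c (a i) * r i) = 0\<^sub>v N"
      by (rule eq_vecI) (simp_all add: t a[folded N] carrier_vecD[OF \<tau>_carrier])
    then show "\<forall>i<M. a i = 0" by (intro ind) (simp add: J_def)
  qed
  then obtain w where w: "w \<in> carrier_vec N"
    and wi: "\<And>a e. (\<forall>j<N. (\<Sum>i<M. a i * \<tau> (r i) $ j) + e * w $ j = 0) ==> e = 0 \<and> (\<forall>i<M. a i = 0)"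
    unfolding N by blast
  obtain y where y: "\<tau> y = w" using \<tau>_surj[OF w] by blast
  have "e = 0 \<and> (\<forall>i<M. a i = 0)" if "(\<Sum>i<M. c (a i) * r i) + c e * y \<in> J" for a e
  proof (rule wi, intro allI impI)
    fix j assume j: "j < N"
    have "\<tau> ((\<Sum>i<M. c (a i) * r i) + c e * y) $ j = 0" using that j by (simp add: J_def)
    then show "(\<Sum>i<M. a i * \<tau> (r i) $ j) + e * w $ j = 0"
      using j w by (simp add: \<tau>_add \<tau>_c t y)
  qed
  then show ?thesis by blast
qed

end

lemma one_plus_power_expand:
  fixes w :: "'a::comm_ring_1"
  shows "\<exists>q. (1 + w) ^ i = 1 + of_nat i * w + w ^ 2 * q"
proof (induction i)
  case 0
  show ?case by (intro exI[of _ 0]) simp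
next
  case (Suc i)
  then obtain q where "(1 + w) ^ i = 1 + of_nat i * w + w ^ 2 * q" by blast
  then have "(1 + w) ^ Suc i = 1 + of_nat (Suc i) * w + w ^ 2 * (of_nat i + q + w * q)"
    by (simp add: algebra_simps power2_eq_square)
  then show ?case by blast
qed

section \<open>Generators and normal form of the algebra\<close>

context norm_alg
begin

interpretation c: comm_ring_hom c by (rule c_hom)

lemma c_of_nat: "c (of_nat i) = of_nat i" by (rule c.hom_of_nat)

text \<open>Polarization: the coefficient of \<open>s\<close> in \<open>\<pi> ((x + s p) ^ (k + 1)) = 0\<close>.\<close>

lemma polarize:
  assumes hi: "\<And>w. aug w = 0 ==> \<pi> (w ^ Suc k) = 0" and x: "aug x = 0" and p: "aug p = 0"
  shows "\<pi> (p * x ^ k) = 0"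
proof -
  define P where "P = (\<Sum>i\<le>Suc k. monom (of_nat (Suc k choose i) * \<pi> (p ^ i * x ^ (Suc k - i))) i)"
  have "poly P t = 0" for t
  proof -
    have "poly P t = (\<Sum>i\<le>Suc k. of_nat (Suc k choose i) * \<pi> (p ^ i * x ^ (Suc k - i)) * t ^ i)"
      by (simp add: P_def poly_sum poly_monom)
    also have "\<dots> = (\<Sum>i\<le>Suc k. \<pi> (c (of_nat (Suc k choose i) * t ^ i) * (p ^ i * x ^ (Suc k - i))))"
      unfolding \<pi>_c by (rule sum.cong) (simp_all add: ac_simps)
    also have "\<dots> = \<pi> (\<Sum>i\<le>Suc k. c (of_nat (Suc k choose i) * t ^ i) * (p ^ i * x ^ (Suc k - i)))"
      by (rule \<pi>_sum[symmetric]) simp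
    also have "\<dots> = \<pi> ((c t * p + x) ^ Suc k)"
      unfolding binomial_ring
      by (rule arg_cong[of _ _ \<pi>], rule sum.cong[OF refl])
        (simp only: c_simps c_of_nat power_mult_distrib ac_simps)
    also have "\<dots> = 0" by (rule hi) (simp add: x p)
    finally show ?thesis .
  qed
  then have "P = 0" using poly_all_0_iff_0 by blast
  then have "coeff P 1 = 0" by simp
  moreover have "coeff P 1 = of_nat (Suc k choose 1) * \<pi> (p ^ 1 * x ^ (Suc k - 1))"
    unfolding P_def coeff_sum_monom_up by simp
  ultimately have "of_nat (Suc k) * \<pi> (p * x ^ k) = 0" by simp
  then show ?thesis using of_nat_neq_0[of k] by (metis mult_eq_0_iff)
qed

text \<open>Polarization and non-degeneracy give \<open>x ^ (d + 1) = 0\<close>, so 1, x, ..., x^d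
  are independent and one vector \<open>y\<close> completes a basis. Nilpotency removes the
  \<open>y\<close>-component from \<open>x * y\<close> and \<open>y ^ 2\<close>. Subtracting a
  polynomial in \<open>x\<close> from \<open>y\<close> makes \<open>x * y = 0\<close>, which forces
  \<open>y ^ 2\<close> to be a multiple of \<open>x ^ d\<close>. If it were 0, a combination of
  \<open>y\<close> and \<open>x ^ d\<close> would be orthogonal to everything.\<close>

lemma structure_aux:
  assumes n: "n = d + 1" and d: "d \<ge> 2"
    and hi: "\<And>w i. aug w = 0 ==> i > d ==> \<pi> (w ^ i) = 0"
    and ndg: "\<And>w. aug w = 0 ==> (\<And>r. \<pi> (w * r) = 0) ==> w \<in> J"
    and x: "aug x = 0" "\<pi> (x ^ d) \<noteq> 0"
  shows "\<exists>y \<alpha>. aug y = 0 \<and> x * y \<in> J \<and> y ^ 2 \<approx> c \<alpha> * x ^ d \<and> \<alpha> \<noteq> 0 \<and> x ^ (d + 1) \<in> J"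
proof -
  have xd1: "x ^ (d + 1) \<in> J"
  proof (rule ndg)
    show "aug (x ^ (d + 1)) = 0" using x by simp
    fix r
    have "\<pi> ((r - c (aug r)) * x ^ (d + 1)) = 0"
    proof (rule polarize)
      show "\<pi> (w ^ Suc (d + 1)) = 0" if "aug w = 0" for w by (rule hi[OF that]) simp
    qed (simp_all add: x)
    moreover have "\<pi> (c (aug r) * x ^ (d + 1)) = 0" unfolding \<pi>_c using hi[OF x(1), of "d + 1"] by simp
    moreover have "x ^ (d + 1) * r = (r - c (aug r)) * x ^ (d + 1) + c (aug r) * x ^ (d + 1)"
      by (simp add: algebra_simps)
    ultimately show "\<pi> (x ^ (d + 1) * r) = 0" by (simp only: \<pi>_add add_0)
  qed
  have xbig: "x ^ k \<in> J" if "k > d" for k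
  proof -
    have "x ^ k = x ^ (k - (d + 1)) * x ^ (d + 1)" using that unfolding power_add[symmetric] by simp
    then show ?thesis using J_mult[OF xd1] by metis
  qed
  define S where "S a = (\<Sum>i<n. c (a i) * x ^ i)" for a
  have ind_x: "\<forall>i<n. a i = 0" if Sa: "S a \<in> J" for a
  proof (rule ccontr)
    assume "\<not> (\<forall>i<n. a i = 0)"
    then have ex: "\<exists>i. i < n \<and> a i \<noteq> 0" by blast
    define j where "j = (LEAST i. i < n \<and> a i \<noteq> 0)"
    have j: "j < n" "a j \<noteq> 0" using LeastI_ex[OF ex] unfolding j_def by blast+
    have jl: "a i = 0" if "i < j" for i
      using not_less_Least[of i "\<lambda>i. i < n \<and> a i \<noteq> 0"] that j(1) unfolding j_def[symmetric] by auto
    \<comment> \<open>With \<open>j\<close> the least index of a nonzero coefficient, this factor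
      leaves only \<open>a j * \<pi> (x ^ d)\<close> under \<pi>.\<close>
    have "x ^ (d - j) * S a \<in> J" by (rule J_mult[OF Sa])
    then have "0 = \<pi> (x ^ (d - j) * S a)" by (rule \<pi>_J[symmetric])
    also have "\<dots> = (\<Sum>i<n. a i * \<pi> (x ^ (d - j + i)))"
      unfolding S_def sum_distrib_left mult.left_commute[of _ "c _"]
      by (simp add: \<pi>_sum \<pi>_c power_add)
    also have "\<dots> = (\<Sum>i<n. if i = j then a j * \<pi> (x ^ d) else 0)"
    proof (rule sum.cong[OF refl])
      fix i assume i: "i \<in> {..<n}"
      consider "i < j" | "i = j" | "i > j" by linarith
      then show "a i * \<pi> (x ^ (d - j + i)) = (if i = j then a j * \<pi> (x ^ d) else 0)"
      proof cases
        case 2 then show ?thesis using j n by simp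
      next
        case 3
        then have "d - j + i > d" using j n by simp
        then show ?thesis using hi[OF x(1)] 3 by simp
      qed (simp add: jl)
    qed
    also have "\<dots> = a j * \<pi> (x ^ d)" using j by simp
    finally show False using j x by simp
  qed
  have S_comb: "S a + c k * S a' = S (\<lambda>i. a i + k * a' i)" for a k a'
    unfolding S_def sum_distrib_left sum.distrib[symmetric]
    by (rule sum.cong) (simp_all add: c_simps algebra_simps)
  have S_shift: "x * S a \<approx> S (\<lambda>i. if i = 0 then 0 else a (i - 1))" for a
  proof -
    have "S (\<lambda>i. if i = 0 then 0 else a (i - 1)) = (\<Sum>i<d. c (a i) * x ^ Suc i)"
      unfolding S_def n Suc_eq_plus1[symmetric] sum.lessThan_Suc_shift by simp
    moreover have "x * S a = (\<Sum>i<d. c (a i) * x ^ Suc i) + c (a d) * x ^ Suc d"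
      unfolding S_def n sum_distrib_left by (simp add: ac_simps)
    moreover have "c (a d) * x ^ Suc d \<in> J" using J_mult xbig[of "Suc d"] by simp
    ultimately show ?thesis by (simp only: eqv_add_J)
  qed
  have aug_S: "aug (S a) = a 0" for a
  proof -
    have "aug (S a) = (\<Sum>i<n. if i = 0 then a 0 else 0)"
      unfolding S_def aug_simps by (rule sum.cong) (auto simp: x(1) power_0_left)
    then show ?thesis by (simp add: n)
  qed
  \<comment> \<open>\<open>y\<close> completes the powers of \<open>x\<close> to a basis; of
    independence only the statement about the coefficient of \<open>y\<close> is recorded.\<close>
  define Bas where "Bas y \<longleftrightarrow> (\<forall>a e. S a + c e * y \<in> J --> e = 0) \<and> (\<forall>r. \<exists>a e. r \<approx> S a + c e * y)" for y
  have BasD: "e = 0" if "Bas y" "S a + c e * y \<in> J" for y a e using that unfolding Bas_def by blast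
  have BasS: "\<exists>a e. r \<approx> S a + c e * y" if "Bas y" for y r using that unfolding Bas_def by blast
  have Bas_shift: "Bas (y - S a')" if B: "Bas y" for y a'
  proof -
    have eq: "S a + c e * (y - S a') = S (\<lambda>i. a i + (- e) * a' i) + c e * y" for a e
      unfolding S_comb[symmetric] by (simp add: c_simps algebra_simps)
    have "e = 0" if "S a + c e * (y - S a') \<in> J" for a e
      using BasD[OF B] that unfolding eq by blast
    moreover have "\<exists>a e. r \<approx> S a + c e * (y - S a')" for r
    proof -
      obtain a e where ae: "r \<approx> S a + c e * y" using BasS[OF B] by blast
      have "S a + c e * y = S (\<lambda>i. a i + e * a' i) + c e * (y - S a')"
        unfolding S_comb[symmetric] by (simp add: algebra_simps)
      then show ?thesis using ae by metis
    qed
    ultimately show ?thesis unfolding Bas_def by blast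
  qed
  obtain y where By: "Bas y"
  proof -
    obtain y where y: "\<And>a e. (\<Sum>i<n. c (a i) * x ^ i) + c e * y \<in> J ==> e = 0 \<and> (\<forall>i<n. a i = 0)"
      using fam_extend[of n "\<lambda>i. x ^ i", OF N_eq] ind_x unfolding S_def by blast
    define r where "r i = (if i < n then x ^ i else y)" for i
    have req: "(\<Sum>i<N. c (a i) * r i) = S a + c (a n) * y" for a
      unfolding N_eq Suc_eq_plus1[symmetric] S_def by (simp add: r_def)
    have rind: "\<forall>i<N. a i = 0" if "(\<Sum>i<N. c (a i) * r i) \<in> J" for a
    proof -
      have "a n = 0 \<and> (\<forall>i<n. a i = 0)" by (rule y) (use that in \<open>simp only: req S_def\<close>)
      then show ?thesis by (auto simp: N_eq less_Suc_eq)
    qed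
    have "\<exists>a e. p \<approx> S a + c e * y" for p
    proof -
      obtain a where "p \<approx> (\<Sum>i<N. c (a i) * r i)" using fam_span[of r p, OF rind] by blast
      then show ?thesis unfolding req by blast
    qed
    moreover have "e = 0" if "S a + c e * y \<in> J" for a e using y[of a e] that unfolding S_def by blast
    ultimately have "Bas y" unfolding Bas_def by blast
    then show ?thesis by (rule that)
  qed
  obtain a e where xy: "x * y \<approx> S a + c e * y" using BasS[OF By] by blast
  \<comment> \<open>Modulo the span of the powers of \<open>x\<close>, multiplication by
    \<open>x\<close> scales \<open>y\<close> by \<open>e\<close>; nilpotency of \<open>x\<close>
    then forces \<open>e = 0\<close>.\<close>
  have "\<exists>a. x ^ k * y \<approx> S a + c (e ^ k) * y" for k
  proof (induction k)
    case 0
    show ?case by (intro exI[of _ "\<lambda>_. 0"]) (simp add: S_def)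
  next
    case (Suc k)
    then obtain a' where a': "x ^ k * y \<approx> S a' + c (e ^ k) * y" by blast
    have "x ^ Suc k * y = x * (x ^ k * y)" by (simp add: ac_simps)
    also have "\<dots> \<approx> x * (S a' + c (e ^ k) * y)" by (rule eqv_mult[OF eqv_refl a'])
    also have "\<dots> = x * S a' + c (e ^ k) * (x * y)" by (simp add: algebra_simps)
    also have "\<dots> \<approx> S (\<lambda>i. if i = 0 then 0 else a' (i - 1)) + c (e ^ k) * (S a + c e * y)"
      by (rule eqv_add[OF S_shift eqv_mult[OF eqv_refl xy]])
    also have "\<dots> = (S (\<lambda>i. if i = 0 then 0 else a' (i - 1)) + c (e ^ k) * S a) + c (e ^ Suc k) * y"
      by (simp add: algebra_simps c_simps)
    finally show ?case unfolding S_comb by blast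
  qed
  then obtain a' where a': "x ^ (d + 1) * y \<approx> S a' + c (e ^ (d + 1)) * y" by blast
  have "S a' + c (e ^ (d + 1)) * y \<approx> 0"
    by (rule eqv_trans[OF eqv_sym[OF a']]) (simp only: eqv_0_iff J_mult2[OF xd1])
  then have "e ^ (d + 1) = 0" using BasD[OF By] by (simp only: eqv_0_iff)
  then have e: "e = 0" using power_eq_0_iff[of e "d + 1"] by blast
  then have xy: "x * y \<approx> S a" using xy by simp
  have a0: "a 0 = 0" using eqv_aug[OF xy] x(1) by (simp add: aug_S)
  \<comment> \<open>\<open>x * y\<close> is a polynomial in \<open>x\<close> without constant term;
    dividing it by \<open>x\<close> gives the correction of \<open>y\<close>.\<close>
  define y1 where "y1 = y - S (\<lambda>i. if i < d then a (i + 1) else 0)"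
  have By1: "Bas y1" unfolding y1_def by (rule Bas_shift[OF By])
  have xy1: "x * y1 \<in> J"
  proof -
    have "x * S (\<lambda>i. if i < d then a (i + 1) else 0) \<approx>
        S (\<lambda>i. if i = 0 then 0 else (if i - 1 < d then a (i - 1 + 1) else 0))" by (rule S_shift)
    also have "\<dots> = S a" unfolding S_def by (rule sum.cong) (use a0 n in auto)
    finally have "x * y - x * S (\<lambda>i. if i < d then a (i + 1) else 0) \<approx> S a - S a"
      by (rule eqv_diff[OF xy])
    then show ?thesis by (simp add: y1_def right_diff_distrib eqv_0_iff)
  qed
  have y1: "aug y1 = 0"
  proof (rule ccontr)
    assume "aug y1 \<noteq> 0"
    then have "x \<in> J" by (rule unit_cancel) (use xy1 in \<open>simp add: mult.commute\<close>)
    then have "x ^ d \<in> J" using J_mult2[of x "x ^ (d - 1)"] d by (simp flip: power_Suc)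
    then show False using x(2) \<pi>_J by blast
  qed
  have y1x: "y1 * x ^ i \<in> J" if "i \<ge> 1" for i
    using J_mult[OF xy1, of "x ^ (i - 1)"] that by (cases i) (simp_all add: ac_simps)
  have y1S: "y1 * S f \<approx> c (f 0) * y1" for f
  proof -
    have "y1 * S f = (\<Sum>i<n. c (f i) * (y1 * x ^ i))" unfolding S_def sum_distrib_left by (simp add: ac_simps)
    also have "\<dots> \<approx> (\<Sum>i<n. if i = 0 then c (f 0) * y1 else 0)"
    proof (rule eqv_sum)
      fix i assume "i \<in> {..<n}"
      show "c (f i) * (y1 * x ^ i) \<approx> (if i = 0 then c (f 0) * y1 else 0)"
        using J_mult[OF y1x[of i], of "c (f i)"] by (cases "i = 0") (simp_all add: eqv_0_iff)
    qed
    also have "\<dots> = c (f 0) * y1" by (simp add: n)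
    finally show ?thesis .
  qed
  obtain a e where yy: "y1 ^ 2 \<approx> S a + c e * y1" using BasS[OF By1] by blast
  have a0: "a 0 = 0" using eqv_aug[OF yy] y1 by (simp add: aug_S)
  have y1Sa: "y1 * S a \<approx> 0" using y1S[of a] a0 by simp
  \<comment> \<open>The same eigenvalue argument, now for \<open>y1\<close>, whose product with
    \<open>S a\<close> vanishes.\<close>
  have "y1 ^ (k + 2) \<approx> c (e ^ k) * S a + c (e ^ (k + 1)) * y1" for k
  proof (induction k)
    case 0
    show ?case using yy by (simp add: numeral_2_eq_2)
  next
    case (Suc k)
    have "y1 ^ (Suc k + 2) = y1 * y1 ^ (k + 2)" by simp
    also have "\<dots> \<approx> y1 * (c (e ^ k) * S a + c (e ^ (k + 1)) * y1)" by (rule eqv_mult[OF eqv_refl Suc])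
    also have "\<dots> = c (e ^ k) * (y1 * S a) + c (e ^ (k + 1)) * y1 ^ 2"
      by (simp add: algebra_simps power2_eq_square)
    also have "\<dots> \<approx> c (e ^ k) * 0 + c (e ^ (k + 1)) * (S a + c e * y1)"
      by (intro eqv_add eqv_mult eqv_refl y1Sa yy)
    also have "\<dots> = c (e ^ Suc k) * S a + c (e ^ (Suc k + 1)) * y1" by (simp add: algebra_simps c_simps)
    finally show ?case .
  qed
  then have "y1 ^ (D + 2) \<approx> c (e ^ D) * S a + c (e ^ (D + 1)) * y1" .
  then have "c (e ^ D) * S a + c (e ^ (D + 1)) * y1 \<approx> 0"
    using eqv_trans[OF eqv_sym] nil_power[OF y1 le_add1, of 2] unfolding eqv_0_iff[symmetric] by blast
  moreover have "c (e ^ D) * S a = S (\<lambda>i. 0 + e ^ D * a i)"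
    unfolding S_comb[symmetric] by (simp add: S_def)
  ultimately have "e ^ (D + 1) = 0" using BasD[OF By1] by (simp only: eqv_0_iff)
  then have "e = 0" using power_eq_0_iff[of e "D + 1"] by blast
  then have yy: "y1 ^ 2 \<approx> S a" using yy by simp
  \<comment> \<open>\<open>x * y1 = 0\<close> gives \<open>x * y1 ^ 2 = 0\<close>, so only the
    coefficient of \<open>x ^ d\<close> in \<open>y1 ^ 2\<close> can be nonzero.\<close>
  have "x * S a \<approx> x * y1 ^ 2" by (rule eqv_mult[OF eqv_refl eqv_sym[OF yy]])
  also have "\<dots> = y1 * (x * y1)" by (simp add: power2_eq_square ac_simps)
  also have "\<dots> \<approx> 0" unfolding eqv_0_iff by (rule J_mult[OF xy1])
  finally have "S (\<lambda>i. if i = 0 then 0 else a (i - 1)) \<approx> 0" by (rule eqv_trans[OF eqv_sym[OF S_shift]])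
  then have sh: "\<forall>i<n. (if i = 0 then 0 else a (i - 1)) = 0" unfolding eqv_0_iff by (rule ind_x)
  have al: "a i = 0" if "i < d" for i using sh[rule_format, of "Suc i"] that n by simp
  have "S a = (\<Sum>i<n. if i = d then c (a d) * x ^ d else 0)"
    unfolding S_def by (rule sum.cong) (use al n in \<open>auto simp: less_Suc_eq\<close>)
  also have "\<dots> = c (a d) * x ^ d" by (simp add: n)
  finally have yy: "y1 ^ 2 \<approx> c (a d) * x ^ d" using yy by simp
  have "a d \<noteq> 0"
  proof
    assume ad: "a d = 0"
    then have y2: "y1 ^ 2 \<in> J" using yy by (simp add: eqv_0_iff)
    \<comment> \<open>Chosen so that \<open>\<pi> w = 0\<close>. It is also annihilated by
      \<open>x\<close> and \<open>y1\<close>, hence orthogonal to everything.\<close>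
    define w where "w = c (\<pi> (x ^ d)) * y1 - c (\<pi> y1) * x ^ d"
    have wx: "w * x ^ i \<in> J" if "i \<ge> 1" for i
    proof -
      have "w * x ^ i = c (\<pi> (x ^ d)) * (y1 * x ^ i) - c (\<pi> y1) * x ^ (d + i)"
        by (simp add: w_def algebra_simps power_add)
      then show ?thesis using J_diff[OF J_mult[OF y1x[OF that]] J_mult[OF xbig[of "d + i"]]] that by simp
    qed
    have wy: "w * y1 \<in> J"
    proof -
      have "w * y1 = c (\<pi> (x ^ d)) * y1 ^ 2 - c (\<pi> y1) * (y1 * x ^ d)"
        by (simp add: w_def algebra_simps power2_eq_square)
      then show ?thesis using J_diff[OF J_mult[OF y2] J_mult[OF y1x[of d]]] d by simp
    qed
    have \<pi>w: "\<pi> w = 0"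
    proof -
      have "\<pi> w + \<pi> (c (\<pi> y1) * x ^ d) = \<pi> (c (\<pi> (x ^ d)) * y1)"
        unfolding \<pi>_add[symmetric] by (simp add: w_def)
      then show ?thesis by (simp add: \<pi>_c)
    qed
    have "w \<in> J"
    proof (rule ndg)
      show "aug w = 0" using y1 x d by (simp add: w_def)
      fix r
      obtain f g where fg: "r \<approx> S f + c g * y1" using BasS[OF By1] by blast
      have "w * r \<approx> w * (S f + c g * y1)" by (rule eqv_mult[OF eqv_refl fg])
      also have "\<dots> = (\<Sum>i<n. c (f i) * (w * x ^ i)) + c g * (w * y1)"
        unfolding S_def by (simp add: algebra_simps sum_distrib_left)
      also have "\<dots> \<approx> (\<Sum>i<n. if i = 0 then c (f 0) * w else 0) + 0"
      proof (intro eqv_add eqv_sum)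
        show "c g * (w * y1) \<approx> 0" unfolding eqv_0_iff by (rule J_mult[OF wy])
        fix i assume "i \<in> {..<n}"
        show "c (f i) * (w * x ^ i) \<approx> (if i = 0 then c (f 0) * w else 0)"
          using J_mult[OF wx[of i], of "c (f i)"] by (cases "i = 0") (simp_all add: eqv_0_iff)
      qed
      also have "\<dots> = c (f 0) * w" by (simp add: n)
      finally show "\<pi> (w * r) = 0" by (simp add: \<pi>_eqv \<pi>_c \<pi>w)
    qed
    moreover have "w = S (\<lambda>i. if i = d then - \<pi> y1 else 0) + c (\<pi> (x ^ d)) * y1"
      by (simp add: w_def S_def n c_simps if_distrib if_distribR cong: if_cong)
    ultimately have "\<pi> (x ^ d) = 0" using BasD[OF By1] by metis
    then show False using x(2) by contradiction
  qed
  then show ?thesis using y1 xy1 yy xd1 by blast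
qed

text \<open>Downward induction on the exponent. Replacing \<open>x\<close> by
  \<open>x * (1 + g * x ^ (d - m))\<close> adds \<open>m * g * \<pi> (x ^ d)\<close> to
  \<open>\<pi> (x ^ m)\<close> and leaves the values at higher exponents alone, where the correction
  consists of powers above \<open>d\<close>.\<close>

lemma adjust_generator:
  assumes d: "d \<ge> 1" and x: "aug x = 0" "x ^ (d + 1) \<in> J" "\<pi> (x ^ d) \<noteq> 0" "x * y \<in> J" and k: "k < d"
  shows "\<exists>x'. aug x' = 0 \<and> x' ^ (d + 1) \<in> J \<and> x' ^ d \<approx> x ^ d \<and> x' * y \<in> J \<and>
    (\<forall>i. d - k \<le> i --> i < d --> \<pi> (x' ^ i) = 0)"
  using k
proof (induction k)
  case 0
  show ?case using x by (intro exI[of _ x]) auto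
next
  case (Suc k)
  then obtain x' where x': "aug x' = 0" "x' ^ (d + 1) \<in> J" "x' ^ d \<approx> x ^ d" "x' * y \<in> J"
    and lowz: "\<And>i. d - k \<le> i ==> i < d ==> \<pi> (x' ^ i) = 0" by auto
  have xbig: "x' ^ i \<in> J" if "i > d" for i
  proof -
    have "x' ^ i = x' ^ (i - (d + 1)) * x' ^ (d + 1)" using that unfolding power_add[symmetric] by simp
    then show ?thesis using J_mult[OF x'(2)] by metis
  qed
  have \<pi>d: "\<pi> (x' ^ d) = \<pi> (x ^ d)" by (rule \<pi>_eqv[OF x'(3)])
  define m where "m = d - Suc k"
  have m: "m \<ge> 1" "m < d" "d - k = m + 1" using Suc.prems by (auto simp: m_def)
  \<comment> \<open>Solves \<open>\<pi> (x' ^ m) + m * g * \<pi> (x ^ d) = 0\<close>; the division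
    by \<open>m\<close> uses characteristic zero.\<close>
  define g where "g = - \<pi> (x' ^ m) / (of_nat m * \<pi> (x ^ d))"
  define w where "w = c g * x' ^ (d - m)"
  define x'' where "x'' = x' * (1 + w)"
  have pw: "x'' ^ i \<approx> x' ^ i + c (of_nat i * g) * x' ^ (i + (d - m))" if i: "i \<ge> m" for i
  proof -
    obtain q where q: "(1 + w) ^ i = 1 + of_nat i * w + w ^ 2 * q" using one_plus_power_expand by blast
    have w2: "w ^ 2 = c (g ^ 2) * x' ^ ((d - m) * 2)"
      by (simp add: w_def power_mult_distrib c_simps power_mult)
    have "x'' ^ i = x' ^ i + c (of_nat i * g) * x' ^ (i + (d - m)) + x' ^ (i + (d - m) * 2) * (c (g ^ 2) * q)"
      unfolding x''_def power_mult_distrib q w2 power_add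
      by (simp only: w_def c_simps c_of_nat algebra_simps mult_1_right mult_1_left)
    moreover have "x' ^ (i + (d - m) * 2) \<in> J" by (rule xbig) (use i m in simp)
    ultimately show ?thesis using J_mult2 by (simp only: eqv_add_J)
  qed
  have "aug x'' = 0" using x' by (simp add: x''_def)
  moreover have "x'' ^ (d + 1) \<in> J"
  proof -
    have "x'' ^ (d + 1) = (1 + w) ^ (d + 1) * x' ^ (d + 1)" unfolding x''_def power_mult_distrib by (rule mult.commute)
    then show ?thesis using J_mult[OF x'(2)] by simp
  qed
  moreover have "x'' ^ d \<approx> x ^ d"
  proof -
    have "x' ^ (d + (d - m)) \<in> J" by (rule xbig) (use m in simp)
    then have "x' ^ d + c (of_nat d * g) * x' ^ (d + (d - m)) \<approx> x' ^ d" by (intro eqv_add_J J_mult)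
    then show ?thesis using eqv_trans[OF eqv_trans[OF pw[of d]] x'(3)] m by simp
  qed
  moreover have "x'' * y \<in> J"
  proof -
    have "x'' * y = (1 + w) * (x' * y)" by (simp add: x''_def ac_simps)
    then show ?thesis using J_mult[OF x'(4)] by simp
  qed
  moreover have "\<pi> (x'' ^ i) = 0" if i: "d - Suc k \<le> i" "i < d" for i
  proof -
    have im: "i \<ge> m" using i by (simp add: m_def)
    have eq: "\<pi> (x'' ^ i) = \<pi> (x' ^ i) + of_nat i * g * \<pi> (x' ^ (i + (d - m)))"
      using \<pi>_eqv[OF pw[OF im]] by (simp add: \<pi>_add \<pi>_c)
    show ?thesis
    proof (cases "i = m")
      case True
      have "i + (d - m) = d" using True m by simp
      moreover have "(of_nat m :: 'k) \<noteq> 0" using m by simp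
      ultimately show ?thesis unfolding eq using True x(3) by (simp add: g_def \<pi>d)
    next
      case False
      then have "\<pi> (x' ^ i) = 0" using lowz[of i] im i m by simp
      moreover have "\<pi> (x' ^ (i + (d - m))) = 0" by (rule \<pi>_J, rule xbig) (use False im m in simp)
      ultimately show ?thesis unfolding eq by simp
    qed
  qed
  ultimately show ?case by blast
qed

text \<open>Besides the relations, \<pi> is normalized to be proportional to the coefficient of
  \<open>x ^ d\<close>. This makes the equations, and not only the algebras, comparable with the
  model.\<close>

lemma normal_form:
  assumes sqrt: "\<And>k::'k. \<exists>l. l ^ 2 = k"
    and n: "n = d + 1" and d: "d \<ge> 2"
    and hi: "\<And>w i. aug w = 0 ==> i > d ==> \<pi> (w ^ i) = 0"
    and lo: "\<exists>w. aug w = 0 \<and> \<pi> (w ^ d) \<noteq> 0"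
    and ndg: "\<And>w. aug w = 0 ==> (\<And>r. \<pi> (w * r) = 0) ==> w \<in> J"
  shows "\<exists>x y. aug x = 0 \<and> aug y = 0 \<and> x * y \<in> J \<and> y ^ 2 \<approx> x ^ d \<and>
    (\<forall>i. 1 \<le> i --> i < d --> \<pi> (x ^ i) = 0) \<and> \<pi> y = 0 \<and> \<pi> (x ^ d) \<noteq> 0"
proof -
  obtain x0 where x0: "aug x0 = 0" "\<pi> (x0 ^ d) \<noteq> 0" using lo by blast
  obtain y1 \<alpha> where y1: "aug y1 = 0" "x0 * y1 \<in> J" "y1 ^ 2 \<approx> c \<alpha> * x0 ^ d" "\<alpha> \<noteq> 0" and xd: "x0 ^ (d + 1) \<in> J"
  proof -
    have "\<exists>y \<alpha>. aug y = 0 \<and> x0 * y \<in> J \<and> y ^ 2 \<approx> c \<alpha> * x0 ^ d \<and> \<alpha> \<noteq> 0 \<and> x0 ^ (d + 1) \<in> J"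
      using n d hi ndg x0 by (rule structure_aux)
    then show ?thesis by (elim exE conjE) (rule that)
  qed
  have d1: "d \<ge> 1" "d - 1 < d" using d by auto
  obtain x where x: "aug x = 0" "x ^ (d + 1) \<in> J" "x ^ d \<approx> x0 ^ d" "x * y1 \<in> J"
    and low: "\<forall>i. d - (d - 1) \<le> i --> i < d --> \<pi> (x ^ i) = 0"
    using adjust_generator[OF d1(1) x0(1) xd x0(2) y1(2) d1(2)] by (elim exE conjE) (rule that)
  \<comment> \<open>A square root of 1 / \<alpha> rescales \<open>y1 ^ 2\<close> to
    \<open>x ^ d\<close>. Subtracting \<open>c t * x ^ d\<close> makes \<open>\<pi> y = 0\<close>
    and preserves both relations, because the maximal ideal annihilates
    \<open>x ^ d\<close>.\<close>
  obtain \<beta> where \<beta>: "\<beta> ^ 2 = 1 / \<alpha>" using sqrt by blast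
  define t where "t = \<pi> y1 / \<pi> (x ^ d)"
  define y where "y = c \<beta> * (y1 - c t * x ^ d)"
  have \<pi>d: "\<pi> (x ^ d) \<noteq> 0" using \<pi>_eqv[OF x(3)] x0(2) by simp
  have xy: "x ^ i * y1 \<in> J" if "i \<ge> 1" for i
    using J_mult[OF x(4), of "x ^ (i - 1)"] that by (cases i) (simp_all add: ac_simps)
  have x2: "x ^ i \<in> J" if "i > d" for i
  proof -
    have "x ^ i = x ^ (i - (d + 1)) * x ^ (d + 1)" using that unfolding power_add[symmetric] by simp
    then show ?thesis using J_mult[OF x(2)] by metis
  qed
  have "aug y = 0" using y1 x d by (simp add: y_def)
  moreover have "x * y \<in> J"
  proof -
    have "x * y = c \<beta> * (x * y1) - c (\<beta> * t) * x ^ (d + 1)" by (simp add: y_def algebra_simps c_simps)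
    then show ?thesis using J_diff[OF J_mult[OF x(4)] J_mult[OF x(2)]] by simp
  qed
  moreover have "y ^ 2 \<approx> x ^ d"
  proof -
    have "c 2 = 2" using c_of_nat[of 2] by simp
    then have "y ^ 2 = c (\<beta> ^ 2) * y1 ^ 2 + (c (\<beta> ^ 2 * t ^ 2) * x ^ (d + d) - c (2 * \<beta> ^ 2 * t) * (x ^ d * y1))"
      by (simp add: y_def algebra_simps c_simps power2_eq_square power_add)
    also have "\<dots> \<approx> c (\<beta> ^ 2) * y1 ^ 2"
      using d by (intro eqv_add_J J_diff J_mult xy x2) auto
    also have "\<dots> \<approx> c (\<beta> ^ 2) * (c \<alpha> * x0 ^ d)" by (rule eqv_mult[OF eqv_refl y1(3)])
    also have "\<dots> = x0 ^ d"
    proof -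
      have "c (\<beta> ^ 2) * c \<alpha> = 1" unfolding c_simps(2)[symmetric] \<beta> using y1(4) by simp
      then show ?thesis by (simp flip: mult.assoc)
    qed
    also have "\<dots> \<approx> x ^ d" by (rule eqv_sym[OF x(3)])
    finally show ?thesis .
  qed
  moreover have "\<forall>i. 1 \<le> i --> i < d --> \<pi> (x ^ i) = 0" using low d by auto
  moreover have "\<pi> y = 0"
  proof -
    have "\<pi> (y1 - c t * x ^ d) + \<pi> (c t * x ^ d) = \<pi> y1" unfolding \<pi>_add[symmetric] by simp
    then have "\<pi> (y1 - c t * x ^ d) = 0" using \<pi>d by (simp add: \<pi>_c t_def)
    then show ?thesis unfolding y_def \<pi>_c by simp
  qed
  ultimately show ?thesis using x(1) \<pi>d by blast
qed

end

section \<open>The algebra of a representation\<close>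

lemma mon_zero: "mon (\<lambda>_. 0 :: 'k::comm_ring_1) t = (if t = 0 then 1 else 0)"
proof (cases "t = 0")
  case False
  then obtain i where i: "i \<in> Poly_Mapping.keys t" by (metis Poly_Mapping.keys_eq_empty ex_in_conv)
  then have "(0 :: 'k) ^ Poly_Mapping.lookup t i = 0" by (simp add: in_keys_iff power_0_left)
  then have "mon (\<lambda>_. 0 :: 'k) t = 0" unfolding mon_def using i by (meson finite_keys prod_zero)
  then show ?thesis using False by simp
qed simp

lemma ev_zero: "ev (\<lambda>_. 0) f = Poly_Mapping.lookup f (0 :: nat \<Rightarrow>\<^sub>0 nat)" for f :: "'k::comm_ring_1 mpoly"
proof -
  have "ev (\<lambda>_. 0) f = (\<Sum>t\<in>Poly_Mapping.keys f. if t = 0 then Poly_Mapping.lookup f 0 else 0)"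
    unfolding mpoly_eval_mon mon_zero by (rule sum.cong) simp_all
  then show ?thesis by (simp add: in_keys_iff)
qed

definition dk :: "nat \<Rightarrow> 'k::comm_ring_1 mpoly \<Rightarrow> 'k mpoly" where
  "dk k f = (\<Sum>t\<in>Poly_Mapping.keys f.
     Poly_Mapping.single (t - Poly_Mapping.single k 1) (of_nat (Poly_Mapping.lookup t k) * Poly_Mapping.lookup f t))"

lemma minus_single_eq:
  fixes t u :: "nat \<Rightarrow>\<^sub>0 nat"
  assumes "Poly_Mapping.lookup t k > 0"
  shows "t - Poly_Mapping.single k 1 = u \<longleftrightarrow> t = u + Poly_Mapping.single k 1"
proof
  assume "t - Poly_Mapping.single k 1 = u"
  then have u: "Poly_Mapping.lookup u i = Poly_Mapping.lookup t i - Poly_Mapping.lookup (Poly_Mapping.single k 1) i" for i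
    by (auto simp: minus_poly_mapping.rep_eq)
  show "t = u + Poly_Mapping.single k 1"
    by (rule poly_mapping_eqI) (use assms in \<open>auto simp: lookup_add u lookup_single when_def\<close>)
qed simp

lemma lookup_dk:
  "Poly_Mapping.lookup (dk k f) u =
    of_nat (Poly_Mapping.lookup u k + 1) * Poly_Mapping.lookup f (u + Poly_Mapping.single k 1)"
proof -
  let ?u = "u + Poly_Mapping.single k 1"
  have "Poly_Mapping.lookup (dk k f) u = (\<Sum>t\<in>Poly_Mapping.keys f.
      if t = ?u then of_nat (Poly_Mapping.lookup ?u k) * Poly_Mapping.lookup f ?u else 0)"
    unfolding dk_def lookup_sum
  proof (rule sum.cong[OF refl])
    fix t
    show "Poly_Mapping.lookup (Poly_Mapping.single (t - Poly_Mapping.single k 1)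
        (of_nat (Poly_Mapping.lookup t k) * Poly_Mapping.lookup f t)) u =
      (if t = ?u then of_nat (Poly_Mapping.lookup ?u k) * Poly_Mapping.lookup f ?u else 0)"
    proof (cases "Poly_Mapping.lookup t k = 0")
      case True
      then have "t \<noteq> ?u" by (auto simp: lookup_add)
      then show ?thesis using True by simp
    next
      case False
      then show ?thesis using minus_single_eq[of t k u] by (auto simp: lookup_single when_def)
    qed
  qed
  also have "\<dots> = of_nat (Poly_Mapping.lookup ?u k) * Poly_Mapping.lookup f ?u"
    by (simp add: in_keys_iff)
  finally show ?thesis by (simp add: lookup_add)
qed

lemma coeff_linear_power:
  fixes x :: "'a::comm_ring_1"
  shows "coeff ([:x, 1:] ^ n) 0 = x ^ n \<and> coeff ([:x, 1:] ^ n) 1 = of_nat n * x ^ (n - 1)"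
proof (induction n)
  case (Suc n)
  have c: "coeff ([:x, 1:] * p) 0 = x * coeff p 0" "coeff ([:x, 1:] * p) 1 = x * coeff p 1 + coeff p 0" for p
    by simp_all
  show ?case
  proof (cases n)
    case 0
    then show ?thesis by simp
  next
    case (Suc k)
    show ?thesis unfolding power_Suc[of "[:x, 1:]" n] c
      using Suc.IH unfolding Suc by (simp add: algebra_simps)
  qed
qed simp

text \<open>The linear coefficient of a shift in one variable is the partial derivative, so the
  functional equation of a representation can be differentiated by comparing coefficients.\<close>

lemma coeff_direction:
  fixes f :: "'k::comm_ring_1 mpoly"
  shows "coeff (mpoly_eval (\<lambda>c. [:c:]) (\<lambda>i. if i = k then [:a i, 1:] else [:a i:]) f) 1 = ev a (dk k f)"
proof -
  let ?s = "\<lambda>i. if i = k then [:a i, 1:] else [:a i:]"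
  have m: "coeff (mon ?s t) 1 = of_nat (Poly_Mapping.lookup t k) * mon a (t - Poly_Mapping.single k 1)" for t
  proof -
    define n where "n = Poly_Mapping.lookup t k"
    define u where "u = t - Poly_Mapping.single k n"
    have lu: "Poly_Mapping.lookup u i = (if i = k then 0 else Poly_Mapping.lookup t i)" for i
      by (auto simp: u_def n_def minus_poly_mapping.rep_eq lookup_single when_def)
    have t: "t = u + Poly_Mapping.single k n"
      by (rule poly_mapping_eqI) (auto simp: lookup_add lu lookup_single when_def n_def)
    have h: "comm_ring_hom (\<lambda>c::'k. [:c:])" by unfold_locales (auto simp: one_pCons)
    have "mon ?s u = mon (\<lambda>i. [:a i:]) u" by (rule mon_cong) (auto simp: in_keys_iff lu)
    also have "\<dots> = [:mon a u:]" by (rule mon_hom[OF h, symmetric])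
    finally have "mon ?s t = [:mon a u:] * [:a k, 1:] ^ n" by (subst t) (simp add: mon_add)
    then have c: "coeff (mon ?s t) 1 = mon a u * (of_nat n * a k ^ (n - 1))"
      using coeff_linear_power[of "a k" n] by simp
    show ?thesis
    proof (cases "n = 0")
      case True
      then show ?thesis using c by (simp add: n_def)
    next
      case False
      have "t - Poly_Mapping.single k 1 = u + Poly_Mapping.single k (n - 1)"
        by (rule poly_mapping_eqI)
          (use False in \<open>auto simp: minus_poly_mapping.rep_eq lookup_add lu lookup_single when_def n_def\<close>)
      then show ?thesis using c by (simp add: mon_add n_def ac_simps)
    qed
  qed
  have "coeff (mpoly_eval (\<lambda>c. [:c:]) ?s f) 1 =
      (\<Sum>t\<in>Poly_Mapping.keys f. Poly_Mapping.lookup f t * coeff (mon ?s t) 1)"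
    unfolding mpoly_eval_mon by (simp add: coeff_sum)
  also have "\<dots> = ev a (dk k f)"
    unfolding dk_def ev_sum m by (simp add: mpoly_eval_single ac_simps)
  finally show ?thesis .
qed

text \<open>The multi-index factorial t!, which converts Taylor coefficients into derivatives at the
  origin.\<close>

definition tf :: "(nat \<Rightarrow>\<^sub>0 nat) \<Rightarrow> 'k::field_char_0" where
  "tf t = (\<Prod>i\<in>Poly_Mapping.keys t. fact (Poly_Mapping.lookup t i))"

lemma tf_superset:
  "finite A ==> Poly_Mapping.keys t \<subseteq> A ==> tf t = (\<Prod>i\<in>A. fact (Poly_Mapping.lookup t i))"
  unfolding tf_def by (rule prod.mono_neutral_left) (auto simp: in_keys_iff)

lemma tf_single: "tf (Poly_Mapping.single k q) = fact q"
  by (simp add: tf_superset[of "{k}"])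

lemma tf_step: "tf (t + Poly_Mapping.single k 1) = of_nat (Poly_Mapping.lookup t k + 1) * (tf t :: 'k::field_char_0)"
proof -
  let ?A = "insert k (Poly_Mapping.keys t)"
  have "Poly_Mapping.keys (t + Poly_Mapping.single k 1) \<subseteq> ?A"
    using Poly_Mapping.keys_add[of t "Poly_Mapping.single k 1"] by auto
  then have "tf (t + Poly_Mapping.single k 1) = (\<Prod>i\<in>?A. fact (Poly_Mapping.lookup (t + Poly_Mapping.single k 1) i) :: 'k)"
    by (intro tf_superset) auto
  also have "\<dots> = fact (Suc (Poly_Mapping.lookup t k)) * (\<Prod>i\<in>?A - {k}. fact (Poly_Mapping.lookup t i))"
    by (subst prod.remove[of _ k]) (auto simp: lookup_add lookup_single when_def intro!: prod.cong)
  also have "\<dots> = of_nat (Poly_Mapping.lookup t k + 1) * (\<Prod>i\<in>?A. fact (Poly_Mapping.lookup t i))"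
    by (subst (2) prod.remove[of _ k]) (auto simp: ac_simps)
  also have "(\<Prod>i\<in>?A. fact (Poly_Mapping.lookup t i)) = (tf t :: 'k)" by (rule tf_superset[symmetric]) auto
  finally show ?thesis .
qed

lemma monomial_induct [case_names zero step]:
  fixes s :: "nat \<Rightarrow>\<^sub>0 nat"
  assumes "Q 0" "\<And>s k. Q s ==> Q (s + Poly_Mapping.single k 1)"
  shows "Q s"
proof (induction "wsum (\<lambda>_. 1) s" arbitrary: s rule: less_induct)
  case less
  show ?case
  proof (cases "s = 0")
    case False
    then obtain k where k: "k \<in> Poly_Mapping.keys s" by (metis Poly_Mapping.keys_eq_empty ex_in_conv)
    define s' where "s' = s - Poly_Mapping.single k 1"
    have s: "s = s' + Poly_Mapping.single k 1"
      using minus_single_eq[of s k s'] k by (simp add: s'_def in_keys_iff)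
    let ?A = "Poly_Mapping.keys s \<union> Poly_Mapping.keys s'"
    have "wsum (\<lambda>_. 1) s = (\<Sum>i\<in>?A. Poly_Mapping.lookup s i)" by (simp add: wsum_superset[of ?A])
    also have "\<dots> > (\<Sum>i\<in>?A. Poly_Mapping.lookup s' i)"
    proof (rule sum_strict_mono_ex1)
      have li: "Poly_Mapping.lookup s i = Poly_Mapping.lookup s' i + (if i = k then 1 else 0)" for i
        by (subst s) (auto simp: lookup_add lookup_single when_def)
      show "\<forall>i\<in>?A. Poly_Mapping.lookup s' i \<le> Poly_Mapping.lookup s i" by (simp add: li)
      show "\<exists>i\<in>?A. Poly_Mapping.lookup s' i < Poly_Mapping.lookup s i"
        by (rule bexI[of _ k]) (use k in \<open>simp_all add: li\<close>)
    qed simp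
    also have "(\<Sum>i\<in>?A. Poly_Mapping.lookup s' i) = wsum (\<lambda>_. 1) s'" by (simp add: wsum_superset[of ?A])
    finally have "Q s'" by (rule less)
    then show ?thesis using assms(2) s by metis
  qed (use assms(1) in simp)
qed

locale poly_rep =
  fixes m N :: nat and P :: "nat \<Rightarrow> nat \<Rightarrow> 'k::field_char_0 mpoly"
  assumes rep: "linear_rep m N P" and N_gt0: "N > 0"
begin

lemma vars_P: "i < N ==> j < N ==> vars (P i j) \<subseteq> {..<m}"
  using rep unfolding linear_rep_def by blast

lemma rep_entry:
  "i < N ==> j < N ==> rep_at N P (vec m a) $$ (i, j) = ev a (P i j)"
  by (simp add: rep_at_def eval_at_vec[OF vars_P])

lemma rep_sum_entry:
  assumes "i < N" "j < N"
  shows "ev (\<lambda>i. a i + b i) (P i j) = (\<Sum>l<N. ev a (P i l) * ev b (P l j))"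
proof -
  have "vec m (\<lambda>i. a i + b i) = vec m a + vec m b" by (intro eq_vecI) auto
  moreover have "rep_at N P (vec m a + vec m b) = rep_at N P (vec m a) * rep_at N P (vec m b)"
    using rep unfolding linear_rep_def by auto
  ultimately have "rep_at N P (vec m (\<lambda>i. a i + b i)) $$ (i, j) = (rep_at N P (vec m a) * rep_at N P (vec m b)) $$ (i, j)"
    by simp
  also have "\<dots> = (\<Sum>l<N. rep_at N P (vec m a) $$ (i, l) * rep_at N P (vec m b) $$ (l, j))"
    using assms by (simp add: scalar_prod_def atLeast0LessThan)
  finally show ?thesis using assms by (simp add: rep_entry)
qed

lemma rep_zero_entry:
  assumes "i < N" "j < N"
  shows "Poly_Mapping.lookup (P i j) 0 = (if i = j then 1 else 0)"
proof -
  have "vec m (\<lambda>_. 0 :: 'k) = 0\<^sub>v m" by auto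
  then have "rep_at N P (vec m (\<lambda>_. 0)) = 1\<^sub>m N" using rep unfolding linear_rep_def by simp
  then show ?thesis using rep_entry[OF assms, of "\<lambda>_. 0"] assms by (simp add: ev_zero)
qed

text \<open>The differential equation \<open>\<partial>\<^sub>k P = P N\<^sub>k\<close> of the representation.\<close>

lemma rep_derivative:
  assumes ij: "i < N" "j < N"
  shows "of_nat (Poly_Mapping.lookup t k + 1) * Poly_Mapping.lookup (P i j) (t + Poly_Mapping.single k 1) =
    (\<Sum>l<N. Poly_Mapping.lookup (P i l) t * Poly_Mapping.lookup (P l j) (Poly_Mapping.single k 1))"
proof -
  let ?e = "Poly_Mapping.single k (1::nat)"
  define q where "q a f = mpoly_eval (\<lambda>c. [:c:]) (\<lambda>i. if i = k then [:a i, 1:] else [:a i:]) f"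
    for a and f :: "'k mpoly"
  have pq: "poly (q a f) t = ev (\<lambda>i. a i + (if i = k then t else 0)) f" for a f t
  proof -
    have h: "comm_ring_hom (\<lambda>p. poly p t)" by unfold_locales auto
    have "poly (q a f) t = mpoly_eval (\<lambda>c. poly [:c:] t) (\<lambda>i. poly (if i = k then [:a i, 1:] else [:a i:]) t) f"
      unfolding q_def by (rule mpoly_eval_comp[OF h])
    also have "(\<lambda>i. poly (if i = k then [:a i, 1:] else [:a i:]) t) = (\<lambda>i. a i + (if i = k then t else 0))"
      by (rule ext) simp
    finally show ?thesis by simp
  qed
  have key: "ev a (dk k (P i j)) = (\<Sum>l<N. ev a (P i l) * Poly_Mapping.lookup (P l j) ?e)" for a
  proof -
    have "poly (q a (P i j)) t = poly (\<Sum>l<N. [:ev a (P i l):] * q (\<lambda>_. 0) (P l j)) t" for t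
    proof -
      have "poly (q a (P i j)) t = (\<Sum>l<N. ev a (P i l) * ev (\<lambda>i. if i = k then t else 0) (P l j))"
        unfolding pq by (rule rep_sum_entry[OF ij])
      then show ?thesis by (simp add: poly_sum pq)
    qed
    then have "q a (P i j) = (\<Sum>l<N. [:ev a (P i l):] * q (\<lambda>_. 0) (P l j))"
      unfolding poly_eq_poly_eq_iff[symmetric] by (rule ext)
    then have "coeff (q a (P i j)) 1 = (\<Sum>l<N. ev a (P i l) * coeff (q (\<lambda>_. 0) (P l j)) 1)"
      by (simp add: coeff_sum)
    then show ?thesis unfolding q_def coeff_direction ev_zero lookup_dk by simp
  qed
  have "dk k (P i j) = (\<Sum>l<N. P i l * mpoly_const (Poly_Mapping.lookup (P l j) ?e))"
    by (rule mpoly_eqI) (simp add: key)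
  then have "Poly_Mapping.lookup (dk k (P i j)) t =
      (\<Sum>l<N. Poly_Mapping.lookup (P i l * mpoly_const (Poly_Mapping.lookup (P l j) ?e)) t)"
    by (simp add: lookup_sum)
  moreover have "Poly_Mapping.lookup (f * mpoly_const c) t = Poly_Mapping.lookup f t * c" for f :: "'k mpoly" and c
  proof -
    have "f * mpoly_const c = (\<Sum>u\<in>Poly_Mapping.keys f. Poly_Mapping.single u (Poly_Mapping.lookup f u * c))"
      by (subst (1) mpoly_sum_single) (simp add: sum_distrib_right mpoly_const_def mult_single)
    then show ?thesis by (simp add: lookup_sum lookup_single when_def in_keys_iff)
  qed
  ultimately show ?thesis unfolding lookup_dk by simp
qed

text \<open>The derivative of order \<open>t\<close> of an entry of \<open>P\<close> at the origin.
  By \<open>ec_step\<close> it is the entry of the monomial with exponent \<open>t\<close> in the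
  matrices N_k, the first derivatives of \<open>P\<close> at the origin.\<close>

definition ec :: "(nat \<Rightarrow>\<^sub>0 nat) \<Rightarrow> nat \<Rightarrow> nat \<Rightarrow> 'k" where
  "ec t i j = tf t * Poly_Mapping.lookup (P i j) t"

lemma ec_step:
  assumes "i < N" "j < N"
  shows "ec (t + Poly_Mapping.single k 1) i j = (\<Sum>l<N. ec t i l * ec (Poly_Mapping.single k 1) l j)"
proof -
  have "ec (t + Poly_Mapping.single k 1) i j =
      tf t * (of_nat (Poly_Mapping.lookup t k + 1) * Poly_Mapping.lookup (P i j) (t + Poly_Mapping.single k 1))"
    unfolding ec_def tf_step by (simp only: ac_simps)
  also have "\<dots> = (\<Sum>l<N. ec t i l * ec (Poly_Mapping.single k 1) l j)"
    unfolding rep_derivative[OF assms] ec_def tf_single sum_distrib_left by (simp add: ac_simps)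
  finally show ?thesis .
qed

lemma ec_0: "i < N ==> j < N ==> ec 0 i j = (if i = j then 1 else 0)"
  by (simp add: ec_def rep_zero_entry tf_def)

text \<open>Since \<open>t + s = s + t\<close>, this also contains that the matrices N_k
  commute.\<close>

lemma ec_add:
  assumes "i < N" "j < N"
  shows "ec (t + s) i j = (\<Sum>l<N. ec t i l * ec s l j)"
  using assms(2)
proof (induction s arbitrary: j rule: monomial_induct)
  case zero
  have "(\<Sum>l<N. ec t i l * ec 0 l j) = (\<Sum>l<N. if l = j then ec t i l else 0)"
    by (rule sum.cong) (use zero in \<open>auto simp: ec_0\<close>)
  then show ?case using zero by simp
next
  case (step s k)
  let ?e = "Poly_Mapping.single k (1::nat)"
  have "ec (t + (s + ?e)) i j = (\<Sum>r<N. ec (t + s) i r * ec ?e r j)"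
    unfolding add.assoc[symmetric] by (rule ec_step[OF assms(1) step.prems])
  also have "\<dots> = (\<Sum>r<N. \<Sum>l<N. ec t i l * (ec s l r * ec ?e r j))"
    by (rule sum.cong) (simp_all add: step.IH sum_distrib_right mult.assoc)
  also have "\<dots> = (\<Sum>l<N. ec t i l * (\<Sum>r<N. ec s l r * ec ?e r j))"
    unfolding sum_distrib_left by (rule sum.swap)
  also have "\<dots> = (\<Sum>l<N. ec t i l * ec (s + ?e) l j)"
    by (rule sum.cong[OF refl]) (simp only: ec_step[OF _ step.prems] lessThan_iff)
  finally show ?case .
qed

definition er :: "nat \<Rightarrow> nat \<Rightarrow> 'k mpoly \<Rightarrow> 'k" where
  "er i j p = (\<Sum>t\<in>Poly_Mapping.keys p. Poly_Mapping.lookup p t * ec t i j)"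

lemma er_superset:
  "finite A ==> Poly_Mapping.keys p \<subseteq> A ==> er i j p = (\<Sum>t\<in>A. Poly_Mapping.lookup p t * ec t i j)"
  unfolding er_def by (rule sum.mono_neutral_left) (auto simp: in_keys_iff)

lemma er_add: "er i j (p + q) = er i j p + er i j q"
proof -
  let ?A = "Poly_Mapping.keys p \<union> Poly_Mapping.keys q"
  have "Poly_Mapping.keys (p + q) \<subseteq> ?A" by (rule Poly_Mapping.keys_add)
  then show ?thesis by (simp add: er_superset[of ?A] lookup_add distrib_right sum.distrib)
qed

lemma er_0 [simp]: "er i j 0 = 0" by (simp add: er_def)

lemma er_sum: "finite A ==> er i j (\<Sum>x\<in>A. F x) = (\<Sum>x\<in>A. er i j (F x))"
  by (induction A rule: finite_induct) (simp_all add: er_add)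

lemma er_single: "er i j (Poly_Mapping.single t k) = k * ec t i j"
  by (cases "k = 0") (simp_all add: er_def)

lemma er_mult:
  assumes "i < N" "j < N"
  shows "er i j (p * q) = (\<Sum>l<N. er i l p * er l j q)"
proof -
  let ?s = "\<lambda>p t. Poly_Mapping.single t (Poly_Mapping.lookup p t)"
  have "p * q = (\<Sum>t\<in>Poly_Mapping.keys p. \<Sum>u\<in>Poly_Mapping.keys q. ?s p t * ?s q u)"
    unfolding sum_product[symmetric] by (rule arg_cong2[of _ _ _ _ "(*)"]; rule mpoly_sum_single)
  then have "er i j (p * q) = (\<Sum>t\<in>Poly_Mapping.keys p. \<Sum>u\<in>Poly_Mapping.keys q.
      Poly_Mapping.lookup p t * Poly_Mapping.lookup q u * ec (t + u) i j)"
    by (simp add: er_sum mult_single er_single)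
  also have "\<dots> = (\<Sum>t\<in>Poly_Mapping.keys p. \<Sum>u\<in>Poly_Mapping.keys q. \<Sum>l<N.
      (Poly_Mapping.lookup p t * ec t i l) * (Poly_Mapping.lookup q u * ec u l j))"
    by (intro sum.cong refl) (simp add: ec_add[OF assms] sum_distrib_left ac_simps)
  also have "\<dots> = (\<Sum>t\<in>Poly_Mapping.keys p. \<Sum>l<N. \<Sum>u\<in>Poly_Mapping.keys q.
      (Poly_Mapping.lookup p t * ec t i l) * (Poly_Mapping.lookup q u * ec u l j))"
    by (rule sum.cong[OF refl]) (rule sum.swap)
  also have "\<dots> = (\<Sum>l<N. \<Sum>t\<in>Poly_Mapping.keys p. \<Sum>u\<in>Poly_Mapping.keys q.
      (Poly_Mapping.lookup p t * ec t i l) * (Poly_Mapping.lookup q u * ec u l j))"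
    by (rule sum.swap)
  also have "\<dots> = (\<Sum>l<N. er i l p * er l j q)"
    unfolding er_def sum_product ..
  finally show ?thesis .
qed

text \<open>Evaluation of a polynomial at the commuting matrices N_k. It presents the generated
  algebra as the polynomial ring modulo the kernel \<open>JR\<close>.\<close>

definition evr :: "'k mpoly \<Rightarrow> 'k mat" where "evr p = mat N N (\<lambda>(i, j). er i j p)"

lemma evr_carrier [simp]: "evr p \<in> carrier_mat N N" by (simp add: evr_def)

lemma evr_add: "evr (p + q) = evr p + evr q" by (intro eq_matI) (simp_all add: evr_def er_add)

lemma evr_mult: "evr (p * q) = evr p * evr q"
  by (intro eq_matI) (simp_all add: evr_def er_mult scalar_prod_def atLeast0LessThan)

lemma evr_const: "evr (mpoly_const k) = k \<cdot>\<^sub>m 1\<^sub>m N"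
  by (intro eq_matI) (simp_all add: evr_def mpoly_const_def er_single ec_0)

lemma evr_smult: "evr (mpoly_const k * p) = k \<cdot>\<^sub>m evr p"
  unfolding evr_mult evr_const
  by (simp add: mult_smult_assoc_mat[OF one_carrier_mat evr_carrier] left_mult_one_mat[OF evr_carrier])

lemma evr_1: "evr 1 = 1\<^sub>m N"
  using evr_const[of 1] by simp

lemma evr_0: "evr 0 = 0\<^sub>m N N"
  by (intro eq_matI) (simp_all add: evr_def)

lemma evr_eq_iff: "evr p = evr q \<longleftrightarrow> (\<forall>i<N. \<forall>j<N. er i j p = er i j q)"
proof
  assume e: "evr p = evr q"
  have "er i j p = er i j q" if "i < N" "j < N" for i j
    using arg_cong[OF e, of "\<lambda>A. A $$ (i, j)"] that by (simp add: evr_def)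
  then show "\<forall>i<N. \<forall>j<N. er i j p = er i j q" by blast
next
  assume "\<forall>i<N. \<forall>j<N. er i j p = er i j q"
  then show "evr p = evr q" by (intro eq_matI) (simp_all add: evr_def)
qed

text \<open>Any number above the total degrees of the monomials of \<open>P\<close> serves as
  nilpotency index; a sum takes the place of a maximum.\<close>

definition D :: nat where
  "D = Suc (\<Sum>i<N. \<Sum>j<N. \<Sum>t\<in>Poly_Mapping.keys (P i j). wsum (\<lambda>_. 1) t)"

lemma wsum_less_D:
  assumes "i < N" "j < N" "t \<in> Poly_Mapping.keys (P i j)"
  shows "wsum (\<lambda>_. 1) t < D"
proof -
  have "wsum (\<lambda>_. 1) t \<le> (\<Sum>t\<in>Poly_Mapping.keys (P i j). wsum (\<lambda>_. 1) t)"
    by (rule member_le_sum) (use assms in auto)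
  also have "\<dots> \<le> (\<Sum>j<N. \<Sum>t\<in>Poly_Mapping.keys (P i j). wsum (\<lambda>_. 1) t)"
    by (rule member_le_sum[of j "{..<N}" "\<lambda>j. \<Sum>t\<in>Poly_Mapping.keys (P i j). wsum (\<lambda>_. 1) t"]) (use assms in auto)
  also have "\<dots> \<le> (\<Sum>i<N. \<Sum>j<N. \<Sum>t\<in>Poly_Mapping.keys (P i j). wsum (\<lambda>_. 1) t)"
    by (rule member_le_sum[of i "{..<N}" "\<lambda>i. \<Sum>j<N. \<Sum>t\<in>Poly_Mapping.keys (P i j). wsum (\<lambda>_. 1) t"]) (use assms in auto)
  finally show ?thesis by (simp add: D_def)
qed

lemma wsum_add: "wsum w (t + u) = wsum w t + wsum w u"
proof -
  let ?A = "Poly_Mapping.keys t \<union> Poly_Mapping.keys u"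
  have "Poly_Mapping.keys (t + u) \<subseteq> ?A" by (rule Poly_Mapping.keys_add)
  then show ?thesis by (simp add: wsum_superset[of ?A] lookup_add distrib_left sum.distrib)
qed

lemma keys_power_wsum:
  assumes "Poly_Mapping.lookup p 0 = 0" "t \<in> Poly_Mapping.keys (p ^ k)"
  shows "k \<le> wsum (\<lambda>_. 1) t"
  using assms(2)
proof (induction k arbitrary: t)
  case (Suc k)
  then obtain a b where ab: "t = a + b" "a \<in> Poly_Mapping.keys p" "b \<in> Poly_Mapping.keys (p ^ k)"
    using Poly_Mapping.keys_mult[of p "p ^ k"] by auto
  have "a \<noteq> 0" using ab(2) assms(1) by (auto simp: in_keys_iff)
  then have "wsum (\<lambda>_. 1) a \<noteq> 0" using wsum_1_eq_0 by blast
  then show ?case using Suc.IH[OF ab(3)] unfolding ab(1) wsum_add by simp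
qed simp

definition JR :: "'k mpoly set" where "JR = {p. evr p = 0\<^sub>m N N}"

text \<open>A \<open>D\<close>-th power of a polynomial without constant term has only monomials of
  degree at least \<open>D\<close>, and these do not occur in the entries of
  \<open>P\<close>.\<close>

lemma nilpotent:
  assumes "ev (\<lambda>_. 0) p = 0" shows "evr (p ^ D) = 0\<^sub>m N N"
  unfolding evr_0[symmetric] evr_eq_iff
proof (intro allI impI)
  fix i j assume ij: "i < N" "j < N"
  have "er i j (p ^ D) = 0"
    unfolding er_def
  proof (rule sum.neutral, rule ballI)
    fix t assume "t \<in> Poly_Mapping.keys (p ^ D)"
    then have "D \<le> wsum (\<lambda>_. 1) t" by (rule keys_power_wsum[OF assms[unfolded ev_zero]])
    then have "t \<notin> Poly_Mapping.keys (P i j)" using wsum_less_D[OF ij, of t] leD by blast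
    then show "Poly_Mapping.lookup (p ^ D) t * ec t i j = 0" by (simp add: ec_def in_keys_iff)
  qed
  then show "er i j (p ^ D) = er i j 0" by simp
qed

sublocale nil_alg mpoly_const "ev (\<lambda>_. 0 :: 'k)" JR D
proof (intro nil_alg.intro)
  show "comm_ring_hom (mpoly_const :: 'k \<Rightarrow> _)" by (rule const_hom)
  show "comm_ring_hom (ev (\<lambda>_. 0 :: 'k))" by (rule ev_hom)
  show "1 \<notin> JR"
  proof
    assume "1 \<in> JR"
    then have "1\<^sub>m N = (0\<^sub>m N N :: 'k mat)" by (simp add: JR_def evr_1)
    then have "1\<^sub>m N $$ (0, 0) = (0\<^sub>m N N :: 'k mat) $$ (0, 0)" by simp
    then show False using N_gt0 by simp
  qed
  show "r * a \<in> JR" if "a \<in> JR" for r a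
    using that right_mult_zero_mat[OF evr_carrier, of r N] by (simp add: JR_def evr_mult)
qed (simp_all add: JR_def evr_0 evr_add nilpotent)

lemma eqv_evr: "eqv p q \<longleftrightarrow> evr p = evr q"
proof -
  have "evr (p - q) = 0\<^sub>m N N \<longleftrightarrow> evr p = evr q"
  proof -
    have "er i j (p - q) = er i j p - er i j q" for i j
      using er_add[of i j "p - q" q] by simp
    then show ?thesis unfolding evr_0[symmetric] evr_eq_iff by simp
  qed
  then show ?thesis unfolding eqv_def by (simp add: JR_def)
qed

section \<open>The representation as an exponential, and the algebra it generates\<close>

definition ell :: "'k vec \<Rightarrow> 'k mpoly" where "ell a = (\<Sum>k<m. mpoly_const (a $ k) * mpoly_var k)"

lemma single_power: "(mpoly_const s * mpoly_var k) ^ q = Poly_Mapping.single (Poly_Mapping.single k q) (s ^ q :: 'k)"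
proof (induction q)
  case (Suc q)
  have "mpoly_const s * mpoly_var k = Poly_Mapping.single (Poly_Mapping.single k 1) s"
    by (simp add: mpoly_const_def mpoly_var_def mult_single)
  then show ?case using Suc by (simp add: mult_single single_add[symmetric])
qed simp

lemma const_times_single:
  "mpoly_const a * Poly_Mapping.single t b = Poly_Mapping.single t (a * b :: 'k)"
  by (simp add: mpoly_const_def mult_single)

text \<open>On a coordinate axis only the powers of one variable survive, and their coefficients are
  those of the exponential series.\<close>

lemma rep_axis:
  "evr (E (mpoly_const s * mpoly_var k)) = rep_at N P (vec m (\<lambda>i. if i = k then s else 0))"
proof (rule eq_matI)
  fix i j assume "i < dim_row (rep_at N P (vec m (\<lambda>i. if i = k then s else 0)))"
    "j < dim_col (rep_at N P (vec m (\<lambda>i. if i = k then s else 0)))"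
  then have ij: "i < N" "j < N" by simp_all
  let ?a = "\<lambda>i. if i = k then s else 0"
  have "er i j (E (mpoly_const s * mpoly_var k)) =
      (\<Sum>q<2*D. 1 / fact q * (s ^ q * ec (Poly_Mapping.single k q) i j))"
    unfolding E_def evf_def single_power
    by (simp add: er_sum const_times_single er_single)
  also have "\<dots> = (\<Sum>q<2*D. Poly_Mapping.lookup (P i j) (Poly_Mapping.single k q) * mon ?a (Poly_Mapping.single k q))"
    by (rule sum.cong) (simp_all add: ec_def tf_single)
  also have "\<dots> = (\<Sum>t\<in>Poly_Mapping.single k ` {..<2*D}. Poly_Mapping.lookup (P i j) t * mon ?a t)"
    by (subst sum.reindex) (auto intro: inj_on_subset[OF inj_single])
  also have "\<dots> = (\<Sum>t\<in>Poly_Mapping.keys (P i j). Poly_Mapping.lookup (P i j) t * mon ?a t)"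
  proof (rule sum.mono_neutral_cong)
    fix t assume t: "t \<in> Poly_Mapping.keys (P i j) - Poly_Mapping.single k ` {..<2*D}"
    have "\<exists>l. l \<noteq> k \<and> l \<in> Poly_Mapping.keys t"
    proof (rule ccontr)
      assume n: "\<not> (\<exists>l. l \<noteq> k \<and> l \<in> Poly_Mapping.keys t)"
      have eq: "t = Poly_Mapping.single k (Poly_Mapping.lookup t k)"
        by (rule poly_mapping_eqI) (use n in \<open>auto simp: lookup_single when_def in_keys_iff\<close>)
      have "wsum (\<lambda>_. 1) t < D" using wsum_less_D[OF ij] t by blast
      moreover have "wsum (\<lambda>_. 1) t = Poly_Mapping.lookup t k"
        by (subst eq) (simp add: wsum_def)
      ultimately have "t \<in> Poly_Mapping.single k ` {..<2*D}" using eq by (intro image_eqI[of _ _ "Poly_Mapping.lookup t k"]) auto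
      then show False using t by blast
    qed
    then obtain l where l: "l \<noteq> k" "l \<in> Poly_Mapping.keys t" by blast
    then have "?a l ^ Poly_Mapping.lookup t l = 0" by (simp add: in_keys_iff)
    then have "mon ?a t = 0" unfolding mon_def using l(2) by (meson finite_keys prod_zero)
    then show "Poly_Mapping.lookup (P i j) t * mon ?a t = 0" by simp
  qed (auto simp: in_keys_iff)
  also have "\<dots> = ev ?a (P i j)" by (simp add: mpoly_eval_mon)
  finally show "evr (E (mpoly_const s * mpoly_var k)) $$ (i, j) =
      rep_at N P (vec m ?a) $$ (i, j)"
    using ij by (simp add: evr_def rep_entry)
qed (simp_all add: evr_def)

text \<open>Both sides turn sums into products, so splitting \<open>a\<close> along the coordinate
  axes reduces the claim to \<open>rep_axis\<close>.\<close>

lemma rep_exp: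
  assumes a: "a \<in> carrier_vec m"
  shows "rep_at N P a = evr (E (ell a))"
proof -
  define h where "h r = vec m (\<lambda>i. if i < r then a $ i else 0)" for r
  have "rep_at N P (h r) = evr (E (\<Sum>k<r. mpoly_const (a $ k) * mpoly_var k))" if "r \<le> m" for r
    using that
  proof (induction r)
    case 0
    have "h 0 = 0\<^sub>v m" by (auto simp: h_def)
    then show ?case using rep unfolding linear_rep_def by (simp add: E_0 evr_1)
  next
    case (Suc r)
    let ?g = "vec m (\<lambda>i. if i = r then a $ r else 0)"
    have "h (Suc r) = h r + ?g" by (intro eq_vecI) (auto simp: h_def less_Suc_eq)
    then have "rep_at N P (h (Suc r)) = rep_at N P (h r) * rep_at N P ?g"
      using rep unfolding linear_rep_def by (simp add: h_def)
    also have "\<dots> = evr (E (\<Sum>k<r. mpoly_const (a $ k) * mpoly_var k)) * evr (E (mpoly_const (a $ r) * mpoly_var r))"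
      using Suc by (simp add: rep_axis)
    also have "\<dots> = evr (E (\<Sum>k<r. mpoly_const (a $ k) * mpoly_var k) * E (mpoly_const (a $ r) * mpoly_var r))"
      by (simp add: evr_mult)
    also have "\<dots> = evr (E ((\<Sum>k<r. mpoly_const (a $ k) * mpoly_var k) + mpoly_const (a $ r) * mpoly_var r))"
      unfolding eqv_evr[symmetric] by (rule eqv_sym, rule E_add) simp_all
    finally show ?case by simp
  qed
  moreover have "h m = a" using a by (intro eq_vecI) (auto simp: h_def)
  ultimately show ?thesis unfolding ell_def by (metis order.refl)
qed

lemma evr_ell:
  "evr (ell u) = rep_differential m N P u"
proof (rule eq_matI)
  fix i j assume "i < dim_row (rep_differential m N P u)" "j < dim_col (rep_differential m N P u)"
  then have ij: "i < N" "j < N" by (simp_all add: rep_differential_def)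
  have "er i j (ell u) = (\<Sum>k<m. u $ k * ec (Poly_Mapping.single k 1) i j)"
    unfolding ell_def er_sum[OF finite_lessThan]
    by (rule sum.cong) (simp_all add: mpoly_const_def mpoly_var_def mult_single er_single)
  then show "evr (ell u) $$ (i, j) = rep_differential m N P u $$ (i, j)"
    using ij by (simp add: evr_def rep_differential_def ec_def tf_single[of _ 1, simplified])
qed (simp_all add: evr_def rep_differential_def)

text \<open>The ambient ring has infinitely many variables; those from \<open>m\<close> on lie in
  the kernel.\<close>

lemma evr_var_outside:
  assumes "k \<ge> m" shows "evr (mpoly_var k) = 0\<^sub>m N N"
proof (rule eq_matI)
  fix i j assume "i < dim_row (0\<^sub>m N N :: 'k mat)" "j < dim_col (0\<^sub>m N N :: 'k mat)"
  then have ij: "i < N" "j < N" by simp_all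
  have "Poly_Mapping.single k 1 \<notin> Poly_Mapping.keys (P i j)"
  proof
    assume "Poly_Mapping.single k 1 \<in> Poly_Mapping.keys (P i j)"
    then have "k \<in> vars (P i j)" unfolding vars_def by force
    then show False using vars_P[OF ij] assms by auto
  qed
  then show "evr (mpoly_var k) $$ (i, j) = 0\<^sub>m N N $$ (i, j)"
    using ij by (simp add: evr_def mpoly_var_def er_single ec_def in_keys_iff)
qed (simp_all add: evr_def)

lemma generated_algebra_eq:
  "generated_algebra N (rep_differential m N P ` carrier_vec m) = range evr"
proof
  show "generated_algebra N (rep_differential m N P ` carrier_vec m) \<subseteq> range evr"
  proof
    fix A assume "A \<in> generated_algebra N (rep_differential m N P ` carrier_vec m)"
    then show "A \<in> range evr"
    proof induction
      case (gen A)
      then obtain u where "A = evr (ell u)" unfolding evr_ell by blast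
      then show ?case by blast
    next
      case one
      show ?case unfolding evr_1[symmetric] by blast
    next
      case (add A B)
      then obtain p q where "A = evr p" "B = evr q" by blast
      then have "A + B = evr (p + q)" by (simp add: evr_add)
      then show ?case by blast
    next
      case (mult A B)
      then obtain p q where "A = evr p" "B = evr q" by blast
      then have "A * B = evr (p * q)" by (simp add: evr_mult)
      then show ?case by blast
    next
      case (smult A k)
      then obtain p where "A = evr p" by blast
      then have "k \<cdot>\<^sub>m A = evr (mpoly_const k * p)" by (simp add: evr_smult)
      then show ?case by blast
    qed
  qed
  let ?G = "generated_algebra N (rep_differential m N P ` carrier_vec m)"
  have "evr p \<in> ?G" for p
  proof (induction p rule: mpoly_induct)
    case (const k)
    show ?case unfolding evr_const by (intro generated_algebra.smult generated_algebra.one)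
  next
    case (var k)
    show ?case
    proof (cases "k < m")
      case True
      have "ell (unit_vec m k) = (\<Sum>l<m. if l = k then mpoly_var k else 0)"
        unfolding ell_def by (rule sum.cong) (use True in auto)
      then have "ell (unit_vec m k) = mpoly_var k" using True by simp
      then have "evr (mpoly_var k) = rep_differential m N P (unit_vec m k)" using evr_ell by metis
      then show ?thesis by (metis generated_algebra.gen imageI unit_vec_carrier)
    next
      case False
      have "evr (mpoly_var k) = 0 \<cdot>\<^sub>m 1\<^sub>m N" using evr_var_outside[of k] evr_const[of 0] False evr_0 by simp
      then show ?thesis using generated_algebra.smult[OF generated_algebra.one] by metis
    qed
  next
    case (add p q)
    then show ?case unfolding evr_add by (rule generated_algebra.add)
  next
    case (mult p q)
    then show ?case unfolding evr_mult by (rule generated_algebra.mult)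
  qed
  then show "range evr \<subseteq> ?G" by blast
qed

end

section \<open>Linear changes of coordinates and non-degeneracy\<close>

lemma ev_linear_change:
  fixes f :: "'k::comm_ring_1 mpoly"
  shows "ev s (linear_change M f) = ev (\<lambda>i. \<Sum>j<dim_col M. M $$ (i, j) * s j) f"
proof -
  have "ev s (linear_change M f) = mpoly_eval (\<lambda>c. ev s (mpoly_const c))
      (\<lambda>i. ev s (\<Sum>j<dim_col M. mpoly_const (M $$ (i, j)) * mpoly_var j)) f"
    unfolding linear_change_def by (rule mpoly_eval_comp[OF ev_hom])
  then show ?thesis by simp
qed

lemma mat_vec_index:
  assumes "M \<in> carrier_mat N N" "v \<in> carrier_vec N" "i < N"
  shows "(M *\<^sub>v v) $ i = (\<Sum>j<N. M $$ (i, j) * v $ j)"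
  using assms by (simp add: scalar_prod_def atLeast0LessThan)

lemma eval_linear_change:
  fixes f :: "'k::comm_ring_1 mpoly"
  assumes M: "M \<in> carrier_mat N N" and f: "vars f \<subseteq> {..<N}" and v: "v \<in> carrier_vec N"
  shows "ev (($) v) (linear_change M f) = ev (($) (M *\<^sub>v v)) f"
  unfolding ev_linear_change
proof (rule mpoly_eval_cong)
  fix i assume "i \<in> vars f"
  then have "i < N" using f by auto
  then show "(\<Sum>j<dim_col M. M $$ (i, j) * v $ j) = (M *\<^sub>v v) $ i"
    using mat_vec_index[OF M v] M by simp
qed

lemma vars_linear_change: "vars (linear_change M (f :: 'k::comm_ring_1 mpoly)) \<subseteq> {..<dim_col M}"
proof -
  have r: "vars (\<Sum>j<dim_col M. mpoly_const (M $$ (i, j)) * mpoly_var j) \<subseteq> {..<dim_col M}" for i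
  proof (rule vars_subset_intros(5))
    fix j assume "j \<in> {..<dim_col M}"
    then show "vars (mpoly_const (M $$ (i, j)) * mpoly_var j) \<subseteq> {..<dim_col M}"
      by (intro vars_subset_intros(3)) simp_all
  qed
  show ?thesis
    unfolding linear_change_def mpoly_eval_mon mon_def
    by (rule vars_subset_intros(5), rule vars_subset_intros(3), simp,
        rule vars_subset_intros(6), rule vars_subset_intros(4), rule r)
qed

lemma mult_mat_zero_vec:
  fixes A :: "'a::comm_ring_1 mat"
  shows "A \<in> carrier_mat nr nc ==> A *\<^sub>v 0\<^sub>v nc = 0\<^sub>v nr"
  by (intro eq_vecI) (simp_all add: scalar_prod_def)

lemma zero_mat_mult_vec:
  fixes v :: "'a::comm_ring_1 vec"
  shows "v \<in> carrier_vec nc ==> 0\<^sub>m nr nc *\<^sub>v v = 0\<^sub>v nr"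
  by (intro eq_vecI) (simp_all add: scalar_prod_def)

lemma linear_change_const: "linear_change M (mpoly_const k) = mpoly_const (k :: 'k::comm_ring_1)"
  by (simp add: linear_change_def)

lemma mpoly_eq_on_carrier:
  fixes f g :: "'k::field_char_0 mpoly"
  assumes "vars f \<subseteq> {..<N}" "vars g \<subseteq> {..<N}"
    and "\<And>v. v \<in> carrier_vec N ==> ev (($) v) f = ev (($) v) g"
  shows "f = g"
proof (rule mpoly_eqI)
  fix s
  have "ev s f = ev (($) (vec N s)) f" by (rule mpoly_eval_cong) (use assms(1) in auto)
  also have "\<dots> = ev (($) (vec N s)) g" by (rule assms(3)) simp
  also have "\<dots> = ev s g" by (rule mpoly_eval_cong) (use assms(2) in auto)
  finally show "ev s f = ev s g" .
qed

lemma linear_change_inverse: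
  fixes f :: "'k::field_char_0 mpoly"
  assumes "M \<in> carrier_mat N N" "M' \<in> carrier_mat N N" "M * M' = 1\<^sub>m N" "vars f \<subseteq> {..<N}"
  shows "linear_change M' (linear_change M f) = f"
proof (rule mpoly_eq_on_carrier[of _ N])
  show "vars (linear_change M' (linear_change M f)) \<subseteq> {..<N}"
    using vars_linear_change[of M'] assms(2) by auto
  fix v :: "'k vec" assume v: "v \<in> carrier_vec N"
  have "vars (linear_change M f) \<subseteq> {..<N}" using vars_linear_change[of M] assms(1) by auto
  then have "ev (($) v) (linear_change M' (linear_change M f)) = ev (($) (M *\<^sub>v (M' *\<^sub>v v))) f"
    using eval_linear_change[OF assms(2) _ v] eval_linear_change[OF assms(1,4) mult_mat_vec_carrier[OF assms(2) v]]
    by simp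
  also have "M *\<^sub>v (M' *\<^sub>v v) = v"
    using assoc_mult_mat_vec[OF assms(1,2) v] assms(3) v by simp
  finally show "ev (($) v) (linear_change M' (linear_change M f)) = ev (($) v) f" .
qed (rule assms(4))

lemma linear_change_hom: "comm_ring_hom (linear_change M :: 'k::comm_ring_1 mpoly \<Rightarrow> _)"
  unfolding linear_change_def[abs_def] by (rule mpoly_eval_hom[OF const_hom])

text \<open>The factors of the transformed polynomial again use only the first \<open>N\<close>
  variables, so the inverse substitution applies to them and gives a factorization of
  \<open>f\<close>.\<close>

lemma irreducible_linear_change:
  fixes f :: "'k::field_char_0 mpoly"
  assumes M: "M \<in> carrier_mat N N" "M' \<in> carrier_mat N N" "M * M' = 1\<^sub>m N" "M' * M = 1\<^sub>m N"
    and f: "irreducible f" "vars f \<subseteq> {..<N}"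
  shows "irreducible (linear_change M f)"
proof -
  interpret l: comm_ring_hom "linear_change M' :: 'k mpoly \<Rightarrow> _" by (rule linear_change_hom)
  interpret l2: comm_ring_hom "linear_change M :: 'k mpoly \<Rightarrow> _" by (rule linear_change_hom)
  have inv: "linear_change M' (linear_change M f) = f" by (rule linear_change_inverse[OF M(1-3) f(2)])
  have vl: "vars (linear_change M f) \<subseteq> {..<N}" using vars_linear_change[of M] M(1) by auto
  have un: "a dvd 1" if a: "linear_change M' a dvd 1" "vars a \<subseteq> {..<N}" for a
  proof -
    obtain k where k: "k \<noteq> 0" "linear_change M' a = mpoly_const k" using a(1) by (rule is_unit_mpolyE)
    have "a = linear_change M (linear_change M' a)" using linear_change_inverse[OF M(2,1,4) a(2)] by simp
    also have "\<dots> = mpoly_const k" unfolding k(2) by (rule linear_change_const)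
    finally show ?thesis using is_unit_const[OF k(1)] by simp
  qed
  show ?thesis unfolding irreducible_def
  proof (intro conjI allI impI)
    show nz: "linear_change M f \<noteq> 0" using inv f(1) by auto
    show "\<not> linear_change M f dvd 1"
    proof
      assume "linear_change M f dvd 1"
      then have "linear_change M' (linear_change M f) dvd linear_change M' 1" by (elim dvdE) (metis dvdI l.hom_mult)
      then show False using inv f(1) by (simp add: irreducible_def)
    qed
    fix a b assume ab: "linear_change M f = a * b"
    then have "a \<noteq> 0" "b \<noteq> 0" using nz by auto
    then have v: "vars a \<subseteq> {..<N}" "vars b \<subseteq> {..<N}" using vars_mult_eq[of a b] vl ab by auto
    have "f = linear_change M' a * linear_change M' b" using inv ab by (simp add: l.hom_mult)
    then have "linear_change M' a dvd 1 \<or> linear_change M' b dvd 1" using irreducibleD[OF f(1)] by blast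
    then show "a dvd 1 \<or> b dvd 1" using un v by blast
  qed
qed

lemma homog_linear_change:
  fixes f :: "'k::field_char_0 mpoly"
  assumes "homog 0 n d f" "M \<in> carrier_mat (n + 1) (n + 1)"
  shows "homog 0 n d (linear_change M f)"
proof -
  let ?w = "ind 0 n"
  have l: "whomog ?w 1 (\<Sum>j<dim_col M. mpoly_const (M $$ (i, j)) * mpoly_var j)" for i
  proof (rule whomog_sum)
    fix j assume "j \<in> {..<dim_col M}"
    then have "?w j = 1" using assms(2) by (auto simp: ind_def)
    then show "whomog ?w 1 (mpoly_const (M $$ (i, j)) * mpoly_var j)"
      using whomog_mult[OF whomog_const[of ?w "M $$ (i, j)"] whomog_var[of ?w j]] by simp
  qed
  have m: "whomog ?w (wsum (\<lambda>_. 1) t) (mon (\<lambda>i. \<Sum>j<dim_col M. mpoly_const (M $$ (i, j)) * mpoly_var j) t)" for t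
  proof -
    have "whomog ?w (\<Sum>i\<in>A. Poly_Mapping.lookup t i)
        (\<Prod>i\<in>A. (\<Sum>j<dim_col M. mpoly_const (M $$ (i, j)) * mpoly_var j) ^ Poly_Mapping.lookup t i)"
      if "finite A" for A
      using that
    proof (induction A rule: finite_induct)
      case (insert i A)
      then show ?case using whomog_mult[OF whomog_power[OF l] insert.IH] by simp
    qed (simp add: whomog_1)
    then show ?thesis by (simp add: mon_def wsum_def)
  qed
  have "whomog ?w d (linear_change M f)"
    unfolding linear_change_def mpoly_eval_mon
  proof (rule whomog_sum)
    fix t assume t: "t \<in> Poly_Mapping.keys f"
    have kt: "Poly_Mapping.keys t \<subseteq> {..n}" using t assms(1) by (auto simp: homog_def vars_def)
    have "wsum (\<lambda>_. 1) t = (\<Sum>i\<in>{0..0+n}. Poly_Mapping.lookup t i)"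
      using wsum_superset[of "{0..0+n}" t "\<lambda>_. 1"] kt by (simp add: atMost_atLeast0)
    also have "\<dots> = d" using t assms(1) by (auto simp: homog_def)
    finally show "whomog ?w d (mpoly_const (Poly_Mapping.lookup f t) *
        mon (\<lambda>i. \<Sum>j<dim_col M. mpoly_const (M $$ (i, j)) * mpoly_var j) t)"
      using whomog_mult[OF whomog_const[of ?w "Poly_Mapping.lookup f t"] m[of t]] by simp
  qed
  moreover have "vars (linear_change M f) \<subseteq> {..0 + n}" using vars_linear_change[of M f] assms(2) by auto
  ultimately show ?thesis by (simp add: homog_iff)
qed

lemma not_in_vars_if_constant:
  fixes g :: "'k::field_char_0 mpoly"
  assumes "\<And>s a. ev (s(x := a)) g = ev s g"
  shows "x \<notin> vars g"
proof -
  have "g = coeff (up x g) 0"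
  proof (rule mpoly_eqI)
    fix s
    have "ev s g = ev (s(x := 0)) g" using assms by simp
    also have "\<dots> = coeff (\<Sum>i\<le>degree (up x g). monom (ev s (coeff (up x g) i)) i) 0"
      unfolding ev_up poly_0_coeff_0 ..
    also have "\<dots> = ev s (coeff (up x g) 0)" unfolding coeff_sum_monom_up by simp
    finally show "ev s g = ev s (coeff (up x g) 0)" .
  qed
  then show ?thesis using vars_coeff_up[of x g 0] by auto
qed

text \<open>A linear change removes a variable exactly when the form is invariant under translation
  along the corresponding column of the matrix. Invariance under translations is what the
  logarithmic equation can test.\<close>

lemma nondegenerate_iff:
  fixes f :: "'k::field_char_0 mpoly"
  assumes f: "vars f \<subseteq> {..n}"
  shows "nondegenerate n f \<longleftrightarrow>
    (\<forall>w\<in>carrier_vec (n + 1). w \<noteq> 0\<^sub>v (n + 1) --> (\<exists>v t. ev (\<lambda>j. v j + t * w $ j) f \<noteq> ev v f))"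
proof -
  let ?N = "n + 1"
  have vf: "vars f \<subseteq> {..<?N}" using f by auto
  show ?thesis
  proof (rule iffI)
    assume nd: "nondegenerate n f"
    show "\<forall>w\<in>carrier_vec ?N. w \<noteq> 0\<^sub>v ?N --> (\<exists>v t. ev (\<lambda>j. v j + t * w $ j) f \<noteq> ev v f)"
    proof (intro ballI impI, rule ccontr)
      fix w :: "'k vec" assume w: "w \<in> carrier_vec ?N" "w \<noteq> 0\<^sub>v ?N"
      assume "\<not> (\<exists>v t. ev (\<lambda>j. v j + t * w $ j) f \<noteq> ev v f)"
      then have inv: "ev (\<lambda>j. v j + t * w $ j) f = ev v f" for v t by blast
      obtain j0 where j0: "j0 < ?N" "w $ j0 \<noteq> 0" using nonzero_vec_entry[OF w] by blast
      \<comment> \<open>The identity with column \<open>j0\<close> replaced by \<open>w\<close>: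
        raising coordinate \<open>j0\<close> moves the argument along \<open>w\<close>. It is
        invertible because \<open>w $ j0\<close> is nonzero.\<close>
      define M where "M = mat ?N ?N (\<lambda>(i, j). if j = j0 then w $ i else if i = j then 1 else 0)"
      have M: "M \<in> carrier_mat ?N ?N" by (simp add: M_def)
      have Mi: "(\<Sum>j<?N. M $$ (i, j) * s j) = (if i = j0 then 0 else s i) + s j0 * w $ i" if "i < ?N" for i s
      proof -
        have "(\<Sum>j<?N. M $$ (i, j) * s j) = M $$ (i, j0) * s j0 + (\<Sum>j\<in>{..<?N} - {j0}. M $$ (i, j) * s j)"
          using j0 by (intro sum.remove) auto
        also have "(\<Sum>j\<in>{..<?N} - {j0}. M $$ (i, j) * s j) = (\<Sum>j\<in>{..<?N} - {j0}. if j = i then s i else 0)"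
          by (rule sum.cong) (use that in \<open>auto simp: M_def\<close>)
        also have "\<dots> = (if i = j0 then 0 else s i)" using that by auto
        finally show ?thesis using that j0 by (simp add: M_def)
      qed
      have "\<exists>B'\<in>carrier_mat ?N ?N. M * B' = 1\<^sub>m ?N \<and> B' * M = 1\<^sub>m ?N"
      proof (rule inverse_mat_exists[OF M])
        fix v :: "'k vec" assume v: "v \<in> carrier_vec ?N" "M *\<^sub>v v = 0\<^sub>v ?N"
        have e: "(if i = j0 then 0 else v $ i) + v $ j0 * w $ i = 0" if "i < ?N" for i
          using mat_vec_index[OF M v(1) that] Mi[OF that, of "($) v"] v(2) that by simp
        have "v $ j0 = 0" using e[OF j0(1)] j0(2) by simp
        then have "v $ i = 0" if "i < ?N" for i using e[OF that] by (cases "i = j0") simp_all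
        then show "v = 0\<^sub>v ?N" using v(1) by (intro eq_vecI) auto
      qed
      then obtain B' where B': "B' \<in> carrier_mat ?N ?N" "M * B' = 1\<^sub>m ?N" "B' * M = 1\<^sub>m ?N" by blast
      then have "invertible_mat M"
        unfolding invertible_mat_def inverts_mat_def using M by (intro conjI exI[of _ B']) auto
      moreover have "j0 \<notin> vars (linear_change M f)"
      proof (rule not_in_vars_if_constant)
        fix s :: "nat \<Rightarrow> 'k" and a :: 'k
        have e: "ev u (linear_change M f) = ev (\<lambda>i. (if i = j0 then 0 else u i) + u j0 * w $ i) f" for u
          unfolding ev_linear_change
        proof (rule mpoly_eval_cong)
          fix i assume "i \<in> vars f"
          then have "i < ?N" using vf by auto
          from Mi[OF this] show "(\<Sum>j<dim_col M. M $$ (i, j) * u j) = (if i = j0 then 0 else u i) + u j0 * w $ i"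
            using M by simp
        qed
        have p: "(\<lambda>i. (if i = j0 then 0 else (s(j0 := a)) i) + (s(j0 := a)) j0 * w $ i) =
            (\<lambda>i. (if i = j0 then 0 else s i) + a * w $ i)"
          by (rule ext) simp
        show "ev (s(j0 := a)) (linear_change M f) = ev s (linear_change M f)"
          unfolding e p inv[of "\<lambda>i. if i = j0 then 0 else s i" a]
            inv[of "\<lambda>i. if i = j0 then 0 else s i" "s j0"] by (rule refl)
      qed
      moreover have "vars (linear_change M f) \<subseteq> {..<?N}" using vars_linear_change[of M f] M by simp
      ultimately have "vars (linear_change M f) \<subset> {..<?N}" using j0 by auto
      then have "card (vars (linear_change M f)) < ?N" using psubset_card_mono[of "{..<?N}"] by simp
      then show False using nd M \<open>invertible_mat M\<close> unfolding nondegenerate_def by blast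
    qed
  next
    assume nd: "\<forall>w\<in>carrier_vec ?N. w \<noteq> 0\<^sub>v ?N --> (\<exists>v t. ev (\<lambda>j. v j + t * w $ j) f \<noteq> ev v f)"
    show "nondegenerate n f"
      unfolding nondegenerate_def
    proof (rule notI, elim bexE conjE)
      fix M :: "'k mat" assume M: "M \<in> carrier_mat ?N ?N" "invertible_mat M"
        and c: "card (vars (linear_change M f)) < ?N"
      obtain B where "inverts_mat M B" "inverts_mat B M"
        using M(2) unfolding invertible_mat_def by blast
      then have B: "M * B = 1\<^sub>m ?N" "B * M = 1\<^sub>m (dim_row B)"
        using M(1) by (simp_all add: inverts_mat_def)
      have dB: "dim_row B = ?N" "dim_col B = ?N"
        using arg_cong[OF B(2), of dim_col] arg_cong[OF B(1), of dim_col] M(1) by auto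
      then have Bc: "B \<in> carrier_mat ?N ?N" by auto
      have "\<exists>j0<?N. j0 \<notin> vars (linear_change M f)"
      proof (rule ccontr)
        assume "\<not> ?thesis"
        then have "{..<?N} \<subseteq> vars (linear_change M f)" by auto
        then have "card {..<?N} \<le> card (vars (linear_change M f))" by (rule card_mono[OF finite_vars])
        then show False using c by simp
      qed
      then obtain j0 where j0: "j0 < ?N" "j0 \<notin> vars (linear_change M f)" by blast
      \<comment> \<open>The column of the variable that is missing after the change.\<close>
      define w where "w = M *\<^sub>v unit_vec ?N j0"
      have w: "w \<in> carrier_vec ?N" unfolding w_def using M(1) by simp
      have "w \<noteq> 0\<^sub>v ?N"
      proof
        assume "w = 0\<^sub>v ?N"
        then have "B *\<^sub>v w = 0\<^sub>v ?N" using mult_mat_zero_vec[OF Bc] by simp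
        moreover have "B *\<^sub>v w = unit_vec ?N j0"
          unfolding w_def using assoc_mult_mat_vec[OF Bc M(1), of "unit_vec ?N j0"] B(2) dB by simp
        ultimately show False using j0 unit_vec_nonzero[of j0 ?N] by simp
      qed
      then obtain v t where neq: "ev (\<lambda>j. v j + t * w $ j) f \<noteq> ev v f" using nd w by blast
      define s where "s = B *\<^sub>v vec ?N v"
      have sc: "s \<in> carrier_vec ?N" unfolding s_def using Bc by simp
      have Ms: "M *\<^sub>v s = vec ?N v"
        unfolding s_def using assoc_mult_mat_vec[OF M(1) Bc, of "vec ?N v"] B(1) by simp
      let ?s = "s + t \<cdot>\<^sub>v unit_vec ?N j0"
      have s': "?s \<in> carrier_vec ?N" using sc by simp
      have Ms': "M *\<^sub>v ?s = vec ?N v + t \<cdot>\<^sub>v w"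
        unfolding w_def Ms[symmetric] using mult_add_distrib_mat_vec[OF M(1) sc, of "t \<cdot>\<^sub>v unit_vec ?N j0"]
          mult_mat_vec[OF M(1), of "unit_vec ?N j0" t] by simp
      have "ev (\<lambda>j. v j + t * w $ j) f = ev (($) (M *\<^sub>v ?s)) f"
        unfolding Ms' by (rule mpoly_eval_cong) (use vf w in auto)
      also have "\<dots> = ev (($) ?s) (linear_change M f)" by (rule eval_linear_change[OF M(1) vf s', symmetric])
      also have "\<dots> = ev (($) s) (linear_change M f)"
      proof (rule mpoly_eval_cong)
        fix i assume i: "i \<in> vars (linear_change M f)"
        then have "i < ?N" using vars_linear_change[of M f] M(1) by auto
        then show "?s $ i = s $ i" using i j0 sc by auto
      qed
      also have "\<dots> = ev (($) (vec ?N v)) f" unfolding Ms[symmetric] by (rule eval_linear_change[OF M(1) vf sc])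
      also have "\<dots> = ev v f" by (rule mpoly_eval_cong) (use vf in auto)
      finally show False using neq by contradiction
    qed
  qed
qed

section \<open>The algebra of a hypersurface\<close>

context norm_alg
begin

text \<open>The equation free of coordinates, at an element scaled to augmentation 1. In this form
  it can be carried along algebra homomorphisms.\<close>

lemma equation_formula:
  assumes fG: "\<And>v. ev v f = \<kappa> * G d v" and hi: "\<And>w i. aug w = 0 ==> i > d ==> \<pi> (w ^ i) = 0"
    and r: "aug r \<noteq> 0"
  shows "ev (($) (\<tau> r)) f = \<kappa> * aug r ^ d * \<pi> (L (c (1 / aug r) * r - 1))"
proof -
  let ?v = "($) (\<tau> r)"
  have v0: "?v 0 = aug r" by (simp add: aug_\<tau>)
  then have nz: "?v 0 \<noteq> 0" using r by simp
  have "z ?v \<approx> r - c (aug r)"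
    using eqv_diff[OF eqv_sym[OF coords[of r]] eqv_refl, of "c (aug r)"] by (simp add: aug_\<tau>)
  then have "c (1 / aug r) * z ?v \<approx> c (1 / aug r) * (r - c (aug r))" by (rule eqv_mult[OF eqv_refl])
  also have "\<dots> = c (1 / aug r) * r - 1"
    using r by (simp add: algebra_simps flip: c_simps(2))
  finally have "z (\<lambda>j. ?v j / ?v 0) \<approx> c (1 / aug r) * r - 1"
    using z_scale[of "1 / aug r" ?v] by (simp add: v0)
  then have "\<pi> (L (z (\<lambda>j. ?v j / ?v 0))) = \<pi> (L (c (1 / aug r) * r - 1))" by (rule \<pi>_eqv[OF L_cong])
  then show ?thesis unfolding fG using G_eq[of d ?v, OF hi nz] by (simp add: v0)
qed

end

text \<open>Evaluation at the cyclic vector \<open>v0\<close> identifies the generated algebra with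
  the representation space.\<close>

locale cyclic_rep = poly_rep m N P
  for m N :: nat and P :: "nat \<Rightarrow> nat \<Rightarrow> 'k::field_char_0 mpoly" +
  fixes v0 :: "'k vec"
  assumes v0: "v0 \<in> carrier_vec N" and cyclic: "v \<in> carrier_vec N ==> \<exists>p. evr p *\<^sub>v v0 = v"
begin

definition \<tau> :: "'k mpoly \<Rightarrow> 'k vec" where "\<tau> p = evr p *\<^sub>v v0"

lemma \<tau>_mult: "\<tau> (p * q) = evr p *\<^sub>v \<tau> q"
  unfolding \<tau>_def evr_mult by (rule assoc_mult_mat_vec[OF evr_carrier evr_carrier v0])

text \<open>The algebra is commutative: an element that kills the cyclic vector kills all its
  images, hence the whole space.\<close>

lemma \<tau>_zero_iff: "\<tau> p = 0\<^sub>v N \<longleftrightarrow> evr p = 0\<^sub>m N N"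
proof
  assume "evr p = 0\<^sub>m N N"
  then show "\<tau> p = 0\<^sub>v N" using zero_mat_mult_vec[OF v0] by (simp add: \<tau>_def)
next
  assume t: "\<tau> p = 0\<^sub>v N"
  have z: "evr p *\<^sub>v v = 0\<^sub>v N" if v: "v \<in> carrier_vec N" for v
  proof -
    obtain q where q: "evr q *\<^sub>v v0 = v" using cyclic[OF v] by blast
    have "evr p *\<^sub>v v = \<tau> (p * q)" unfolding \<tau>_mult unfolding \<tau>_def q ..
    also have "\<dots> = evr q *\<^sub>v \<tau> p" unfolding \<tau>_mult[symmetric] by (simp only: mult.commute)
    also have "\<dots> = 0\<^sub>v N" unfolding t by (rule mult_mat_zero_vec[OF evr_carrier])
    finally show ?thesis .
  qed
  show "evr p = 0\<^sub>m N N"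
  proof (rule eq_matI)
    fix i j assume "i < dim_row (0\<^sub>m N N :: 'k mat)" "j < dim_col (0\<^sub>m N N :: 'k mat)"
    then have ij: "i < N" "j < N" by simp_all
    have "evr p $$ (i, j) = (evr p *\<^sub>v unit_vec N j) $ i"
      using ij mat_unit_vec_col[OF evr_carrier, of j p] carrier_matD[OF evr_carrier] by simp
    then show "evr p $$ (i, j) = 0\<^sub>m N N $$ (i, j)" using z[of "unit_vec N j"] ij by simp
  qed (simp_all add: evr_def)
qed

lemma quot: "quot_alg N mpoly_const (ev (\<lambda>_. 0 :: 'k)) \<tau> D"
proof (rule quot_alg.intro)
  show "comm_ring_hom (mpoly_const :: 'k \<Rightarrow> _)" by (rule const_hom)
  show "comm_ring_hom (ev (\<lambda>_. 0 :: 'k))" by (rule ev_hom)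
  show "ev (\<lambda>_. 0) (mpoly_const k) = k" for k :: 'k by simp
  show "N > 0" by (rule N_gt0)
  show "\<tau> r \<in> carrier_vec N" for r unfolding \<tau>_def by (rule mult_mat_vec_carrier[OF evr_carrier v0])
  show "\<tau> (r + s) = \<tau> r + \<tau> s" for r s
    unfolding \<tau>_def evr_add by (rule add_mult_distrib_mat_vec[OF evr_carrier evr_carrier v0])
  show "\<tau> (mpoly_const k * r) = k \<cdot>\<^sub>v \<tau> r" for k r
    unfolding \<tau>_def evr_smult by (rule smult_mat_vec[OF evr_carrier v0])
  show "\<exists>r. \<tau> r = v" if "v \<in> carrier_vec N" for v using cyclic[OF that] by (simp add: \<tau>_def)
  show "\<tau> (q * r) = 0\<^sub>v N" if "\<tau> r = 0\<^sub>v N" for q r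
    using J_mult[of r q] that unfolding \<tau>_zero_iff JR_def by simp
  show "\<tau> (r ^ D) = 0\<^sub>v N" if "ev (\<lambda>_. 0) r = 0" for r
    unfolding \<tau>_zero_iff by (rule nilpotent[OF that])
qed

lemma quot_J: "quot_alg.J N \<tau> = JR"
  unfolding quot_alg.J_def[OF quot] JR_def \<tau>_zero_iff ..

lemma \<tau>_exp: "a \<in> carrier_vec m ==> \<tau> (E (ell a)) = rep_at N P a *\<^sub>v v0"
  by (simp add: \<tau>_def rep_exp)

lemma ell_aug [simp]: "ev (\<lambda>_. 0) (ell a) = 0"
  by (simp add: ell_def)

text \<open>If the Lie algebra element vanishes, its exponential is the identity, and injectivity of
  the representation applies.\<close>

lemma ell_independent:
  assumes faith: "inj_on (rep_at N P) (carrier_vec m)" and a: "a \<in> carrier_vec m" "ell a \<in> JR"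
  shows "a = 0\<^sub>v m"
proof -
  have "eqv (ell a) 0" using a(2) by (simp add: eqv_0_iff)
  then have "eqv (E (ell a)) (E 0)" by (rule E_cong)
  then have "rep_at N P a = 1\<^sub>m N" using a(1) by (simp add: eqv_evr rep_exp E_0 evr_1)
  then have "rep_at N P a = rep_at N P (0\<^sub>v m)" using rep unfolding linear_rep_def by simp
  then show ?thesis using inj_onD[OF faith] a(1) by simp
qed

end

section \<open>The algebra \<open>K[x, y] / (xy, y\<^sup>2 - x\<^sup>d)\<close>\<close>

lemma poly_map_hom:
  fixes h :: "'k::comm_ring_1 \<Rightarrow> 'r::comm_ring_1"
  assumes "comm_ring_hom h" shows "comm_ring_hom (\<lambda>p. poly (map_poly h p) x)"
proof -
  interpret h: comm_ring_hom h by (rule assms)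
  have add: "map_poly h (p + q) = map_poly h p + map_poly h q" for p q
    by (rule poly_eqI) (simp add: coeff_map_poly h.hom_add)
  have sm: "map_poly h (Polynomial.smult a q) = Polynomial.smult (h a) (map_poly h q)" for a q
    by (rule poly_eqI) (simp add: coeff_map_poly h.hom_mult)
  have mult: "poly (map_poly h (p * q)) x = poly (map_poly h p) x * poly (map_poly h q) x" for p q
  proof (induction p)
    case (pCons a p)
    then show ?case by (simp add: add sm map_poly_pCons algebra_simps)
  qed simp
  show ?thesis by unfold_locales (simp_all add: add mult one_pCons map_poly_pCons)
qed

definition bimap :: "('k::comm_ring_1 \<Rightarrow> 'r::comm_ring_1) \<Rightarrow> 'r \<Rightarrow> 'r \<Rightarrow> 'k poly poly \<Rightarrow> 'r" where
  "bimap c x y q = poly (map_poly (\<lambda>p. poly (map_poly c p) x) q) y"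

lemma bimap_hom: "comm_ring_hom c ==> comm_ring_hom (bimap c x y)"
  unfolding bimap_def[abs_def] by (rule poly_map_hom[OF poly_map_hom])

definition mconst :: "'k::field \<Rightarrow> 'k poly poly" where "mconst k = [:[:k:]:]"
definition maug :: "'k::field poly poly \<Rightarrow> 'k" where "maug q = coeff (coeff q 0) 0"

text \<open>Coordinates modulo the ideal of x y and y^2 - x^d, in the basis 1, x, ..., x^(d-1), y,
  x^d. The socle generator comes last, where \<open>norm_alg\<close> reads its functional; y^2
  counts towards it, and all other monomials are zero in the quotient.\<close>

definition mtau :: "nat \<Rightarrow> 'k::field poly poly \<Rightarrow> 'k vec" where
  "mtau d q = vec (d + 2) (\<lambda>i. if i < d then coeff (coeff q 0) i else if i = d then coeff (coeff q 1) 0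
     else coeff (coeff q 0) d + coeff (coeff q 2) 0)"

definition mbase :: "nat \<Rightarrow> nat \<Rightarrow> 'k::field poly poly" where
  "mbase d j = (if j < d then poly_x ^ j else if j = d then poly_y else poly_x ^ d)"

lemma mconst_hom: "comm_ring_hom (mconst :: 'k::field \<Rightarrow> _)"
  by unfold_locales (simp_all add: mconst_def one_pCons)

lemma bimap_mconst [simp]: "comm_ring_hom c ==> bimap c x y (mconst k) = c k"
proof -
  assume "comm_ring_hom c"
  then interpret c: comm_ring_hom c .
  show ?thesis by (simp add: bimap_def mconst_def map_poly_pCons)
qed

lemma bimap_x [simp]: "comm_ring_hom c ==> bimap c x y poly_x = x"
proof -
  assume "comm_ring_hom c"
  then interpret c: comm_ring_hom c .
  show ?thesis by (simp add: bimap_def poly_x_def map_poly_pCons)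
qed

lemma bimap_y [simp]: "comm_ring_hom c ==> bimap c x y poly_y = y"
proof -
  assume "comm_ring_hom c"
  then interpret c: comm_ring_hom c .
  show ?thesis by (simp add: bimap_def poly_y_def map_poly_pCons)
qed

lemma coeff_mult_012:
  fixes q r :: "'a::comm_semiring_0 poly"
  shows "coeff (q * r) 0 = coeff q 0 * coeff r 0"
    "coeff (q * r) 1 = coeff q 0 * coeff r 1 + coeff q 1 * coeff r 0"
    "coeff (q * r) 2 = coeff q 0 * coeff r 2 + coeff q 1 * coeff r 1 + coeff q 2 * coeff r 0"
  by (simp_all add: coeff_mult numeral_2_eq_2)

lemma maug_hom: "comm_ring_hom (maug :: 'k::field poly poly \<Rightarrow> 'k)"
  by unfold_locales (simp_all add: maug_def coeff_mult_012)

lemma poly_x_power: "poly_x ^ k = [:monom 1 k:]"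
  by (induction k) (simp_all add: poly_x_def one_pCons monom_0 monom_Suc)

lemma coeff_x_power_mult: "coeff (coeff (q * poly_x ^ k) i) j = (if k \<le> j then coeff (coeff q i) (j - k) else 0)"
  by (simp add: poly_x_power mult.commute[of q] coeff_monom_mult)

lemma coeff_y_mult: "coeff (q * poly_y) i = (case i of 0 \<Rightarrow> 0 | Suc k \<Rightarrow> coeff q k)"
  by (simp add: poly_y_def mult.commute[of q] coeff_pCons)

lemma mtau_carrier [simp]: "mtau d q \<in> carrier_vec (d + 2)" by (simp add: mtau_def)

lemma mtau_eq_0_iff:
  "mtau d q = 0\<^sub>v (d + 2) \<longleftrightarrow> (\<forall>i<d. coeff (coeff q 0) i = 0) \<and> coeff (coeff q 1) 0 = 0 \<and>
    coeff (coeff q 0) d + coeff (coeff q 2) 0 = 0"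
proof
  assume m: "mtau d q = 0\<^sub>v (d + 2)"
  have e: "mtau d q $ i = 0" if "i < d + 2" for i using m that by simp
  show "(\<forall>i<d. coeff (coeff q 0) i = 0) \<and> coeff (coeff q 1) 0 = 0 \<and>
    coeff (coeff q 0) d + coeff (coeff q 2) 0 = 0"
  proof (intro conjI allI impI)
    show "coeff (coeff q 0) i = 0" if "i < d" for i using e[of i] that by (simp add: mtau_def)
    show "coeff (coeff q 1) 0 = 0" using e[of d] by (simp add: mtau_def)
    show "coeff (coeff q 0) d + coeff (coeff q 2) 0 = 0" using e[of "d + 1"] by (simp add: mtau_def)
  qed
next
  assume a: "(\<forall>i<d. coeff (coeff q 0) i = 0) \<and> coeff (coeff q 1) 0 = 0 \<and>
    coeff (coeff q 0) d + coeff (coeff q 2) 0 = 0"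
  show "mtau d q = 0\<^sub>v (d + 2)" by (rule eq_vecI) (use a in \<open>simp_all add: mtau_def\<close>)
qed

lemma mtau_ideal:
  assumes d: "d \<ge> 1" and r: "mtau d r = 0\<^sub>v (d + 2)"
  shows "mtau d (q * r) = 0\<^sub>v (d + 2)"
proof -
  have r0: "coeff (coeff r 0) i = 0" if "i < d" for i using r that unfolding mtau_eq_0_iff by blast
  have r1: "coeff (coeff r 1) 0 = 0" "coeff (coeff r 0) d + coeff (coeff r 2) 0 = 0"
    using r unfolding mtau_eq_0_iff by blast+
  have r00: "coeff (coeff r 0) 0 = 0" using r0 d by simp
  have s: "coeff (coeff q 0 * coeff r 0) d = coeff (coeff q 0) 0 * coeff (coeff r 0) d"
  proof -
    have "coeff (coeff q 0 * coeff r 0) d = (\<Sum>k\<le>d. if k = 0 then coeff (coeff q 0) 0 * coeff (coeff r 0) d else 0)"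
      unfolding coeff_mult by (rule sum.cong) (auto simp: r0)
    then show ?thesis by simp
  qed
  show ?thesis unfolding mtau_eq_0_iff
  proof (intro conjI allI impI)
    show "coeff (coeff (q * r) 0) i = 0" if "i < d" for i
      unfolding coeff_mult_012(1) coeff_mult[of "coeff q 0"] by (rule sum.neutral) (use that r0 in auto)
    show "coeff (coeff (q * r) 1) 0 = 0"
      unfolding coeff_mult_012 coeff_add by (simp add: coeff_mult_012(1) r00 r1[unfolded One_nat_def])
    have "coeff (coeff (q * r) 2) 0 = coeff (coeff q 0) 0 * coeff (coeff r 2) 0"
      unfolding coeff_mult_012 coeff_add by (simp add: coeff_mult_012(1) r00 r1[unfolded One_nat_def])
    then have "coeff (coeff (q * r) 0) d + coeff (coeff (q * r) 2) 0 =
        coeff (coeff q 0) 0 * (coeff (coeff r 0) d + coeff (coeff r 2) 0)"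
      unfolding coeff_mult_012(1) s by (simp only: distrib_left)
    then show "coeff (coeff (q * r) 0) d + coeff (coeff (q * r) 2) 0 = 0" unfolding r1(2) by simp
  qed
qed

lemma mtau_nil:
  assumes r: "maug r = 0" and k: "k > d" "d \<ge> 2"
  shows "mtau d (r ^ k) = 0\<^sub>v (d + 2)"
proof -
  have r0: "coeff (coeff r 0) 0 = 0" using r by (simp add: maug_def)
  \<comment> \<open>For \<open>r\<close> in the maximal ideal the part of \<open>r ^ k\<close> free
    of \<open>y\<close> has order at least \<open>k\<close> in \<open>x\<close>, and the constant
    coefficients at \<open>y\<close> and \<open>y ^ 2\<close> vanish from \<open>k = 2\<close> and
    \<open>k = 3\<close> on. Here \<open>k > d \<ge> 2\<close> covers all three.\<close>
  have P: "(\<forall>i<k. coeff (coeff (r ^ k) 0) i = 0) \<and> (k \<ge> 2 --> coeff (coeff (r ^ k) 1) 0 = 0) \<and>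
      (k \<ge> 3 --> coeff (coeff (r ^ k) 2) 0 = 0)" for k
  proof (induction k)
    case (Suc k)
    have I: "coeff (coeff (r ^ k) 0) i = 0" if "i < k" for i using Suc that by blast
    show ?case
    proof (intro conjI allI impI)
      fix i assume i: "i < Suc k"
      show "coeff (coeff (r ^ Suc k) 0) i = 0"
        unfolding power_Suc coeff_mult_012(1) coeff_mult[of "coeff r 0"]
      proof (rule sum.neutral, rule ballI)
        fix j assume "j \<in> {..i}"
        then show "coeff (coeff r 0) j * coeff (coeff (r ^ k) 0) (i - j) = 0"
          using r0 I[of "i - j"] i by (cases "j = 0") auto
      qed
    next
      assume "2 \<le> Suc k"
      then show "coeff (coeff (r ^ Suc k) 1) 0 = 0"
        unfolding power_Suc coeff_mult_012 coeff_add using I[of 0] by (simp add: coeff_mult_012(1) r0)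
    next
      assume k: "3 \<le> Suc k"
      then have "coeff (coeff (r ^ k) 1) 0 = 0" using Suc by auto
      then show "coeff (coeff (r ^ Suc k) 2) 0 = 0"
        unfolding power_Suc coeff_mult_012 coeff_add using I[of 0] k by (simp add: coeff_mult_012(1) r0)
    qed
  qed simp
  show ?thesis unfolding mtau_eq_0_iff using P[of k] k by auto
qed

lemma mtau_mbase:
  assumes "j < d + 2" "d \<ge> 2" shows "mtau d (mbase d j) = (unit_vec (d + 2) j :: 'k::field vec)"
proof (rule eq_vecI)
  fix i assume "i < dim_vec (unit_vec (d + 2) j :: 'k vec)"
  then have i: "i < d + 2" by simp
  consider "j < d" | "j = d" | "j = d + 1" using assms(1) by linarith
  then show "mtau d (mbase d j) $ i = unit_vec (d + 2) j $ i"
    using i assms(2) by cases (auto simp: mtau_def mbase_def poly_x_power poly_y_def coeff_monom numeral_2_eq_2)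
qed (simp add: mtau_def)

lemma maug_mbase: "0 < j ==> d \<ge> 2 ==> maug (mbase d j) = 0"
  by (simp add: maug_def mbase_def poly_x_power poly_y_def coeff_monom)

lemma model_quot:
  assumes d: "d \<ge> 2" "D > d"
  shows "quot_alg (d + 2) (mconst :: 'k::field_char_0 \<Rightarrow> _) maug (mtau d) D"
proof (rule quot_alg.intro)
  show "comm_ring_hom (mconst :: 'k \<Rightarrow> _)" by (rule mconst_hom)
  show "comm_ring_hom (maug :: 'k poly poly \<Rightarrow> 'k)" by (rule maug_hom)
  show "maug (mconst k) = k" for k :: 'k by (simp add: maug_def mconst_def)
  show "mtau d r \<in> carrier_vec (d + 2)" for r :: "'k poly poly" by (rule mtau_carrier)
  show "mtau d (r + s) = mtau d r + mtau d s" for r s :: "'k poly poly"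
    by (rule eq_vecI) (simp_all add: mtau_def)
  show "mtau d (mconst k * r) = k \<cdot>\<^sub>v mtau d r" for k :: 'k and r
    by (rule eq_vecI) (simp_all add: mtau_def mconst_def distrib_left)
  show "\<exists>r. mtau d r = v" if v: "v \<in> carrier_vec (d + 2)" for v :: "'k vec"
  proof
    define p where "p = (\<Sum>i<d. monom (v $ i) i) + monom (v $ (d + 1)) d"
    have c: "coeff p i = (if i < d then v $ i else if i = d then v $ (d + 1) else 0)" for i
    proof -
      have "coeff (\<Sum>k<d. monom (v $ k) k) i = (\<Sum>k<d. if i = k then v $ k else 0)"
        unfolding coeff_sum by (rule sum.cong) auto
      also have "\<dots> = (if i < d then v $ i else 0)" by (simp add: sum.delta)
      finally show ?thesis by (simp add: coeff_monom p_def)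
    qed
    show "mtau d [:p, [:v $ d:]:] = v"
    proof (rule eq_vecI)
      fix i assume "i < dim_vec v"
      then have i: "i < d + 2" using v by simp
      then consider "i < d" | "i = d" | "i = d + 1" by linarith
      then show "mtau d [:p, [:v $ d:]:] $ i = v $ i"
        by cases (simp_all add: mtau_def c numeral_2_eq_2)
    qed (use v in \<open>simp add: mtau_def\<close>)
  qed
  show "mtau d (q * r) = 0\<^sub>v (d + 2)" if "mtau d r = 0\<^sub>v (d + 2)" for q r :: "'k poly poly"
    by (rule mtau_ideal[OF _ that]) (use d in simp)
  show "mtau d (r ^ D) = 0\<^sub>v (d + 2)" if "maug r = 0" for r :: "'k poly poly"
    by (rule mtau_nil[OF that d(2,1)])
qed simp

lemma model_norm:
  assumes d: "d \<ge> 2" "D > d"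
  shows "norm_alg (d + 2) (mconst :: 'k::field_char_0 \<Rightarrow> _) maug (mtau d) D (d + 1) (mbase d)"
proof (rule norm_alg.intro[OF model_quot[OF d]], rule norm_alg_axioms.intro)
  show "mtau d (mbase d j) = unit_vec (d + 2) j" if "j < d + 2" for j by (rule mtau_mbase[OF that d(1)])
  show "mbase d 0 = (1 :: 'k poly poly)" using d by (simp add: mbase_def)
  show "maug (mbase d j) = (0 :: 'k)" if "0 < j" for j by (rule maug_mbase[OF that d(1)])
qed simp_all

definition ideal2 :: "'a::comm_ring_1 \<Rightarrow> 'a \<Rightarrow> 'a \<Rightarrow> bool" where
  "ideal2 u v p \<longleftrightarrow> (\<exists>A B. p = u * A + v * B)"

lemma ideal2_add: "ideal2 u v p ==> ideal2 u v r ==> ideal2 u v (p + r)"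
proof -
  assume "ideal2 u v p" "ideal2 u v r"
  then obtain A B A' B' where "p = u * A + v * B" "r = u * A' + v * B'" unfolding ideal2_def by (elim exE)
  then have "p + r = u * (A + A') + v * (B + B')" by (simp add: algebra_simps)
  then show ?thesis unfolding ideal2_def by blast
qed

lemma ideal2_mult: "ideal2 u v p ==> ideal2 u v (r * p)"
proof -
  assume "ideal2 u v p"
  then obtain A B where "p = u * A + v * B" unfolding ideal2_def by (elim exE)
  then have "r * p = u * (r * A) + v * (r * B)" by (simp add: algebra_simps)
  then show ?thesis unfolding ideal2_def by blast
qed

lemma ideal2_gen: "ideal2 u v u" "ideal2 u v v"
proof -
  have "u = u * 1 + v * 0" "v = u * 0 + v * 1" by simp_all
  then show "ideal2 u v u" "ideal2 u v v" unfolding ideal2_def by blast+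
qed

abbreviation "mideal d \<equiv> ideal2 (poly_x * poly_y) (poly_y ^ 2 - poly_x ^ d)"

text \<open>\<open>x ^ (d + 1)\<close> and \<open>y ^ 3\<close> lie in the ideal, so only the basis
  monomials survive, with \<open>y ^ 2\<close> replaced by \<open>x ^ d\<close>.\<close>

lemma model_decomposition:
  fixes q :: "'k::field poly poly"
  assumes d: "d \<ge> 1"
  shows "mideal d (q - (\<Sum>j<d+2. mconst (mtau d q $ j) * mbase d j))"
proof -
  let ?I = "mideal d :: 'k poly poly \<Rightarrow> bool"
  note I_add = ideal2_add and I_mult = ideal2_mult
  have I_xy: "?I (poly_x * poly_y)" and I_y2: "?I (poly_y ^ 2 - poly_x ^ d)" by (rule ideal2_gen)+
  have I_xd: "?I (poly_x ^ (d + 1))"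
  proof -
    have e: "poly_x ^ (d + 1) = poly_y * (poly_x * poly_y) + (- poly_x) * (poly_y ^ 2 - poly_x ^ d :: 'k poly poly)"
      by (simp add: power2_eq_square algebra_simps)
    show ?thesis unfolding e by (intro I_add I_mult I_xy I_y2)
  qed
  have y_p: "?I (poly_y * [:p:] - mconst (coeff p 0) * poly_y)" for p
  proof -
    have p: "[:p:] = mconst (coeff p 0) + poly_x * [:poly_shift 1 p:]"
      by (rule poly_eqI, rule poly_eqI)
        (auto simp: mconst_def poly_x_def coeff_pCons coeff_poly_shift split: nat.split)
    have g: "y * (u + x * w) - u * y = w * (x * y)" for u w x y :: "'k poly poly"
      by (simp add: algebra_simps)
    have e: "poly_y * [:p:] - mconst (coeff p 0) * poly_y = [:poly_shift 1 p:] * (poly_x * poly_y)"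
      by (subst p) (rule g)
    show ?thesis unfolding e by (rule I_mult[OF I_xy])
  qed
  have x_p: "?I ([:p:] - (\<Sum>i\<le>d. mconst (coeff p i) * poly_x ^ i))" for p
  proof -
    have p: "p = (\<Sum>i\<le>d. monom (coeff p i) i) + monom 1 (d + 1) * poly_shift (d + 1) p"
    proof (rule poly_eqI)
      fix k
      have "coeff (\<Sum>i\<le>d. monom (coeff p i) i) k = (\<Sum>i\<le>d. if k = i then coeff p i else 0)"
        unfolding coeff_sum by (rule sum.cong) auto
      then show "coeff p k = coeff ((\<Sum>i\<le>d. monom (coeff p i) i) + monom 1 (d + 1) * poly_shift (d + 1) p) k"
        by (auto simp: sum.delta coeff_monom_mult coeff_poly_shift)
    qed
    have s: "[:\<Sum>i\<in>A. monom (coeff p i) i:] = (\<Sum>i\<in>A. mconst (coeff p i) * poly_x ^ i)" if "finite A" for A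
      using that
    proof (induction A rule: finite_induct)
      case (insert i A)
      have "[:monom (coeff p i) i + u:] = mconst (coeff p i) * poly_x ^ i + [:u:]" for u
        by (simp add: mconst_def poly_x_power smult_monom)
      then show ?case using insert by simp
    qed simp
    have g: "[:u + monom 1 (d + 1) * w:] = [:u:] + [:w:] * poly_x ^ (d + 1)" for u w :: "'k poly"
      by (simp only: poly_x_power) (simp add: mult.commute)
    have e: "[:p:] - (\<Sum>i\<le>d. mconst (coeff p i) * poly_x ^ i) = [:poly_shift (d + 1) p:] * poly_x ^ (d + 1)"
      by (subst p, subst g, subst s) (simp_all only: finite_atMost add_diff_cancel_left')
    show ?thesis unfolding e by (rule I_mult[OF I_xd])
  qed
  have y3: "?I (poly_y ^ 3)"
  proof -
    obtain e where e: "d = Suc e" using d by (cases d) auto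
    have y: "poly_y ^ 3 = poly_y * (poly_y ^ 2 - poly_x ^ d) + poly_x ^ e * (poly_x * (poly_y :: 'k poly poly))"
      by (simp add: e power2_eq_square power3_eq_cube algebra_simps)
    show ?thesis unfolding y by (intro I_add I_mult I_xy I_y2)
  qed
  obtain q0 q1 q2 r where qq: "q = pCons q0 (pCons q1 (pCons q2 r))" by (metis pCons_cases)
  have c: "coeff q 0 = q0" "coeff q 1 = q1" "coeff q 2 = q2" by (simp_all add: qq numeral_2_eq_2)
  have q: "q = [:q0:] + poly_y * [:q1:] + poly_y ^ 2 * [:q2:] + r * poly_y ^ 3"
    by (simp add: qq poly_y_def power2_eq_square power3_eq_cube mult.commute[of r])
  have S: "(\<Sum>j<d+2. mconst (mtau d q $ j) * mbase d j) =
      (\<Sum>i\<le>d. mconst (coeff q0 i) * poly_x ^ i) + mconst (coeff q1 0) * poly_y + mconst (coeff q2 0) * poly_x ^ d"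
  proof -
    have "(\<Sum>j<d+2. mconst (mtau d q $ j) * mbase d j) = (\<Sum>j<d. mconst (mtau d q $ j) * mbase d j)
        + mconst (mtau d q $ d) * mbase d d + mconst (mtau d q $ (d + 1)) * mbase d (d + 1)"
      by simp
    also have "(\<Sum>j<d. mconst (mtau d q $ j) * mbase d j) = (\<Sum>j<d. mconst (coeff q0 j) * poly_x ^ j)"
      by (rule sum.cong) (simp_all add: mtau_def mbase_def c)
    also have "mconst (mtau d q $ d) * mbase d d = mconst (coeff q1 0) * poly_y"
      by (simp add: mtau_def mbase_def c[unfolded One_nat_def])
    also have "mconst (mtau d q $ (d + 1)) * mbase d (d + 1) =
        mconst (coeff q0 d) * poly_x ^ d + mconst (coeff q2 0) * poly_x ^ d"
    proof -
      have "mconst (a + b) = mconst a + (mconst b :: 'k poly poly)" for a b by (simp add: mconst_def)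
      then show ?thesis by (simp add: mtau_def mbase_def c distrib_right)
    qed
    finally show ?thesis by (simp add: lessThan_Suc_atMost[symmetric] ac_simps)
  qed
  have y2p: "?I (poly_y ^ 2 * [:q2:] - mconst (coeff q2 0) * poly_x ^ d)"
  proof -
    have g: "y ^ 2 * u - k * w = y * (y * u - k * y) + k * (y ^ 2 - w)" for y u k w :: "'k poly poly"
      by (simp add: power2_eq_square algebra_simps)
    show ?thesis unfolding g[of poly_y "[:q2:]"] by (intro I_add I_mult y_p I_y2)
  qed
  have g: "(a + b + e + h) - (a' + b' + e') = (a - a') + (b - b') + (e - e') + h" for a b e h a' b' e' :: "'k poly poly"
    by simp
  have "q - (\<Sum>j<d+2. mconst (mtau d q $ j) * mbase d j) = ([:q0:] - (\<Sum>i\<le>d. mconst (coeff q0 i) * poly_x ^ i))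
      + (poly_y * [:q1:] - mconst (coeff q1 0) * poly_y)
      + (poly_y ^ 2 * [:q2:] - mconst (coeff q2 0) * poly_x ^ d) + r * poly_y ^ 3"
    unfolding S g[symmetric] using q by simp
  also have "?I \<dots>" by (intro I_add x_p y_p y2p I_mult[OF y3])
  finally show ?thesis .
qed

lemma mtau_generators:
  assumes "d \<ge> 2"
  shows "mtau d (poly_x * poly_y) = 0\<^sub>v (d + 2)" "mtau d (poly_y ^ 2 - poly_x ^ d) = 0\<^sub>v (d + 2)"
proof -
  show "mtau d (poly_x * poly_y) = 0\<^sub>v (d + 2)"
    unfolding mtau_eq_0_iff by (simp add: poly_x_def poly_y_def numeral_2_eq_2)
  show "mtau d (poly_y ^ 2 - poly_x ^ d) = 0\<^sub>v (d + 2)"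
    unfolding mtau_eq_0_iff poly_x_power
    by (simp add: poly_y_def numeral_2_eq_2 coeff_monom)
qed

text \<open>The reference polynomial to which all forms are transported. It is obtained by choice
  because \<open>norm_alg\<close> provides it as a polynomial function, which determines it in
  characteristic zero.\<close>

definition mform :: "nat \<Rightarrow> 'k::field_char_0 mpoly" where
  "mform d = (SOME g. vars g \<subseteq> {..<d+2} \<and>
    (\<forall>v. ev v g = norm_alg.G mconst (mtau d) (d + 1) (mbase d) d v))"

lemma mform:
  assumes d: "d \<ge> 2"
  shows "vars (mform d :: 'k::field_char_0 mpoly) \<subseteq> {..<d+2}"
    "ev v (mform d :: 'k mpoly) = norm_alg.G mconst (mtau d) (d + 1) (mbase d) d v"
proof -
  interpret M: norm_alg "d + 2" "mconst :: 'k \<Rightarrow> _" maug "mtau d" "d + 1" "d + 1" "mbase d"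
    by (rule model_norm[OF d]) simp
  have "\<exists>g :: 'k mpoly. vars g \<subseteq> {..<d+2} \<and> (\<forall>v. ev v g = M.G d v)"
    using M.pfn_G[of d] unfolding pfn_def by metis
  then have *: "vars (mform d :: 'k mpoly) \<subseteq> {..<d+2} \<and> (\<forall>v. ev v (mform d :: 'k mpoly) = M.G d v)"
    unfolding mform_def by (rule someI_ex)
  from * show "vars (mform d :: 'k mpoly) \<subseteq> {..<d+2}" by blast
  from * show "ev v (mform d :: 'k mpoly) = M.G d v" by blast
qed

text \<open>Multiplication by \<open>x ^ (d - i)\<close>, by \<open>y\<close> and by 1 moves each
  coordinate in turn to the last place.\<close>

lemma mtau_pairing:
  assumes z: "\<And>r. mtau d (q * r) $ (d + 1) = 0"
  shows "mtau d q = 0\<^sub>v (d + 2)"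
  unfolding mtau_eq_0_iff
proof (intro conjI allI impI)
  show "coeff (coeff q 0) i = 0" if "i < d" for i
    using z[of "poly_x ^ (d - i)"] that by (simp add: mtau_def coeff_x_power_mult)
  show "coeff (coeff q 1) 0 = 0"
    using z[of poly_y] by (simp add: mtau_def coeff_y_mult numeral_2_eq_2)
  show "coeff (coeff q 0) d + coeff (coeff q 2) 0 = 0"
    using z[of 1] by (simp add: mtau_def)
qed

text \<open>The outcome of \<open>normal_form\<close>: generators satisfying the model relations
  together with a functional adapted to them.\<close>

locale normal_alg = norm_alg N c aug \<tau> D n b
  for N :: nat and c :: "'k::field_char_0 \<Rightarrow> 'r::comm_ring_1" and aug :: "'r \<Rightarrow> 'k"
    and \<tau> :: "'r \<Rightarrow> 'k vec" and D :: nat and n :: nat and b :: "nat \<Rightarrow> 'r" +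
  fixes d :: nat and x y :: 'r
  assumes d: "d \<ge> 2" and n_eq: "n = d + 1"
    and aug_x: "aug x = 0" and aug_y: "aug y = 0" and xy: "x * y \<in> J" and y2: "y ^ 2 \<approx> x ^ d"
    and \<pi>_x: "1 \<le> i ==> i < d ==> \<pi> (x ^ i) = 0" and \<pi>_y: "\<pi> y = 0" and \<pi>_xd: "\<pi> (x ^ d) \<noteq> 0"
begin

interpretation c: comm_ring_hom c by (rule c_hom)

lemma D_gt: "D > d"
proof (rule ccontr)
  assume "\<not> D > d"
  then have "x ^ d \<in> J" by (intro nil_power[OF aug_x]) simp
  then show False using \<pi>_J \<pi>_xd by simp
qed

interpretation M: norm_alg "d + 2" "mconst :: 'k \<Rightarrow> _" maug "mtau d" D "d + 1" "mbase d"
  by (rule model_norm[OF d D_gt])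

lemma N_d: "N = d + 2" using N_eq n_eq by simp

definition \<theta> :: "'k poly poly \<Rightarrow> 'r" where "\<theta> = bimap c x y"

interpretation \<theta>: comm_ring_hom \<theta> unfolding \<theta>_def by (rule bimap_hom[OF c_hom])

lemma \<theta>_mconst: "\<theta> (mconst k) = c k" unfolding \<theta>_def by (rule bimap_mconst[OF c_hom])
lemma \<theta>_x: "\<theta> poly_x = x" unfolding \<theta>_def by (rule bimap_x[OF c_hom])
lemma \<theta>_y: "\<theta> poly_y = y" unfolding \<theta>_def by (rule bimap_y[OF c_hom])

lemma \<theta>_ideal: "mideal d p ==> \<theta> p \<in> J"
proof -
  assume "mideal d p"
  then obtain A B where p: "p = poly_x * poly_y * A + (poly_y ^ 2 - poly_x ^ d) * B"
    unfolding ideal2_def by (elim exE)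
  have "\<theta> p = x * y * \<theta> A + (y ^ 2 - x ^ d) * \<theta> B"
    unfolding p by (simp add: \<theta>.hom_add \<theta>.hom_mult \<theta>.hom_minus \<theta>.hom_power \<theta>_x \<theta>_y)
  moreover have "y ^ 2 - x ^ d \<in> J" using y2 by (simp add: eqv_def)
  ultimately show ?thesis using J_add[OF J_mult2[OF xy] J_mult2] by simp
qed

lemma \<theta>_sum: "\<theta> (\<Sum>j<M. mconst (a j) * r j) = (\<Sum>j<M. c (a j) * \<theta> (r j))"
  by (simp add: \<theta>.hom_sum \<theta>.hom_mult \<theta>_mconst)

lemma \<theta>_coords: "\<theta> q \<approx> (\<Sum>j<d+2. c (mtau d q $ j) * \<theta> (mbase d j))"
proof -
  have "\<theta> (q - (\<Sum>j<d+2. mconst (mtau d q $ j) * mbase d j)) \<in> J"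
    by (rule \<theta>_ideal[OF model_decomposition]) (use d in simp)
  then show ?thesis unfolding eqv_def \<theta>.hom_minus \<theta>_sum .
qed

lemma \<pi>_1: "\<pi> 1 = 0"
  using \<tau>_b[of 0] b_0 N_eq n_pos by (simp add: \<pi>_def)

text \<open>The vanishing of \<pi> on all basis elements except \<open>x ^ d\<close> makes it a
  multiple of the last model coordinate.\<close>

lemma \<pi>_\<theta>: "\<pi> (\<theta> q) = \<pi> (x ^ d) * mtau d q $ (d + 1)"
proof -
  have "\<pi> (\<theta> q) = (\<Sum>j<d+2. mtau d q $ j * \<pi> (\<theta> (mbase d j)))"
    unfolding \<pi>_eqv[OF \<theta>_coords[of q]] by (simp add: \<pi>_sum \<pi>_c \<pi>_add)
  also have "\<dots> = (\<Sum>j<d+2. if j = d + 1 then mtau d q $ j * \<pi> (x ^ d) else 0)"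
  proof (rule sum.cong[OF refl])
    fix j assume "j \<in> {..<d+2}"
    then consider "j < d" | "j = d" | "j = d + 1" by fastforce
    then show "mtau d q $ j * \<pi> (\<theta> (mbase d j)) = (if j = d + 1 then mtau d q $ j * \<pi> (x ^ d) else 0)"
    proof cases
      case 1
      then show ?thesis using \<pi>_1 \<pi>_x[of j]
        by (cases "j = 0") (simp_all add: mbase_def \<theta>.hom_power \<theta>_x)
    qed (simp_all add: mbase_def \<theta>.hom_power \<theta>_x \<theta>_y \<pi>_y)
  qed
  also have "\<dots> = \<pi> (x ^ d) * mtau d q $ (d + 1)" by (simp add: sum.delta)
  finally show ?thesis .
qed

text \<open>An element of the kernel is orthogonal to everything in the model, where the pairing is
  non-degenerate.\<close>

lemma \<theta>_J_iff: "\<theta> q \<in> J \<longleftrightarrow> mtau d q = 0\<^sub>v (d + 2)"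
proof
  assume m: "mtau d q = 0\<^sub>v (d + 2)"
  have "\<theta> q \<approx> (\<Sum>j<d+2. c (mtau d q $ j) * \<theta> (mbase d j))" by (rule \<theta>_coords)
  also have "\<dots> = 0" unfolding m by (rule sum.neutral) simp
  finally show "\<theta> q \<in> J" unfolding eqv_0_iff .
next
  assume J: "\<theta> q \<in> J"
  have z: "mtau d (q * r) $ (d + 1) = 0" for r
  proof -
    have "\<pi> (\<theta> (q * r)) = 0" unfolding \<theta>.hom_mult by (rule \<pi>_J[OF J_mult2[OF J]])
    then show ?thesis unfolding \<pi>_\<theta> using \<pi>_xd by simp
  qed
  show "mtau d q = 0\<^sub>v (d + 2)" by (rule mtau_pairing[OF z])
qed

lemma base_independent:
  assumes "(\<Sum>i<N. c (a i) * \<theta> (mbase d i)) \<in> J" shows "\<forall>i<N. a i = 0"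
proof (intro allI impI)
  fix i assume i: "i < N"
  let ?q = "\<Sum>i<d+2. mconst (a i) * mbase d i"
  have "mtau d ?q = 0\<^sub>v (d + 2)" using assms unfolding \<theta>_J_iff[symmetric] \<theta>_sum N_d .
  moreover have "mtau d ?q $ i = (\<Sum>j<d+2. mtau d (mconst (a j) * mbase d j) $ i)"
    by (rule M.\<tau>_sum) (use i N_d in simp_all)
  moreover have "\<dots> = (\<Sum>j<d+2. if j = i then a i else 0)"
    by (rule sum.cong) (use i N_d d in \<open>auto simp: M.\<tau>_c mtau_mbase\<close>)
  ultimately show "a i = 0" using i N_d by (simp add: sum.delta del: sum.lessThan_Suc)
qed

lemma \<theta>_surj: "\<exists>q. p \<approx> \<theta> q"
proof -
  obtain a where "p \<approx> (\<Sum>i<N. c (a i) * \<theta> (mbase d i))"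
    using fam_span[of "\<lambda>i. \<theta> (mbase d i)" p, OF base_independent] by blast
  then show ?thesis unfolding \<theta>_sum[symmetric] by blast
qed

definition T :: "'k mat" where "T = fam_mat (\<lambda>j. \<theta> (mbase d j))"

lemma T_carrier [simp]: "T \<in> carrier_mat N N" by (simp add: T_def)

lemma T_inverse: "\<exists>T'\<in>carrier_mat N N. T * T' = 1\<^sub>m N \<and> T' * T = 1\<^sub>m N"
  unfolding T_def by (rule fam_mat_inverse[OF base_independent])

lemma \<tau>_\<theta>: "\<tau> (\<theta> q) = T *\<^sub>v mtau d q"
proof -
  have "vec N (($) (mtau d q)) = mtau d q" unfolding N_d by (rule eq_vecI) (simp_all add: mtau_def)
  then show ?thesis
    using \<theta>_coords[of q] unfolding eqv_iff N_d[symmetric] \<tau>_fam T_def by simp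
qed

lemma aug_\<theta>: "aug (\<theta> q) = maug q"
proof -
  have "aug (\<theta> q) = (\<Sum>j<d+2. mtau d q $ j * aug (\<theta> (mbase d j)))"
    unfolding eqv_aug[OF \<theta>_coords[of q]] by simp
  also have "\<dots> = (\<Sum>j<d+2. if j = 0 then mtau d q $ 0 else 0)"
  proof (rule sum.cong[OF refl])
    fix j
    show "mtau d q $ j * aug (\<theta> (mbase d j)) = (if j = 0 then mtau d q $ 0 else 0)"
      using d by (cases "j = 0") (simp_all add: mbase_def \<theta>.hom_power \<theta>_x \<theta>_y aug_x aug_y)
  qed
  also have "\<dots> = maug q" using d by (simp add: mtau_def maug_def)
  finally show ?thesis .
qed

lemma M_hi: "maug w = 0 ==> i > d ==> M.\<pi> (w ^ i) = 0"
  unfolding M.\<pi>_def using mtau_nil[of w d i] d by simp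

text \<open>A homomorphism commutes with powers, hence with \<open>L\<close>, and \<pi> corresponds
  to the model functional up to the factor \<open>\<pi> (x ^ d)\<close>. The coordinate-free formula
  needs nonzero augmentation; the remaining points follow because both sides are
  polynomials.\<close>

lemma form_transport:
  assumes fG: "\<And>v. ev v f = \<kappa> * G d v" and vf: "vars f \<subseteq> {..<N}"
    and hi: "\<And>w i. aug w = 0 ==> i > d ==> \<pi> (w ^ i) = 0" and v: "v \<in> carrier_vec N"
  shows "ev (($) (T *\<^sub>v v)) f = \<kappa> * \<pi> (x ^ d) * ev (($) v) (mform d)"
proof -
  have g: "ev v (mform d) = 1 * M.G d v" for v :: "nat \<Rightarrow> 'k" using mform(2)[OF d] by simp
  have *: "ev (($) (T *\<^sub>v v)) f = \<kappa> * \<pi> (x ^ d) * ev (($) v) (mform d)"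
    if v: "v \<in> carrier_vec N" "v $ 0 \<noteq> 0" for v
  proof -
    obtain q where q: "mtau d q = v" using M.\<tau>_surj[of v] v(1) N_d by auto
    have a: "maug q = v $ 0" using M.aug_\<tau>[of q] q by simp
    define p where "p = mconst (1 / maug q) * q - 1"
    have \<theta>p: "\<theta> p = c (1 / maug q) * \<theta> q - 1" by (simp add: p_def \<theta>.hom_minus \<theta>.hom_mult \<theta>_mconst)
    have "\<pi> (L (\<theta> p)) = (\<Sum>i<K. s i * \<pi> (\<theta> (p ^ i)))" unfolding \<pi>_L \<theta>.hom_power ..
    also have "\<dots> = \<pi> (x ^ d) * (\<Sum>i<K. s i * M.\<pi> (p ^ i))"
      unfolding \<pi>_\<theta> M.\<pi>_def sum_distrib_left by (rule sum.cong) (simp_all add: ac_simps)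
    also have "(\<Sum>i<K. s i * M.\<pi> (p ^ i)) = M.\<pi> (M.L p)"
      unfolding M.\<pi>_L s_def M.s_def ..
    finally have L: "\<pi> (L (\<theta> p)) = \<pi> (x ^ d) * M.\<pi> (M.L p)" .
    have "ev (($) (T *\<^sub>v v)) f = \<kappa> * maug q ^ d * \<pi> (L (\<theta> p))"
      using equation_formula[OF fG hi, of "\<theta> q"] a v(2) unfolding \<tau>_\<theta> q aug_\<theta> \<theta>p by simp
    also have "\<dots> = \<kappa> * \<pi> (x ^ d) * (1 * maug q ^ d * M.\<pi> (M.L p))" unfolding L by simp
    also have "1 * maug q ^ d * M.\<pi> (M.L p) = ev (($) v) (mform d)"
      using M.equation_formula[OF g M_hi, of q] a v(2) unfolding q p_def by simp
    finally show ?thesis .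
  qed
  have "linear_change T f = mpoly_const (\<kappa> * \<pi> (x ^ d)) * mform d"
  proof (rule mpoly_eqI_nz)
    fix u :: "nat \<Rightarrow> 'k" assume u: "u 0 \<noteq> 0"
    have vl: "vars (linear_change T f) \<subseteq> {..<N}" using vars_linear_change[of T f] carrier_matD[OF T_carrier] by simp
    have "ev u (linear_change T f) = ev (($) (vec N u)) (linear_change T f)"
      by (rule mpoly_eval_cong) (use vl in auto)
    also have "\<dots> = ev (($) (T *\<^sub>v vec N u)) f" by (rule eval_linear_change[OF T_carrier vf]) simp
    also have "\<dots> = \<kappa> * \<pi> (x ^ d) * ev (($) (vec N u)) (mform d)" by (rule *) (use u N_pos in simp_all)
    also have "ev (($) (vec N u)) (mform d) = ev u (mform d)"
      by (rule mpoly_eval_cong) (use mform(1)[OF d, where 'k='k] N_d in auto)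
    finally show "ev u (linear_change T f) = ev u (mpoly_const (\<kappa> * \<pi> (x ^ d)) * mform d)" by simp
  qed
  then show ?thesis using eval_linear_change[OF T_carrier vf v] by simp
qed

end

section \<open>Normal form of an H-pair\<close>

text \<open>An independent family in \<open>W\<close> is grown to size \<open>N\<close>: while it is
  too small, a nonzero functional kills it, and a member of \<open>W\<close> on which that
  functional is nonzero extends it.\<close>

lemma subspace_total:
  fixes W :: "'k::field vec set"
  assumes W: "\<And>w. w \<in> W ==> w \<in> carrier_vec N" and W_0: "0\<^sub>v N \<in> W"
    and W_add: "\<And>u w. u \<in> W ==> w \<in> W ==> u + w \<in> W" and W_smult: "\<And>k w. w \<in> W ==> k \<cdot>\<^sub>v w \<in> W"
    and ann: "\<And>l. l \<in> carrier_vec N ==> (\<And>w. w \<in> W ==> (\<Sum>j<N. w $ j * l $ j) = 0) ==> l = 0\<^sub>v N"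
  shows "carrier_vec N \<subseteq> W"
proof -
  have "\<exists>V. (\<forall>i<k. V i \<in> W) \<and> (\<forall>a. (\<forall>j<N. (\<Sum>i<k. a i * V i $ j) = 0) --> (\<forall>i<k. a i = 0))" if "k \<le> N" for k
    using that
  proof (induction k)
    case (Suc k)
    then obtain V where V: "\<forall>i<k. V i \<in> W"
      and ind: "\<forall>a. (\<forall>j<N. (\<Sum>i<k. a i * V i $ j) = 0) --> (\<forall>i<k. a i = 0)" by (elim meta_impE exE conjE) simp
    have Vc: "V i \<in> carrier_vec N" if "i < k" for i using W V that by blast
    have k: "k < N" using Suc.prems by simp
    have "\<exists>l\<in>carrier_vec N. l \<noteq> 0\<^sub>v N \<and> (\<forall>i<k. (\<Sum>j<N. V i $ j * l $ j) = 0)"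
      by (rule annihilator_exists[OF Vc k])
    then obtain l where l: "l \<in> carrier_vec N" "l \<noteq> 0\<^sub>v N" and Vl: "\<forall>i<k. (\<Sum>j<N. V i $ j * l $ j) = 0"
      by (elim bexE conjE)
    obtain w where w: "w \<in> W" "(\<Sum>j<N. w $ j * l $ j) \<noteq> 0" using ann[OF l(1)] l(2) by blast
    let ?V = "V(k := w)"
    have s: "(\<Sum>i<Suc k. a i * ?V i $ j) = (\<Sum>i<k. a i * V i $ j) + a k * w $ j" for a j by simp
    have "\<forall>i<Suc k. a i = 0" if eq: "\<forall>j<N. (\<Sum>i<Suc k. a i * ?V i $ j) = 0" for a
    proof -
      have eq': "(\<Sum>i<k. a i * V i $ j) + a k * w $ j = 0" if "j < N" for j
        unfolding s[symmetric] using eq that by blast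
      have e: "a k = 0"
        by (rule independent_extend[where a = a, OF Vl[rule_format] w(2) eq'])
      have "\<forall>j<N. (\<Sum>i<k. a i * V i $ j) = 0" using eq s e by simp
      then have "\<forall>i<k. a i = 0" using ind by blast
      then show ?thesis using e by (simp add: less_Suc_eq)
    qed
    moreover have "\<forall>i<Suc k. ?V i \<in> W" using V w(1) by (simp add: less_Suc_eq)
    ultimately show ?case by (intro exI[of _ ?V] conjI allI impI) blast+
  qed simp
  then obtain V where V: "\<forall>i<N. V i \<in> W"
    and ind: "\<forall>a. (\<forall>j<N. (\<Sum>i<N. a i * V i $ j) = 0) --> (\<forall>i<N. a i = 0)" by blast
  define B where "B = mat N N (\<lambda>(j, i). V i $ j)"
  have B: "B \<in> carrier_mat N N" by (simp add: B_def)
  have Bi: "(B *\<^sub>v v) $ j = (\<Sum>i<N. v $ i * V i $ j)" if "v \<in> carrier_vec N" "j < N" for v j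
    unfolding mat_vec_index[OF B that] by (rule sum.cong) (use that in \<open>simp_all add: B_def mult.commute\<close>)
  have "\<exists>B'\<in>carrier_mat N N. B * B' = 1\<^sub>m N \<and> B' * B = 1\<^sub>m N"
  proof (rule inverse_mat_exists[OF B])
    fix v :: "'k vec" assume v: "v \<in> carrier_vec N" "B *\<^sub>v v = 0\<^sub>v N"
    have "\<forall>j<N. (\<Sum>i<N. v $ i * V i $ j) = 0" using Bi[OF v(1)] v(2) by simp
    then have "\<forall>i<N. v $ i = 0" using ind by blast
    then show "v = 0\<^sub>v N" using v(1) by (intro eq_vecI) auto
  qed
  then obtain B' where B': "B' \<in> carrier_mat N N" "B * B' = 1\<^sub>m N" by blast
  show ?thesis
  proof
    fix v :: "'k vec" assume v: "v \<in> carrier_vec N"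
    define a where "a = B' *\<^sub>v v"
    have a: "a \<in> carrier_vec N" unfolding a_def using B'(1) v by (rule mult_mat_vec_carrier)
    have Ba: "B *\<^sub>v a = v" unfolding a_def using assoc_mult_mat_vec[OF B B'(1) v] B'(2) v by simp
    have sW: "vec N (\<lambda>j. \<Sum>i<k. a $ i * V i $ j) \<in> W" if "k \<le> N" for k
      using that
    proof (induction k)
      case 0
      have "vec N (\<lambda>j. \<Sum>i<0. a $ i * V i $ j) = 0\<^sub>v N" by (rule eq_vecI) simp_all
      then show ?case using W_0 by simp
    next
      case (Suc k)
      have Vk: "V k \<in> W" "dim_vec (V k) = N" using V Suc.prems W[of "V k"] by auto
      have "vec N (\<lambda>j. \<Sum>i<Suc k. a $ i * V i $ j) = vec N (\<lambda>j. \<Sum>i<k. a $ i * V i $ j) + a $ k \<cdot>\<^sub>v V k"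
        by (rule eq_vecI) (simp_all add: Vk(2))
      then show ?case using W_add[OF Suc.IH W_smult[OF Vk(1)]] Suc.prems by simp
    qed
    have "v = vec N (\<lambda>j. \<Sum>i<N. a $ i * V i $ j)"
      by (rule eq_vecI) (use Bi[OF a] Ba v in auto)
    then show "v \<in> W" using sW[of N] by simp
  qed
qed

text \<open>A linear form \<open>lf\<close> that kills all images of \<open>v0\<close> vanishes on
  the orbit, hence where \<open>f\<close> is zero and \<open>g\<close> is not. So \<open>f\<close>
  divides \<open>lf * g\<close> but not \<open>g\<close>, and a form of degree at least 2 divides a
  linear one only if that is zero. The Nullstellensatz is a hypothesis since the field of the locale
  need not be algebraically closed.\<close>

lemma (in poly_rep) cyclic_if_open_orbit:
  fixes f g :: "'k mpoly"
  assumes nst: "\<And>h. (\<And>s. ev s f = 0 ==> ev s h = 0) ==> f dvd h"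
    and N: "N = n + 1" and d: "d \<ge> 2" and f: "irreducible f" "homog 0 n d f"
    and v0: "v0 \<in> carrier_vec N" and van: "ev (($) v0) f = 0"
    and g: "vars g \<subseteq> {..<N}" "ev (($) v0) g \<noteq> 0"
    and orb: "\<And>v. v \<in> carrier_vec N ==> v \<noteq> 0\<^sub>v N ==> ev (($) v) f = 0 ==> ev (($) v) g \<noteq> 0 ==>
      \<exists>k. \<exists>a\<in>carrier_vec m. v = k \<cdot>\<^sub>v (rep_at N P a *\<^sub>v v0)"
    and v: "v \<in> carrier_vec N"
  shows "\<exists>p. evr p *\<^sub>v v0 = v"
proof -
  define W where "W = range (\<lambda>p. evr p *\<^sub>v v0)"
  have vf: "vars f \<subseteq> {..<N}" using vars_homog[OF f(2)] N by simp
  have "carrier_vec N \<subseteq> W"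
  proof (rule subspace_total)
    show "w \<in> carrier_vec N" if "w \<in> W" for w
      using that unfolding W_def by (elim rangeE) (simp add: mult_mat_vec_carrier[OF evr_carrier v0])
    show "0\<^sub>v N \<in> W" unfolding W_def
      by (rule range_eqI[of _ _ 0]) (simp add: evr_0 zero_mat_mult_vec[OF v0])
    show "u + w \<in> W" if uw: "u \<in> W" "w \<in> W" for u w
    proof -
      obtain p q where "u = evr p *\<^sub>v v0" "w = evr q *\<^sub>v v0" using uw unfolding W_def by (elim rangeE)
      then have "u + w = evr (p + q) *\<^sub>v v0"
        by (simp add: evr_add add_mult_distrib_mat_vec[OF evr_carrier evr_carrier v0])
      then show ?thesis unfolding W_def by (rule range_eqI)
    qed
    show "k \<cdot>\<^sub>v w \<in> W" if w: "w \<in> W" for k w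
    proof -
      obtain p where "w = evr p *\<^sub>v v0" using w unfolding W_def by (elim rangeE)
      then have "k \<cdot>\<^sub>v w = evr (mpoly_const k * p) *\<^sub>v v0"
        by (simp add: evr_smult smult_mat_vec[OF evr_carrier v0])
      then show ?thesis unfolding W_def by (rule range_eqI)
    qed
    fix l :: "'k vec" assume l: "l \<in> carrier_vec N" and lW: "\<And>w. w \<in> W ==> (\<Sum>j<N. w $ j * l $ j) = 0"
    define lf where "lf = (\<Sum>j<N. mpoly_const (l $ j) * mpoly_var j :: 'k mpoly)"
    have elf: "ev s lf = (\<Sum>j<N. s j * l $ j)" for s
      by (simp add: lf_def mult.commute)
    have "f dvd lf * g"
    proof (rule nst)
      fix s assume s: "ev s f = 0"
      let ?v = "vec N s"
      have ef: "ev (($) ?v) f = 0" unfolding s[symmetric] by (rule mpoly_eval_cong) (use vf in auto)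
      have eg: "ev (($) ?v) g = ev s g" by (rule mpoly_eval_cong) (use g(1) in auto)
      have "ev s lf = 0" if gs: "ev s g \<noteq> 0"
      proof (cases "?v = 0\<^sub>v N")
        case True
        have "s j = 0" if "j < N" for j using arg_cong[OF True, of "\<lambda>u. u $ j"] that by simp
        then show ?thesis by (simp add: elf)
      next
        case False
        obtain k a where ka: "a \<in> carrier_vec m" "?v = k \<cdot>\<^sub>v (rep_at N P a *\<^sub>v v0)"
          using orb[OF _ False ef] gs eg by auto
        have "?v = evr (mpoly_const k * E (ell a)) *\<^sub>v v0"
          unfolding ka(2) evr_smult smult_mat_vec[OF evr_carrier v0] rep_exp[OF ka(1)] ..
        then have "?v \<in> W" unfolding W_def by (rule range_eqI)
        then show ?thesis using lW[of ?v] by (simp add: elf)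
      qed
      then show "ev s (lf * g) = 0" by auto
    qed
    then have "f dvd lf \<or> f dvd g" by (rule irreducible_dvd_mult[OF f(1)])
    moreover have "\<not> f dvd g"
    proof
      assume "f dvd g"
      then obtain h where "g = f * h" by (elim dvdE)
      then show False using van g(2) by simp
    qed
    ultimately have fl: "f dvd lf" by blast
    have "lf = 0"
    proof (rule ccontr)
      assume nz: "lf \<noteq> 0"
      obtain h where h: "lf = f * h" using fl by (elim dvdE)
      have "whomog (ind 0 n) 1 lf" unfolding lf_def
      proof (rule whomog_sum)
        fix j assume "j \<in> {..<N}"
        then have "ind 0 n j = 1" using N by (auto simp: ind_def)
        then show "whomog (ind 0 n) 1 (mpoly_const (l $ j) * mpoly_var j)"
          using whomog_mult[OF whomog_const[of "ind 0 n" "l $ j"] whomog_var[of "ind 0 n" j]] by simp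
      qed
      then obtain k where k: "k \<le> 1" "whomog (ind 0 n) k f" using whomog_factor[of "ind 0 n" 1 f h] nz h by auto
      have "whomog (ind 0 n) d f" "f \<noteq> 0" using f by (auto simp: homog_iff)
      then have "d = k" using k(2) by (intro whomog_unique)
      then show False using k(1) d by simp
    qed
    then have e0: "(\<Sum>j<N. s j * l $ j) = 0" for s using elf[of s] by simp
    show "l = 0\<^sub>v N"
    proof (rule eq_vecI)
      fix i assume "i < dim_vec (0\<^sub>v N :: 'k vec)"
      then have i: "i < N" by simp
      have "(\<Sum>j<N. (if j = i then 1 else 0) * l $ j) = (\<Sum>j<N. if j = i then l $ i else 0)"
        by (rule sum.cong) auto
      then show "l $ i = 0\<^sub>v N $ i" using e0[of "\<lambda>j. if j = i then 1 else 0"] i by simp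
    qed (use l in simp)
  qed
  then have "v \<in> W" using v by blast
  then show ?thesis unfolding W_def by (elim rangeE) (metis (no_types))
qed

lemma (in quot_alg) norm_alg_of_basis:
  assumes N: "N = n + 1" "n \<ge> 1" and b: "b 0 = 1" "\<And>j. 0 < j ==> j < N ==> aug (b j) = 0"
    and B: "B' \<in> carrier_mat N N" "fam_mat b * B' = 1\<^sub>m N" "B' * fam_mat b = 1\<^sub>m N"
  shows "norm_alg N c aug (\<lambda>p. B' *\<^sub>v \<tau> p) D n b"
    "quot_alg.J N (\<lambda>p. B' *\<^sub>v \<tau> p) = J"
proof -
  have z: "B' *\<^sub>v \<tau> r = 0\<^sub>v N \<longleftrightarrow> \<tau> r = 0\<^sub>v N" for r
  proof
    assume "B' *\<^sub>v \<tau> r = 0\<^sub>v N"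
    then have "fam_mat b *\<^sub>v (B' *\<^sub>v \<tau> r) = 0\<^sub>v N" using mult_mat_zero_vec[OF fam_mat_carrier] by simp
    then show "\<tau> r = 0\<^sub>v N" using assoc_mult_mat_vec[OF fam_mat_carrier B(1) \<tau>_carrier, of b r] B(2) by simp
  next
    assume "\<tau> r = 0\<^sub>v N"
    then show "B' *\<^sub>v \<tau> r = 0\<^sub>v N" using mult_mat_zero_vec[OF B(1)] by simp
  qed
  have Q: "quot_alg N c aug (\<lambda>p. B' *\<^sub>v \<tau> p) D"
  proof (rule quot_alg.intro)
    show "B' *\<^sub>v \<tau> r \<in> carrier_vec N" for r using B(1) \<tau>_carrier by (rule mult_mat_vec_carrier)
    show "B' *\<^sub>v \<tau> (r + s) = B' *\<^sub>v \<tau> r + B' *\<^sub>v \<tau> s" for r s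
      unfolding \<tau>_add by (rule mult_add_distrib_mat_vec[OF B(1) \<tau>_carrier \<tau>_carrier])
    show "B' *\<^sub>v \<tau> (c k * r) = k \<cdot>\<^sub>v (B' *\<^sub>v \<tau> r)" for k r
      unfolding \<tau>_c by (rule mult_mat_vec[OF B(1) \<tau>_carrier])
    show "\<exists>r. B' *\<^sub>v \<tau> r = v" if v: "v \<in> carrier_vec N" for v
    proof -
      obtain r where r: "\<tau> r = fam_mat b *\<^sub>v v" using \<tau>_surj[OF mult_mat_vec_carrier[OF fam_mat_carrier v]] by blast
      have "B' *\<^sub>v \<tau> r = v" unfolding r using assoc_mult_mat_vec[OF B(1) fam_mat_carrier v, of b] B(3) v by simp
      then show ?thesis by blast
    qed
    show "B' *\<^sub>v \<tau> (q * r) = 0\<^sub>v N" if "B' *\<^sub>v \<tau> r = 0\<^sub>v N" for q r using that unfolding z by (rule \<tau>_ideal)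
    show "B' *\<^sub>v \<tau> (r ^ D) = 0\<^sub>v N" if "aug r = 0" for r unfolding z by (rule \<tau>_nil[OF that])
  qed (fact c_hom' aug_hom' aug_c' N_pos)+
  show "norm_alg N c aug (\<lambda>p. B' *\<^sub>v \<tau> p) D n b"
  proof (rule norm_alg.intro[OF Q], rule norm_alg_axioms.intro)
    fix j assume j: "j < N"
    have "\<tau> (b j) = fam_mat b *\<^sub>v unit_vec N j"
      unfolding mat_unit_vec_col[OF fam_mat_carrier j]
      by (rule eq_vecI) (use j in \<open>simp_all add: fam_mat_def carrier_vecD[OF \<tau>_carrier]\<close>)
    then show "B' *\<^sub>v \<tau> (b j) = unit_vec N j"
      using assoc_mult_mat_vec[OF B(1) fam_mat_carrier, of "unit_vec N j" b] B(3) by simp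
  qed (use N b in simp_all)
  show "quot_alg.J N (\<lambda>p. B' *\<^sub>v \<tau> p) = J" unfolding quot_alg.J_def[OF Q] J_def z ..
qed

text \<open>The first clauses identify the algebra with the model, the last one transports the form
  to \<open>mform d\<close>. Square roots are a hypothesis because the field of the locale need not
  be algebraically closed.\<close>

lemma (in cyclic_rep) structure_theorem:
  assumes sqrt: "\<And>k::'k. \<exists>l. l ^ 2 = k"
    and N: "N = d + 2" and m: "m = d" and d: "d \<ge> 2" and faith: "inj_on (rep_at N P) (carrier_vec m)"
    and f: "irreducible f" "homog 0 (d + 1) d f" "nondegenerate (d + 1) f"
    and van: "\<And>a. a \<in> carrier_vec m ==> ev (($) (rep_at N P a *\<^sub>v v0)) f = 0"
  shows "\<exists>x y. ev (\<lambda>_. 0) x = 0 \<and> ev (\<lambda>_. 0) y = 0 \<and>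
    (\<forall>q. bimap mpoly_const x y q \<in> JR \<longleftrightarrow> mtau d q = 0\<^sub>v (d + 2)) \<and>
    (\<forall>p. \<exists>q. p - bimap mpoly_const x y q \<in> JR) \<and>
    (\<exists>T\<in>carrier_mat N N. \<exists>T'\<in>carrier_mat N N. \<exists>\<kappa>. T * T' = 1\<^sub>m N \<and> T' * T = 1\<^sub>m N \<and> \<kappa> \<noteq> 0 \<and>
      (\<forall>v\<in>carrier_vec N. ev (($) (T *\<^sub>v v)) f = \<kappa> * ev (($) v) (mform d)))"
proof -
  interpret q: quot_alg N mpoly_const "ev (\<lambda>_. 0 :: 'k)" \<tau> D by (rule quot)
  let ?aug = "ev (\<lambda>_. 0 :: 'k)"
  let ?c = "mpoly_const :: 'k \<Rightarrow> 'k mpoly"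
  \<comment> \<open>The unit followed by a basis of the Lie algebra. Faithfulness makes them
    independent; one further vector completes a basis and is placed last, so that \<pi> vanishes on
    the Lie algebra.\<close>
  define r :: "nat \<Rightarrow> 'k mpoly" where "r i = (if i = 0 then 1 else mpoly_var (i - 1))" for i
  have r_sum: "(\<Sum>i<m+1. ?c (a i) * r i) = ?c (a 0) + ell (vec m (\<lambda>k. a (k + 1)))" for a
    unfolding ell_def Suc_eq_plus1[symmetric] sum.lessThan_Suc_shift by (simp add: r_def)
  have ind: "\<forall>i<m+1. a i = 0" if J: "(\<Sum>i<m+1. ?c (a i) * r i) \<in> q.J" for a
  proof -
    have a0: "a 0 = 0" using q.J_aug[OF J] unfolding r_sum by simp
    have "ell (vec m (\<lambda>k. a (k + 1))) \<in> JR" using J a0 unfolding r_sum quot_J by simp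
    then have v: "vec m (\<lambda>k. a (k + 1)) = 0\<^sub>v m" by (rule ell_independent[OF faith vec_carrier])
    have "a (k + 1) = 0" if "k < m" for k using arg_cong[OF v, of "\<lambda>u. u $ k"] that by simp
    moreover have "i = 0 \<or> (\<exists>k<m. i = k + 1)" if "i < m + 1" for i using that by (cases i) auto
    ultimately show ?thesis using a0 by (intro allI impI) metis
  qed
  have "\<exists>y. \<forall>a e. (\<Sum>i<m+1. ?c (a i) * r i) + ?c e * y \<in> q.J --> e = 0 \<and> (\<forall>i<m+1. a i = 0)"
    by (rule q.fam_extend[OF _ ind]) (use N m in simp)
  then obtain e0 where e0: "\<forall>a e. (\<Sum>i<m+1. ?c (a i) * r i) + ?c e * e0 \<in> q.J --> e = 0 \<and> (\<forall>i<m+1. a i = 0)"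
    by (elim exE)
  \<comment> \<open>Subtracting its augmentation moves the extra vector into the maximal
    ideal.\<close>
  define e where "e = e0 - ?c (?aug e0)"
  define b where "b j = (if j < m + 1 then r j else e)" for j
  have b0: "b 0 = 1" by (simp add: b_def r_def)
  have bj: "?aug (b j) = 0" if "0 < j" for j using that by (simp add: b_def r_def e_def)
  have bind: "\<forall>i<N. a i = 0" if J: "(\<Sum>i<N. ?c (a i) * b i) \<in> q.J" for a
  proof -
    \<comment> \<open>The shift from \<open>e0\<close> to \<open>e\<close> is absorbed in the
      coefficient of the unit.\<close>
    define a' where "a' i = (if i = 0 then a 0 - a (m + 1) * ?aug e0 else a i)" for i
    have "(\<Sum>i<N. ?c (a i) * b i) = (\<Sum>i<m+1. ?c (a i) * b i) + ?c (a (m + 1)) * b (m + 1)"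
      using N m by simp
    also have "(\<Sum>i<m+1. ?c (a i) * b i) = (\<Sum>i<m+1. ?c (a i) * r i)"
      by (rule sum.cong) (simp_all add: b_def)
    also have "\<dots> = ?c (a (m + 1) * ?aug e0) + (\<Sum>i<m+1. ?c (a' i) * r i)"
    proof -
      have "?c (a 0) = ?c (a (m + 1) * ?aug e0) + ?c (a' 0)" by (simp add: a'_def flip: const_add)
      moreover have "vec m (\<lambda>k. a (k + 1)) = vec m (\<lambda>k. a' (k + 1))" by (simp add: a'_def)
      ultimately show ?thesis unfolding r_sum by (simp add: add.assoc)
    qed
    finally have sum_eq: "(\<Sum>i<N. ?c (a i) * b i) = (\<Sum>i<m+1. ?c (a' i) * r i) + ?c (a (m + 1)) * e0"
      by (simp add: b_def e_def right_diff_distrib const_mult)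
    have z: "a (m + 1) = 0 \<and> (\<forall>i<m+1. a' i = 0)"
      by (rule e0[THEN spec, THEN spec, THEN mp, OF J[unfolded sum_eq]])
    show ?thesis
    proof (intro allI impI)
      fix i assume "i < N"
      then have "i < m + 1 \<or> i = m + 1" using N m by auto
      moreover have "a i = 0" if "i < m + 1" using z[THEN conjunct2, rule_format, OF that] z[THEN conjunct1] by (simp add: a'_def split: if_splits)
      ultimately show "a i = 0" using z[THEN conjunct1] by (elim disjE) simp_all
    qed
  qed
  define B where "B = q.fam_mat b"
  have B: "B \<in> carrier_mat N N" by (simp add: B_def)
  obtain B' where B': "B' \<in> carrier_mat N N" "B * B' = 1\<^sub>m N" "B' * B = 1\<^sub>m N"
    using q.fam_mat_inverse[of b, OF bind] unfolding B_def by blast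
  define \<tau>' where "\<tau>' p = B' *\<^sub>v \<tau> p" for p
  have \<tau>'_eq: "(\<lambda>p. B' *\<^sub>v \<tau> p) = \<tau>'" by (simp add: \<tau>'_def fun_eq_iff)
  have nb: "norm_alg N ?c ?aug (\<lambda>p. B' *\<^sub>v \<tau> p) D (d + 1) b" "quot_alg.J N (\<lambda>p. B' *\<^sub>v \<tau> p) = q.J"
    using q.norm_alg_of_basis[of "d + 1" b B'] N b0 bj B' unfolding B_def by simp_all
  interpret M: norm_alg N mpoly_const "ev (\<lambda>_. 0 :: 'k)" \<tau>' D "d + 1" b
    using nb(1) unfolding \<tau>'_eq .
  have MJ: "M.J = JR" using nb(2) unfolding \<tau>'_eq quot_J .
  have B\<tau>': "B *\<^sub>v \<tau>' p = \<tau> p" for p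
    unfolding \<tau>'_def using assoc_mult_mat_vec[OF B B'(1) q.\<tau>_carrier, of p] B'(2) by simp
  define f' where "f' = linear_change B f"
  have vf: "vars f \<subseteq> {..<N}" using vars_homog[OF f(2)] N by simp
  have f'_ev: "ev (($) v) f' = ev (($) (B *\<^sub>v v)) f" if "v \<in> carrier_vec N" for v
    unfolding f'_def by (rule eval_linear_change[OF B vf that])
  have f'_irr: "irreducible f'" unfolding f'_def by (rule irreducible_linear_change[OF B B' f(1) vf])
  have f'_hom: "homog 0 (d + 1) d f'" unfolding f'_def by (rule homog_linear_change[OF f(2)]) (use B N in simp)
  have vf': "vars f' \<subseteq> {..<N}" using vars_homog[OF f'_hom] N by simp
  have vec_ev: "ev s h = ev (($) (vec N s)) h" if "vars h \<subseteq> {..<N}" for h :: "'k mpoly" and s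
    by (rule mpoly_eval_cong) (use that in auto)
  \<comment> \<open>A zero last coordinate puts the argument into the Lie algebra, so its
    exponential is a group element and the point lies on the orbit.\<close>
  have van': "ev (\<lambda>j. \<tau>' (M.E (M.z a)) $ j) f' = 0" if a: "a (d + 1) = 0" for a
  proof -
    have "M.z a = (\<Sum>j\<in>{1..m}. ?c (a j) * mpoly_var (j - 1))"
      unfolding M.z_def using a m by (simp add: b_def r_def)
    also have "\<dots> = ell (vec m (\<lambda>k. a (k + 1)))"
      unfolding ell_def by (rule sum.reindex_bij_witness[of _ Suc "\<lambda>j. j - 1"]) auto
    finally have z: "M.z a = ell (vec m (\<lambda>k. a (k + 1)))" .
    have "ev (($) (\<tau>' (M.E (M.z a)))) f' = ev (($) (\<tau> (M.E (M.z a)))) f"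
      using f'_ev[OF M.\<tau>_carrier] unfolding B\<tau>' .
    also have "\<dots> = 0" unfolding z \<tau>_exp[OF vec_carrier] by (rule van[OF vec_carrier])
    finally show ?thesis .
  qed
  have "\<exists>\<kappa>. \<kappa> \<noteq> 0 \<and> (\<forall>v. ev v f' = \<kappa> * M.G d v) \<and> (\<forall>w i. ?aug w = 0 --> i > d --> M.\<pi> (w ^ i) = 0) \<and>
      (\<exists>w. ?aug w = 0 \<and> M.\<pi> (w ^ d) \<noteq> 0)"
    by (rule M.equation[OF f'_irr f'_hom van'])
  then obtain \<kappa> where \<kappa>4: "\<kappa> \<noteq> 0 \<and> (\<forall>v. ev v f' = \<kappa> * M.G d v) \<and> (\<forall>w i. ?aug w = 0 --> i > d --> M.\<pi> (w ^ i) = 0) \<and>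
      (\<exists>w. ?aug w = 0 \<and> M.\<pi> (w ^ d) \<noteq> 0)" by (rule exE)
  note \<kappa> = \<kappa>4[THEN conjunct1] and fG = \<kappa>4[THEN conjunct2, THEN conjunct1]
    and hi = \<kappa>4[THEN conjunct2, THEN conjunct2, THEN conjunct1] and lo = \<kappa>4[THEN conjunct2, THEN conjunct2, THEN conjunct2]
  note fG = fG[rule_format] and hi = hi[rule_format]
  have nd': "\<exists>v t. ev (\<lambda>j. v j + t * w $ j) f' \<noteq> ev v f'" if w: "w \<in> carrier_vec N" "w \<noteq> 0\<^sub>v N" for w
  proof -
    have Bw: "B *\<^sub>v w \<in> carrier_vec N" using B w(1) by (rule mult_mat_vec_carrier)
    have B'Bw: "B' *\<^sub>v (B *\<^sub>v w) = w" using assoc_mult_mat_vec[OF B'(1) B w(1)] B'(3) w(1) by simp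
    have "B *\<^sub>v w \<noteq> 0\<^sub>v N" using B'Bw mult_mat_zero_vec[OF B'(1)] w(2) by auto
    then obtain v t where vt: "ev (\<lambda>j. v j + t * (B *\<^sub>v w) $ j) f \<noteq> ev v f"
      using f(3) Bw nondegenerate_iff[of f "d + 1"] vars_homog[OF f(2)] f(2) N unfolding homog_def by auto
    define u where "u = B' *\<^sub>v vec N v"
    have u: "u \<in> carrier_vec N" unfolding u_def using B'(1) by (rule mult_mat_vec_carrier) simp
    have Bu: "B *\<^sub>v u = vec N v" unfolding u_def using assoc_mult_mat_vec[OF B B'(1), of "vec N v"] B'(2) by simp
    have "ev (\<lambda>j. u $ j + t * w $ j) f' = ev (($) (u + t \<cdot>\<^sub>v w)) f'"
      by (rule mpoly_eval_cong) (use vf' u w in auto)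
    also have "\<dots> = ev (($) (B *\<^sub>v (u + t \<cdot>\<^sub>v w))) f" by (rule f'_ev) (use u w in simp)
    also have "B *\<^sub>v (u + t \<cdot>\<^sub>v w) = vec N v + t \<cdot>\<^sub>v (B *\<^sub>v w)"
      using mult_add_distrib_mat_vec[OF B u, of "t \<cdot>\<^sub>v w"] mult_mat_vec[OF B w(1)] w(1) Bu by simp
    also have "ev (($) (vec N v + t \<cdot>\<^sub>v (B *\<^sub>v w))) f = ev (\<lambda>j. v j + t * (B *\<^sub>v w) $ j) f"
      by (rule mpoly_eval_cong) (use vf carrier_matD[OF B] in auto)
    finally have 1: "ev (\<lambda>j. u $ j + t * w $ j) f' = ev (\<lambda>j. v j + t * (B *\<^sub>v w) $ j) f" .
    have 2: "ev (($) u) f' = ev v f" unfolding f'_ev[OF u] Bu by (rule vec_ev[OF vf, symmetric])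
    show ?thesis by (intro exI[of _ "($) u"] exI[of _ t]) (use 1 2 vt in simp)
  qed
  have ndg: "w \<in> M.J" if "?aug w = 0" "\<And>r. M.\<pi> (w * r) = 0" for w
    by (rule M.nondegenerate_imp[OF fG vf' hi nd' that])
  have "\<exists>x y. ?aug x = 0 \<and> ?aug y = 0 \<and> x * y \<in> M.J \<and> M.eqv (y ^ 2) (x ^ d) \<and>
      (\<forall>i. 1 \<le> i --> i < d --> M.\<pi> (x ^ i) = 0) \<and> M.\<pi> y = 0 \<and> M.\<pi> (x ^ d) \<noteq> 0"
    by (rule M.normal_form[OF sqrt refl d hi lo ndg])
  then obtain x y where xy: "?aug x = 0" "?aug y = 0" "x * y \<in> M.J" "M.eqv (y ^ 2) (x ^ d)"
    "\<forall>i. 1 \<le> i --> i < d --> M.\<pi> (x ^ i) = 0" "M.\<pi> y = 0" "M.\<pi> (x ^ d) \<noteq> 0"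
    by (elim exE conjE)
  have F: "normal_alg N mpoly_const (ev (\<lambda>_. 0 :: 'k)) \<tau>' D (d + 1) b d x y"
  proof (rule normal_alg.intro, rule M.norm_alg_axioms, rule normal_alg_axioms.intro)
    show "d \<ge> 2" by (rule d)
    show "d + 1 = d + 1" by (rule refl)
    show "?aug x = 0" by (rule xy(1))
    show "?aug y = 0" by (rule xy(2))
    show "x * y \<in> M.J" by (rule xy(3))
    show "M.eqv (y ^ 2) (x ^ d)" by (rule xy(4))
    show "M.\<pi> (x ^ i) = 0" if "1 \<le> i" "i < d" for i by (rule xy(5)[rule_format, OF that])
    show "M.\<pi> y = 0" by (rule xy(6))
    show "M.\<pi> (x ^ d) \<noteq> 0" by (rule xy(7))
  qed
  define T where "T = normal_alg.T N mpoly_const \<tau>' d x y"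
  obtain T' where T': "T' \<in> carrier_mat N N" "T * T' = 1\<^sub>m N" "T' * T = 1\<^sub>m N" using normal_alg.T_inverse[OF F] unfolding T_def by blast
  have Tc: "T \<in> carrier_mat N N" unfolding T_def by (rule normal_alg.T_carrier[OF F])
  have inv1: "(B * T) * (T' * B') = 1\<^sub>m N"
  proof -
    have "(B * T) * (T' * B') = B * ((T * T') * B')"
      using assoc_mult_mat[OF B Tc mult_carrier_mat[OF T'(1) B'(1)]] assoc_mult_mat[OF Tc T'(1) B'(1)] by simp
    then show ?thesis using T' B' by simp
  qed
  have inv2: "(T' * B') * (B * T) = 1\<^sub>m N"
  proof -
    have "(T' * B') * (B * T) = T' * ((B' * B) * T)"
      using assoc_mult_mat[OF T'(1) B'(1) mult_carrier_mat[OF B Tc]] assoc_mult_mat[OF B'(1) B Tc] by simp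
    then show ?thesis using T' B' Tc by simp
  qed
  have form: "ev (($) ((B * T) *\<^sub>v v)) f = (\<kappa> * M.\<pi> (x ^ d)) * ev (($) v) (mform d)" if v: "v \<in> carrier_vec N" for v
  proof -
    have "ev (($) ((B * T) *\<^sub>v v)) f = ev (($) (T *\<^sub>v v)) f'"
      unfolding assoc_mult_mat_vec[OF B Tc v] by (rule f'_ev[symmetric]) (rule mult_mat_vec_carrier[OF Tc v])
    also have "\<dots> = \<kappa> * M.\<pi> (x ^ d) * ev (($) v) (mform d)"
      unfolding T_def by (rule normal_alg.form_transport[OF F fG vf' hi v])
    finally show ?thesis .
  qed
  show ?thesis
  proof (rule exI[of _ x], rule exI[of _ y], intro conjI allI)
    show "bimap mpoly_const x y q \<in> JR \<longleftrightarrow> mtau d q = 0\<^sub>v (d + 2)" for q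
      using normal_alg.\<theta>_J_iff[OF F, of q] unfolding normal_alg.\<theta>_def[OF F] MJ .
    show "\<exists>q. p - bimap mpoly_const x y q \<in> JR" for p
      using normal_alg.\<theta>_surj[OF F, of p] unfolding normal_alg.\<theta>_def[OF F] MJ eqv_def .
    show "\<exists>T\<in>carrier_mat N N. \<exists>T'\<in>carrier_mat N N. \<exists>\<kappa>. T * T' = 1\<^sub>m N \<and> T' * T = 1\<^sub>m N \<and> \<kappa> \<noteq> 0 \<and>
      (\<forall>v\<in>carrier_vec N. ev (($) (T *\<^sub>v v)) f = \<kappa> * ev (($) v) (mform d))"
    proof (rule bexI[of _ "B * T"], rule bexI[of _ "T' * B'"], rule exI[of _ "\<kappa> * M.\<pi> (x ^ d)"], intro conjI ballI)
      show "B * T * (T' * B') = 1\<^sub>m N" by (rule inv1)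
      show "T' * B' * (B * T) = 1\<^sub>m N" by (rule inv2)
      show "\<kappa> * M.\<pi> (x ^ d) \<noteq> 0" using \<kappa> xy(7) by (rule no_zero_divisors)
      show "ev (($) (B * T *\<^sub>v v)) f = \<kappa> * M.\<pi> (x ^ d) * ev (($) v) (mform d)" if "v \<in> carrier_vec N" for v
        by (rule form[OF that])
      show "T' * B' \<in> carrier_mat N N" by (rule mult_carrier_mat[OF T'(1) B'(1)])
      show "B * T \<in> carrier_mat N N" by (rule mult_carrier_mat[OF B Tc])
    qed
    show "?aug x = 0" by (rule xy(1))
    show "?aug y = 0" by (rule xy(2))
  qed
qed

section \<open>Linear maps on projective space\<close>

lemma image_proj_point:
  fixes A :: "'k::field mat"
  assumes "A \<in> carrier_mat N N" "v \<in> carrier_vec N"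
  shows "(\<lambda>w. A *\<^sub>v w) ` proj_point v = proj_point (A *\<^sub>v v)"
proof -
  have "A *\<^sub>v (c \<cdot>\<^sub>v v) = c \<cdot>\<^sub>v (A *\<^sub>v v)" for c by (rule mult_mat_vec[OF assms])
  then show ?thesis unfolding proj_point_def by (auto simp: image_iff) metis
qed

lemma proj_spaceE:
  assumes "p \<in> proj_space n"
  obtains v where "v \<in> carrier_vec (n + 1)" "v \<noteq> 0\<^sub>v (n + 1)" "p = proj_point v"
  using assms unfolding proj_space_def by (elim CollectE exE conjE) (rule that)

lemma in_proj_pointD:
  fixes v :: "'k::field vec"
  assumes v: "v \<in> carrier_vec N" "v \<noteq> 0\<^sub>v N" and w: "w \<in> proj_point v"
  shows "w \<in> carrier_vec N" "w \<noteq> 0\<^sub>v N" "proj_point w = proj_point v"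
proof -
  obtain c where c: "w = c \<cdot>\<^sub>v v" "c \<noteq> 0" using w unfolding proj_point_def by (elim CollectE exE conjE)
  show "w \<in> carrier_vec N" using c v by simp
  show "proj_point w = proj_point v" unfolding c(1) by (rule proj_point_smult[OF c(2)])
  show "w \<noteq> 0\<^sub>v N"
  proof
    assume "w = 0\<^sub>v N"
    then have z: "(1 / c) \<cdot>\<^sub>v (c \<cdot>\<^sub>v v) = 0\<^sub>v N" unfolding c(1) by (simp add: smult_vec_zero')
    then show False using c(2) v by (simp add: smult_smult_assoc)
  qed
qed

lemma zariski_open_refl:
  assumes "Y \<subseteq> carrier_vec m \<times> proj_space n"
  shows "zariski_open_in m n Y (Y :: ('k::field vec \<times> 'k vec set) set)"
proof -
  have e: "eval_at (1 :: 'k mpoly) v = 1" for v by (simp add: eval_at_ev)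
  have "homog m n 0 (1 :: 'k mpoly)" by (simp add: homog_iff whomog_1)
  moreover have "{} = {(a, p). a \<in> carrier_vec m \<and> p \<in> proj_space n \<and>
      (\<forall>f\<in>{1 :: 'k mpoly}. \<forall>v\<in>p. eval_at f (a @\<^sub>v v) = 0)}"
    using self_in_proj_point by (auto simp: e elim!: proj_spaceE)
  ultimately have "zariski_closed m n ({} :: ('k vec \<times> 'k vec set) set)"
    unfolding zariski_closed_def by (intro exI[of _ "{1}"]) auto
  then show ?thesis unfolding zariski_open_in_def by (intro exI[of _ "{}"]) simp
qed

lemma regular_map_cong:
  assumes "\<And>b q. (b, q) \<in> Y ==> \<phi> b q = \<phi>' b q" "regular_map m n Y \<phi>"
  shows "regular_map m n Y \<phi>'"
  unfolding regular_map_def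
proof
  fix y assume "y \<in> Y"
  then obtain W F d where W: "zariski_open_in m n Y W" "y \<in> W" "\<forall>i\<le>n. homog m n d (F i)"
    and WF: "\<forall>(b, q)\<in>W. \<forall>v\<in>q. let w = vec (n + 1) (\<lambda>i. eval_at (F i) (b @\<^sub>v v)) in
       w \<noteq> 0\<^sub>v (n + 1) \<and> \<phi> b q = proj_point w"
    using assms(2) unfolding regular_map_def by blast
  have "W \<subseteq> Y" using W(1) unfolding zariski_open_in_def by auto
  then have "\<forall>(b, q)\<in>W. \<forall>v\<in>q. let w = vec (n + 1) (\<lambda>i. eval_at (F i) (b @\<^sub>v v)) in
       w \<noteq> 0\<^sub>v (n + 1) \<and> \<phi>' b q = proj_point w"
    using WF assms(1) by fastforce
  then show "\<exists>W F d. zariski_open_in m n Y W \<and> y \<in> W \<and> (\<forall>i\<le>n. homog m n d (F i)) \<and>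
    (\<forall>(b, q)\<in>W. \<forall>v\<in>q. let w = vec (n + 1) (\<lambda>i. eval_at (F i) (b @\<^sub>v v)) in
       w \<noteq> 0\<^sub>v (n + 1) \<and> \<phi>' b q = proj_point w)"
    using W by (intro exI[of _ W] exI[of _ F] exI[of _ d] conjI)
qed

lemma regular_map_matrix:
  fixes P :: "nat \<Rightarrow> nat \<Rightarrow> 'k::field mpoly"
  assumes vP: "\<And>i j. i < n + 1 ==> j < n + 1 ==> vars (P i j) \<subseteq> {..<m}"
    and inj: "\<And>a v. a \<in> carrier_vec m ==> v \<in> carrier_vec (n + 1) ==> v \<noteq> 0\<^sub>v (n + 1) ==>
      rep_at (n + 1) P a *\<^sub>v v \<noteq> 0\<^sub>v (n + 1)"
    and Y: "Y \<subseteq> carrier_vec m \<times> proj_space n"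
  shows "regular_map m n Y (\<lambda>a p. (\<lambda>v. rep_at (n + 1) P a *\<^sub>v v) ` p)"
  unfolding regular_map_def
proof
  fix y assume y: "y \<in> Y"
  define F where "F i = (\<Sum>j<n+1. P i j * mpoly_var (m + j))" for i
  have hF: "homog m n 1 (F i)" if i: "i \<le> n" for i
    unfolding homog_iff
  proof
    show "vars (F i) \<subseteq> {..m + n}" unfolding F_def
    proof (rule vars_subset_intros(5), rule vars_subset_intros(3))
      fix j assume "j \<in> {..<n+1}"
      then show "vars (P i j) \<subseteq> {..m + n}" using vP[of i j] i by auto
      show "vars (mpoly_var (m + j) :: 'k mpoly) \<subseteq> {..m + n}" using \<open>j \<in> {..<n+1}\<close> by simp
    qed
    show "whomog (ind m n) 1 (F i)" unfolding F_def
    proof (rule whomog_sum)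
      fix j assume j: "j \<in> {..<n+1}"
      have "whomog (ind m n) 0 (P i j)" unfolding whomog_def
      proof
        fix t assume t: "t \<in> Poly_Mapping.keys (P i j)"
        have "Poly_Mapping.keys t \<subseteq> {..<m}" using vP[of i j] i j t by (auto simp: vars_def)
        then show "wsum (ind m n) t = 0" unfolding wsum_def by (intro sum.neutral) (auto simp: ind_def)
      qed
      moreover have "ind m n (m + j) = 1" using j by (auto simp: ind_def)
      ultimately show "whomog (ind m n) 1 (P i j * mpoly_var (m + j))"
        using whomog_mult[of "ind m n" 0 "P i j" "ind m n (m + j)", OF _ whomog_var] by simp
    qed
  qed
  have val: "vec (n + 1) (\<lambda>i. eval_at (F i) (b @\<^sub>v v)) = rep_at (n + 1) P b *\<^sub>v v"
    if b: "b \<in> carrier_vec m" and v: "v \<in> carrier_vec (n + 1)" for b v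
  proof (rule eq_vecI)
    fix i assume "i < dim_vec (rep_at (n + 1) P b *\<^sub>v v)"
    then have i: "i < n + 1" by simp
    have P: "ev (($) (b @\<^sub>v v)) (P i j) = ev (($) b) (P i j)" if "j < n + 1" for j
      by (rule mpoly_eval_cong) (use vP[OF i that] b in auto)
    have "eval_at (F i) (b @\<^sub>v v) = (\<Sum>j<n+1. ev (($) b) (P i j) * v $ j)"
      unfolding eval_at_ev F_def ev_sum ev_mult by (rule sum.cong) (use P b v in auto)
    then show "vec (n + 1) (\<lambda>i. eval_at (F i) (b @\<^sub>v v)) $ i = (rep_at (n + 1) P b *\<^sub>v v) $ i"
      unfolding mat_vec_index[OF rep_at_carrier v i] using i by (simp add: rep_at_def eval_at_ev del: sum.lessThan_Suc)
  qed simp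
  show "\<exists>W F d. zariski_open_in m n Y W \<and> y \<in> W \<and> (\<forall>i\<le>n. homog m n d (F i)) \<and>
    (\<forall>(b, q)\<in>W. \<forall>v\<in>q. let w = vec (n + 1) (\<lambda>i. eval_at (F i) (b @\<^sub>v v)) in
       w \<noteq> 0\<^sub>v (n + 1) \<and> (\<lambda>v. rep_at (n + 1) P b *\<^sub>v v) ` q = proj_point w)"
  proof (rule exI[of _ Y], rule exI[of _ F], rule exI[of _ 1], intro conjI ballI)
    show "zariski_open_in m n Y Y" by (rule zariski_open_refl[OF Y])
    show "y \<in> Y" by (rule y)
    show "\<forall>i\<le>n. homog m n 1 (F i)" using hF by blast
    fix bq assume bq: "bq \<in> Y"
    obtain b q where e: "bq = (b, q)" by (cases bq)
    have b: "b \<in> carrier_vec m" and q: "q \<in> proj_space n" using bq Y e by auto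
    from q obtain u where u: "u \<in> carrier_vec (n + 1)" "u \<noteq> 0\<^sub>v (n + 1)" "q = proj_point u" by (rule proj_spaceE)
    have "let w = vec (n + 1) (\<lambda>i. eval_at (F i) (b @\<^sub>v v)) in
       w \<noteq> 0\<^sub>v (n + 1) \<and> (\<lambda>v. rep_at (n + 1) P b *\<^sub>v v) ` q = proj_point w" if v: "v \<in> q" for v
    proof -
      note vv = in_proj_pointD[OF u(1,2) v[unfolded u(3)]]
      show ?thesis unfolding Let_def val[OF b vv(1)]
        using inj[OF b vv(1,2)] image_proj_point[OF rep_at_carrier[of "n + 1" P b] vv(1)] vv(3) u(3) by simp
    qed
    then show "case bq of (b, q) \<Rightarrow> \<forall>v\<in>q. let w = vec (n + 1) (\<lambda>i. eval_at (F i) (b @\<^sub>v v)) in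
       w \<noteq> 0\<^sub>v (n + 1) \<and> (\<lambda>v. rep_at (n + 1) P b *\<^sub>v v) ` q = proj_point w"
      unfolding e by simp
  qed
qed

lemma regular_self_map_matrix:
  fixes A :: "'k::field mat"
  assumes A: "A \<in> carrier_mat (n + 1) (n + 1)"
    and inj: "\<And>v. v \<in> carrier_vec (n + 1) ==> v \<noteq> 0\<^sub>v (n + 1) ==> A *\<^sub>v v \<noteq> 0\<^sub>v (n + 1)"
  shows "regular_self_map n (\<lambda>p. (\<lambda>v. A *\<^sub>v v) ` p)"
proof -
  let ?P = "\<lambda>i j. mpoly_const (A $$ (i, j))"
  have r: "rep_at (n + 1) ?P a = A" for a
    by (rule eq_matI) (use A in \<open>auto simp: rep_at_def eval_at_ev\<close>)
  have "regular_map 0 n ({0\<^sub>v 0} \<times> proj_space n) (\<lambda>a p. (\<lambda>v. rep_at (n + 1) ?P a *\<^sub>v v) ` p)"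
  proof (rule regular_map_matrix)
    show "rep_at (n + 1) ?P a *\<^sub>v v \<noteq> 0\<^sub>v (n + 1)" if "v \<in> carrier_vec (n + 1)" "v \<noteq> 0\<^sub>v (n + 1)" for a v
      unfolding r by (rule inj[OF that])
    have "{0\<^sub>v 0} \<subseteq> (carrier_vec 0 :: 'k vec set)" using zero_carrier_vec[of 0] by blast
    then show "({0\<^sub>v 0} :: 'k vec set) \<times> proj_space n \<subseteq> carrier_vec 0 \<times> (proj_space n :: 'k vec set set)"
      by (intro Sigma_mono order.refl)
  qed simp
  then show ?thesis unfolding regular_self_map_def r .
qed

lemma inverse_mat_vec:
  fixes A :: "'k::field mat"
  assumes "A \<in> carrier_mat N N" "A' \<in> carrier_mat N N" "A' * A = 1\<^sub>m N" "v \<in> carrier_vec N"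
  shows "A' *\<^sub>v (A *\<^sub>v v) = v"
  using assoc_mult_mat_vec[OF assms(2,1,4)] assms(3,4) by simp

lemma inverse_mat_nonzero:
  fixes A :: "'k::field mat"
  assumes A: "A \<in> carrier_mat N N" "A' \<in> carrier_mat N N" "A' * A = 1\<^sub>m N" and v: "v \<in> carrier_vec N" "v \<noteq> 0\<^sub>v N"
  shows "A *\<^sub>v v \<noteq> 0\<^sub>v N"
  using inverse_mat_vec[OF A v(1)] mult_mat_zero_vec[OF A(2)] v(2) by auto

lemma linear_automorphism:
  fixes A :: "'k::field mat"
  assumes A: "A \<in> carrier_mat (n + 1) (n + 1)" "A' \<in> carrier_mat (n + 1) (n + 1)"
    "A * A' = 1\<^sub>m (n + 1)" "A' * A = 1\<^sub>m (n + 1)"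
  shows "proj_automorphism n (\<lambda>p. (\<lambda>v. A *\<^sub>v v) ` p)"
proof -
  let ?f = "\<lambda>B :: 'k mat. \<lambda>p. (\<lambda>v. B *\<^sub>v v) ` p"
  have into: "?f B p \<in> proj_space n"
    if B: "B \<in> carrier_mat (n + 1) (n + 1)" "B' \<in> carrier_mat (n + 1) (n + 1)" "B' * B = 1\<^sub>m (n + 1)" "p \<in> proj_space n" for B B' p
  proof -
    obtain v where v: "v \<in> carrier_vec (n + 1)" "v \<noteq> 0\<^sub>v (n + 1)" "p = proj_point v" using B(4) by (rule proj_spaceE)
    show ?thesis unfolding v(3) image_proj_point[OF B(1) v(1)]
      by (rule proj_spaceI[OF mult_mat_vec_carrier[OF B(1) v(1)] inverse_mat_nonzero[OF B(1-3) v(1,2)]])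
  qed
  have inv: "?f B' (?f B p) = p"
    if B: "B \<in> carrier_mat (n + 1) (n + 1)" "B' \<in> carrier_mat (n + 1) (n + 1)" "B' * B = 1\<^sub>m (n + 1)" "p \<in> proj_space n" for B B' p
  proof -
    obtain v where v: "v \<in> carrier_vec (n + 1)" "v \<noteq> 0\<^sub>v (n + 1)" "p = proj_point v" using B(4) by (rule proj_spaceE)
    show ?thesis unfolding v(3) image_proj_point[OF B(1) v(1)]
        image_proj_point[OF B(2) mult_mat_vec_carrier[OF B(1) v(1)]] inverse_mat_vec[OF B(1-3) v(1)] ..
  qed
  have bij: "bij_betw (?f A) (proj_space n) (proj_space n)"
  proof (rule bij_betw_byWitness[of _ "?f A'"])
    show "\<forall>a\<in>proj_space n. ?f A' (?f A a) = a" by (intro ballI inv[OF A(1,2,4)])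
    show "\<forall>a\<in>proj_space n. ?f A (?f A' a) = a" by (intro ballI inv[OF A(2,1,3)])
    show "?f A ` proj_space n \<subseteq> proj_space n" by (intro image_subsetI into[OF A(1,2,4)])
    show "?f A' ` proj_space n \<subseteq> proj_space n" by (intro image_subsetI into[OF A(2,1,3)])
  qed
  have r: "regular_self_map n (?f A)" by (rule regular_self_map_matrix[OF A(1) inverse_mat_nonzero[OF A(1,2,4)]])
  have r': "regular_self_map n (?f A')" by (rule regular_self_map_matrix[OF A(2) inverse_mat_nonzero[OF A(2,1,3)]])
  have "regular_self_map n (inv_into (proj_space n) (?f A))"
    unfolding regular_self_map_def
  proof (rule regular_map_cong[OF _ r'[unfolded regular_self_map_def]])
    fix b :: "'k vec" and q :: "'k vec set" assume "(b, q) \<in> {0\<^sub>v 0} \<times> proj_space n"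
    then have q: "q \<in> proj_space n" by simp
    have "inv_into (proj_space n) (?f A) (?f A (?f A' q)) = ?f A' q"
      by (rule inv_into_f_f[OF bij_betw_imp_inj_on[OF bij] into[OF A(2,1,3) q]])
    then show "?f A' q = inv_into (proj_space n) (?f A) q" unfolding inv[OF A(2,1,3) q] by (rule sym)
  qed
  with bij r show ?thesis unfolding proj_automorphism_def by (intro conjI)
qed

definition hyp :: "nat \<Rightarrow> 'k::field mpoly \<Rightarrow> 'k vec set set" where
  "hyp n f = {p \<in> proj_space n. \<forall>v\<in>p. eval_at f v = 0}"

lemma ev_smult_vec:
  fixes f :: "'k::field mpoly"
  assumes f: "homog 0 n d f" and v: "v \<in> carrier_vec (n + 1)"
  shows "ev (($) (c \<cdot>\<^sub>v v)) f = c ^ d * ev (($) v) f"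
proof -
  have "ev (($) (c \<cdot>\<^sub>v v)) f = ev (\<lambda>i. c * v $ i) f"
    by (rule mpoly_eval_cong) (use vars_homog[OF f] v in auto)
  then show ?thesis using homog_scale[OF f] by simp
qed

lemma hyp_iff:
  assumes f: "homog 0 n d f" and v: "v \<in> carrier_vec (n + 1)" "v \<noteq> 0\<^sub>v (n + 1)"
  shows "proj_point v \<in> hyp n f \<longleftrightarrow> ev (($) v) f = 0"
proof
  assume "proj_point v \<in> hyp n f"
  then show "ev (($) v) f = 0" using self_in_proj_point[of v] by (auto simp: hyp_def eval_at_ev)
next
  assume z: "ev (($) v) f = 0"
  have "eval_at f w = 0" if w: "w \<in> proj_point v" for w
  proof -
    obtain c where "w = c \<cdot>\<^sub>v v" using w unfolding proj_point_def by (elim CollectE exE conjE)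
    then show ?thesis using ev_smult_vec[OF f v(1), of c] z by (simp add: eval_at_ev)
  qed
  then show "proj_point v \<in> hyp n f" using proj_spaceI[OF v] by (simp add: hyp_def)
qed

lemma proj_isomorphic_linear:
  fixes f h :: "'k::field mpoly"
  assumes A: "A \<in> carrier_mat (n + 1) (n + 1)" "A' \<in> carrier_mat (n + 1) (n + 1)"
      "A * A' = 1\<^sub>m (n + 1)" "A' * A = 1\<^sub>m (n + 1)"
    and f: "homog 0 n d f" and h: "homog 0 n e h"
    and fh: "\<And>v. v \<in> carrier_vec (n + 1) ==> ev (($) v) f = 0 \<longleftrightarrow> ev (($) (A *\<^sub>v v)) h = 0"
  shows "proj_isomorphic n (hyp n f) (hyp n h)"
  unfolding proj_isomorphic_def
proof (intro exI conjI)
  let ?f = "\<lambda>p. (\<lambda>v. A *\<^sub>v v) ` p"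
  show "proj_automorphism n ?f" by (rule linear_automorphism[OF A])
  have hp: "p \<in> proj_space n" if "p \<in> hyp n g" for p and g :: "'k mpoly" using that by (simp add: hyp_def)
  show "?f ` hyp n f = hyp n h"
  proof (rule equalityI, rule image_subsetI)
    fix p assume p: "p \<in> hyp n f"
    obtain v where v: "v \<in> carrier_vec (n + 1)" "v \<noteq> 0\<^sub>v (n + 1)" "p = proj_point v" using hp[OF p] by (rule proj_spaceE)
    show "?f p \<in> hyp n h"
      using p unfolding v(3) image_proj_point[OF A(1) v(1)] hyp_iff[OF f v(1,2)]
        hyp_iff[OF h mult_mat_vec_carrier[OF A(1) v(1)] inverse_mat_nonzero[OF A(1,2,4) v(1,2)]] fh[OF v(1)] .
  next
    show "hyp n h \<subseteq> ?f ` hyp n f"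
    proof
      fix p assume p: "p \<in> hyp n h"
      obtain v where v: "v \<in> carrier_vec (n + 1)" "v \<noteq> 0\<^sub>v (n + 1)" "p = proj_point v" using hp[OF p] by (rule proj_spaceE)
      let ?w = "A' *\<^sub>v v"
      have w: "?w \<in> carrier_vec (n + 1)" "?w \<noteq> 0\<^sub>v (n + 1)"
        using mult_mat_vec_carrier[OF A(2) v(1)] inverse_mat_nonzero[OF A(2,1,3) v(1,2)] by auto
      have Aw: "A *\<^sub>v ?w = v" by (rule inverse_mat_vec[OF A(2,1,3) v(1)])
      have "proj_point ?w \<in> hyp n f"
        using p unfolding v(3) hyp_iff[OF f w] hyp_iff[OF h v(1,2)] fh[OF w(1)] Aw .
      moreover have "p = ?f (proj_point ?w)" unfolding image_proj_point[OF A(1) w(1)] Aw by (rule v(3))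
      ultimately show "p \<in> ?f ` hyp n f" by (rule rev_image_eqI)
    qed
  qed
qed

section \<open>The model hypersurface\<close>

text \<open>With the coefficients evaluated at a point, \<open>grade\<close> becomes a polynomial in
  the scaling parameter, and over an infinite field its coefficients can be compared.\<close>

lemma homog_if_scale:
  fixes f :: "'k::field_char_0 mpoly"
  assumes vf: "vars f \<subseteq> {..n}" and sc: "\<And>t v. ev (\<lambda>i. t * v i) f = t ^ d * ev v f"
  shows "homog 0 n d f"
proof -
  let ?w = "ind 0 n"
  have "grade ?w f = monom f d"
  proof (rule poly_eqI, rule mpoly_eqI)
    fix k and s :: "nat \<Rightarrow> 'k"
    have "map_poly (ev s) (grade ?w f) = monom (ev s f) d"
    proof -
      have h: "comm_ring_hom (\<lambda>p. poly (map_poly (ev s) p) t)" for t by (rule poly_map_hom[OF ev_hom])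
      have "poly (map_poly (ev s) (grade ?w f)) t = poly (monom (ev s f) d) t" for t
      proof -
        have "poly (map_poly (ev s) (grade ?w f)) t = ev (\<lambda>i. t ^ ?w i * s i) f"
          unfolding grade_def mpoly_eval_comp[OF h] by (simp add: map_poly_pCons map_poly_monom poly_monom mult.commute)
        also have "\<dots> = ev (\<lambda>i. t * s i) f" by (rule mpoly_eval_cong) (use vf in \<open>auto simp: ind_def\<close>)
        finally show ?thesis by (simp add: sc poly_monom mult.commute)
      qed
      then have "poly (map_poly (ev s) (grade ?w f)) = poly (monom (ev s f) d)" by (rule ext)
      then show ?thesis by (simp only: poly_eq_poly_eq_iff)
    qed
    then have "coeff (map_poly (ev s) (grade ?w f)) k = coeff (monom (ev s f) d) k" by (rule arg_cong)
    then show "ev s (coeff (grade ?w f) k) = ev s (coeff (monom f d) k)"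
      by (simp add: coeff_map_poly coeff_monom split: if_splits)
  qed
  then show ?thesis using vf by (simp add: homog_iff whomog_iff_grade)
qed

text \<open>An irreducible factor of \<open>b\<close> divides a power of the variable, so it is the
  variable up to a unit.\<close>

lemma dvd_var_power_unit:
  fixes b :: "'k::field mpoly"
  assumes b: "b dvd mpoly_const k * mpoly_var i ^ e" "k \<noteq> 0" and nd: "\<not> mpoly_var i dvd b"
  shows "b dvd 1"
proof (rule ccontr)
  assume nu: "\<not> b dvd 1"
  have "b \<noteq> 0"
  proof
    assume "b = 0"
    then show False using nd by simp
  qed
  then obtain p g where p: "irreducible p" "b = p * g" using exists_irreducible_factor[OF _ nu] by blast
  have pb: "p dvd b" unfolding p(2) by simp
  then have "p dvd mpoly_const k * mpoly_var i ^ e" using b(1) by (rule dvd_trans)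
  then have "p dvd mpoly_const k \<or> p dvd mpoly_var i ^ e" by (rule irreducible_dvd_mult[OF p(1)])
  moreover have np: "\<not> p dvd 1" using p(1) by (simp add: irreducible_def)
  moreover have "\<not> p dvd mpoly_const k" using np is_unit_const[OF b(2)] dvd_trans by blast
  ultimately have "p dvd mpoly_var i ^ e" by blast
  then have "p dvd mpoly_var i"
  proof (induction e)
    case 0
    then show ?case using np by simp
  next
    case (Suc e)
    then show ?case using irreducible_dvd_mult[OF p(1), of "mpoly_var i" "mpoly_var i ^ e"] by auto
  qed
  then obtain u where u: "mpoly_var i = p * u" by (elim dvdE)
  then have "p dvd 1 \<or> u dvd 1" by (rule irreducibleD[OF irreducible_mpoly_var])
  then have "u dvd 1" using np by blast
  then obtain u' where u': "1 = u * u'" by (elim dvdE)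
  have "p = mpoly_var i * u'" unfolding u mult.assoc u'[symmetric] by simp
  then have "mpoly_var i dvd p" by (rule dvdI)
  then show False using nd pb dvd_trans by blast
qed

text \<open>As \<open>g\<close> has degree 1 in variable \<open>n\<close>, one of two factors is
  free of it and divides the leading coefficient, a power of variable 0 up to a constant. The point
  \<open>v\<close> shows that variable 0 does not divide \<open>g\<close>, so this factor is a
  unit.\<close>

lemma irreducible_linear_in_var:
  fixes g h :: "'k::field mpoly"
  assumes g: "g = mpoly_const k * mpoly_var 0 ^ e * mpoly_var n + h" and k: "k \<noteq> 0" and n: "n \<noteq> 0"
    and h: "n \<notin> vars h" and v: "v 0 = 0" "ev v g \<noteq> 0"
  shows "irreducible g"
proof -
  let ?q = "mpoly_const k * mpoly_var 0 ^ e"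
  have nq: "n \<notin> vars ?q"
    using vars_subset_intros(3)[OF _ vars_subset_intros(4), of "mpoly_const k" "{0}" "mpoly_var 0" e] n by auto
  have q0: "?q \<noteq> 0" using k by simp
  have up: "up n g = [:h, ?q:]"
    unfolding g by (simp add: up_add up_mult up_free[OF h] up_free[OF nq, unfolded up_mult])
  have nd: "\<not> mpoly_var 0 dvd g"
  proof
    assume "mpoly_var 0 dvd g"
    then obtain r where "g = mpoly_var 0 * r" by (elim dvdE)
    then show False using v by simp
  qed
  have unit: "b dvd 1" if gab: "g = a * b" and b: "degree (up n b) = 0" for a b
  proof -
    obtain b0 where b0: "up n b = [:b0:]" using degree_eq_zeroE[OF b] by blast
    have "b = b0" using poly_up[of n b] unfolding b0 by simp
    then have "?q = coeff (up n a) 1 * b"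
      using arg_cong[OF up, of "\<lambda>p. coeff p 1"] unfolding gab up_mult b0 by (simp add: mult.commute)
    then have "b dvd ?q" by simp
    moreover have "\<not> mpoly_var 0 dvd b" using nd gab by auto
    ultimately show ?thesis using dvd_var_power_unit k by blast
  qed
  show ?thesis unfolding irreducible_def
  proof (intro conjI allI impI)
    show g0: "g \<noteq> 0" using v by auto
    show "\<not> g dvd 1"
    proof
      assume "g dvd 1"
      then have "vars g = {}" by (rule unit_vars)
      then have "up n g = [:g:]" by (intro up_free) simp
      then show False unfolding up using q0 by simp
    qed
    fix a b assume ab: "g = a * b"
    have "degree (up n a * up n b) = 1" unfolding up_mult[symmetric] ab[symmetric] up using q0 by simp
    moreover have "up n a \<noteq> 0" "up n b \<noteq> 0" using ab g0 by auto
    ultimately have "degree (up n a) + degree (up n b) = 1" by (simp add: degree_mult_eq)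
    then have "degree (up n a) = 0 \<or> degree (up n b) = 0" by linarith
    then show "a dvd 1 \<or> b dvd 1" using unit[OF ab] unit[OF ab[unfolded mult.commute[of a b]]] by blast
  qed
qed

text \<open>Converse to \<open>nondegenerate_imp\<close>. For \<open>q = z w * e\<close>, invariance
  along \<open>w\<close> says that \<pi> of ln(1 + t q) is 0 for all t; the coefficient of t is
  \<open>\<pi> q\<close>.\<close>

lemma (in norm_alg) pairing_zero_if_invariant:
  assumes hi: "\<And>w i. aug w = 0 ==> i > d ==> \<pi> (w ^ i) = 0" and w0: "w 0 = 0"
    and inv: "\<And>v t. G d (\<lambda>j. v j + t * w j) = G d v"
  shows "\<pi> (z w * r) = 0"
proof -
  have unit: "\<pi> (z w * e) = 0" if e: "aug e = 1" for e
  proof -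
    obtain e' where e': "e * e' \<approx> 1" using unit_exists[of e] e by auto
    have ae': "aug e' = 1" using eqv_aug[OF e'] e by simp
    \<comment> \<open>\<open>1 + z u\<close> represents the inverse of \<open>e\<close>, so adding
      \<open>c t * z w\<close> to it amounts to multiplying it by
      \<open>1 + c t * q\<close>.\<close>
    define u where "u j = (if j = 0 then 1 else \<tau> (e' - 1) $ j)" for j
    have "z u = z (\<lambda>j. \<tau> (e' - 1) $ j)" by (rule z_cong) (simp add: u_def)
    also have "\<dots> \<approx> e' - 1" by (rule z_coords) (simp add: ae')
    finally have zu: "1 + z u \<approx> e'" using eqv_add[OF eqv_refl[of 1], of "z u" "e' - 1"] by simp
    have ze: "(1 + z u) * e \<approx> 1"
      using eqv_trans[OF eqv_mult[OF zu eqv_refl[of e]]] e' by (simp add: mult.commute)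
    define q where "q = z w * e"
    have L0: "\<pi> (L (c t * q)) = 0" for t
    proof -
      define v' where "v' j = u j + t * w j" for j
      have u0: "u 0 = 1" "v' 0 = 1" by (simp_all add: u_def v'_def w0)
      have "z v' = z u + c t * z w"
        unfolding z_def v'_def sum_distrib_left sum.distrib[symmetric] by (rule sum.cong) (simp_all add: c_simps algebra_simps)
      also have "\<dots> \<approx> z u + c t * z w * ((1 + z u) * e)"
        using eqv_add[OF eqv_refl eqv_mult[OF eqv_refl eqv_sym[OF ze]], of "z u" "c t * z w"] by simp
      also have "\<dots> = (1 + z u) * (1 + c t * q) - 1" by (simp add: q_def algebra_simps)
      finally have "L (z v') \<approx> L ((1 + z u) * (1 + c t * q) - 1)" by (rule L_cong)
      also have "\<dots> \<approx> L (z u) + L (c t * q)" by (rule L_mult) (simp_all add: q_def)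
      finally have "\<pi> (L (z v')) = \<pi> (L (z u)) + \<pi> (L (c t * q))" by (simp add: \<pi>_eqv \<pi>_add)
      moreover have "G d v' = \<pi> (L (z v'))" using G_eq[of d v', OF hi] u0 by simp
      moreover have "G d u = \<pi> (L (z u))" using G_eq[of d u, OF hi] u0 by simp
      moreover have "G d v' = G d u" unfolding v'_def by (rule inv)
      ultimately show ?thesis by simp
    qed
    have "poly (\<Sum>i<K. monom (s i * \<pi> (q ^ i)) i) t = 0" for t
    proof -
      have "poly (\<Sum>i<K. monom (s i * \<pi> (q ^ i)) i) t = (\<Sum>i<K. s i * \<pi> ((c t * q) ^ i))"
        unfolding poly_sum by (rule sum.cong) (simp_all add: poly_monom power_mult_distrib \<pi>_c flip: c_simps(3))
      then show ?thesis using L0[of t] unfolding \<pi>_L by simp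
    qed
    then have "(\<Sum>i<K. monom (s i * \<pi> (q ^ i)) i) = 0" by (intro poly_all_0_iff_0[THEN iffD1] allI)
    then have "coeff (\<Sum>i<K. monom (s i * \<pi> (q ^ i)) i) 1 = 0" by simp
    moreover have "coeff (\<Sum>i<K. monom (s i * \<pi> (q ^ i)) i) 1 = (\<Sum>i<K. if i = 1 then s 1 * \<pi> q else 0)"
      unfolding coeff_sum by (rule sum.cong) (auto simp: coeff_monom)
    ultimately have "s 1 * \<pi> q = 0" using D_pos by (simp add: sum.delta)
    then show ?thesis using s_nz[of 1] by (simp add: q_def)
  qed
  \<comment> \<open>Any \<open>r\<close> is a constant plus an element of augmentation 1, and the
    unit case covers both.\<close>
  have "z w * r = z w * (r - c (aug r) + 1) + c (aug r - 1) * (z w * 1)" by (simp add: c_simps algebra_simps)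
  then have "\<pi> (z w * r) = \<pi> (z w * (r - c (aug r) + 1)) + (aug r - 1) * \<pi> (z w * 1)" by (simp only: \<pi>_add \<pi>_c)
  then show ?thesis using unit[of "r - c (aug r) + 1"] unit[of 1] by simp
qed

context
  fixes d :: nat
  assumes d: "d \<ge> 2"
begin

interpretation M: norm_alg "Suc (Suc d)" "mconst :: 'k::field_char_0 \<Rightarrow> _" maug "mtau d" "Suc d" "Suc d" "mbase d"
  using model_norm[OF d, of "Suc d", where 'k='k] by simp

lemma model_hi: "maug w = 0 ==> i > d ==> M.\<pi> (w ^ i) = 0"
  unfolding M.\<pi>_def using mtau_nil[of w d i] d by simp

lemma mform_ev: "ev v (mform d) = M.G d v"
  using mform(2)[OF d] by simp

lemma mform_homog: "homog 0 (Suc d) d (mform d :: 'k::field_char_0 mpoly)"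
proof (rule homog_if_scale)
  show "vars (mform d :: 'k::field_char_0 mpoly) \<subseteq> {..Suc d}" using mform(1)[OF d, where 'k='k] by auto
qed (simp add: mform_ev M.G_scale)

lemma model_socle: "maug w = 0 ==> mbase d (Suc d) * w \<in> M.J"
proof -
  assume "maug w = 0"
  then have "mtau d (w * poly_x ^ d) = 0\<^sub>v (d + 2)"
    unfolding mtau_eq_0_iff coeff_x_power_mult using d by (auto simp: maug_def)
  then show ?thesis by (simp add: M.J_def mbase_def mult.commute)
qed

text \<open>\<open>x ^ d\<close> annihilates the maximal ideal, so the last variable enters only
  through the first power of \<open>z\<close>.\<close>

lemma model_linear: "M.G d v = M.s 1 * v 0 ^ (d - 1) * v (Suc d) + M.G d (v(Suc d := 0))"
proof -
  let ?v = "v(Suc d := 0)"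
  let ?u = "mconst (v (Suc d)) * mbase d (Suc d)"
  have zz: "M.z v = ?u + M.z ?v"
  proof -
    have "(\<Sum>j\<in>{1..Suc d}. mconst (v j) * mbase d j) = (\<Sum>j\<in>{1..d}. mconst (v j) * mbase d j) + ?u" by simp
    also have "(\<Sum>j\<in>{1..d}. mconst (v j) * mbase d j) = (\<Sum>j\<in>{1..d}. mconst (?v j) * mbase d j)"
      by (rule sum.cong) auto
    also have "\<dots> = (\<Sum>j\<in>{1..Suc d}. mconst (?v j) * mbase d j)" by (simp add: M.c_0)
    finally show ?thesis unfolding M.z_def by (simp add: add.commute)
  qed
  have uw: "?u * w \<in> M.J" if "maug w = 0" for w
    using M.J_mult[OF model_socle[OF that], of "mconst (v (Suc d))"] by (simp add: mult.assoc)
  have au: "maug ?u = 0" using d by (simp add: maug_mbase)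
  have pow: "M.eqv (M.z v ^ i) (M.z ?v ^ i)" if "i \<ge> 2" for i
    using that
  proof (induction i rule: nat_induct_at_least)
    case base
    have e: "M.z v ^ 2 - M.z ?v ^ 2 = ?u * (?u + M.z ?v + M.z ?v)"
      unfolding zz by (simp add: power2_eq_square algebra_simps)
    show ?case unfolding M.eqv_def e by (rule uw) (use d in \<open>simp add: maug_mbase\<close>)
  next
    case (Suc i)
    have "M.eqv (M.z v ^ Suc i) (M.z v * M.z ?v ^ i)" unfolding power_Suc by (rule M.eqv_mult[OF M.eqv_refl Suc.IH])
    also have "M.z v * M.z ?v ^ i = M.z ?v ^ Suc i + ?u * M.z ?v ^ i" unfolding zz by (simp add: algebra_simps)
    also have "M.eqv \<dots> (M.z ?v ^ Suc i)"
      by (rule M.eqv_add_J[OF uw]) (use Suc.hyps in \<open>simp add: power_0_left\<close>)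
    finally show ?case .
  qed
  have p1: "M.\<pi> (M.z u) = u (Suc d)" for u unfolding M.\<pi>_def by (subst M.\<tau>_z) simp_all
  have "M.G d v - M.G d ?v = (\<Sum>i\<in>{1..d}. M.s i * v 0 ^ (d - i) * (M.\<pi> (M.z v ^ i) - M.\<pi> (M.z ?v ^ i)))"
    unfolding M.G_def sum_subtractf[symmetric] by (rule sum.cong) (simp_all add: right_diff_distrib)
  also have "\<dots> = (\<Sum>i\<in>{1..d}. if i = 1 then M.s 1 * v 0 ^ (d - 1) * v (Suc d) else 0)"
  proof (rule sum.cong[OF refl])
    fix i assume "i \<in> {1..d}"
    then show "M.s i * v 0 ^ (d - i) * (M.\<pi> (M.z v ^ i) - M.\<pi> (M.z ?v ^ i)) =
        (if i = 1 then M.s 1 * v 0 ^ (d - 1) * v (Suc d) else 0)"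
      using M.\<pi>_eqv[OF pow[of i]] by (cases "i = 1") (simp_all add: p1[simplified])
  qed
  also have "\<dots> = M.s 1 * v 0 ^ (d - 1) * v (Suc d)" using d by (simp add: sum.delta)
  finally show ?thesis by (simp only: diff_eq_eq)
qed

text \<open>The form is linear in the last variable, with a power of variable 0 as coefficient. The
  point whose only nonzero coordinate has index 1, where \<open>z\<close> is \<open>x\<close>, shows
  that variable 0 is not a factor.\<close>

lemma mform_irreducible: "irreducible (mform d :: 'k::field_char_0 mpoly)"
proof (rule irreducible_linear_in_var)
  let ?f = "mform d :: 'k::field_char_0 mpoly"
  let ?h = "mpoly_eval mpoly_const (\<lambda>i. if i = Suc d then 0 else mpoly_var i) ?f"
  let ?v = "\<lambda>j::nat. if j = 1 then 1 else 0 :: 'k"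
  have eh: "ev v ?h = ev (v(Suc d := 0)) ?f" for v
  proof -
    have "ev v ?h = mpoly_eval (\<lambda>c. ev v (mpoly_const c)) (\<lambda>i. ev v (if i = Suc d then 0 else mpoly_var i)) ?f"
      by (rule mpoly_eval_comp[OF ev_hom])
    also have "\<dots> = ev (v(Suc d := 0)) ?f" by (simp add: fun_upd_def if_distrib cong: if_cong)
    finally show ?thesis .
  qed
  show "?f = mpoly_const (M.s 1) * mpoly_var 0 ^ (d - 1) * mpoly_var (Suc d) + ?h"
  proof (rule mpoly_eqI)
    show "ev v ?f = ev v (mpoly_const (M.s 1) * mpoly_var 0 ^ (d - 1) * mpoly_var (Suc d) + ?h)" for v
      unfolding ev_add ev_mult ev_power eh mform_ev using model_linear[of v] by simp
  qed
  show "M.s 1 \<noteq> (0 :: 'k)" by (rule M.s_nz) simp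
  show "Suc d \<notin> vars ?h"
  proof (rule not_in_vars_if_constant)
    show "ev (s(Suc d := a)) ?h = ev s ?h" for s a unfolding eh by simp
  qed
  show "?v 0 = 0" by simp
  have z: "M.z ?v = poly_x"
  proof -
    have "M.z ?v = (\<Sum>j\<in>{1..Suc d}. if j = 1 then mbase d 1 else 0)"
      unfolding M.z_def by (rule sum.cong) auto
    then show ?thesis using d by (simp add: sum.delta mbase_def)
  qed
  have "M.G d ?v = (\<Sum>i\<in>{1..d}. if i = d then M.s d * M.\<pi> (poly_x ^ d :: 'k poly poly) else 0)"
    unfolding M.G_def z by (rule sum.cong) (auto simp: power_0_left)
  also have "\<dots> = M.s d * M.\<pi> (poly_x ^ d :: 'k poly poly)" using d by (simp add: sum.delta)
  also have "M.\<pi> (poly_x ^ d :: 'k poly poly) = 1"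
    unfolding M.\<pi>_def using mtau_mbase[of "Suc d" d, where 'k='k] d by (simp add: mbase_def)
  finally show "ev ?v ?f \<noteq> 0" using M.s_nz[of d] d by (simp add: mform_ev)
qed simp

lemma mform_nondegenerate: "nondegenerate (Suc d) (mform d :: 'k::field_char_0 mpoly)"
proof -
  let ?f = "mform d :: 'k::field_char_0 mpoly"
  have vf: "vars ?f \<subseteq> {..Suc d}" using mform(1)[OF d, where 'k='k] by auto
  show ?thesis unfolding nondegenerate_iff[OF vf]
  proof (intro ballI impI, rule ccontr)
    fix w :: "'k vec" assume w: "w \<in> carrier_vec (Suc d + 1)" "w \<noteq> 0\<^sub>v (Suc d + 1)"
      and "\<not> (\<exists>v t. ev (\<lambda>j. v j + t * w $ j) ?f \<noteq> ev v ?f)"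
    then have inv: "M.G d (\<lambda>j. v j + t * w $ j) = M.G d v" for v t unfolding mform_ev by blast
    let ?e = "\<lambda>j. if j = Suc d then 1 else 0 :: 'k"
    \<comment> \<open>The pairing argument needs \<open>w\<close> in the maximal ideal. Comparing
      the translates of 0 and of the last unit vector leaves a nonzero constant times
      \<open>(w $ 0) ^ (d - 1)\<close>.\<close>
    have w0: "w $ 0 = 0"
    proof -
      let ?w1 = "\<lambda>j. ?e j + 1 * w $ j" and ?w0 = "\<lambda>j. 0 + 1 * w $ j"
      have u: "?w1(Suc d := 0) = ?w0(Suc d := 0)" "?e(Suc d := 0) = (\<lambda>_. 0)" by (auto simp: fun_eq_iff)
      have "M.G d ?w1 = M.s 1 * (w $ 0) ^ (d - 1) * (1 + w $ (Suc d)) + M.G d (?w1(Suc d := 0))"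
        using model_linear[of ?w1] by simp
      moreover have "M.G d ?w0 = M.s 1 * (w $ 0) ^ (d - 1) * (w $ (Suc d)) + M.G d (?w0(Suc d := 0))"
        using model_linear[of ?w0] by simp
      moreover have "M.G d ?e = M.s 1 * 0 ^ (d - 1) * 1 + M.G d (\<lambda>_. 0)" using model_linear[of ?e] u(2) by simp
      ultimately have "M.s 1 * (w $ 0) ^ (d - 1) = 0"
        using inv[of ?e 1] inv[of "\<lambda>_. 0" 1] d unfolding u(1) by (simp add: algebra_simps power_0_left)
      moreover have "M.s 1 \<noteq> (0 :: 'k)" by (rule M.s_nz) simp
      ultimately show ?thesis by simp
    qed
    have "M.\<pi> (M.z (($) w) * r) = 0" for r
      by (rule M.pairing_zero_if_invariant[OF model_hi w0 inv])
    then have "mtau d (M.z (($) w)) = 0\<^sub>v (d + 2)" unfolding M.\<pi>_def by (intro mtau_pairing) simp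
    then have "w $ j = 0" if "j < d + 2" for j
      using M.\<tau>_z[of j "($) w"] w0 that by (cases "j = 0") simp_all
    then have "w = 0\<^sub>v (Suc d + 1)" using w(1) by (intro eq_vecI) simp_all
    then show False using w(2) by contradiction
  qed
qed

end

section \<open>Linear actions\<close>

lemma mat_eq_if_vec:
  fixes A B :: "'k::comm_ring_1 mat"
  assumes A: "A \<in> carrier_mat N N" and B: "B \<in> carrier_mat N N"
    and eq: "\<And>v. v \<in> carrier_vec N ==> A *\<^sub>v v = B *\<^sub>v v"
  shows "A = B"
proof (rule eq_matI)
  fix i j assume "i < dim_row B" "j < dim_col B"
  then have ij: "i < N" "j < N" using B by auto
  have "col A j = col B j"
    using eq[of "unit_vec N j"] unfolding mat_unit_vec_col[OF A ij(2)] mat_unit_vec_col[OF B ij(2)] by simp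
  then have "col A j $ i = col B j $ i" by (rule arg_cong)
  then show "A $$ (i, j) = B $$ (i, j)" using ij A B by simp
qed (use A B in auto)

lemma linear_rep_inverse:
  assumes P: "linear_rep m N P" and a: "a \<in> carrier_vec m"
  shows "rep_at N P (- a) * rep_at N P a = 1\<^sub>m N"
proof -
  have h: "\<forall>a\<in>carrier_vec m. \<forall>b\<in>carrier_vec m. rep_at N P (a + b) = rep_at N P a * rep_at N P b"
    using P unfolding linear_rep_def by (elim conjE)
  have "- a \<in> carrier_vec m" using a by simp
  then have "rep_at N P (- a + a) = rep_at N P (- a) * rep_at N P a" by (rule h[rule_format]) (rule a)
  moreover have "- a + a = 0\<^sub>v m" using a by (rule uminus_l_inv_vec)
  ultimately show ?thesis using P unfolding linear_rep_def by simp
qed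

lemma linear_rep_nonzero:
  assumes P: "linear_rep m N P" and a: "a \<in> carrier_vec m" and v: "v \<in> carrier_vec N" "v \<noteq> 0\<^sub>v N"
  shows "rep_at N P a *\<^sub>v v \<noteq> 0\<^sub>v N"
  by (rule inverse_mat_nonzero[OF rep_at_carrier rep_at_carrier linear_rep_inverse[OF P a] v])

lemma regular_action_linear:
  assumes P: "linear_rep m (n + 1) P" and X: "X \<subseteq> proj_space n"
    and inv: "\<And>a p. a \<in> carrier_vec m ==> p \<in> X ==> (\<lambda>v. rep_at (n + 1) P a *\<^sub>v v) ` p \<in> X"
  shows "regular_action m n X (\<lambda>a p. (\<lambda>v. rep_at (n + 1) P a *\<^sub>v v) ` p)"
  unfolding regular_action_def
proof (intro conjI ballI)
  let ?f = "\<lambda>a p. (\<lambda>v. rep_at (n + 1) P a *\<^sub>v v) ` p"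
  show "?f a p \<in> X" if "a \<in> carrier_vec m" "p \<in> X" for a p by (rule inv[OF that])
  show "?f (0\<^sub>v m) p = p" if p: "p \<in> X" for p
  proof -
    obtain v where v: "v \<in> carrier_vec (n + 1)" "v \<noteq> 0\<^sub>v (n + 1)" "p = proj_point v"
      using subsetD[OF X p] by (rule proj_spaceE)
    show ?thesis unfolding v(3) image_proj_point[OF rep_at_carrier v(1)]
      using P v(1) unfolding linear_rep_def by simp
  qed
  show "?f (a + b) p = ?f a (?f b p)" if a: "a \<in> carrier_vec m" and b: "b \<in> carrier_vec m" and p: "p \<in> X" for a b p
  proof -
    obtain v where v: "v \<in> carrier_vec (n + 1)" "v \<noteq> 0\<^sub>v (n + 1)" "p = proj_point v"
      using subsetD[OF X p] by (rule proj_spaceE)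
    have ab: "rep_at (n + 1) P (a + b) = rep_at (n + 1) P a * rep_at (n + 1) P b"
      using P a b unfolding linear_rep_def by blast
    show ?thesis unfolding v(3) image_proj_point[OF rep_at_carrier v(1)]
      unfolding image_proj_point[OF rep_at_carrier mult_mat_vec_carrier[OF rep_at_carrier v(1)]] ab
        assoc_mult_mat_vec[OF rep_at_carrier rep_at_carrier v(1)] ..
  qed
  show "regular_map m n (carrier_vec m \<times> X) ?f"
  proof (rule regular_map_matrix)
    show "vars (P i j) \<subseteq> {..<m}" if "i < n + 1" "j < n + 1" for i j
      using P that unfolding linear_rep_def by blast
    show "rep_at (n + 1) P a *\<^sub>v v \<noteq> 0\<^sub>v (n + 1)"
      if "a \<in> carrier_vec m" "v \<in> carrier_vec (n + 1)" "v \<noteq> 0\<^sub>v (n + 1)" for a v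
      by (rule linear_rep_nonzero[OF P that])
    show "carrier_vec m \<times> X \<subseteq> carrier_vec m \<times> proj_space n" by (rule Sigma_mono[OF order.refl X])
  qed
qed

section \<open>The group acting on the model hypersurface\<close>

context
  fixes d :: nat
  assumes d: "d \<ge> 2"
begin

interpretation M: norm_alg "Suc (Suc d)" "mconst :: 'k::field_char_0 \<Rightarrow> _" maug "mtau d" "Suc d" "Suc d" "mbase d"
  using model_norm[OF d, of "Suc d", where 'k='k] by simp

text \<open>Group elements: exponentials of the span of x, ..., x^(d-1), y, which is the kernel of
  the functional within the maximal ideal.\<close>

definition munip :: "(nat \<Rightarrow> 'k::field_char_0) \<Rightarrow> 'k poly poly" where
  "munip a = M.E (\<Sum>k<d. mconst (a k) * mbase d (Suc k))"

definition mlie :: "(nat \<Rightarrow> 'k::field_char_0) \<Rightarrow> 'k poly poly" where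
  "mlie a = (\<Sum>k<d. mconst (a k) * mbase d (Suc k))"

lemma munip_eq: "munip a = M.E (mlie a)" by (simp add: munip_def mlie_def)

lemma maug_mlie: "maug (mlie a :: 'k::field_char_0 poly poly) = 0"
proof -
  interpret a: comm_ring_hom "maug :: 'k poly poly \<Rightarrow> 'k" by (rule maug_hom)
  show ?thesis unfolding mlie_def a.hom_sum a.hom_mult using d by (simp add: maug_mbase)
qed

lemma maug_munip: "maug (munip a) = 1"
  unfolding munip_eq by (rule M.aug_E[OF maug_mlie])

lemma pi_mlie: "mtau d (mlie a) $ Suc d = 0"
proof -
  have "mtau d (mlie a) $ Suc d = (\<Sum>k<d. mtau d (mconst (a k) * mbase d (Suc k)) $ Suc d)"
    unfolding mlie_def by (rule M.\<tau>_sum) simp_all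
  also have "\<dots> = 0"
  proof (rule sum.neutral, rule ballI)
    fix k assume "k \<in> {..<d}"
    then have k: "Suc k < Suc (Suc d)" "Suc k \<noteq> Suc d" by auto
    show "mtau d (mconst (a k) * mbase d (Suc k)) $ Suc d = 0"
      unfolding M.\<tau>_c M.\<tau>_b[OF k(1)] using k by simp
  qed
  finally show ?thesis .
qed

lemma munip_pfn: "i < Suc (Suc d) ==> pfn d (\<lambda>a. mtau d (munip a * mbase d j) $ i)"
proof -
  assume i: "i < Suc (Suc d)"
  have "M.rpf d mlie" unfolding mlie_def[abs_def]
    by (rule M.rpf_sum, rule M.rpf.base, rule pfn_var) simp
  then have "M.rpf d (\<lambda>a. munip a * mbase d j)"
    unfolding munip_eq M.E_def by (intro M.rpf_mult M.rpf_evf M.rpf_const)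
  then show ?thesis using i by (rule M.pfn_\<tau>)
qed

text \<open>The matrix of multiplication by \<open>munip a\<close>; its entries are known as
  polynomial functions of \<open>a\<close>, and polynomials for them are chosen.\<close>

definition mrep :: "nat \<Rightarrow> nat \<Rightarrow> 'k::field_char_0 mpoly" where
  "mrep i j = (SOME p. vars p \<subseteq> {..<d} \<and> (\<forall>a. mtau d (munip a * mbase d j) $ i = ev a p))"

lemma mrep:
  assumes "i < Suc (Suc d)"
  shows "vars (mrep i j :: 'k::field_char_0 mpoly) \<subseteq> {..<d}"
    "ev a (mrep i j :: 'k mpoly) = mtau d (munip a * mbase d j) $ i"
proof -
  have "\<exists>p :: 'k mpoly. vars p \<subseteq> {..<d} \<and> (\<forall>a. mtau d (munip a * mbase d j) $ i = ev a p)"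
    using munip_pfn[OF assms] unfolding pfn_def .
  then have *: "vars (mrep i j :: 'k mpoly) \<subseteq> {..<d} \<and>
      (\<forall>a. mtau d (munip a * mbase d j) $ i = ev a (mrep i j :: 'k mpoly))"
    unfolding mrep_def by (rule someI_ex)
  from * show "vars (mrep i j :: 'k mpoly) \<subseteq> {..<d}" by (rule conjunct1)
  from * show "ev a (mrep i j :: 'k mpoly) = mtau d (munip a * mbase d j) $ i" by simp
qed

abbreviation "mact a \<equiv> rep_at (Suc (Suc d)) mrep a"

lemma mact_mtau: "mact a *\<^sub>v mtau d q = mtau d (munip (($) a) * q)"
proof -
  let ?e = "munip (($) a)" and ?v = "($) (mtau d q)"
  have m: "mact a = M.fam_mat (\<lambda>j. ?e * mbase d j)"
    by (rule eq_matI) (simp_all add: rep_at_def M.fam_mat_def eval_at_ev mrep)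
  have v: "vec (Suc (Suc d)) ?v = mtau d q" by (rule eq_vecI) (simp_all add: mtau_def)
  have "M.eqv q (mconst (?v 0) + M.z ?v)" by (rule M.coords)
  also have "mconst (?v 0) + M.z ?v = (\<Sum>j<Suc (Suc d). mconst (?v j) * mbase d j)"
    unfolding M.z_def One_nat_def sum.atLeast1_atMost_eq
    by (subst sum.lessThan_Suc_shift) (simp add: M.b_0)
  finally have "M.eqv (?e * q) (?e * (\<Sum>j<Suc (Suc d). mconst (?v j) * mbase d j))"
    by (rule M.eqv_mult[OF M.eqv_refl])
  also have "?e * (\<Sum>j<Suc (Suc d). mconst (?v j) * mbase d j) = (\<Sum>j<Suc (Suc d). mconst (?v j) * (?e * mbase d j))"
    unfolding sum_distrib_left by (rule sum.cong) (simp_all only: ac_simps)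
  finally show ?thesis unfolding M.eqv_iff M.\<tau>_fam m v by (rule sym)
qed

lemma mtau_exists: "v \<in> carrier_vec (Suc (Suc d)) ==> \<exists>q. mtau d q = (v :: 'k::field_char_0 vec)"
  by (rule M.\<tau>_surj)

lemma munip_add: "M.eqv (munip (\<lambda>k. a k + b k)) (munip a * munip b)"
proof -
  have "mlie (\<lambda>k. a k + b k) = mlie a + mlie b"
    unfolding mlie_def sum.distrib[symmetric] by (simp add: M.c_simps distrib_right)
  then show ?thesis unfolding munip_eq using M.E_add[OF maug_mlie maug_mlie] by simp
qed

lemma munip_cong: "(\<And>k. k < d ==> a k = b k) ==> munip a = munip b"
  unfolding munip_def by (intro arg_cong[of _ _ M.E] sum.cong) auto

lemma munip_0: "munip (\<lambda>_. 0) = 1"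
  by (simp add: munip_def M.c_0 M.E_0)

lemma mrep_linear: "linear_rep d (Suc (Suc d)) (mrep :: nat \<Rightarrow> nat \<Rightarrow> 'k::field_char_0 mpoly)"
  unfolding linear_rep_def
proof (intro conjI allI impI ballI)
  let ?N = "Suc (Suc d)"
  show "vars (mrep i j :: 'k mpoly) \<subseteq> {..<d}" if "i < ?N" for i j by (rule mrep(1)[OF that])
  show "mact (0\<^sub>v d) = (1\<^sub>m ?N :: 'k mat)"
  proof (rule mat_eq_if_vec)
    fix v :: "'k vec" assume v: "v \<in> carrier_vec ?N"
    obtain q where q: "mtau d q = v" using mtau_exists[OF v] by blast
    have "munip (($) (0\<^sub>v d)) = munip (\<lambda>_. 0 :: 'k)" by (rule munip_cong) simp
    then show "mact (0\<^sub>v d) *\<^sub>v v = 1\<^sub>m ?N *\<^sub>v v" using v unfolding q[symmetric] mact_mtau by (simp add: munip_0)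
  qed simp_all
  fix a b :: "'k vec" assume ab: "a \<in> carrier_vec d" "b \<in> carrier_vec d"
  show "mact (a + b) = mact a * mact b"
  proof (rule mat_eq_if_vec)
    show "mact a * mact b \<in> carrier_mat ?N ?N" by (rule mult_carrier_mat[OF rep_at_carrier rep_at_carrier])
    fix v :: "'k vec" assume v: "v \<in> carrier_vec ?N"
    obtain q where q: "mtau d q = v" using mtau_exists[OF v] by blast
    have "munip (($) (a + b)) = munip (\<lambda>k. a $ k + b $ k)" by (rule munip_cong) (use ab in simp)
    then have "M.eqv (munip (($) (a + b)) * q) (munip (($) a) * munip (($) b) * q)"
      using M.eqv_mult[OF munip_add M.eqv_refl] by simp
    then have "mtau d (munip (($) (a + b)) * q) = mtau d (munip (($) a) * (munip (($) b) * q))"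
      unfolding M.eqv_iff mult.assoc .
    then show "mact (a + b) *\<^sub>v v = mact a * mact b *\<^sub>v v"
      unfolding assoc_mult_mat_vec[OF rep_at_carrier rep_at_carrier v] unfolding q[symmetric] mact_mtau .
  qed simp
qed

lemma mform_value:
  assumes "maug q \<noteq> 0"
  shows "ev (($) (mtau d q)) (mform d) = maug q ^ d * M.\<pi> (M.L (mconst (1 / maug q) * q - 1))"
proof -
  have "ev v (mform d) = 1 * M.G d v" for v :: "nat \<Rightarrow> 'a" using mform_ev[OF d] by simp
  from M.equation_formula[OF this model_hi[OF d, simplified] assms] show ?thesis by simp
qed

text \<open>Multiplication by an exponential adds a Lie algebra element to the logarithm, and \<pi>
  vanishes there.\<close>

lemma mform_invariant:
  assumes v: "v \<in> carrier_vec (Suc (Suc d))"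
  shows "ev (($) (mact a *\<^sub>v v)) (mform d) = ev (($) v) (mform d :: 'k::field_char_0 mpoly)"
proof -
  let ?N = "Suc (Suc d)"
  let ?f = "mform d :: 'k mpoly"
  have vf: "vars ?f \<subseteq> {..<?N}" using mform(1)[OF d, where 'k='k] by simp
  have A: "mact a \<in> carrier_mat ?N ?N" by (rule rep_at_carrier)
  have *: "ev (($) (mact a *\<^sub>v mtau d q)) ?f = ev (($) (mtau d q)) ?f" if q: "maug q \<noteq> 0" for q
  proof -
    interpret h: comm_ring_hom "maug :: 'k poly poly \<Rightarrow> 'k" by (rule maug_hom)
    let ?e = "munip (($) a)"
    let ?p = "mconst (1 / maug q) * q - 1"
    have ae: "maug (?e * q) = maug q" by (simp add: h.hom_mult maug_munip)
    have ap: "maug ?p = 0" using q by (simp add: h.hom_minus h.hom_mult M.aug_c)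
    have "mconst (1 / maug q) * (?e * q) - 1 = (1 + (?e - 1)) * (1 + ?p) - 1" by (simp add: algebra_simps)
    also have "M.eqv (M.L \<dots>) (M.L (?e - 1) + M.L ?p)"
      by (rule M.L_mult[OF _ ap]) (simp add: h.hom_minus maug_munip)
    finally have l: "M.\<pi> (M.L (mconst (1 / maug q) * (?e * q) - 1)) = M.\<pi> (M.L (?e - 1)) + M.\<pi> (M.L ?p)"
      by (simp only: M.\<pi>_eqv M.\<pi>_add)
    have "M.\<pi> (M.L (?e - 1)) = M.\<pi> (mlie (($) a))"
      unfolding munip_eq by (rule M.\<pi>_eqv[OF M.L_E[OF maug_mlie]])
    also have "\<dots> = 0" unfolding M.\<pi>_def by (rule pi_mlie)
    finally show ?thesis
      unfolding mact_mtau using mform_value[of "?e * q"] mform_value[of q] q l unfolding ae by simp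
  qed
  have "linear_change (mact a) ?f = ?f"
  proof (rule mpoly_eqI_nz)
    fix w :: "nat \<Rightarrow> 'k" assume w: "w 0 \<noteq> 0"
    obtain q where q: "mtau d q = vec ?N w" using mtau_exists[OF vec_carrier] by blast
    have aq: "maug q \<noteq> 0" using M.aug_\<tau>[of q] w unfolding q by simp
    have vl: "vars (linear_change (mact a) ?f) \<subseteq> {..<?N}" using vars_linear_change[of "mact a" ?f] by simp
    have "ev w (linear_change (mact a) ?f) = ev (($) (vec ?N w)) (linear_change (mact a) ?f)"
      by (rule mpoly_eval_cong) (use vl in auto)
    also have "\<dots> = ev (($) (mact a *\<^sub>v vec ?N w)) ?f" by (rule eval_linear_change[OF A vf vec_carrier])
    also have "\<dots> = ev (($) (vec ?N w)) ?f" using *[OF aq] unfolding q .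
    also have "\<dots> = ev w ?f" by (rule mpoly_eval_cong) (use vf in auto)
    finally show "ev w (linear_change (mact a) ?f) = ev w ?f" .
  qed
  then show ?thesis using eval_linear_change[OF A vf v] by simp
qed

text \<open>By the equation the logarithm of such a point has last coordinate 0. It is therefore a
  Lie algebra element, whose exponential carries the unit to the point.\<close>

lemma orbit_exists:
  assumes q: "maug q = 1" "ev (($) (mtau d q)) (mform d) = 0"
  shows "\<exists>a\<in>carrier_vec d. mact a *\<^sub>v mtau d 1 = mtau d (q :: 'k::field_char_0 poly poly)"
proof -
  interpret h: comm_ring_hom "maug :: 'k poly poly \<Rightarrow> 'k" by (rule maug_hom)
  interpret c: comm_ring_hom "mconst :: 'k \<Rightarrow> 'k poly poly" by (rule mconst_hom)
  define l where "l = M.L (q - 1)"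
  have aq: "maug (q - 1) = 0" using q(1) by (simp add: h.hom_minus)
  have al: "maug l = 0" unfolding l_def by (rule M.aug_L[OF aq])
  have pl: "mtau d l $ Suc d = 0"
    using mform_value[of q] q unfolding l_def M.\<pi>_def by simp
  define a where "a = vec d (\<lambda>k. mtau d l $ Suc k)"
  have "mlie (($) a) = (\<Sum>k<d. mconst (mtau d l $ Suc k) * mbase d (Suc k))"
    unfolding mlie_def by (rule sum.cong) (simp_all add: a_def)
  also have "\<dots> = M.z (($) (mtau d l))"
    unfolding M.z_def One_nat_def sum.atLeast1_atMost_eq using pl by (simp add: M.c_0)
  finally have "M.eqv (mlie (($) a)) l" using M.z_coords[OF al] by simp
  then have "M.eqv (munip (($) a)) (M.E l)" unfolding munip_eq by (rule M.E_cong)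
  also have "M.eqv (M.E l) (1 + (q - 1))" unfolding l_def by (rule M.E_L[OF aq])
  finally have "mtau d (munip (($) a)) = mtau d q" unfolding M.eqv_iff by simp
  then show ?thesis by (intro bexI[of _ a]) (simp_all add: mact_mtau a_def)
qed

lemma mact_effective:
  assumes a: "a \<in> carrier_vec d" and eq: "mact a *\<^sub>v mtau d 1 = k \<cdot>\<^sub>v mtau d (1 :: 'k::field_char_0 poly poly)"
  shows "a = 0\<^sub>v d"
proof -
  have e: "mtau d (munip (($) a)) = k \<cdot>\<^sub>v mtau d 1" using eq unfolding mact_mtau by simp
  have m0: "mtau d (munip (($) a)) $ 0 = 1" using M.aug_\<tau>[of "munip (($) a)"] maug_munip[of "($) a"] by simp
  have e0: "mtau d (1 :: 'k poly poly) $ 0 = 1" using M.aug_\<tau>[of "1 :: 'k poly poly"] by (simp add: maug_def)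
  \<comment> \<open>Coordinate 0 equals 1 for both vectors, so the scalar is 1 and the exponential
    itself is the unit.\<close>
  have "1 = (k \<cdot>\<^sub>v mtau d 1) $ 0" using m0 unfolding e by (rule sym)
  also have "\<dots> = k" using e0 by (subst index_smult_vec) simp_all
  finally have "k = 1" by (rule sym)
  then have "M.eqv (M.E (mlie (($) a))) 1" using e unfolding M.eqv_iff munip_eq by simp
  then have "mlie (($) a) \<in> M.J" by (rule M.E_eq_1_imp[OF maug_mlie])
  then have z: "mtau d (mlie (($) a)) = 0\<^sub>v (Suc (Suc d))" by (simp add: M.J_def)
  have "a $ k = 0" if k: "k < d" for k
  proof -
    have "mtau d (mlie (($) a)) $ Suc k = (\<Sum>i<d. mtau d (mconst (a $ i) * mbase d (Suc i)) $ Suc k)"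
      unfolding mlie_def by (rule M.\<tau>_sum) (use k in simp_all)
    also have "\<dots> = (\<Sum>i<d. if i = k then a $ k else 0)"
    proof (rule sum.cong[OF refl])
      fix i assume "i \<in> {..<d}"
      then have i: "Suc i < Suc (Suc d)" by simp
      show "mtau d (mconst (a $ i) * mbase d (Suc i)) $ Suc k = (if i = k then a $ k else 0)"
        unfolding M.\<tau>_c M.\<tau>_b[OF i] using k by (cases "i = k") (simp_all add: unit_vec_def)
    qed
    also have "\<dots> = a $ k" using k by (simp add: sum.delta)
    finally show ?thesis using z k by simp
  qed
  then show ?thesis using a by (intro eq_vecI) simp_all
qed

text \<open>The base point is the unit of the algebra. Group elements have augmentation 1, so the
  orbit lies in the chart where coordinate 0 is nonzero, and \<open>orbit_exists\<close> shows that
  it fills this chart of the hypersurface.\<close>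

lemma model_additive:
  "additive_hypersurface (Suc d) d (hyp (Suc d) (mform d :: 'k::field_char_0 mpoly))"
proof -
  let ?n = "Suc d" and ?N = "Suc (Suc d)"
  let ?f = "mform d :: 'k mpoly"
  let ?X = "hyp ?n ?f"
  let ?\<phi> = "\<lambda>a p. (\<lambda>v. mact a *\<^sub>v v) ` p :: 'k vec set"
  note hf = mform_homog[OF d, where 'k='k]
  have N: "?n + 1 = ?N" by simp
  note hi = hyp_iff[OF hf, unfolded N]
  have X: "?X \<subseteq> proj_space ?n" by (auto simp: hyp_def)
  have A: "mact a \<in> carrier_mat ?N ?N" for a :: "'k vec" by (rule rep_at_carrier)
  have inv: "?\<phi> a p \<in> ?X" if a: "a \<in> carrier_vec d" and p: "p \<in> ?X" for a p
  proof -
    obtain v where v: "v \<in> carrier_vec ?N" "v \<noteq> 0\<^sub>v ?N" "p = proj_point v"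
      using subsetD[OF X p] unfolding N[symmetric] by (rule proj_spaceE)
    note Av = mult_mat_vec_carrier[OF A v(1), of a] linear_rep_nonzero[OF mrep_linear a v(1,2)]
    show ?thesis using p unfolding v(3) image_proj_point[OF A v(1)] hi[OF Av] hi[OF v(1,2)] mform_invariant[OF v(1)] .
  qed
  have inv': "?\<phi> a p \<in> proj_space ?n" if a: "a \<in> carrier_vec d" and p: "p \<in> proj_space ?n" for a p
  proof -
    obtain v where v: "v \<in> carrier_vec ?N" "v \<noteq> 0\<^sub>v ?N" "p = proj_point v"
      using p unfolding N[symmetric] by (rule proj_spaceE)
    show ?thesis unfolding v(3) image_proj_point[OF A v(1)]
      using proj_spaceI[of _ ?n, unfolded N, OF mult_mat_vec_carrier[OF A v(1), of a] linear_rep_nonzero[OF mrep_linear a v(1,2)]] .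
  qed
  have act: "regular_action d ?n ?X ?\<phi>"
    using regular_action_linear[of d ?n mrep ?X, unfolded N, OF mrep_linear X inv] .
  have Act: "regular_action d ?n (proj_space ?n) ?\<phi>"
    using regular_action_linear[of d ?n mrep "proj_space ?n", unfolded N, OF mrep_linear order.refl inv'] .
  let ?e = "mtau d (1 :: 'k poly poly)"
  have e: "?e \<in> carrier_vec ?N" by (rule M.\<tau>_carrier)
  have e0: "?e $ 0 = 1" using M.aug_\<tau>[of "1 :: 'k poly poly"] by (simp add: maug_def)
  have ne: "?e \<noteq> 0\<^sub>v ?N"
  proof
    assume "?e = 0\<^sub>v ?N"
    then show False using e0 by simp
  qed
  have ae: "maug (1 :: 'k poly poly) = 1" by (simp add: maug_def)
  have mc1: "mconst 1 = (1 :: 'k poly poly)" by (simp add: mconst_def one_pCons)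
  have p0: "M.\<pi> (0 :: 'k poly poly) = 0" by (rule M.\<pi>_J[OF M.J_0])
  have "M.\<pi> (M.L (0 :: 'k poly poly)) = 0"
    unfolding M.\<pi>_L
  proof (rule sum.neutral, rule ballI)
    fix i
    show "M.s i * M.\<pi> (0 ^ i :: 'k poly poly) = 0" using p0 by (cases "i = 0") (simp_all add: power_0_left)
  qed
  then have fe: "ev (($) ?e) ?f = 0" using mform_value[of "1 :: 'k poly poly"] by (simp add: ae mc1)
  let ?p = "proj_point ?e"
  have pX: "?p \<in> ?X" unfolding hi[OF e ne] by (rule fe)
  have eff: "a = 0\<^sub>v d" if a: "a \<in> carrier_vec d" and fix_all: "\<forall>p\<in>?X. ?\<phi> a p = p" for a
  proof -
    have "proj_point (mact a *\<^sub>v ?e) = ?p"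
      using bspec[OF fix_all pX] unfolding image_proj_point[OF A e] .
    from proj_point_eqD[OF this] obtain k where "mact a *\<^sub>v ?e = k \<cdot>\<^sub>v ?e" by (elim exE conjE)
    then show ?thesis by (rule mact_effective[OF a])
  qed
  have "proj_open_in ?n ?X ((\<lambda>a. ?\<phi> a ?p) ` carrier_vec d)"
    unfolding proj_open_in_def zariski_open_in_def
  proof (rule exI, rule conjI)
    let ?x = "mpoly_var 0 :: 'k mpoly"
    let ?Z = "{(a, p). a \<in> carrier_vec 0 \<and> p \<in> proj_space ?n \<and> (\<forall>f\<in>{?x}. \<forall>v\<in>p. eval_at f (a @\<^sub>v v) = 0)}"
    have i0: "ind 0 ?n 0 = 1" by (simp add: ind_def)
    have "whomog (ind 0 ?n) (ind 0 ?n 0) ?x" by (rule whomog_var)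
    then have "homog 0 ?n 1 ?x" unfolding i0 by (simp add: homog_iff)
    then show "zariski_closed 0 ?n ?Z" unfolding zariski_closed_def by (intro exI[of _ "{?x}"]) auto
    have Zi: "(0\<^sub>v 0, proj_point v) \<in> ?Z \<longleftrightarrow> v $ 0 = 0" if v: "v \<in> carrier_vec ?N" "v \<noteq> 0\<^sub>v ?N" for v
    proof -
      have x: "eval_at ?x (0\<^sub>v 0 @\<^sub>v w) = w $ 0" if "w \<in> carrier_vec ?N" for w
        using that by (simp add: eval_at_ev)
      have "(\<forall>w\<in>proj_point v. eval_at ?x (0\<^sub>v 0 @\<^sub>v w) = 0) \<longleftrightarrow> v $ 0 = 0"
      proof
        assume z: "\<forall>w\<in>proj_point v. eval_at ?x (0\<^sub>v 0 @\<^sub>v w) = 0"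
        show "v $ 0 = 0" using bspec[OF z self_in_proj_point] unfolding x[OF v(1)] .
      next
        assume v0: "v $ 0 = 0"
        show "\<forall>w\<in>proj_point v. eval_at ?x (0\<^sub>v 0 @\<^sub>v w) = 0"
        proof
          fix w assume "w \<in> proj_point v"
          then obtain k where "w = k \<cdot>\<^sub>v v" unfolding proj_point_def by (elim CollectE exE conjE)
          then show "eval_at ?x (0\<^sub>v 0 @\<^sub>v w) = 0" using x[of w] v v0 by simp
        qed
      qed
      moreover have "proj_point v \<in> proj_space ?n" using proj_spaceI[of v ?n, unfolded N] v by simp
      moreover have "0\<^sub>v 0 \<in> (carrier_vec 0 :: 'k vec set)" by (rule zero_carrier_vec)
      ultimately show ?thesis by (simp del: zero_vec_zero)
    qed
    show "({0\<^sub>v 0} :: 'k vec set) \<times> (\<lambda>a. ?\<phi> a ?p) ` carrier_vec d = {0\<^sub>v 0} \<times> ?X - ?Z"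
    proof (rule equalityI, rule subsetI)
      fix bp :: "'k vec \<times> 'k vec set" assume "bp \<in> {0\<^sub>v 0} \<times> (\<lambda>a. ?\<phi> a ?p) ` carrier_vec d"
      then obtain a where a: "a \<in> carrier_vec d" "bp = (0\<^sub>v 0, ?\<phi> a ?p)" by blast
      have v: "mact a *\<^sub>v ?e \<in> carrier_vec ?N" "mact a *\<^sub>v ?e \<noteq> 0\<^sub>v ?N"
        using mult_mat_vec_carrier[OF A e, of a] linear_rep_nonzero[OF mrep_linear a(1) e ne] by auto
      have "(mact a *\<^sub>v ?e) $ 0 = 1"
        unfolding mact_mtau using M.aug_\<tau>[of "munip (($) a)"] maug_munip[of "($) a"] by simp
      then have "(0\<^sub>v 0, proj_point (mact a *\<^sub>v ?e)) \<notin> ?Z" using Zi[OF v] by simp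
      then show "bp \<in> {0\<^sub>v 0} \<times> ?X - ?Z"
        unfolding a(2) using inv[OF a(1) pX] unfolding image_proj_point[OF A e] by blast
    next
      show "({0\<^sub>v 0} :: 'k vec set) \<times> ?X - ?Z \<subseteq> {0\<^sub>v 0} \<times> (\<lambda>a. ?\<phi> a ?p) ` carrier_vec d"
      proof
        fix bp :: "'k vec \<times> 'k vec set" assume bp: "bp \<in> {0\<^sub>v 0} \<times> ?X - ?Z"
        then obtain p where p: "bp = (0\<^sub>v 0, p)" "p \<in> ?X" by blast
        obtain v where v: "v \<in> carrier_vec ?N" "v \<noteq> 0\<^sub>v ?N" "p = proj_point v"
          using subsetD[OF X p(2)] unfolding N[symmetric] by (rule proj_spaceE)
        have v0: "v $ 0 \<noteq> 0" using bp Zi[OF v(1,2)] unfolding p(1) v(3) by blast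
        \<comment> \<open>Normalized to coordinate 0 equal to 1, as \<open>orbit_exists\<close>
          requires.\<close>
        define v' where "v' = (1 / v $ 0) \<cdot>\<^sub>v v"
        have pv': "p = proj_point v'" unfolding v'_def v(3) by (rule proj_point_smult[symmetric]) (use v0 in simp)
        have v': "v' \<in> carrier_vec ?N" "v' $ 0 = 1" using v v0 by (simp_all add: v'_def)
        have nv': "v' \<noteq> 0\<^sub>v ?N" using v'(2) by auto
        have fv': "ev (($) v') ?f = 0" using p(2) unfolding pv' hi[OF v'(1) nv'] .
        obtain q where q: "mtau d q = v'" using mtau_exists[OF v'(1)] by blast
        have "maug q = 1" using M.aug_\<tau>[of q] q v'(2) by simp
        from orbit_exists[OF this] obtain a where a: "a \<in> carrier_vec d" "mact a *\<^sub>v ?e = v'"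
          using fv' unfolding q by blast
        have "p = ?\<phi> a ?p" unfolding image_proj_point[OF A e] a(2) by (rule pv')
        then show "bp \<in> {0\<^sub>v 0} \<times> (\<lambda>a. ?\<phi> a ?p) ` carrier_vec d" unfolding p(1) using a(1) by blast
      qed
    qed
  qed
  then have add: "additive_action d ?n ?X ?\<phi>"
    unfolding additive_action_def using act eff pX by blast
  have "induced_additive_action ?n ?X ?\<phi>"
    unfolding induced_additive_action_def diff_Suc_1 using add Act by blast
  moreover have "nondegenerate_hypersurface ?n d ?X"
    unfolding nondegenerate_hypersurface_def hyp_def
    using hf mform_irreducible[OF d, where 'k='k] mform_nondegenerate[OF d, where 'k='k] by blast
  ultimately show ?thesis unfolding additive_hypersurface_def by blast
qed

end

section \<open>The corresponding algebra\<close>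

text \<open>A matrix image of K[x, y] with the kernel of \<open>mtau d\<close>. Statements about the
  algebra are checked on representatives in K[x, y].\<close>

locale mat_model =
  fixes N d :: nat and \<Theta> :: "'k::field_char_0 poly poly \<Rightarrow> 'k mat"
  assumes d: "d \<ge> 2" and \<Theta>_carrier: "\<Theta> q \<in> carrier_mat N N"
    and \<Theta>_add: "\<Theta> (p + q) = \<Theta> p + \<Theta> q" and \<Theta>_mult: "\<Theta> (p * q) = \<Theta> p * \<Theta> q"
    and \<Theta>_smult: "\<Theta> (mconst k * q) = k \<cdot>\<^sub>m \<Theta> q" and \<Theta>_1: "\<Theta> 1 = 1\<^sub>m N" and \<Theta>_0: "\<Theta> 0 = 0\<^sub>m N N"
    and \<Theta>_eq_iff: "\<Theta> p = \<Theta> q \<longleftrightarrow> mtau d (p - q) = 0\<^sub>v (d + 2)"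
begin

interpretation c: comm_ring_hom "mconst :: 'k \<Rightarrow> 'k poly poly" by (rule mconst_hom)
interpretation h: comm_ring_hom "maug :: 'k poly poly \<Rightarrow> 'k" by (rule maug_hom)
interpretation M: quot_alg "Suc (Suc d)" "mconst :: 'k \<Rightarrow> _" maug "mtau d" "Suc d"
  using model_quot[OF d, of "Suc d", where 'k='k] by simp

lemma J_iff: "q \<in> M.J \<longleftrightarrow> mtau d q = 0\<^sub>v (d + 2)"
  by (simp add: M.J_def)

definition A :: "('k, 'k mat) module" where "A = mat_algebra N (range \<Theta>)"

lemma A_simps [simp]:
  "carrier A = range \<Theta>" "X \<otimes>\<^bsub>A\<^esub> Y = X * Y" "\<one>\<^bsub>A\<^esub> = 1\<^sub>m N" "\<zero>\<^bsub>A\<^esub> = 0\<^sub>m N N"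
  "X \<oplus>\<^bsub>A\<^esub> Y = X + Y" "k \<odot>\<^bsub>A\<^esub> X = k \<cdot>\<^sub>m X"
  by (simp_all add: A_def mat_algebra_def module_mat_def)

lemmas \<Theta>_ops = \<Theta>_add[symmetric] \<Theta>_mult[symmetric] \<Theta>_smult[symmetric] \<Theta>_1[symmetric] \<Theta>_0[symmetric]

text \<open>The set \<open>S\<close> of representatives is a parameter because both the whole
  algebra and its socle have to be modules.\<close>

lemma A_group:
  assumes "0 \<in> S" "\<And>p q. p \<in> S ==> q \<in> S ==> p + q \<in> S" "\<And>p. p \<in> S ==> - p \<in> S"
  shows "abelian_group (A\<lparr>carrier := \<Theta> ` S\<rparr>)"
proof (rule abelian_groupI, goal_cases)
  case (1 X Y)
  then obtain p q where "X = \<Theta> p" "p \<in> S" "Y = \<Theta> q" "q \<in> S" by (simp, elim imageE) simp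
  then show ?case using assms(2)[of p q] by (simp add: \<Theta>_add[symmetric])
next
  case 2
  show ?case using assms(1) by (simp add: \<Theta>_0[symmetric])
next
  case (3 X Y Z)
  then have "X \<in> carrier_mat N N" "Y \<in> carrier_mat N N" "Z \<in> carrier_mat N N" using \<Theta>_carrier by auto
  then show ?case by simp
next
  case (4 X Y)
  then have "X \<in> carrier_mat N N" "Y \<in> carrier_mat N N" using \<Theta>_carrier by auto
  then show ?case by (simp add: comm_add_mat)
next
  case (5 X)
  then have "X \<in> carrier_mat N N" using \<Theta>_carrier by auto
  then show ?case by simp
next
  case (6 X)
  then obtain p where p: "X = \<Theta> p" "p \<in> S" by (simp, elim imageE) simp
  have "\<Theta> (- p) + X = 0\<^sub>m N N" by (simp add: p \<Theta>_add[symmetric] \<Theta>_0)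
  then show ?case using assms(3)[OF p(2)] by (intro bexI[of _ "\<Theta> (- p)"]) simp_all
qed

lemma smult_rules:
  fixes X Y :: "'k mat"
  assumes "X \<in> carrier_mat N N" "Y \<in> carrier_mat N N"
  shows "(a + b) \<cdot>\<^sub>m X = a \<cdot>\<^sub>m X + b \<cdot>\<^sub>m X" "a \<cdot>\<^sub>m (X + Y) = a \<cdot>\<^sub>m X + a \<cdot>\<^sub>m Y"
    "(a * b) \<cdot>\<^sub>m X = a \<cdot>\<^sub>m (b \<cdot>\<^sub>m X)" "(a \<cdot>\<^sub>m X) * Y = a \<cdot>\<^sub>m (X * Y)"
  using assms by (auto simp: algebra_simps intro!: eq_matI)

lemma A_module:
  assumes "0 \<in> S" "\<And>p q. p \<in> S ==> q \<in> S ==> p + q \<in> S" "\<And>k p. p \<in> S ==> mconst k * p \<in> S"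
  shows "Module.module class_ring (A\<lparr>carrier := \<Theta> ` S\<rparr>)"
proof (rule moduleI, goal_cases)
  case 1
  show ?case by (rule class_cring.is_cring)
next
  case 2
  show ?case
  proof (rule A_group)
    show "0 \<in> S" by (rule assms(1))
    show "p + q \<in> S" if "p \<in> S" "q \<in> S" for p q by (rule assms(2)[OF that])
    show "- p \<in> S" if "p \<in> S" for p using assms(3)[OF that, of "- 1"] by (simp add: c.hom_uminus)
  qed
next
  case (3 a X)
  then obtain p where "X = \<Theta> p" "p \<in> S" by (simp, elim imageE) simp
  then show ?case using assms(3)[of p a] by (simp add: \<Theta>_smult[symmetric])
next
  case (4 a b X)
  then have "X \<in> carrier_mat N N" using \<Theta>_carrier by auto
  then show ?case by (simp add: smult_rules(1))
next
  case (5 a X Y)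
  then have "X \<in> carrier_mat N N" "Y \<in> carrier_mat N N" using \<Theta>_carrier by auto
  then show ?case by (simp add: smult_rules(2))
next
  case (6 a b X)
  then have "X \<in> carrier_mat N N" using \<Theta>_carrier by auto
  then show ?case by (simp add: smult_rules(3))
next
  case (7 X)
  show ?case by simp
qed

lemma A_carrier_update: "A\<lparr>carrier := range \<Theta>\<rparr> = A"
  by (simp add: A_def mat_algebra_def)

lemma A_elem: "X \<in> carrier A ==> X \<in> carrier_mat N N"
  using \<Theta>_carrier by auto

lemma A_group_UNIV: "abelian_group A"
  using A_group[of UNIV] unfolding A_carrier_update by simp

lemma A_mult_closed: "X \<in> carrier A ==> Y \<in> carrier A ==> X * Y \<in> carrier A"
  and A_mult_comm: "X \<in> carrier A ==> Y \<in> carrier A ==> X * Y = Y * X"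
proof -
  assume "X \<in> carrier A" "Y \<in> carrier A"
  then obtain p q where pq: "X = \<Theta> p" "Y = \<Theta> q" unfolding A_simps by (elim rangeE)
  show "X * Y \<in> carrier A" by (simp add: pq \<Theta>_mult[symmetric])
  show "X * Y = Y * X" unfolding pq \<Theta>_mult[symmetric] by (simp only: mult.commute)
qed

lemma A_cring: "cring A"
proof (rule cringI)
  show "abelian_group A" by (rule A_group_UNIV)
  show "comm_monoid A"
  proof (rule comm_monoidI)
    show "\<one>\<^bsub>A\<^esub> \<in> carrier A" by (simp add: \<Theta>_1[symmetric])
    show "X \<otimes>\<^bsub>A\<^esub> Y \<otimes>\<^bsub>A\<^esub> Z = X \<otimes>\<^bsub>A\<^esub> (Y \<otimes>\<^bsub>A\<^esub> Z)"
      if "X \<in> carrier A" "Y \<in> carrier A" "Z \<in> carrier A" for X Y Z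
      unfolding A_simps by (rule assoc_mult_mat[OF that[THEN A_elem]])
    show "\<one>\<^bsub>A\<^esub> \<otimes>\<^bsub>A\<^esub> X = X" if "X \<in> carrier A" for X using A_elem[OF that] by simp
    show "X \<otimes>\<^bsub>A\<^esub> Y \<in> carrier A" if "X \<in> carrier A" "Y \<in> carrier A" for X Y
      using A_mult_closed[OF that] unfolding A_simps .
    show "X \<otimes>\<^bsub>A\<^esub> Y = Y \<otimes>\<^bsub>A\<^esub> X" if "X \<in> carrier A" "Y \<in> carrier A" for X Y
      using A_mult_comm[OF that] unfolding A_simps .
  qed
  show "(X \<oplus>\<^bsub>A\<^esub> Y) \<otimes>\<^bsub>A\<^esub> Z = X \<otimes>\<^bsub>A\<^esub> Z \<oplus>\<^bsub>A\<^esub> Y \<otimes>\<^bsub>A\<^esub> Z"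
    if "X \<in> carrier A" "Y \<in> carrier A" "Z \<in> carrier A" for X Y Z
    unfolding A_simps by (rule add_mult_distrib_mat[OF that[THEN A_elem]])
qed

lemma A_module_UNIV: "Module.module class_ring A"
  using A_module[of UNIV] unfolding A_carrier_update by simp

lemma A_vectorspace: "vectorspace class_ring A"
  using A_module_UNIV class_field unfolding vectorspace_def by (rule conjI)

lemma A_algebra: "algebra class_ring A"
  unfolding algebra_def algebra_axioms_def
proof (intro conjI allI impI)
  show "Module.module class_ring A" by (rule A_module_UNIV)
  show "cring A" by (rule A_cring)
  show "(k \<odot>\<^bsub>A\<^esub> X) \<otimes>\<^bsub>A\<^esub> Y = k \<odot>\<^bsub>A\<^esub> (X \<otimes>\<^bsub>A\<^esub> Y)" if "X \<in> carrier A" "Y \<in> carrier A" for k X Y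
    unfolding A_simps by (rule smult_rules(4)[OF that[THEN A_elem]])
qed

lemma \<Theta>_sum_in:
  fixes k :: nat
  assumes "submodule class_ring W A" "\<And>j. j < k ==> \<Theta> (f j) \<in> W"
  shows "\<Theta> (\<Sum>j<k. mconst (a j) * f j) \<in> W"
  using assms(2)
proof (induction k)
  case 0
  show ?case using submodule.zero_closed[OF assms(1)] by (simp add: \<Theta>_0)
next
  case (Suc k)
  have "a k \<cdot>\<^sub>m \<Theta> (f k) \<in> W" using submodule.smult_closed[OF assms(1), of "a k" "\<Theta> (f k)"] Suc.prems by simp
  then have "\<Theta> (\<Sum>j<k. mconst (a j) * f j) + a k \<cdot>\<^sub>m \<Theta> (f k) \<in> W"
    using submodule.m_closed[OF assms(1), of "\<Theta> (\<Sum>j<k. mconst (a j) * f j)"] Suc by simp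
  then show ?case by (simp add: \<Theta>_ops)
qed

lemma \<Theta>_coords: "\<Theta> q = \<Theta> (\<Sum>j<d+2. mconst (mtau d q $ j) * mbase d j)"
proof -
  have "mideal d (q - (\<Sum>j<d+2. mconst (mtau d q $ j) * mbase d j))"
    by (rule model_decomposition) (use d in simp)
  then obtain B C where e: "q - (\<Sum>j<d+2. mconst (mtau d q $ j) * mbase d j) =
      poly_x * poly_y * B + (poly_y ^ 2 - poly_x ^ d) * C" unfolding ideal2_def by (elim exE)
  have "q - (\<Sum>j<d+2. mconst (mtau d q $ j) * mbase d j) \<in> M.J"
    unfolding e by (rule M.J_add[OF M.J_mult2 M.J_mult2]) (simp_all only: J_iff mtau_generators[OF d])
  then show ?thesis unfolding \<Theta>_eq_iff J_iff .
qed

lemma A_fin_dim: "vectorspace.fin_dim class_ring A"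
proof -
  interpret V: vectorspace class_ring A by (rule A_vectorspace)
  let ?S = "(\<lambda>j. \<Theta> (mbase d j)) ` {..<d+2}"
  have sub: "?S \<subseteq> carrier A" by auto
  have W: "submodule class_ring (V.span ?S) A" by (rule V.span_is_submodule[OF sub])
  have "carrier A \<subseteq> V.span ?S"
  proof
    fix X assume "X \<in> carrier A"
    then obtain q where q: "X = \<Theta> q" by auto
    show "X \<in> V.span ?S" unfolding q \<Theta>_coords[of q]
      by (rule \<Theta>_sum_in[OF W], rule subsetD[OF V.in_own_span[OF sub]]) simp
  qed
  then have "V.span ?S = carrier A" using V.span_is_subset2[OF sub] by blast
  then show ?thesis unfolding V.fin_dim_def using sub by (intro exI[of _ ?S]) simp
qed

section \<open>The maximal ideal and the socle\<close>

definition Mx :: "'k mat set" where "Mx = \<Theta> ` {q. maug q = 0}"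

lemma \<Theta>_maug: "\<Theta> p = \<Theta> q ==> maug p = maug q"
  using M.J_aug[of "p - q"] unfolding \<Theta>_eq_iff J_iff by (simp add: h.hom_minus)

lemma Mx_iff: "\<Theta> q \<in> Mx \<longleftrightarrow> maug q = 0"
proof
  assume "\<Theta> q \<in> Mx"
  then obtain p where p: "\<Theta> q = \<Theta> p" "p \<in> {q. maug q = 0}" unfolding Mx_def by (rule imageE)
  then show "maug q = 0" using \<Theta>_maug[OF p(1)] by simp
next
  assume "maug q = 0"
  then show "\<Theta> q \<in> Mx" unfolding Mx_def by (intro imageI CollectI)
qed

lemma Mx_elem: "X \<in> Mx ==> \<exists>p. X = \<Theta> p \<and> maug p = 0"
  unfolding Mx_def by (elim imageE CollectE) (intro exI conjI)

lemma Mx_ideal: "ideal Mx A"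
proof (rule idealI)
  show "ring A" by (rule cring.axioms(1)[OF A_cring])
  show "subgroup Mx (add_monoid A)"
  proof (rule subgroup.intro)
    show "Mx \<subseteq> carrier (add_monoid A)" unfolding Mx_def by (simp add: image_mono)
    show "X \<otimes>\<^bsub>add_monoid A\<^esub> Y \<in> Mx" if X: "X \<in> Mx" and Y: "Y \<in> Mx" for X Y
    proof -
      from Mx_elem[OF X] obtain p where p: "X = \<Theta> p \<and> maug p = 0" by (rule exE)
      from Mx_elem[OF Y] obtain q where q: "Y = \<Theta> q \<and> maug q = 0" by (rule exE)
      have "\<Theta> (p + q) \<in> Mx" unfolding Mx_iff h.hom_add p[THEN conjunct2] q[THEN conjunct2] by (rule add_0_left)
      then show ?thesis unfolding p[THEN conjunct1] q[THEN conjunct1] \<Theta>_add by simp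
    qed
    have "\<Theta> 0 \<in> Mx" unfolding Mx_iff by (rule h.hom_zero)
    then show "\<one>\<^bsub>add_monoid A\<^esub> \<in> Mx" unfolding \<Theta>_0 by simp
    show "inv\<^bsub>add_monoid A\<^esub> X \<in> Mx" if X: "X \<in> Mx" for X
    proof -
      obtain p where p: "X = \<Theta> p" "maug p = 0" using Mx_elem[OF X] by (elim exE conjE)
      have z: "\<Theta> (- p) + \<Theta> p = 0\<^sub>m N N" unfolding \<Theta>_add[symmetric] left_minus by (rule \<Theta>_0)
      have "\<ominus>\<^bsub>A\<^esub> X = \<Theta> (- p)"
        unfolding p(1) by (rule abelian_group.minus_equality[OF A_group_UNIV]) (unfold A_simps, rule z, (rule rangeI)+)
      moreover have "\<Theta> (- p) \<in> Mx" unfolding Mx_iff h.hom_uminus p(2) by (rule minus_zero)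
      ultimately have "\<ominus>\<^bsub>A\<^esub> X \<in> Mx" by (simp only:)
      then show ?thesis unfolding a_inv_def .
    qed
  qed
  fix X Y assume X: "X \<in> Mx" and Y: "Y \<in> carrier A"
  obtain p where p: "X = \<Theta> p" "maug p = 0" using Mx_elem[OF X] by (elim exE conjE)
  obtain q where q: "Y = \<Theta> q" using Y unfolding A_simps by (elim rangeE)
  have "\<Theta> (q * p) \<in> Mx" "\<Theta> (p * q) \<in> Mx" unfolding Mx_iff h.hom_mult p(2) by (rule mult_zero_right, rule mult_zero_left)
  then show "Y \<otimes>\<^bsub>A\<^esub> X \<in> Mx" "X \<otimes>\<^bsub>A\<^esub> Y \<in> Mx" unfolding p(1) q A_simps \<Theta>_mult .
qed

text \<open>An element outside \<open>Mx\<close> has nonzero augmentation and is therefore a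
  unit.\<close>

lemma ideal_in_Mx:
  assumes J: "ideal J A" shows "J \<subseteq> Mx \<or> J = carrier A"
proof (cases "J \<subseteq> Mx")
  case True
  then show ?thesis by (rule disjI1)
next
  case False
  then have "\<exists>X. X \<in> J \<and> X \<notin> Mx" by (simp only: subset_iff not_all not_imp)
  then obtain X where X: "X \<in> J" "X \<notin> Mx" by (elim exE conjE)
  have "X \<in> carrier A" by (rule ideal.Icarr[OF J X(1)])
  then obtain q where q: "X = \<Theta> q" unfolding A_simps by (elim rangeE)
  have "maug q \<noteq> 0" using X(2) unfolding q Mx_iff .
  then have "\<exists>b. M.eqv (q * b) 1" by (rule M.unit_exists)
  then obtain b where b: "M.eqv (q * b) 1" by (elim exE)
  have qb: "\<Theta> q * \<Theta> b = 1\<^sub>m N"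
    using b unfolding \<Theta>_mult[symmetric] \<Theta>_1[symmetric] \<Theta>_eq_iff M.eqv_def J_iff .
  have "\<Theta> b \<in> carrier A" unfolding A_simps by (rule rangeI)
  from ideal.I_r_closed[OF J X(1) this] have "\<one>\<^bsub>A\<^esub> \<in> J" unfolding A_simps q qb .
  then have "J = carrier A" by (rule ideal.one_imp_carrier[OF J])
  then show ?thesis by (rule disjI2)
qed

lemma Mx_neq: "Mx \<noteq> carrier A"
proof
  assume e: "Mx = carrier A"
  have "\<Theta> 1 \<in> Mx" unfolding e A_simps by (rule rangeI)
  then have "maug (1 :: 'k poly poly) = 0" unfolding Mx_iff .
  then show False by (simp add: maug_def)
qed

lemma maximal_ideals: "{I. maximalideal I A} = {Mx}"
proof (rule equalityI, rule subsetI)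
  fix I assume "I \<in> {I. maximalideal I A}"
  then have I: "maximalideal I A" by (rule CollectD)
  have "I \<noteq> carrier A" using maximalideal.I_notcarr[OF I] by (rule not_sym)
  then have sub: "I \<subseteq> Mx" using ideal_in_Mx[OF maximalideal.axioms(1)[OF I]] by (elim disjE) simp_all
  have "Mx \<subseteq> carrier A" by (rule subsetI[OF ideal.Icarr[OF Mx_ideal]])
  then have "Mx = I \<or> Mx = carrier A" by (rule maximalideal.I_maximal[OF I Mx_ideal sub])
  then have "Mx = I" using Mx_neq by (elim disjE) simp_all
  then show "I \<in> {Mx}" by (simp only: singleton_iff)
next
  have "maximalideal Mx A"
  proof (rule maximalidealI[OF Mx_ideal])
    show "carrier A \<noteq> Mx" using Mx_neq by (rule not_sym)
    show "J = Mx \<or> J = carrier A" if J: "ideal J A" "Mx \<subseteq> J" for J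
      using ideal_in_Mx[OF J(1)] equalityI[OF _ J(2)] by (elim disjE) simp_all
  qed
  then show "{Mx} \<subseteq> {I. maximalideal I A}" by (intro insert_subsetI empty_subsetI CollectI)
qed

definition Sc :: "'k poly poly set" where "Sc = range (\<lambda>k. mconst k * poly_x ^ d)"

lemma socle_eq: "socle A Mx = \<Theta> ` Sc"
proof (rule equalityI, rule subsetI)
  fix X assume X: "X \<in> socle A Mx"
  then have "X \<in> carrier A" unfolding socle_def by (elim CollectE conjE)
  then have "X \<in> range \<Theta>" unfolding A_simps(1) .
  then obtain q where q: "X = \<Theta> q" by (elim rangeE)
  have ann: "X * Y = 0\<^sub>m N N" if "Y \<in> Mx" for Y
    using X that unfolding socle_def A_simps by (elim CollectE conjE) (rule bspec)
  have k: "mtau d (q * r) = 0\<^sub>v (d + 2)" if "maug r = 0" for r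
  proof -
    have "\<Theta> q * \<Theta> r = 0\<^sub>m N N" unfolding q[symmetric] by (rule ann) (simp only: Mx_iff that)
    then have "\<Theta> (q * r) = \<Theta> 0" by (simp add: \<Theta>_ops)
    then show ?thesis unfolding \<Theta>_eq_iff by simp
  qed
  have x: "maug (poly_x :: 'k poly poly) = 0" and y: "maug (poly_y :: 'k poly poly) = 0"
    by (simp_all add: maug_def poly_x_def poly_y_def)
  \<comment> \<open>Being annihilated by \<open>x\<close> kills the coefficients of 1, ..., x^(d-1).
    After the shift the last of them lands in the coordinate that also counts \<open>y ^ 2\<close>,
    hence the case distinction.\<close>
  have q0: "coeff (coeff q 0) i = 0" if "i < d" for i
  proof (cases "Suc i = d")
    case True
    have "coeff (coeff (q * poly_x ^ 1) 0) d + coeff (coeff (q * poly_x ^ 1) 2) 0 = 0"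
      using k[OF x] unfolding mtau_eq_0_iff by simp
    then show ?thesis unfolding coeff_x_power_mult using True d by auto
  next
    case False
    have "coeff (coeff (q * poly_x ^ 1) 0) (Suc i) = 0"
      using k[OF x] False that unfolding mtau_eq_0_iff by simp
    then show ?thesis unfolding coeff_x_power_mult by simp
  qed
  have q1: "coeff (coeff q 1) 0 = 0"
    using k[OF y] d unfolding mtau_eq_0_iff coeff_y_mult by (simp add: numeral_2_eq_2)
  let ?k = "coeff (coeff q 0) d + coeff (coeff q 2) 0"
  have X_eq: "\<Theta> q = \<Theta> (mconst ?k * poly_x ^ d)"
    unfolding \<Theta>_eq_iff mtau_eq_0_iff
    using q0 q1 d by (auto simp: mconst_def poly_x_power coeff_monom numeral_2_eq_2)
  show "X \<in> \<Theta> ` Sc" unfolding q X_eq Sc_def by (rule imageI[OF rangeI])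
next
  show "\<Theta> ` Sc \<subseteq> socle A Mx"
  proof (rule image_subsetI)
    fix s assume "s \<in> Sc"
    then obtain k where s: "s = mconst k * poly_x ^ d" unfolding Sc_def by (elim rangeE)
    have "\<Theta> s * X = 0\<^sub>m N N" if X: "X \<in> Mx" for X
    proof -
      obtain q where q: "X = \<Theta> q" "maug q = 0" using X unfolding Mx_def by (elim imageE CollectE)
      have "mtau d (q * poly_x ^ d) = 0\<^sub>v (d + 2)"
        unfolding mtau_eq_0_iff coeff_x_power_mult using d q(2) by (auto simp: maug_def)
      then have "q * poly_x ^ d \<in> M.J" by (simp only: J_iff)
      then have "mconst k * (q * poly_x ^ d) \<in> M.J" by (rule M.J_mult)
      then have "mtau d (s * q - 0) = 0\<^sub>v (d + 2)" by (simp only: s J_iff ac_simps diff_zero)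
      then have "\<Theta> (s * q) = \<Theta> 0" unfolding \<Theta>_eq_iff .
      then show ?thesis by (simp add: q \<Theta>_ops)
    qed
    then show "\<Theta> s \<in> socle A Mx" unfolding socle_def A_simps by (intro CollectI conjI rangeI ballI)
  qed
qed

lemma A_gorenstein: "gorenstein_local_algebra A"
proof -
  let ?B = "A\<lparr>carrier := \<Theta> ` Sc\<rparr>"
  have m: "Module.module class_ring ?B"
  proof (rule A_module)
    show "0 \<in> Sc" unfolding Sc_def by (rule range_eqI[of _ _ 0]) simp
    show "p + q \<in> Sc" if "p \<in> Sc" "q \<in> Sc" for p q
      using that unfolding Sc_def by (auto simp: c.hom_add[symmetric] distrib_right[symmetric] simp del: c.hom_add)
    show "mconst k * p \<in> Sc" if "p \<in> Sc" for k p
      using that unfolding Sc_def by (auto simp: c.hom_mult[symmetric] mult.assoc[symmetric] simp del: c.hom_mult)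
  qed
  then have "vectorspace class_ring ?B" using class_field unfolding vectorspace_def by simp
  then interpret V: vectorspace class_ring ?B .
  let ?v = "\<Theta> (poly_x ^ d)"
  have v: "{?v} \<subseteq> carrier ?B" unfolding Sc_def by (auto intro!: image_eqI[of _ _ "mconst 1 * poly_x ^ d"] range_eqI[of _ _ 1])
  have "carrier ?B \<subseteq> V.span {?v}"
  proof
    fix X assume "X \<in> carrier ?B"
    then obtain k where k: "X = k \<cdot>\<^sub>m ?v" unfolding Sc_def by (auto simp: \<Theta>_smult)
    have "?v \<in> V.span {?v}" using V.in_own_span[OF v] by simp
    then have "k \<odot>\<^bsub>?B\<^esub> ?v \<in> V.span {?v}" by (intro submodule.smult_closed[OF V.span_is_submodule[OF v]]) simp_all
    then show "X \<in> V.span {?v}" by (simp add: k)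
  qed
  then have gen: "V.span {?v} = carrier ?B" using V.span_is_subset2[OF v] by blast
  have nz: "?v \<noteq> \<zero>\<^bsub>?B\<^esub>"
  proof
    assume "?v = \<zero>\<^bsub>?B\<^esub>"
    then have "?v = \<Theta> 0" by (simp add: \<Theta>_0)
    then show False unfolding \<Theta>_eq_iff mtau_eq_0_iff using d by (simp add: poly_x_power numeral_2_eq_2)
  qed
  have "vectorspace.dim class_ring ?B = 1" by (rule V.dim1I[OF gen nz]) (use v in simp)
  then have "vectorspace.dim class_ring (A\<lparr>carrier := socle A Mx\<rparr>) = 1" unfolding socle_eq .
  then show ?thesis
    unfolding gorenstein_local_algebra_def by (intro conjI exI[of _ Mx] A_algebra A_fin_dim maximal_ideals)
qed

section \<open>The presentation by two generators and two relations\<close>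

lemma kernel_eq:
  "genideal (class_ring :: 'k poly poly ring) {poly_x * poly_y, poly_y ^ 2 - poly_x ^ d} = {q. mtau d q = 0\<^sub>v (d + 2)}"
proof -
  let ?R = "class_ring :: 'k poly poly ring" and ?S = "{poly_x * poly_y, poly_y ^ 2 - poly_x ^ d :: 'k poly poly}"
  have I: "ideal (genideal ?R ?S) ?R" by (rule ring.genideal_ideal[OF cring.axioms(1)[OF class_cring.is_cring]]) simp
  have S: "?S \<subseteq> genideal ?R ?S" by (rule ring.genideal_self[OF cring.axioms(1)[OF class_cring.is_cring]]) simp
  have J: "ideal M.J ?R"
  proof (rule idealI)
    show "ring ?R" by (rule cring.axioms(1)[OF class_cring.is_cring])
    show "subgroup M.J (add_monoid ?R)"
    proof (rule subgroup.intro)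
      show "M.J \<subseteq> carrier (add_monoid ?R)" by simp
      show "p \<otimes>\<^bsub>add_monoid ?R\<^esub> q \<in> M.J" if "p \<in> M.J" "q \<in> M.J" for p q
        using M.J_add[OF that] by simp
      show "\<one>\<^bsub>add_monoid ?R\<^esub> \<in> M.J" using M.J_0 by simp
      show "inv\<^bsub>add_monoid ?R\<^esub> p \<in> M.J" if "p \<in> M.J" for p
      proof -
        have "\<ominus>\<^bsub>?R\<^esub> p = - p" by (rule abelian_group.minus_equality[OF class_ring.is_abelian_group]) simp_all
        then show ?thesis using M.J_uminus[OF that] unfolding a_inv_def by simp
      qed
    qed
    show "q \<otimes>\<^bsub>?R\<^esub> p \<in> M.J" if "p \<in> M.J" for p q using M.J_mult[OF that, of q] by simp
    show "p \<otimes>\<^bsub>?R\<^esub> q \<in> M.J" if "p \<in> M.J" for p q using M.J_mult2[OF that, of q] by simp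
  qed
  have "genideal ?R ?S \<subseteq> M.J"
    by (rule ring.genideal_minimal[OF cring.axioms(1)[OF class_cring.is_cring] J]) (intro insert_subsetI empty_subsetI J_iff[THEN iffD2] mtau_generators[OF d])
  moreover have "M.J \<subseteq> genideal ?R ?S"
  proof
    fix q assume "q \<in> M.J"
    then have m: "mtau d q = 0\<^sub>v (d + 2)" by (simp only: J_iff)
    have "(\<Sum>j<d+2. mconst (mtau d q $ j) * mbase d j) = 0" unfolding m by (rule sum.neutral) simp
    then have "mideal d q" using model_decomposition[of d q] d by simp
    then obtain B C where q: "q = poly_x * poly_y * B + (poly_y ^ 2 - poly_x ^ d) * C"
      unfolding ideal2_def by (elim exE)
    have "poly_x * poly_y * B \<in> genideal ?R ?S" "(poly_y ^ 2 - poly_x ^ d) * C \<in> genideal ?R ?S"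
      using ideal.I_r_closed[OF I, of "poly_x * poly_y" B] ideal.I_r_closed[OF I, of "poly_y ^ 2 - poly_x ^ d" C] S by simp_all
    then show "q \<in> genideal ?R ?S"
      unfolding q using additive_subgroup.a_closed[OF ideal.axioms(1)[OF I]] by simp
  qed
  ultimately have "genideal ?R ?S = M.J" by (rule equalityI)
  then show ?thesis by (simp add: M.J_def)
qed

lemma A_isomorphic: "algebra_isomorphic A (bivariate_quotient {poly_x * poly_y, poly_y ^ 2 - poly_x ^ d})"
proof -
  let ?R = "class_ring :: 'k poly poly ring" and ?S = "{poly_x * poly_y, poly_y ^ 2 - poly_x ^ d :: 'k poly poly}"
  define I where "I = genideal ?R ?S"
  have I: "ideal I ?R" unfolding I_def by (rule ring.genideal_ideal[OF cring.axioms(1)[OF class_cring.is_cring]]) simp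
  have Ia: "additive_subgroup I ?R" by (rule ideal.axioms(1)[OF I])
  have Ias: "abelian_subgroup I ?R" by (rule abelian_subgroupI3[OF Ia class_ring.is_abelian_group])
  let ?B = "bivariate_quotient ?S"
  have B: "carrier ?B = carrier (?R Quot I)" "X \<otimes>\<^bsub>?B\<^esub> Y = X \<otimes>\<^bsub>?R Quot I\<^esub> Y"
    "X \<oplus>\<^bsub>?B\<^esub> Y = X \<oplus>\<^bsub>?R Quot I\<^esub> Y" "\<one>\<^bsub>?B\<^esub> = \<one>\<^bsub>?R Quot I\<^esub>"
    "k \<odot>\<^bsub>?B\<^esub> X = (I +>\<^bsub>?R\<^esub> mconst k) \<otimes>\<^bsub>?R Quot I\<^esub> X" for X Y k
    by (simp_all add: bivariate_quotient_def Let_def I_def mconst_def)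
  have I_iff: "q \<in> I \<longleftrightarrow> mtau d q = 0\<^sub>v (d + 2)" for q unfolding I_def kernel_eq by simp
  have cos: "I +>\<^bsub>?R\<^esub> p = I +>\<^bsub>?R\<^esub> q \<longleftrightarrow> \<Theta> p = \<Theta> q" for p q
  proof -
    have e: "I +>\<^bsub>?R\<^esub> p = {i + p | i. i \<in> I}" for p by (auto simp: a_r_coset_def r_coset_def)
    have "I +>\<^bsub>?R\<^esub> p = I +>\<^bsub>?R\<^esub> q \<longleftrightarrow> p - q \<in> I"
    proof
      assume eq: "I +>\<^bsub>?R\<^esub> p = I +>\<^bsub>?R\<^esub> q"
      have "0 \<in> I" using additive_subgroup.zero_closed[OF Ia] by simp
      then have "0 + p \<in> I +>\<^bsub>?R\<^esub> p" unfolding e by (intro CollectI exI[of _ 0] conjI refl)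
      then have "0 + p \<in> {i + q | i. i \<in> I}" unfolding eq unfolding e .
      then obtain i where i: "0 + p = i + q" "i \<in> I" by (elim CollectE exE conjE)
      have "p - q = i" using i(1) by (simp add: algebra_simps)
      then show "p - q \<in> I" using i(2) by (simp only:)
    next
      assume pq: "p - q \<in> I"
      have sub: "I +>\<^bsub>?R\<^esub> a \<subseteq> I +>\<^bsub>?R\<^esub> b" if ab: "a - b \<in> I" for a b
      proof
        fix u assume "u \<in> I +>\<^bsub>?R\<^esub> a"
        then have "u \<in> {i + a | i. i \<in> I}" unfolding e .
        then obtain i where i: "u = i + a" "i \<in> I" by (elim CollectE exE conjE)
        have "i + (a - b) \<in> I" using additive_subgroup.a_closed[OF Ia, of i "a - b"] i ab by simp
        moreover have "u = (i + (a - b)) + b" using i by simp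
        ultimately show "u \<in> I +>\<^bsub>?R\<^esub> b" unfolding e by (intro CollectI exI conjI)
      qed
      have "q - p \<in> I" using ideal.I_l_closed[OF I pq, of "- 1"] by simp
      then show "I +>\<^bsub>?R\<^esub> p = I +>\<^bsub>?R\<^esub> q" using sub[OF pq] sub[of q p] by (intro equalityI)
    qed
    then show ?thesis unfolding I_iff \<Theta>_eq_iff .
  qed
  \<comment> \<open>The coset of a chosen preimage; by \<open>cos\<close> it does not depend on the
    choice.\<close>
  define h where "h X = I +>\<^bsub>?R\<^esub> (SOME q. \<Theta> q = X)" for X
  have h: "h (\<Theta> q) = I +>\<^bsub>?R\<^esub> q" for q
    unfolding h_def cos by (rule someI[of "\<lambda>p. \<Theta> p = \<Theta> q" q]) simp
  have mul: "(I +>\<^bsub>?R\<^esub> p) \<otimes>\<^bsub>?R Quot I\<^esub> (I +>\<^bsub>?R\<^esub> q) = I +>\<^bsub>?R\<^esub> (p * q)" for p q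
    using ideal.rcoset_mult_add[OF I, of p q] by (simp add: FactRing_def)
  have ad: "(I +>\<^bsub>?R\<^esub> p) \<oplus>\<^bsub>?R Quot I\<^esub> (I +>\<^bsub>?R\<^esub> q) = I +>\<^bsub>?R\<^esub> (p + q)" for p q
    using abelian_subgroup.a_rcos_sum[OF Ias, of p q] by (simp add: FactRing_def)
  have carr: "carrier (?R Quot I) = range (\<lambda>q. I +>\<^bsub>?R\<^esub> q)"
    by (auto simp: FactRing_def A_RCOSETS_def RCOSETS_def a_r_coset_def)
  have "h \<in> ring_iso A ?B"
  proof (rule ring_iso_memI)
    show "h X \<in> carrier ?B" if "X \<in> carrier A" for X using that unfolding B carr by (auto simp: h)
    show "h (X \<otimes>\<^bsub>A\<^esub> Y) = h X \<otimes>\<^bsub>?B\<^esub> h Y" if "X \<in> carrier A" "Y \<in> carrier A" for X Y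
      using that unfolding B by (auto simp: h mul \<Theta>_mult[symmetric])
    show "h (X \<oplus>\<^bsub>A\<^esub> Y) = h X \<oplus>\<^bsub>?B\<^esub> h Y" if "X \<in> carrier A" "Y \<in> carrier A" for X Y
      using that unfolding B by (auto simp: h ad \<Theta>_add[symmetric])
    have "h (\<Theta> 1) = \<one>\<^bsub>?B\<^esub>" unfolding B h by (simp add: FactRing_def)
    then show "h \<one>\<^bsub>A\<^esub> = \<one>\<^bsub>?B\<^esub>" unfolding \<Theta>_1 by simp
    show "bij_betw h (carrier A) (carrier ?B)"
      unfolding bij_betw_def
    proof
      show "inj_on h (carrier A)" by (rule inj_onI) (auto simp: h cos)
      show "h ` carrier A = carrier ?B" unfolding B carr by (auto simp: h image_iff)
    qed
  qed
  moreover have "h (k \<odot>\<^bsub>A\<^esub> X) = k \<odot>\<^bsub>?B\<^esub> h X" if "X \<in> carrier A" for k X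
    using that unfolding B by (auto simp: h mul \<Theta>_smult[symmetric])
  ultimately show ?thesis unfolding algebra_isomorphic_def by (intro bexI[of _ h] allI ballI)
qed

end

section \<open>Additive actions on hypersurfaces of degree \<open>n - 1\<close>\<close>

lemma (in poly_rep) evr_eq_iff_JR: "evr p = evr q \<longleftrightarrow> p - q \<in> JR"
  unfolding eqv_evr[symmetric] eqv_def ..

text \<open>Openness of the orbit supplies a form \<open>g\<close>, nonzero at the base point, such
  that the part of the hypersurface where \<open>g\<close> is nonzero lies in one orbit. This makes
  the base point a cyclic vector.\<close>

lemma hypersurface_structure:
  fixes f :: "'k::{alg_closed_field, field_char_0} mpoly"
  assumes d: "d \<ge> 2" and f: "homog 0 (Suc d) d f" "irreducible f" "nondegenerate (Suc d) f"
    and act: "additive_action d (Suc d) (hyp (Suc d) f) \<phi>" and P: "faithful_rep d (Suc (Suc d)) P"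
    and \<phi>P: "\<And>a v. a \<in> carrier_vec d ==> v \<in> carrier_vec (Suc (Suc d)) ==> proj_point v \<in> hyp (Suc d) f ==>
      \<phi> a (proj_point v) = proj_point (rep_at (Suc (Suc d)) P a *\<^sub>v v)"
  shows "(\<exists>T\<in>carrier_mat (Suc (Suc d)) (Suc (Suc d)). \<exists>T'\<in>carrier_mat (Suc (Suc d)) (Suc (Suc d)). \<exists>\<kappa>.
      T * T' = 1\<^sub>m (Suc (Suc d)) \<and> T' * T = 1\<^sub>m (Suc (Suc d)) \<and> \<kappa> \<noteq> 0 \<and>
      (\<forall>v\<in>carrier_vec (Suc (Suc d)). ev (($) (T *\<^sub>v v)) f = \<kappa> * ev (($) v) (mform d))) \<and>
    gorenstein_local_algebra (mat_algebra (Suc (Suc d))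
      (generated_algebra (Suc (Suc d)) (rep_differential d (Suc (Suc d)) P ` carrier_vec d))) \<and>
    algebra_isomorphic (mat_algebra (Suc (Suc d))
      (generated_algebra (Suc (Suc d)) (rep_differential d (Suc (Suc d)) P ` carrier_vec d)))
      (bivariate_quotient {poly_x * poly_y, poly_y ^ 2 - poly_x ^ d})"
proof -
  let ?n = "Suc d" and ?N = "Suc (Suc d)"
  let ?X = "hyp ?n f"
  have N: "?n + 1 = ?N" by simp
  have lin: "linear_rep d ?N P" and faith: "inj_on (rep_at ?N P) (carrier_vec d)"
    using P unfolding faithful_rep_def by simp_all
  have R: "poly_rep d ?N P" using lin by (intro poly_rep.intro) simp_all
  note hi = hyp_iff[OF f(1), unfolded N]
  have ra: "regular_action d ?n ?X \<phi>" using act unfolding additive_action_def by (elim conjE)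
  have "\<exists>p\<in>?X. proj_open_in ?n ?X ((\<lambda>a. \<phi> a p) ` carrier_vec d)"
    using act unfolding additive_action_def by (elim conjE)
  then obtain p0 where p0: "p0 \<in> ?X" and op: "proj_open_in ?n ?X ((\<lambda>a. \<phi> a p0) ` carrier_vec d)" by (elim bexE)
  have pp: "p0 \<in> proj_space ?n" using p0 by (simp add: hyp_def)
  obtain v0 where v0: "v0 \<in> carrier_vec ?N" "v0 \<noteq> 0\<^sub>v ?N" "p0 = proj_point v0"
    using pp unfolding N[symmetric] by (rule proj_spaceE)
  let ?orb = "(\<lambda>a. \<phi> a p0) ` carrier_vec d"
  have "\<exists>Z. zariski_closed 0 ?n Z \<and> {0\<^sub>v 0} \<times> ?orb = {0\<^sub>v 0} \<times> ?X - Z"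
    using op unfolding proj_open_in_def zariski_open_in_def .
  then obtain Z where Z: "zariski_closed 0 ?n Z" and oz: "{0\<^sub>v 0} \<times> ?orb = {0\<^sub>v 0} \<times> ?X - Z" by (elim exE conjE)
  obtain S where S: "\<forall>g\<in>S. \<exists>e. homog 0 ?n e g"
    and ZS: "Z = {(a, p). a \<in> carrier_vec 0 \<and> p \<in> proj_space ?n \<and> (\<forall>g\<in>S. \<forall>v\<in>p. eval_at g (a @\<^sub>v v) = 0)}"
    using Z unfolding zariski_closed_def by (elim exE conjE)
  have z0: "0\<^sub>v 0 \<in> (carrier_vec 0 :: 'k vec set)" by (rule zero_carrier_vec)
  have app: "(0\<^sub>v 0 :: 'k vec) @\<^sub>v w = w" for w by (rule eq_vecI) simp_all
  have Z_iff: "(0\<^sub>v 0, p) \<in> Z \<longleftrightarrow> (\<forall>g\<in>S. \<forall>v\<in>p. eval_at g v = 0)" if "p \<in> proj_space ?n" for p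
    unfolding ZS mem_Collect_eq prod.case app using that z0 by blast
  have orb_iff: "p \<in> ?orb \<longleftrightarrow> (0\<^sub>v 0, p) \<in> {0\<^sub>v 0} \<times> ?X - Z" for p unfolding oz[symmetric] by blast
  have "\<phi> (0\<^sub>v d) p0 = p0" using ra p0 unfolding regular_action_def by blast
  then have "p0 \<in> ?orb" by (intro image_eqI[of _ _ "0\<^sub>v d"]) simp_all
  then have "(0\<^sub>v 0, p0) \<notin> Z" unfolding orb_iff by blast
  then obtain g w where g: "g \<in> S" "w \<in> p0" "eval_at g w \<noteq> 0" unfolding Z_iff[OF pp] by blast
  obtain e where hg: "homog 0 ?n e g" using bspec[OF S g(1)] by (elim exE)
  obtain k where k: "w = k \<cdot>\<^sub>v v0" using g(2) unfolding v0(3) proj_point_def by (elim CollectE exE conjE)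
  have gv0: "ev (($) v0) g \<noteq> 0"
  proof
    assume "ev (($) v0) g = 0"
    then show False using g(3) ev_smult_vec[OF hg, of v0 k] v0(1) unfolding k eval_at_ev by simp
  qed
  have orb: "\<exists>k. \<exists>a\<in>carrier_vec d. v = k \<cdot>\<^sub>v (rep_at ?N P a *\<^sub>v v0)"
    if v: "v \<in> carrier_vec ?N" "v \<noteq> 0\<^sub>v ?N" and fv: "ev (($) v) f = 0" and gv: "ev (($) v) g \<noteq> 0" for v
  proof -
    have ps: "proj_point v \<in> proj_space ?n" using proj_spaceI[of v ?n, unfolded N, OF v] .
    have X: "proj_point v \<in> ?X" unfolding hi[OF v] by (rule fv)
    have "(0\<^sub>v 0, proj_point v) \<notin> Z"
      unfolding Z_iff[OF ps] using g(1) self_in_proj_point[of v] gv unfolding eval_at_ev by blast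
    then have "proj_point v \<in> ?orb" unfolding orb_iff using X by blast
    then obtain a where a: "a \<in> carrier_vec d" "proj_point v = \<phi> a p0" by (elim imageE) simp
    have "proj_point v = proj_point (rep_at ?N P a *\<^sub>v v0)"
      unfolding a(2) v0(3) by (rule \<phi>P[OF a(1) v0(1) p0[unfolded v0(3)]])
    from proj_point_eqD[OF this] show ?thesis using a(1) by blast
  qed
  have fv0: "ev (($) v0) f = 0" using p0 unfolding v0(3) hi[OF v0(1,2)] .
  have vg: "vars g \<subseteq> {..<?N}" using vars_homog[OF hg] by simp
  have C: "cyclic_rep d ?N P v0"
  proof (rule cyclic_rep.intro[OF R], rule cyclic_rep_axioms.intro[OF v0(1)])
    show "\<exists>p. poly_rep.evr ?N P p *\<^sub>v v0 = v" if "v \<in> carrier_vec ?N" for v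
      by (rule poly_rep.cyclic_if_open_orbit[OF R hypersurface_nullstellensatz[OF f(2)] N[symmetric] d f(2,1) v0(1) fv0 vg gv0 orb that])
  qed
  have van: "ev (($) (rep_at ?N P a *\<^sub>v v0)) f = 0" if a: "a \<in> carrier_vec d" for a
  proof -
    note Av = mult_mat_vec_carrier[OF rep_at_carrier v0(1), of P a] linear_rep_nonzero[OF lin a v0(1,2)]
    have "\<phi> a p0 \<in> ?X" using ra a p0 unfolding regular_action_def by blast
    then have "proj_point (rep_at ?N P a *\<^sub>v v0) \<in> ?X" using \<phi>P[OF a v0(1)] p0 unfolding v0(3) by simp
    then show ?thesis unfolding hi[OF Av] .
  qed
  have sqrt: "\<exists>l :: 'k. l ^ 2 = k" for k by (rule nth_root_exists) simp
  have f': "homog 0 (d + 1) d f" "nondegenerate (d + 1) f" using f by simp_all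
  have Nd: "?N = d + 2" by simp
  have "\<exists>x y. ev (\<lambda>_. 0) x = 0 \<and> ev (\<lambda>_. 0) y = 0 \<and>
      (\<forall>q. bimap mpoly_const x y q \<in> poly_rep.JR ?N P \<longleftrightarrow> mtau d q = 0\<^sub>v (d + 2)) \<and>
      (\<forall>p. \<exists>q. p - bimap mpoly_const x y q \<in> poly_rep.JR ?N P) \<and>
      (\<exists>T\<in>carrier_mat ?N ?N. \<exists>T'\<in>carrier_mat ?N ?N. \<exists>\<kappa>. T * T' = 1\<^sub>m ?N \<and> T' * T = 1\<^sub>m ?N \<and> \<kappa> \<noteq> 0 \<and>
        (\<forall>v\<in>carrier_vec ?N. ev (($) (T *\<^sub>v v)) f = \<kappa> * ev (($) v) (mform d)))"
    by (rule cyclic_rep.structure_theorem[OF C sqrt Nd refl d faith f(2) f' van])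
  then obtain x y where xy: "\<forall>q. bimap mpoly_const x y q \<in> poly_rep.JR ?N P \<longleftrightarrow> mtau d q = 0\<^sub>v (d + 2)"
      "\<forall>p. \<exists>q. p - bimap mpoly_const x y q \<in> poly_rep.JR ?N P"
    and T: "\<exists>T\<in>carrier_mat ?N ?N. \<exists>T'\<in>carrier_mat ?N ?N. \<exists>\<kappa>. T * T' = 1\<^sub>m ?N \<and> T' * T = 1\<^sub>m ?N \<and> \<kappa> \<noteq> 0 \<and>
      (\<forall>v\<in>carrier_vec ?N. ev (($) (T *\<^sub>v v)) f = \<kappa> * ev (($) v) (mform d))"
    by (elim exE conjE)
  define \<Theta> where "\<Theta> q = poly_rep.evr ?N P (bimap mpoly_const x y q)" for q
  interpret b: comm_ring_hom "bimap (mpoly_const :: 'k \<Rightarrow> _) x y" by (rule bimap_hom[OF const_hom])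
  have eqJ: "poly_rep.evr ?N P p = poly_rep.evr ?N P q \<longleftrightarrow> p - q \<in> poly_rep.JR ?N P" for p q
    by (rule poly_rep.evr_eq_iff_JR[OF R])
  have mm: "mat_model ?N d \<Theta>"
  proof (rule mat_model.intro)
    show "d \<ge> 2" by (rule d)
    show "\<Theta> q \<in> carrier_mat ?N ?N" for q unfolding \<Theta>_def by (rule poly_rep.evr_carrier[OF R])
    show "\<Theta> (p + q) = \<Theta> p + \<Theta> q" for p q unfolding \<Theta>_def b.hom_add by (rule poly_rep.evr_add[OF R])
    show "\<Theta> (p * q) = \<Theta> p * \<Theta> q" for p q unfolding \<Theta>_def b.hom_mult by (rule poly_rep.evr_mult[OF R])
    show "\<Theta> (mconst k * q) = k \<cdot>\<^sub>m \<Theta> q" for k q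
      unfolding \<Theta>_def b.hom_mult bimap_mconst[OF const_hom] by (rule poly_rep.evr_smult[OF R])
    show "\<Theta> 1 = 1\<^sub>m ?N" unfolding \<Theta>_def b.hom_one by (rule poly_rep.evr_1[OF R])
    show "\<Theta> 0 = 0\<^sub>m ?N ?N" unfolding \<Theta>_def b.hom_zero by (rule poly_rep.evr_0[OF R])
    show "\<Theta> p = \<Theta> q \<longleftrightarrow> mtau d (p - q) = 0\<^sub>v (d + 2)" for p q
      unfolding \<Theta>_def eqJ b.hom_minus[symmetric] by (rule xy(1)[rule_format])
  qed
  have "range \<Theta> = range (poly_rep.evr ?N P)"
  proof (rule equalityI, unfold \<Theta>_def, rule image_subsetI, rule rangeI, rule image_subsetI)
    fix p
    obtain q where "p - bimap mpoly_const x y q \<in> poly_rep.JR ?N P" using xy(2) by blast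
    then have "poly_rep.evr ?N P p = poly_rep.evr ?N P (bimap mpoly_const x y q)" unfolding eqJ .
    then show "poly_rep.evr ?N P p \<in> range (\<lambda>q. poly_rep.evr ?N P (bimap mpoly_const x y q))" by (rule range_eqI)
  qed
  then have gen: "generated_algebra ?N (rep_differential d ?N P ` carrier_vec d) = range \<Theta>"
    using poly_rep.generated_algebra_eq[OF R] by simp
  show ?thesis
    unfolding gen
    using T mat_model.A_gorenstein[OF mm] mat_model.A_isomorphic[OF mm] unfolding mat_model.A_def[OF mm] by (intro conjI)
qed

text \<open>Effectiveness on \<open>X\<close> gives faithfulness: if two arguments have equal
  matrices, their difference acts trivially on \<open>X\<close> and is zero.\<close>

lemma lift_exists:
  fixes X :: "'k::{alg_closed_field, field_char_0} vec set set"
  assumes n: "n \<ge> 1" and X: "X \<subseteq> proj_space n" and act: "induced_additive_action n X \<phi>"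
  shows "\<exists>P. faithful_rep (n - 1) (n + 1) P \<and>
    (\<forall>a\<in>carrier_vec (n - 1). \<forall>v\<in>carrier_vec (n + 1). proj_point v \<in> X -->
       \<phi> a (proj_point v) = proj_point (rep_at (n + 1) P a *\<^sub>v v))"
proof -
  let ?m = "n - 1"
  obtain \<Phi> where \<Phi>: "regular_action ?m n (proj_space n) \<Phi>" "\<forall>a\<in>carrier_vec ?m. \<forall>p\<in>X. \<Phi> a p = \<phi> a p"
    using act unfolding induced_additive_action_def by (elim conjE exE)
  have aa: "additive_action ?m n X \<phi>" using act unfolding induced_additive_action_def by (elim conjE)
  note aa' = aa[unfolded additive_action_def]
  note eff = aa'[THEN conjunct2, THEN conjunct1]
  note ra = aa'[THEN conjunct1, unfolded regular_action_def]
  note rin = ra[THEN conjunct1] and r0 = ra[THEN conjunct2, THEN conjunct1]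
    and radd = ra[THEN conjunct2, THEN conjunct2, THEN conjunct1]
  obtain P where P: "linear_rep ?m (n + 1) P"
    and \<Phi>P: "\<forall>a\<in>carrier_vec ?m. \<forall>v\<in>carrier_vec (n + 1). v \<noteq> 0\<^sub>v (n + 1) -->
       \<Phi> a (proj_point v) = proj_point (rep_at (n + 1) P a *\<^sub>v v)"
    using action_lift[OF n \<Phi>(1)] by (elim exE conjE)
  have \<phi>P: "\<phi> a (proj_point v) = proj_point (rep_at (n + 1) P a *\<^sub>v v)"
    if a: "a \<in> carrier_vec ?m" and v: "v \<in> carrier_vec (n + 1)" and p: "proj_point v \<in> X" for a v
  proof -
    obtain u where u: "u \<in> carrier_vec (n + 1)" "u \<noteq> 0\<^sub>v (n + 1)" "proj_point v = proj_point u"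
      using subsetD[OF X p] by (rule proj_spaceE)
    have nz: "v \<noteq> 0\<^sub>v (n + 1)" using in_proj_pointD(2)[OF u(1,2), of v] self_in_proj_point[of v] u(3) by simp
    show ?thesis using \<Phi>P[rule_format, OF a v nz] \<Phi>(2)[rule_format, OF a p] by simp
  qed
  have "inj_on (rep_at (n + 1) P) (carrier_vec ?m)"
  proof (rule inj_onI)
    fix a b assume a: "a \<in> carrier_vec ?m" and b: "b \<in> carrier_vec ?m" and eq: "rep_at (n + 1) P a = rep_at (n + 1) P b"
    have same: "\<phi> a p = \<phi> b p" if p: "p \<in> X" for p
    proof -
      obtain u where u: "u \<in> carrier_vec (n + 1)" "u \<noteq> 0\<^sub>v (n + 1)" "p = proj_point u"
        using subsetD[OF X p] by (rule proj_spaceE)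
      show ?thesis using \<phi>P[OF a u(1)] \<phi>P[OF b u(1)] p unfolding u(3) eq by simp
    qed
    have mb: "- b \<in> carrier_vec ?m" using b by simp
    have "\<phi> (a + - b) p = p" if p: "p \<in> X" for p
    proof -
      have q: "\<phi> (- b) p \<in> X" using rin mb p by blast
      have "\<phi> (a + - b) p = \<phi> a (\<phi> (- b) p)" using radd a mb p by blast
      also have "\<dots> = \<phi> b (\<phi> (- b) p)" by (rule same[OF q])
      also have "\<dots> = \<phi> (b + - b) p" by (rule radd[rule_format, OF b mb p, symmetric])
      also have "b + - b = 0\<^sub>v ?m" by (rule uminus_r_inv_vec[OF b])
      finally show ?thesis using r0 p by simp
    qed
    moreover have "a + - b \<in> carrier_vec ?m" using a mb by simp
    ultimately have z: "a + - b = 0\<^sub>v ?m" using eff by blast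
    show "a = b"
    proof (rule eq_vecI)
      fix i assume "i < dim_vec b"
      then show "a $ i = b $ i" using arg_cong[OF z, of "\<lambda>v. v $ i"] a b by simp
    qed (use a b in simp)
  qed
  then show ?thesis using P \<phi>P unfolding faithful_rep_def by blast
qed

theorem theorem4:
  fixes n :: nat
  assumes "n \<ge> 3"
  shows "(\<exists>X :: 'k::{alg_closed_field, field_char_0} vec set set. additive_hypersurface n (n - 1) X) \<and>
    (\<forall>X Y :: 'k vec set set. additive_hypersurface n (n - 1) X \<and> additive_hypersurface n (n - 1) Y \<longrightarrow>
      proj_isomorphic n X Y) \<and>
    (\<forall>X :: 'k vec set set. additive_hypersurface n (n - 1) X \<longrightarrow>
      (\<exists>A. corresponding_algebra n X A) \<and>
      (\<forall>A. corresponding_algebra n X A \<longrightarrow>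
        gorenstein_local_algebra A \<and>
        algebra_isomorphic A
          (bivariate_quotient {poly_x * poly_y, poly_y ^ 2 - poly_x ^ (n - 1)})))"
proof -
  define d where "d = n - 1"
  have d: "d \<ge> 2" and nd: "n = Suc d" using assms by (simp_all add: d_def)
  have n1: "n - 1 = d" by (simp add: nd)
  have N: "n + 1 = Suc (Suc d)" by (simp add: nd)
  have form: "\<exists>f. homog 0 (Suc d) d f \<and> irreducible f \<and> nondegenerate (Suc d) f \<and> X = hyp (Suc d) f"
    if "additive_hypersurface n (n - 1) X" for X :: "'k vec set set"
    using that unfolding additive_hypersurface_def nondegenerate_hypersurface_def hyp_def nd diff_Suc_1 by (elim conjE)
  have lift: "\<exists>\<phi> P. induced_additive_action n X \<phi> \<and> faithful_rep (n - 1) (n + 1) P \<and>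
    (\<forall>a\<in>carrier_vec (n - 1). \<forall>v\<in>carrier_vec (n + 1). proj_point v \<in> X -->
       \<phi> a (proj_point v) = proj_point (rep_at (n + 1) P a *\<^sub>v v))"
    if X: "additive_hypersurface n (n - 1) X" for X :: "'k vec set set"
  proof -
    obtain \<phi> where \<phi>: "induced_additive_action n X \<phi>" using X unfolding additive_hypersurface_def by (elim conjE exE)
    obtain f where "X = hyp (Suc d) f" using form[OF X] by (elim exE conjE)
    then have sub: "X \<subseteq> proj_space n" by (auto simp: hyp_def nd)
    have "n \<ge> 1" using assms by simp
    from lift_exists[OF this sub \<phi>] \<phi> show ?thesis by blast
  qed
  note st = hypersurface_structure[OF d]
  have use: "(\<exists>T\<in>carrier_mat (Suc (Suc d)) (Suc (Suc d)). \<exists>T'\<in>carrier_mat (Suc (Suc d)) (Suc (Suc d)). \<exists>\<kappa>.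
      T * T' = 1\<^sub>m (Suc (Suc d)) \<and> T' * T = 1\<^sub>m (Suc (Suc d)) \<and> \<kappa> \<noteq> 0 \<and>
      (\<forall>v\<in>carrier_vec (Suc (Suc d)). ev (($) (T *\<^sub>v v)) f = \<kappa> * ev (($) v) (mform d))) \<and>
    gorenstein_local_algebra (mat_algebra (n + 1) (generated_algebra (n + 1) (rep_differential (n - 1) (n + 1) P ` carrier_vec (n - 1)))) \<and>
    algebra_isomorphic (mat_algebra (n + 1) (generated_algebra (n + 1) (rep_differential (n - 1) (n + 1) P ` carrier_vec (n - 1))))
      (bivariate_quotient {poly_x * poly_y, poly_y ^ 2 - poly_x ^ (n - 1)})"
    if f: "homog 0 (Suc d) d f" "irreducible f" "nondegenerate (Suc d) f" "X = hyp (Suc d) f"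
      and \<phi>: "induced_additive_action n X \<phi>" and P: "faithful_rep (n - 1) (n + 1) P"
      and \<phi>P: "\<forall>a\<in>carrier_vec (n - 1). \<forall>v\<in>carrier_vec (n + 1). proj_point v \<in> X -->
         \<phi> a (proj_point v) = proj_point (rep_at (n + 1) P a *\<^sub>v v)"
    for f :: "'k mpoly" and X \<phi> P
  proof -
    have "additive_action d (Suc d) (hyp (Suc d) f) \<phi>"
      using \<phi> unfolding induced_additive_action_def n1 nd f(4)[symmetric] diff_Suc_1 by (elim conjE)
    from st[OF f(1-3) this P[unfolded n1 N]] show ?thesis unfolding n1 N using \<phi>P[unfolded n1 N f(4)] by blast
  qed
  have iso: "proj_isomorphic n X Y"
    if X: "additive_hypersurface n (n - 1) X" and Y: "additive_hypersurface n (n - 1) Y" for X Y :: "'k vec set set"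
  proof -
    let ?N = "Suc (Suc d)"
    have T: "\<exists>f T T' \<kappa>. homog 0 (Suc d) d f \<and> Z = hyp (Suc d) f \<and> T \<in> carrier_mat ?N ?N \<and> T' \<in> carrier_mat ?N ?N \<and>
        T * T' = 1\<^sub>m ?N \<and> T' * T = 1\<^sub>m ?N \<and> \<kappa> \<noteq> 0 \<and> (\<forall>v\<in>carrier_vec ?N. ev (($) (T *\<^sub>v v)) f = \<kappa> * ev (($) v) (mform d))"
      if Z: "additive_hypersurface n (n - 1) Z" for Z :: "'k vec set set"
    proof -
      obtain f where f: "homog 0 (Suc d) d f" "irreducible f" "nondegenerate (Suc d) f" "Z = hyp (Suc d) f"
        using form[OF Z] by (elim exE conjE)
      obtain \<phi> P where \<phi>: "induced_additive_action n Z \<phi>" "faithful_rep (n - 1) (n + 1) P"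
        "\<forall>a\<in>carrier_vec (n - 1). \<forall>v\<in>carrier_vec (n + 1). proj_point v \<in> Z -->
         \<phi> a (proj_point v) = proj_point (rep_at (n + 1) P a *\<^sub>v v)" using lift[OF Z] by (elim exE conjE)
      from use[OF f \<phi>, THEN conjunct1] f(1,4) show ?thesis by blast
    qed
    obtain f S S' k where f: "homog 0 (Suc d) d f" "X = hyp (Suc d) f" "S \<in> carrier_mat ?N ?N" "S' \<in> carrier_mat ?N ?N"
      "S * S' = 1\<^sub>m ?N" "S' * S = 1\<^sub>m ?N" "k \<noteq> 0" "\<forall>v\<in>carrier_vec ?N. ev (($) (S *\<^sub>v v)) f = k * ev (($) v) (mform d)"
      using T[OF X] by (elim exE conjE)
    obtain h T T' l where h: "homog 0 (Suc d) d h" "Y = hyp (Suc d) h" "T \<in> carrier_mat ?N ?N" "T' \<in> carrier_mat ?N ?N"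
      "T * T' = 1\<^sub>m ?N" "T' * T = 1\<^sub>m ?N" "l \<noteq> 0" "\<forall>v\<in>carrier_vec ?N. ev (($) (T *\<^sub>v v)) h = l * ev (($) v) (mform d)"
      using T[OF Y] by (elim exE conjE)
    have inv: "(A * B') * (B * A') = 1\<^sub>m ?N"
      if "A \<in> carrier_mat ?N ?N" "A' \<in> carrier_mat ?N ?N" "B \<in> carrier_mat ?N ?N" "B' \<in> carrier_mat ?N ?N"
        "A * A' = 1\<^sub>m ?N" "B' * B = 1\<^sub>m ?N" for A A' B B' :: "'k mat"
    proof -
      have "(A * B') * (B * A') = A * ((B' * B) * A')"
        using assoc_mult_mat[OF that(1,4) mult_carrier_mat[OF that(3,2)]] assoc_mult_mat[OF that(4,3,2)] by simp
      then show ?thesis using that by simp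
    qed
    have "proj_isomorphic (Suc d) (hyp (Suc d) f) (hyp (Suc d) h)"
    \<comment> \<open>The map passes through the model: \<open>S'\<close> carries the first
      hypersurface to that of \<open>mform d\<close>, and \<open>T\<close> carries that one to the
      second.\<close>
    proof (rule proj_isomorphic_linear[of "T * S'" "Suc d" "S * T'"])
      show "T * S' \<in> carrier_mat (Suc d + 1) (Suc d + 1)" "S * T' \<in> carrier_mat (Suc d + 1) (Suc d + 1)"
        using mult_carrier_mat[OF h(3) f(4)] mult_carrier_mat[OF f(3) h(4)] by simp_all
      show "T * S' * (S * T') = 1\<^sub>m (Suc d + 1)" "S * T' * (T * S') = 1\<^sub>m (Suc d + 1)"
        using inv[OF h(3,4) f(3,4) h(5) f(6)] inv[OF f(3,4) h(3,4) f(5) h(6)] by simp_all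
      show "homog 0 (Suc d) d f" by (rule f(1))
      show "homog 0 (Suc d) d h" by (rule h(1))
      fix v :: "'k vec" assume "v \<in> carrier_vec (Suc d + 1)"
      then have v: "v \<in> carrier_vec ?N" by simp
      have u: "S' *\<^sub>v v \<in> carrier_vec ?N" by (rule mult_mat_vec_carrier[OF f(4) v])
      have "ev (($) v) f = k * ev (($) (S' *\<^sub>v v)) (mform d)"
        using bspec[OF f(8) u] unfolding inverse_mat_vec[OF f(4,3,5) v] .
      moreover have "ev (($) (T * S' *\<^sub>v v)) h = l * ev (($) (S' *\<^sub>v v)) (mform d)"
        unfolding assoc_mult_mat_vec[OF h(3) f(4) v] by (rule bspec[OF h(8) u])
      ultimately show "ev (($) v) f = 0 \<longleftrightarrow> ev (($) (T * S' *\<^sub>v v)) h = 0" using f(7) h(7) by simp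
    qed
    then show ?thesis unfolding f(2) h(2) nd .
  qed
  have ex: "\<exists>X :: 'k vec set set. additive_hypersurface n (n - 1) X"
    unfolding nd diff_Suc_1 by (rule exI, rule model_additive[OF d])
  have alg: "(\<exists>A. corresponding_algebra n X A) \<and> (\<forall>A. corresponding_algebra n X A -->
        gorenstein_local_algebra A \<and> algebra_isomorphic A
          (bivariate_quotient {poly_x * poly_y, poly_y ^ 2 - poly_x ^ (n - 1)}))"
    if X: "additive_hypersurface n (n - 1) X" for X :: "'k vec set set"
  proof
    show "\<exists>A. corresponding_algebra n X A" unfolding corresponding_algebra_def using lift[OF X] by blast
    obtain f where f: "homog 0 (Suc d) d f" "irreducible f" "nondegenerate (Suc d) f" "X = hyp (Suc d) f"
      using form[OF X] by (elim exE conjE)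
    show "\<forall>A. corresponding_algebra n X A --> gorenstein_local_algebra A \<and> algebra_isomorphic A
          (bivariate_quotient {poly_x * poly_y, poly_y ^ 2 - poly_x ^ (n - 1)})"
    proof (intro allI impI)
      fix A assume "corresponding_algebra n X A"
      then obtain \<phi> P where \<phi>: "induced_additive_action n X \<phi>" "faithful_rep (n - 1) (n + 1) P"
        "\<forall>a\<in>carrier_vec (n - 1). \<forall>v\<in>carrier_vec (n + 1). proj_point v \<in> X -->
         \<phi> a (proj_point v) = proj_point (rep_at (n + 1) P a *\<^sub>v v)"
        and A: "A = mat_algebra (n + 1)
          (generated_algebra (n + 1) (rep_differential (n - 1) (n + 1) P ` carrier_vec (n - 1)))"
        unfolding corresponding_algebra_def by (elim exE conjE)
      show "gorenstein_local_algebra A \<and> algebra_isomorphic A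
          (bivariate_quotient {poly_x * poly_y, poly_y ^ 2 - poly_x ^ (n - 1)})"
        unfolding A by (rule use[OF f \<phi>, THEN conjunct2])
    qed
  qed
  show ?thesis
  proof (intro conjI[OF ex] conjI allI impI, elim conjE, rule iso)
  qed (use alg in blast)+
qed

end
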